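(* Let $B:[0,T]\times\mathbb{R}^d\times\mathcal{P}(\mathbb{R}^d)\to\mathbb{R}^d$ satisfy Assumption (B) and $G:\mathcal{P}(\mathbb{R}^d)\to\mathbb{R}$ satisfy Assumption (G) of the context. If $\mathcal{U}:[0,T]\times\mathcal{P}(\mathbb{R}^d)\to\mathbb{R}$ is a smooth solution (in the sense of the context) of the terminal-value problem $$\begin{cases}\partial_t\mathcal{U}(t,m)+\mathfrak{L}^B\mathcal{U}(t,m)=0,&(t,m)\in[0,T)\times\mathcal{P}(\mathbb{R}^d),\\ \mathcal{U}(T,m)=G(m),&m\in\mathcal{P}(\mathbb{R}^d),\end{cases}$$ where $$\begin{aligned}\mathfrak{L}^B\varphi(t,m)&:=\int_{\mathbb{R}^d}\nabla_x\delta_m\varphi(t,m)(x)\cdot B(t,x,m)\,m(\mathrm{d}x)+\frac12\int_{\mathbb{R}^d}\mathrm{Tr}\left[\nabla_x^2\delta_m\varphi(t,m)(x)\bigl(\mathrm{I}_d+\sigma_\circ\sigma_\circ^\top\bigr)\right]m(\mathrm{d}x)\\&\quad+\frac12\int_{\mathbb{R}^d\times\mathbb{R}^d}\mathrm{Tr}\left[\nabla_y\nabla_x\delta_m^2\varphi(t,m)(x,y)\,\sigma_\circ\sigma_\circ^\top\right]m(\mathrm{d}x)m(\mathrm{d}y),\end{aligned}$$ then $$\mathcal{U}(t,m)=\mathcal{K}_BG(t,m)=\mathbb{E}\bigl[G(\mu^{t,m}_T)\bigr],\qquad(t,m)\in[0,T]\times\mathcal{P}(\mathbb{R}^d).$$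
   Context: Setting. $T>0$, $d\ge1$, and $(\Omega,\mathcal{F},\mathbb{F},\mathbb{P})$ is a filtered probability space supporting two independent $\mathbb{R}^d$-valued Brownian motions $W$ and $W^\circ$ on $[0,T]$. A matrix $\sigma_\circ\in\mathbb{R}^{d\times d}$ is fixed and $\mathcal{G}_t:=\sigma\{\sigma_\circ W^\circ_r:0\le r\le t\}$. $\mathcal{P}(\mathbb{R}^d)$ carries the weak convergence topology; $\mathcal{L}(\cdot\mid\mathcal{G})$ is the conditional law; $\mathrm{I}_d$ is the identity matrix. Linear functional derivative. A map $F:\mathcal{P}(\mathbb{R}^d)\to\mathbb{R}$ (or vector-valued) admits a linear functional derivative if there is a Borel map $\delta_mF$ on $\mathcal{P}(\mathbb{R}^d)\times\mathbb{R}^d$ such that for all $m,m'$ with $\int_0^1\int|\delta_mF((1-\theta)m+\theta m')(x)|(m'+m)(\mathrm{d}x)\mathrm{d}\theta<\infty$, $$F(m')-F(m)=\int_0^1\int_{\mathbb{R}^d}\delta_mF\bigl((1-\theta)m+\theta m'\bigr)(x)\,(m'-m)(\mathrm{d}x)\,\mathrm{d}\theta.$$ It is defined up to an additive constant in $x$. When $m\mapsto\delta_mF(m)(x)$ itself admits a linear functional derivative, it is denoted $\delta_m^2F(m)(x,y)$, and $\nabla_y\nabla_x\delta_m^2F(m)(x,y)$ is its mixed spatial gradient. Smoothness. $\varphi:[0,T]\times\mathcal{P}(\mathbb{R}^d)\to\mathbb{R}$ is smooth if it is continuously differentiable in time, admits first and second linear functional derivatives in the measure variable, and $\partial_t\varphi$,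 $\nabla_x\delta_m\varphi$, $\nabla_x^2\delta_m\varphi$, $\nabla_y\nabla_x\delta_m^2\varphi$ are continuous and bounded on their respective domains. Assumption (B). $B$ is bounded and continuous in $(x,m)$ for each $t$; it is differentiable in the space variable and admits a linear functional derivative in the measure variable; $\nabla_xB(t,x,m)$, $\delta_mB(t,x,m)(y)$, $\nabla_y\delta_mB(t,x,m)(y)$ are bounded, and continuous in $(x,m,y)$ for each $t$. Assumption (G). $G$ is bounded and continuous and admits a linear functional derivative whose spatial gradient $\nabla_x\delta_mG(m)(x)$ is bounded and continuous. Conditional McKean–Vlasov flow. For $U\sim m$ independent of $(W,W^\circ)$, $S^{t,m}$ is the solution of $S^{t,m}_r=U$ for $r\in[0,t]$ and, for $r\in[t,T]$, $\mathrm{d}S^{t,m}_r=B(r,S^{t,m}_r,\mu^{t,m}_r)\,\mathrm{d}r+\mathrm{d}W_r+\sigma_\circ\,\mathrm{d}W^\circ_r$ with $\mu^{t,m}_r:=\mathcal{L}(S^{t,m}_r\mid\mathcal{G}_r)$. The McKean–Vlasov semigroup is $\mathcal{K}_BG(t,m):=\mathbb{E}[G(\mu^{t,m}_T)]$.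
   Formalization: Smoothness uses versions of the derivatives of U vanishing at the origin (first: at x=0; second: at x=0 or y=0), since a non-integrable additive constant makes the defining identity vacuous and the claim false; B is also assumed jointly Borel measurable so that the drift is defined. *)

theory Defs
  imports "HOL-Probability.Probability"
begin

section \<open>Borel probability measures with the topology of weak convergence\<close>

typedef (overloaded) 'a prob_measure =
    "{M :: 'a::topological_space measure. sets M = sets borel \<and> prob_space M}"
  morphisms meas Abs_prob_measure
  by (rule exI[of _ "return borel undefined"]) (auto intro: prob_space_return)

text \<open>The coarsest topology making \<open>m \<mapsto> \<integral>f dm\<close> continuous for every bounded continuous \<open>f\<close>.\<close>

instantiation prob_measure :: (topological_space) topological_space
begin

definition open_prob_measure :: "'a prob_measure set \<Rightarrow> bool" where
  "open_prob_measure = generate_topology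
     {{m. (\<integral>x. f x \<partial>meas m) \<in> V} | (f :: 'a \<Rightarrow> real) (V :: real set).
        continuous_on UNIV f \<and> bounded (range f) \<and> open V}"

instance
  by standard (auto simp: open_prob_measure_def
      intro: generate_topology.UNIV generate_topology.Int generate_topology.UN)

end

text \<open>The measure \<open>(1 - \<theta>) m + \<theta> m'\<close>; only meaningful for \<open>0 \<le> \<theta> \<le> 1\<close>.\<close>

definition mix :: "real \<Rightarrow> 'a::topological_space prob_measure \<Rightarrow> 'a prob_measure \<Rightarrow> 'a prob_measure"
  where "mix \<theta> m m' = Abs_prob_measure (measure_of UNIV (sets borel)
    (\<lambda>A. ennreal (1 - \<theta>) * emeasure (meas m) A + ennreal \<theta> * emeasure (meas m') A))"

lemma emeasure_mix:
  fixes m m' :: "'a::topological_space prob_measure"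
  assumes \<theta>: "0 \<le> \<theta>" "\<theta> \<le> 1" and A: "A \<in> sets borel"
  shows "emeasure (meas (mix \<theta> m m')) A
           = ennreal (1 - \<theta>) * emeasure (meas m) A + ennreal \<theta> * emeasure (meas m') A"
proof -
  let ?f = "\<lambda>A. ennreal (1 - \<theta>) * emeasure (meas m) A + ennreal \<theta> * emeasure (meas m') A"
  let ?N = "measure_of UNIV (sets (borel :: 'a measure)) ?f"
  have sets: "sets (meas m) = sets borel" "sets (meas m') = sets borel"
    and prob: "prob_space (meas m)" "prob_space (meas m')"
    using meas[of m] meas[of m'] by auto
  have sa: "sigma_algebra UNIV (sets (borel :: 'a measure))"
    using sets.sigma_algebra_axioms[of "borel :: 'a measure"] by simp
  have setsN: "sets ?N = sets borel"
    by (simp add: sigma_algebra.sigma_sets_eq[OF sa])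
  have ca: "countably_additive (sets borel) ?f"
  proof (rule countably_additiveI)
    fix A :: "nat \<Rightarrow> 'a set"
    assume "range A \<subseteq> sets borel" "disjoint_family A" "\<Union> (range A) \<in> sets borel"
    then have "(\<Sum>i. emeasure (meas m) (A i)) = emeasure (meas m) (\<Union> (range A))"
      "(\<Sum>i. emeasure (meas m') (A i)) = emeasure (meas m') (\<Union> (range A))"
      by (intro suminf_emeasure; simp add: sets)+
    then show "(\<Sum>i. ?f (A i)) = ?f (\<Union> (range A))"
      by (simp add: suminf_add[symmetric] ennreal_suminf_cmult)
  qed
  have em: "emeasure ?N A = ?f A" if "A \<in> sets borel" for A
    using that ca by (intro emeasure_measure_of_sigma[OF sa]) (auto simp: positive_def)
  have "space (meas m) = UNIV" "space (meas m') = UNIV"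
    using sets_eq_imp_space_eq[OF sets(1)] sets_eq_imp_space_eq[OF sets(2)] by auto
  then have "?f UNIV = ennreal (1 - \<theta>) + ennreal \<theta>"
    using prob_space.emeasure_space_1[OF prob(1)] prob_space.emeasure_space_1[OF prob(2)] by simp
  also have "\<dots> = 1"
    using \<theta> by (simp flip: ennreal_plus)
  finally have "prob_space ?N"
    using em[of UNIV] by (intro prob_spaceI) (simp add: space_measure_of_conv)
  then have "meas (mix \<theta> m m') = ?N"
    unfolding mix_def using setsN by (intro Abs_prob_measure_inverse) simp
  then show ?thesis
    using em[OF A] by simp
qed


section \<open>Derivatives\<close>

definition grad :: "(real^'n \<Rightarrow> real) \<Rightarrow> real^'n \<Rightarrow> real^'n" where
  "grad f x = (\<chi> i. frechet_derivative f (at x) (axis i 1))"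

definition jac :: "(real^'n \<Rightarrow> real^'m) \<Rightarrow> real^'n \<Rightarrow> real^'n^'m" where
  "jac f x = matrix (frechet_derivative f (at x))"

definition bounded_continuous_on ::
  "'a::topological_space set \<Rightarrow> ('a \<Rightarrow> 'b::real_normed_vector) \<Rightarrow> bool" where
  "bounded_continuous_on A f \<longleftrightarrow> continuous_on A f \<and> bounded (f ` A)"

text \<open>\<open>D\<close> is a version of the linear functional derivative \<open>\<delta>\<^sub>mF\<close>. The integral
  against the signed measure \<open>m' - m\<close> is the difference of the two integrals.\<close>

definition has_linear_derivative ::
  "((real^'d) prob_measure \<Rightarrow> 'b::euclidean_space) \<Rightarrow>
   ((real^'d) prob_measure \<Rightarrow> real^'d \<Rightarrow> 'b) \<Rightarrow> bool" where
  "has_linear_derivative F D \<longleftrightarrow>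
     (\<lambda>(m, x). D m x) \<in> borel_measurable (borel \<Otimes>\<^sub>M borel) \<and>
     (\<forall>m m'.
        (\<integral>\<^sup>+\<theta>\<in>{0..1}. ((\<integral>\<^sup>+x. norm (D (mix \<theta> m m') x) \<partial>meas m')
                   + (\<integral>\<^sup>+x. norm (D (mix \<theta> m m') x) \<partial>meas m)) \<partial>lborel) < \<infinity>
        \<longrightarrow> F m' - F m = (LBINT \<theta>:{0..1}. (\<integral>x. D (mix \<theta> m m') x \<partial>meas m')
                                          - (\<integral>x. D (mix \<theta> m m') x \<partial>meas m)))"

definition mixed_grad :: "(real^'d \<Rightarrow> real^'d \<Rightarrow> real) \<Rightarrow> real^'d \<Rightarrow> real^'d \<Rightarrow> real^'d^'d" where
  "mixed_grad f x y = jac (\<lambda>y'. grad (\<lambda>x'. f x' y') x) y"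

text \<open>
  \<open>\<phi>\<close> is smooth with time derivative \<open>\<phi>t\<close> and first and second linear functional derivatives
  \<open>D1\<close> and \<open>D2\<close>.

  Linear functional derivatives are determined only up to additive terms that do not affect
  \<open>\<nabla>\<^sub>x\<delta>\<^sub>m\<phi>\<close> and \<open>\<nabla>\<^sub>y\<nabla>\<^sub>x\<delta>\<^sub>m\<^sup>2\<phi>\<close>. The versions vanishing at the origin are the ones taken here:
  \<open>\<delta>\<^sub>m\<phi>(m)(0) = 0\<close>, \<open>\<delta>\<^sub>m\<^sup>2\<phi>(m)(x,0) = 0\<close>, and \<open>\<delta>\<^sub>m\<^sup>2\<phi>(m)(0,y) = 0\<close> as the derivative of
  \<open>m \<mapsto> \<delta>\<^sub>m\<phi>(m)(0) = 0\<close>. Fixing the version is needed: adding to \<open>\<delta>\<^sub>m\<phi>(m)\<close> a constant \<open>c(m)\<close> that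
  is not integrable along any segment of measures makes the defining identity of the derivative
  vacuous, and every function of \<open>m\<close> would then have derivative \<open>c(m)\<close> with zero gradient.
\<close>

definition smooth_with ::
  "real \<Rightarrow> (real \<Rightarrow> (real^'d) prob_measure \<Rightarrow> real)
   \<Rightarrow> (real \<Rightarrow> (real^'d) prob_measure \<Rightarrow> real)
   \<Rightarrow> (real \<Rightarrow> (real^'d) prob_measure \<Rightarrow> real^'d \<Rightarrow> real)
   \<Rightarrow> (real \<Rightarrow> (real^'d) prob_measure \<Rightarrow> real^'d \<Rightarrow> real^'d \<Rightarrow> real) \<Rightarrow> bool" where
  "smooth_with T \<phi> \<phi>t D1 D2 \<longleftrightarrow>
     (\<forall>t\<in>{0..T}. \<forall>m.
        ((\<lambda>s. \<phi> s m) has_real_derivative \<phi>t t m) (at t within {0..T})) \<and>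
     (\<forall>t\<in>{0..T}. has_linear_derivative (\<phi> t) (D1 t)) \<and>
     (\<forall>t\<in>{0..T}. \<forall>x. has_linear_derivative (\<lambda>m. D1 t m x) (\<lambda>m y. D2 t m x y)) \<and>
     (\<forall>t\<in>{0..T}. \<forall>m. D1 t m 0 = 0 \<and> (\<forall>x. D2 t m x 0 = 0) \<and> (\<forall>y. D2 t m 0 y = 0)) \<and>
     (\<forall>t\<in>{0..T}. \<forall>m x. D1 t m differentiable at x \<and> grad (D1 t m) differentiable at x) \<and>
     (\<forall>t\<in>{0..T}. \<forall>m x y. (\<lambda>x'. D2 t m x' y) differentiable at x \<and>
        (\<lambda>y'. grad (\<lambda>x'. D2 t m x' y') x) differentiable at y) \<and>
     bounded_continuous_on ({0..T} \<times> UNIV) (\<lambda>(t, m). \<phi>t t m) \<and>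
     bounded_continuous_on ({0..T} \<times> UNIV \<times> UNIV) (\<lambda>(t, m, x). grad (D1 t m) x) \<and>
     bounded_continuous_on ({0..T} \<times> UNIV \<times> UNIV) (\<lambda>(t, m, x). jac (grad (D1 t m)) x) \<and>
     bounded_continuous_on ({0..T} \<times> UNIV \<times> UNIV \<times> UNIV)
       (\<lambda>(t, m, x, y). mixed_grad (D2 t m) x y)"


section \<open>Assumptions on the coefficients\<close>

text \<open>Bounds are uniform in \<open>t\<close>. Borel measurability is what makes the drift of the equation
  well defined, as \<open>B\<close> has no other regularity in \<open>t\<close>.\<close>

definition assumption_B ::
  "real \<Rightarrow> (real \<Rightarrow> real^'d \<Rightarrow> (real^'d) prob_measure \<Rightarrow> real^'d) \<Rightarrow> bool" where
  "assumption_B T B \<longleftrightarrow>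
     (\<lambda>(t, x, m). B t x m)
       \<in> borel_measurable (restrict_space borel {0..T} \<Otimes>\<^sub>M borel \<Otimes>\<^sub>M borel) \<and>
     bounded ((\<lambda>(t, x, m). B t x m) ` ({0..T} \<times> UNIV \<times> UNIV)) \<and>
     (\<forall>t\<in>{0..T}. continuous_on UNIV (\<lambda>(x, m). B t x m)) \<and>
     (\<forall>t\<in>{0..T}. \<forall>m x. (\<lambda>x'. B t x' m) differentiable at x) \<and>
     bounded ((\<lambda>(t, x, m). jac (\<lambda>x'. B t x' m) x) ` ({0..T} \<times> UNIV \<times> UNIV)) \<and>
     (\<forall>t\<in>{0..T}. continuous_on UNIV (\<lambda>(x, m). jac (\<lambda>x'. B t x' m) x)) \<and>
     (\<exists>DB :: real \<Rightarrow> real^'d \<Rightarrow> (real^'d) prob_measure \<Rightarrow> real^'d \<Rightarrow> real^'d.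
        (\<forall>t\<in>{0..T}. \<forall>x. has_linear_derivative (B t x) (DB t x)) \<and>
        (\<forall>t\<in>{0..T}. \<forall>x m y. DB t x m differentiable at y) \<and>
        bounded ((\<lambda>(t, x, m, y). DB t x m y) ` ({0..T} \<times> UNIV \<times> UNIV \<times> UNIV)) \<and>
        (\<forall>t\<in>{0..T}. continuous_on UNIV (\<lambda>(x, m, y). DB t x m y)) \<and>
        bounded ((\<lambda>(t, x, m, y). jac (DB t x m) y) ` ({0..T} \<times> UNIV \<times> UNIV \<times> UNIV)) \<and>
        (\<forall>t\<in>{0..T}. continuous_on UNIV (\<lambda>(x, m, y). jac (DB t x m) y)))"

definition assumption_G :: "((real^'d) prob_measure \<Rightarrow> real) \<Rightarrow> bool" where
  "assumption_G G \<longleftrightarrow>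
     bounded_continuous_on UNIV G \<and>
     (\<exists>DG. has_linear_derivative G DG \<and>
        (\<forall>m x. DG m differentiable at x) \<and>
        bounded_continuous_on UNIV (\<lambda>(m, x). grad (DG m) x))"


section \<open>The conditional McKean--Vlasov equation\<close>

definition filtered_prob_space :: "'w measure \<Rightarrow> (real \<Rightarrow> 'w measure) \<Rightarrow> real \<Rightarrow> bool" where
  "filtered_prob_space M F T \<longleftrightarrow> prob_space M \<and>
     (\<forall>t\<in>{0..T}. subalgebra M (F t)) \<and>
     (\<forall>s t. 0 \<le> s \<longrightarrow> s \<le> t \<longrightarrow> t \<le> T \<longrightarrow> sets (F s) \<subseteq> sets (F t))"

text \<open>\<open>indep_var\<close> requires both variables to have the same type.\<close>

definition independent_rvs ::
  "'w measure \<Rightarrow> 'a measure \<Rightarrow> ('w \<Rightarrow> 'a) \<Rightarrow> 'b measure \<Rightarrow> ('w \<Rightarrow> 'b) \<Rightarrow> bool" where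
  "independent_rvs M K X L Y \<longleftrightarrow> X \<in> measurable M K \<and> Y \<in> measurable M L \<and>
     prob_space.indep_set M
       (sets (vimage_algebra (space M) X K)) (sets (vimage_algebra (space M) Y L))"

definition brownian_motion ::
  "'w measure \<Rightarrow> (real \<Rightarrow> 'w measure) \<Rightarrow> real \<Rightarrow> (real \<Rightarrow> 'w \<Rightarrow> real^'d) \<Rightarrow> bool" where
  "brownian_motion M F T W \<longleftrightarrow>
     (\<forall>t\<in>{0..T}. W t \<in> borel_measurable (F t)) \<and>
     (AE \<omega> in M. W 0 \<omega> = 0) \<and>
     (\<forall>\<omega>\<in>space M. continuous_on {0..T} (\<lambda>t. W t \<omega>)) \<and>
     (\<forall>s t. 0 \<le> s \<longrightarrow> s < t \<longrightarrow> t \<le> T \<longrightarrow>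
        prob_space.indep_set M (sets (F s))
          (sets (vimage_algebra (space M) (\<lambda>\<omega>. W t \<omega> - W s \<omega>) borel)) \<and>
        distr M borel (\<lambda>\<omega>. W t \<omega> - W s \<omega>) =
          density lborel (\<lambda>x. ennreal (\<Prod>i\<in>UNIV. normal_density 0 (sqrt (t - s)) (x $ i))))"

definition independent_processes ::
  "'w measure \<Rightarrow> real \<Rightarrow> (real \<Rightarrow> 'w \<Rightarrow> real^'d) \<Rightarrow> (real \<Rightarrow> 'w \<Rightarrow> real^'d) \<Rightarrow> bool" where
  "independent_processes M T X Y \<longleftrightarrow>
     independent_rvs M
       (\<Pi>\<^sub>M t\<in>{0..T}. borel) (\<lambda>\<omega>. \<lambda>t\<in>{0..T}. X t \<omega>)
       (\<Pi>\<^sub>M t\<in>{0..T}. borel) (\<lambda>\<omega>. \<lambda>t\<in>{0..T}. Y t \<omega>)"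

definition common_noise_algebra ::
  "'w measure \<Rightarrow> real^'d^'d \<Rightarrow> (real \<Rightarrow> 'w \<Rightarrow> real^'d) \<Rightarrow> real \<Rightarrow> 'w measure" where
  "common_noise_algebra M \<sigma> W0 t = sigma (space M)
     {(\<lambda>\<omega>. \<sigma> *v W0 r \<omega>) -` A \<inter> space M | r A. r \<in> {0..t} \<and> A \<in> sets borel}"

text \<open>\<open>\<kappa>\<close> is a (regular) version of the conditional law of \<open>X\<close> given \<open>G\<close>.\<close>

definition is_conditional_law ::
  "'w measure \<Rightarrow> 'w measure \<Rightarrow> ('w \<Rightarrow> real^'d) \<Rightarrow> ('w \<Rightarrow> (real^'d) prob_measure) \<Rightarrow> bool" where
  "is_conditional_law M G X \<kappa> \<longleftrightarrow>
     \<kappa> \<in> measurable G borel \<and>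
     (\<forall>A\<in>sets borel. AE \<omega> in M.
        measure (meas (\<kappa> \<omega>)) A = real_cond_exp M G (\<lambda>\<omega>'. indicator A (X \<omega>')) \<omega>)"

text \<open>
  \<open>S\<close> is a solution \<open>S\<^sup>t\<^sup>,\<^sup>m\<close> started from \<open>X\<close>, with conditional laws \<open>\<mu> = \<mu>\<^sup>t\<^sup>,\<^sup>m\<close>. Joint measurability
  of \<open>\<mu>\<close> selects versions for which the drift can be integrated in time. Adaptedness of \<open>S\<close> is not
  imposed: the noise is additive and \<open>B\<close> is Lipschitz in \<open>x\<close>, so given \<open>\<mu>\<close> the equation determines
  \<open>S\<close> path by path.
\<close>

definition mckean_vlasov_flow ::
  "'w measure \<Rightarrow> real \<Rightarrow> (real \<Rightarrow> real^'d \<Rightarrow> (real^'d) prob_measure \<Rightarrow> real^'d) \<Rightarrow> real^'d^'d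
   \<Rightarrow> (real \<Rightarrow> 'w \<Rightarrow> real^'d) \<Rightarrow> (real \<Rightarrow> 'w \<Rightarrow> real^'d)
   \<Rightarrow> real \<Rightarrow> (real^'d) prob_measure
   \<Rightarrow> ('w \<Rightarrow> real^'d) \<Rightarrow> (real \<Rightarrow> 'w \<Rightarrow> real^'d) \<Rightarrow> (real \<Rightarrow> 'w \<Rightarrow> (real^'d) prob_measure) \<Rightarrow> bool"
  where
  "mckean_vlasov_flow M T B \<sigma> W W0 t m X S \<mu> \<longleftrightarrow>
     distr M borel X = meas m \<and>
     independent_rvs M
       borel X (\<Pi>\<^sub>M r\<in>{0..T}. borel) (\<lambda>\<omega>. \<lambda>r\<in>{0..T}. (W r \<omega>, W0 r \<omega>)) \<and>
     (\<forall>r\<in>{0..T}. S r \<in> borel_measurable M) \<and>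
     (\<forall>\<omega>\<in>space M. continuous_on {0..T} (\<lambda>r. S r \<omega>)) \<and>
     (\<forall>r\<in>{0..T}. is_conditional_law M (common_noise_algebra M \<sigma> W0 r) (S r) (\<mu> r)) \<and>
     (\<lambda>(r, \<omega>). \<mu> r \<omega>) \<in> measurable (restrict_space borel {0..T} \<Otimes>\<^sub>M M) borel \<and>
     (AE \<omega> in M. (\<forall>r\<in>{0..t}. S r \<omega> = X \<omega>) \<and>
        (\<forall>r\<in>{t..T}. S r \<omega> = X \<omega> + (LBINT s:{t..r}. B s (S s \<omega>) (\<mu> s \<omega>))
           + (W r \<omega> - W t \<omega>) + \<sigma> *v (W0 r \<omega> - W0 t \<omega>)))"

text \<open>The semigroup \<open>\<K>\<^sub>BG(t,m)\<close>: the common value of \<open>E[G(\<mu>\<^sub>T)]\<close> over the solutions.\<close>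

definition mckean_vlasov_semigroup ::
  "'w measure \<Rightarrow> real \<Rightarrow> (real \<Rightarrow> real^'d \<Rightarrow> (real^'d) prob_measure \<Rightarrow> real^'d) \<Rightarrow> real^'d^'d
   \<Rightarrow> (real \<Rightarrow> 'w \<Rightarrow> real^'d) \<Rightarrow> (real \<Rightarrow> 'w \<Rightarrow> real^'d)
   \<Rightarrow> ((real^'d) prob_measure \<Rightarrow> real) \<Rightarrow> real \<Rightarrow> (real^'d) prob_measure \<Rightarrow> real" where
  "mckean_vlasov_semigroup M T B \<sigma> W W0 G t m =
     (THE v. \<exists>X S \<mu>. mckean_vlasov_flow M T B \<sigma> W W0 t m X S \<mu> \<and> v = (\<integral>\<omega>. G (\<mu> T \<omega>) \<partial>M))"

definition generator ::
  "(real \<Rightarrow> real^'d \<Rightarrow> (real^'d) prob_measure \<Rightarrow> real^'d) \<Rightarrow> real^'d^'d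
   \<Rightarrow> (real \<Rightarrow> (real^'d) prob_measure \<Rightarrow> real^'d \<Rightarrow> real)
   \<Rightarrow> (real \<Rightarrow> (real^'d) prob_measure \<Rightarrow> real^'d \<Rightarrow> real^'d \<Rightarrow> real)
   \<Rightarrow> real \<Rightarrow> (real^'d) prob_measure \<Rightarrow> real" where
  "generator B \<sigma> D1 D2 t m =
     (\<integral>x. grad (D1 t m) x \<bullet> B t x m \<partial>meas m)
     + 1 / 2 * (\<integral>x. trace (jac (grad (D1 t m)) x ** (mat 1 + \<sigma> ** transpose \<sigma>)) \<partial>meas m)
     + 1 / 2 * (\<integral>(x, y). trace (mixed_grad (D2 t m) x y ** (\<sigma> ** transpose \<sigma>))
                  \<partial>(meas m \<Otimes>\<^sub>M meas m))"

end

theory Submission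
  imports Defs
begin

text \<open>
  Along a solution, \<open>f r = E[U(r, \<mu>\<^sub>r)]\<close> is constant, so \<open>E[G(\<mu>\<^sub>T)] = f T = f t = U(t, m)\<close>. No stochastic calculus
  is used: for \<open>u \<le> s \<le> v\<close> with \<open>u, v \<rightarrow> s\<close> the increment \<open>f v - f u\<close> is split into three. Changing the time
  only gives \<open>\<partial>\<^sub>tU\<close>. Translating \<open>\<mu>\<^sub>u\<close> by the common increment \<open>a = \<sigma>(W0\<^sub>v - W0\<^sub>u)\<close> gives the terms in \<open>\<sigma>\<close> by a
  deterministic second-order expansion in \<open>a\<close>, which is independent of \<open>\<mu>\<^sub>u\<close>. Passing from the translated law
  to \<open>\<mu>\<^sub>v\<close> is done along the segment between the two laws: both are conditional laws given the common noise,
  so the derivative along the segment is \<open>E[\<delta>\<^sub>mU(S\<^sub>v) - \<delta>\<^sub>mU(S\<^sub>u + a)]\<close> with \<open>\<delta>\<^sub>mU\<close> taken at a measure that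
  depends on the common noise alone. An ordinary Taylor expansion in \<open>x\<close> then suffices, as the increments of \<open>W\<close> are
  independent of that measure. The three limits add up to zero by the equation.
\<close>

section \<open>The topology of weak convergence\<close>

text \<open>Two obstacles shape the estimates. The laws need not have moments and \<open>D1\<close>
  is only Lipschitz in \<open>x\<close>, so the integrability premise in
  \<open>has_linear_derivative\<close> may fail for the laws themselves. The identity is therefore
  used after projecting both laws to a ball, and the projection is removed in expectation, where
  only the difference of two coupled variables has to be integrable. Next, smoothness controls the
  time derivative and the gradients, not \<open>U\<close>, \<open>D1\<close> or \<open>D2\<close>;
  their continuity is recovered by integrating derivatives from places where the values are known:
  \<open>U T = G\<close>, and the zeros of \<open>D1\<close> and \<open>D2\<close> at the origin.
  Conditioning is on the entire path of the common noise rather than on its past. All laws are then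
  conditional laws for one sigma-algebra, which gives their almost sure convergence along sequences
  of times, and the increments of \<open>W\<close> remain independent of it. The quotient over
  \<open>u \<le> s \<le> v\<close> contains left and right difference quotients alike, so the
  expected value has derivative zero at interior times.\<close>

lemma sets_meas [simp, measurable_cong]: "sets (meas m) = sets borel"
  and prob_space_meas [simp]: "prob_space (meas m)"
  using meas[of m] by auto

lemma space_meas [simp]: "space (meas m) = UNIV"
  using sets_eq_imp_space_eq[OF sets_meas[of m]] by simp

lemma finite_measure_meas [simp]: "finite_measure (meas m)"
  by (rule prob_space.finite_measure) simp

lemma measure_meas_UNIV [simp]: "measure (meas m) UNIV = 1"
  using prob_space.prob_space[OF prob_space_meas[of m]] by simp

lemma emeasure_meas_UNIV [simp]: "emeasure (meas m) UNIV = 1"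
  using prob_space.emeasure_space_1[OF prob_space_meas[of m]] by simp

lemma borel_measurable_meas_iff [simp]:
  "f \<in> borel_measurable (meas m) \<longleftrightarrow> f \<in> borel_measurable borel"
  using measurable_cong_sets[OF sets_meas refl] by blast

lemma integrable_meas_bounded:
  fixes f :: "'a::topological_space \<Rightarrow> 'b::{banach,second_countable_topology}"
  assumes "f \<in> borel_measurable borel" "\<And>x. norm (f x) \<le> C"
  shows "integrable (meas m) f"
  by (rule finite_measure.integrable_const_bound[where B=C]) (use assms in auto)

lemma integral_meas_bounded:
  fixes f :: "'a::topological_space \<Rightarrow> 'b::{banach,second_countable_topology}"
  assumes "f \<in> borel_measurable borel" "\<And>x. norm (f x) \<le> C"
  shows "norm (\<integral>x. f x \<partial>meas m) \<le> C"
proof -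
  have "norm (\<integral>x. f x \<partial>meas m) \<le> (\<integral>x. norm (f x) \<partial>meas m)"
    by (rule integral_norm_bound)
  also have "\<dots> \<le> (\<integral>x. C \<partial>meas m)"
    using assms by (intro integral_mono integrable_norm integrable_meas_bounded) auto
  finally show ?thesis by simp
qed

lemma integrable_meas_bcont:
  fixes f :: "'a::topological_space \<Rightarrow> real"
  assumes "continuous_on UNIV f" "bounded (range f)"
  shows "integrable (meas m) f"
proof -
  from assms(2) obtain C where "\<And>x. norm (f x) \<le> C"
    by (auto simp: bounded_iff)
  then show ?thesis
    using assms(1) by (intro integrable_meas_bounded[where C=C] borel_measurable_continuous_onI) auto
qed

text \<open>Convergence has to be tested only on the generating sets of the topology: finite
  intersections and unions pass through the filter.\<close>

lemma tendsto_prob_measure_iff: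
  fixes X :: "'i \<Rightarrow> 'a::topological_space prob_measure"
  shows "(X \<longlongrightarrow> m) F \<longleftrightarrow> (\<forall>f :: 'a \<Rightarrow> real. continuous_on UNIV f \<and> bounded (range f) \<longrightarrow>
    ((\<lambda>i. \<integral>x. f x \<partial>meas (X i)) \<longlongrightarrow> (\<integral>x. f x \<partial>meas m)) F)"
    (is "?L \<longleftrightarrow> ?R")
proof
  assume L: ?L
  show ?R
  proof (intro allI impI topological_tendstoI)
    fix f :: "'a \<Rightarrow> real" and V :: "real set"
    assume f: "continuous_on UNIV f \<and> bounded (range f)" and V: "open V" "(\<integral>x. f x \<partial>meas m) \<in> V"
    have "open {m. (\<integral>x. f x \<partial>meas m) \<in> V}"
      unfolding open_prob_measure_def using f V by (intro generate_topology.Basis) auto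
    from topological_tendstoD[OF L this] V show "\<forall>\<^sub>F i in F. (\<integral>x. f x \<partial>meas (X i)) \<in> V" by simp
  qed
next
  assume R: ?R
  show ?L
  proof (rule topological_tendstoI)
    fix S :: "'a prob_measure set"
    assume "open S" "m \<in> S"
    then show "\<forall>\<^sub>F i in F. X i \<in> S"
      unfolding open_prob_measure_def
    proof induction
      case (Int a b)
      then show ?case by (auto elim: eventually_elim2)
    next
      case (UN K)
      then obtain k where "k \<in> K" "\<forall>\<^sub>F i in F. X i \<in> k" by auto
      then show ?case by (auto elim!: eventually_mono)
    next
      case (Basis s)
      from Basis(1) obtain f :: "'a \<Rightarrow> real" and V where fV: "s = {m. (\<integral>x. f x \<partial>meas m) \<in> V}" "continuous_on UNIV f"
        "bounded (range f)" "open V" by blast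
      then show ?case using R Basis topological_tendstoD by fastforce
    qed simp
  qed
qed

lemma tendsto_integral_meas:
  fixes f :: "'a::topological_space \<Rightarrow> real"
  assumes "(X \<longlongrightarrow> m) F" "continuous_on UNIV f" "bounded (range f)"
  shows "((\<lambda>i. \<integral>x. f x \<partial>meas (X i)) \<longlongrightarrow> (\<integral>x. f x \<partial>meas m)) F"
  using assms tendsto_prob_measure_iff by blast

text \<open>Maxima of finitely many tent functions: a countable family that generates the topology.\<close>

fun hat :: "('a::metric_space \<times> real \<times> real) list \<Rightarrow> 'a \<Rightarrow> real" where
  "hat [] x = 0"
| "hat ((p, n, q) # L) x = max (q * max 0 (1 - n * dist x p)) (hat L x)"

lemma hat_append: "hat (L @ L') x = max (hat L x) (hat L' x)"
proof (induction L)
  case Nil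
  have "0 \<le> hat L' x" by (induction L') auto
  then show ?case by simp
qed auto

lemma hat_nonneg: "0 \<le> hat L x"
  by (induction L) auto

lemma continuous_on_hat: "continuous_on A (hat L)"
proof (induction L)
  case Nil
  then show ?case by (simp add: continuous_on_const cong: continuous_on_cong)
next
  case (Cons t L)
  obtain p n q where t: "t = (p, n, q)" by (cases t)
  have "continuous_on A (\<lambda>x. max (q * max 0 (1 - n * dist x p)) (hat L x))"
    using Cons by (intro continuous_intros)
  then show ?case by (simp add: t)
qed

lemma borel_measurable_hat [measurable]: "hat L \<in> borel_measurable borel"
  by (intro borel_measurable_continuous_onI continuous_on_hat)

text \<open>Centres in a countable dense set, natural slopes \<open>n\<close> and nonnegative
  rational heights \<open>q\<close> keep the family countable. For \<open>n > 0\<close> a tent is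
  supported in radius \<open>1 / n\<close> about its centre. Lists encode finite maxima, so that
  concatenation is the maximum (\<open>hat_append\<close>).\<close>

definition hat_lists :: "('a::polish_space \<times> real \<times> real) list set" where
  "hat_lists = lists ((SOME D. countable D \<and> (\<forall>X. open X \<longrightarrow> X \<noteq> {} \<longrightarrow> (\<exists>d\<in>D. d \<in> X))) \<times>
     (real ` (UNIV :: nat set)) \<times> (\<rat> \<inter> {0..}))"

definition hat_points :: "'a::polish_space set" where
  "hat_points = (SOME D. countable D \<and> (\<forall>X. open X \<longrightarrow> X \<noteq> {} \<longrightarrow> (\<exists>d\<in>D. d \<in> X)))"

lemma hat_points: "countable (hat_points :: 'a::polish_space set)"
  "open X \<Longrightarrow> X \<noteq> {} \<Longrightarrow> \<exists>d\<in>hat_points. d \<in> (X :: 'a set)"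
proof -
  obtain D :: "'a set" where "countable D" "\<And>X. open X \<Longrightarrow> X \<noteq> {} \<Longrightarrow> \<exists>d\<in>D. d \<in> X"
    by (rule countable_dense_setE) blast
  then have "\<exists>D :: 'a set. countable D \<and> (\<forall>X. open X \<longrightarrow> X \<noteq> {} \<longrightarrow> (\<exists>d\<in>D. d \<in> X))" by blast
  from someI_ex[OF this] show "countable (hat_points :: 'a set)"
    "open X \<Longrightarrow> X \<noteq> {} \<Longrightarrow> \<exists>d\<in>hat_points. d \<in> (X :: 'a set)"
    by (auto simp: hat_points_def)
qed

lemma hat_lists_eq: "hat_lists = lists (hat_points \<times> range real \<times> (\<rat> \<inter> {0..}))"
  by (simp add: hat_lists_def hat_points_def)

lemma countable_hat_lists: "countable (hat_lists :: ('a::polish_space \<times> real \<times> real) list set)"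
  unfolding hat_lists_eq
  by (intro countable_lists countable_SIGMA hat_points countable_Int1 countable_rat) auto

lemma hat_le: "L \<in> hat_lists \<Longrightarrow> \<exists>C. \<forall>x. hat L x \<le> C"
proof (induction L)
  case Nil then show ?case by auto
next
  case (Cons t L)
  obtain p n q where t: "t = (p, n, q)" by (cases t)
  have *: "L \<in> hat_lists" "q \<ge> 0" "n \<ge> 0" using Cons.prems by (auto simp: hat_lists_eq t)
  with Cons obtain C where C: "\<And>x. hat L x \<le> C" by auto
  have "hat (t # L) x \<le> max q C" for x
  proof -
    have "q * max 0 (1 - n * dist x p) \<le> q * 1"
      using * by (intro mult_left_mono) auto
    then show ?thesis using C[of x] by (auto simp: t)
  qed
  then show ?case by blast
qed

lemma bounded_hat: "L \<in> hat_lists \<Longrightarrow> bounded (range (hat L))"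
  using hat_le[of L] hat_nonneg[of L] by (force simp: bounded_iff)

text \<open>By continuity \<open>f\<close> exceeds some rational \<open>q > c\<close> near
  \<open>x\<close>. A tent of height \<open>q\<close> supported in that neighbourhood stays below
  \<open>f\<close>, and it still exceeds \<open>c\<close> at \<open>x\<close> if its centre is close
  enough.\<close>

lemma hat_approx:
  fixes f :: "'a::polish_space \<Rightarrow> real"
  assumes f: "continuous_on UNIV f" "\<And>x. 0 \<le> f x" and c: "c < f x"
  shows "\<exists>L\<in>hat_lists. (\<forall>y. hat L y \<le> f y) \<and> c < hat L x"
proof (cases "c < 0")
  case True
  \<comment> \<open>For negative \<open>c\<close> the empty maximum, which is zero,
    suffices.\<close>
  then show ?thesis using f(2) by (intro bexI[of _ "[]"]) (auto simp: hat_lists_eq)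
next
  case False
  obtain q where q: "q \<in> \<rat>" "c < q" "q < f x" using Rats_dense_in_real[OF c] by blast
  then have "q > 0" using False by auto
  have "open {y. q < f y}" using f(1) by (intro open_Collect_less continuous_on_const)
  then obtain e where e: "e > 0" "ball x e \<subseteq> {y. q < f y}"
    using q(3) by (auto simp: open_contains_ball)
  obtain n :: nat where n: "2 / e < real n" using reals_Archimedean2 by blast
  moreover have "2 / e > 0" using e by simp
  ultimately have n0: "real n > 0" by linarith
  \<comment> \<open>The first bound keeps the support, of radius \<open>1 / n\<close> about
    \<open>p\<close>, within \<open>2 / n < e\<close> of \<open>x\<close>; the second is equivalent
    to \<open>q * (1 - n * dist x p) > c\<close>.\<close>
  define r where "r = min (1 / real n) ((1 - c / q) / real n)"
  have "r > 0" using n0 q \<open>q > 0\<close> by (auto simp: r_def)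
  obtain p where p: "p \<in> hat_points" "p \<in> ball x r"
    using hat_points(2)[of "ball x r"] \<open>r > 0\<close> by auto
  have d: "dist x p < 1 / real n" "dist x p < (1 - c / q) / real n"
    using p by (auto simp: r_def dist_commute)
  have 1: "c < q * (1 - real n * dist x p)"
  proof -
    have "real n * dist x p < 1 - c / q" using d(2) n0 by (simp add: field_simps)
    then show ?thesis using \<open>q > 0\<close> by (simp add: field_simps)
  qed
  have "q * (1 - real n * dist x p) \<le> q * max 0 (1 - real n * dist x p)"
    using \<open>q > 0\<close> by (intro mult_left_mono) auto
  with 1 have 3: "c < max (q * max 0 (1 - real n * dist x p)) 0" by linarith
  have 2: "q * max 0 (1 - real n * dist y p) \<le> f y" for y
  proof (cases "dist y p < 1 / real n")
    case True
    have "dist x y \<le> dist x p + dist y p" by (metis dist_commute dist_triangle)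
    also have "\<dots> < 2 / real n" using True d(1) by simp
    also have "\<dots> < e" using n n0 e by (simp add: field_simps)
    finally have "q < f y" using e by auto
    moreover have "q * max 0 (1 - real n * dist y p) \<le> q * 1"
      using \<open>q > 0\<close> n0 by (intro mult_left_mono) auto
    ultimately show ?thesis by simp
  next
    case False
    then have "1 - real n * dist y p \<le> 0" using n0 by (simp add: field_simps)
    then show ?thesis using f(2) by simp
  qed
  show ?thesis
    using 2 f(2) p q \<open>q > 0\<close> 3 by (intro bexI[of _ "[(p, real n, q)]"]) (auto simp: hat_lists_eq)
qed

text \<open>The hats below \<open>f\<close> have pointwise supremum \<open>f\<close> by
  \<open>hat_approx\<close>, and there are countably many. Maxima over initial pieces of an
  enumeration stay in the family and increase to \<open>f\<close>, so dominated convergence finds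
  one whose integral already exceeds \<open>c\<close>.\<close>

lemma hat_integral_approx:
  fixes f :: "'a::polish_space \<Rightarrow> real"
  assumes f: "continuous_on UNIV f" "\<And>x. 0 \<le> f x" "bounded (range f)"
    and c: "c < (\<integral>x. f x \<partial>meas m)"
  shows "\<exists>L\<in>hat_lists. (\<forall>y. hat L y \<le> f y) \<and> c < (\<integral>x. hat L x \<partial>meas m)"
proof -
  define A where "A = {L \<in> hat_lists. \<forall>y. hat L y \<le> f y}"
  have "[] \<in> A" using f(2) by (auto simp: A_def hat_lists_eq)
  then have A: "countable A" "A \<noteq> {}"
    using countable_hat_lists unfolding A_def by (auto intro: countable_subset[rotated])
  \<comment> \<open>\<open>concat\<close> forms the maximum of the first \<open>k\<close> hats of
    the enumeration. For \<open>k = 0\<close> it is the empty list, which belongs to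
    \<open>A\<close> because \<open>f\<close> is nonnegative.\<close>
  define G where "G k = concat (map (from_nat_into A) [0..<k])" for k
  have G: "G k \<in> A" for k
  proof (induction k)
    case 0
    then show ?case using \<open>[] \<in> A\<close> by (simp add: G_def)
  next
    case (Suc k)
    have "from_nat_into A k \<in> A" using A(2) by (rule from_nat_into)
    moreover have "G (Suc k) = G k @ from_nat_into A k" by (simp add: G_def)
    ultimately show ?case using Suc by (auto simp: A_def hat_append hat_lists_eq)
  qed
  have mono: "hat (G k) x \<le> hat (G (Suc k)) x" for k x
    by (simp add: G_def hat_append)
  have lim: "(\<lambda>k. hat (G k) x) \<longlonglongrightarrow> f x" for x
  proof (rule increasing_tendsto)
    show "\<forall>\<^sub>F k in sequentially. hat (G k) x \<le> f x" using G by (auto simp: A_def)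
    fix c assume "c < f x"
    from hat_approx[OF f(1,2) this] obtain L where L: "L \<in> A" "c < hat L x" by (auto simp: A_def)
    then obtain j where j: "L = from_nat_into A j" using A by (metis from_nat_into_surj)
    have "c < hat (G (Suc j)) x" using L by (auto simp: G_def hat_append j less_max_iff_disj)
    then have "c < hat (G k) x" if "k \<ge> Suc j" for k
      using lift_Suc_mono_le[of "\<lambda>k. hat (G k) x", OF mono that] by linarith
    then show "\<forall>\<^sub>F k in sequentially. c < hat (G k) x" by (auto simp: eventually_sequentially)
  qed
  obtain C where C: "\<And>x. norm (f x) \<le> C" using f(3) by (auto simp: bounded_iff)
  have "(\<lambda>k. \<integral>x. hat (G k) x \<partial>meas m) \<longlonglongrightarrow> (\<integral>x. f x \<partial>meas m)"
  proof (rule integral_dominated_convergence[where w="\<lambda>_. C"])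
    show "AE x in meas m. norm (hat (G k) x) \<le> C" for k
      using G[of k] hat_nonneg[of "G k"] C by (auto simp: A_def intro!: AE_I2 elim!: order_trans)
       (meson C abs_le_D1 order_trans)
  qed (use lim borel_measurable_continuous_onI[OF f(1)] in \<open>auto intro!: finite_measure.integrable_const\<close>)
  then have "\<forall>\<^sub>F k in sequentially. c < (\<integral>x. hat (G k) x \<partial>meas m)"
    using c by (rule order_tendstoD(1))
  then obtain k where "c < (\<integral>x. hat (G k) x \<partial>meas m)" by (auto simp: eventually_sequentially)
  then show ?thesis using G[of k] by (auto simp: A_def)
qed

definition hat_subbasis :: "'a::polish_space prob_measure set set" where
  "hat_subbasis = (\<lambda>(L, r). {m. r < (\<integral>x. hat L x \<partial>meas m)}) ` (hat_lists \<times> \<rat>)"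

text \<open>Superlevel sets of the integral of a nonnegative \<open>f\<close> are unions of members
  of the countable family by \<open>hat_integral_approx\<close>. A shift reaches all bounded
  \<open>f\<close>, a change of sign gives sublevel sets, and an open \<open>V\<close> is a union of
  intervals.\<close>

lemma open_prob_measure_eq:
  "open = generate_topology (hat_subbasis :: 'a::polish_space prob_measure set set)"
proof (intro ext iffI)
  fix S :: "'a prob_measure set"
  have gUN: "generate_topology hat_subbasis (\<Union>x\<in>A. B x)"
    if "\<And>x. x \<in> A \<Longrightarrow> generate_topology hat_subbasis (B x)" for A and B :: "'i \<Rightarrow> 'a prob_measure set"
    using that by (intro generate_topology.UN) auto
  have pos: "generate_topology hat_subbasis {m. c < (\<integral>x. f x \<partial>meas m)}"
    if "continuous_on UNIV f" "\<And>x. 0 \<le> f x" "bounded (range f)" for f :: "'a \<Rightarrow> real" and c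
  proof -
    have "{m. c < (\<integral>x. f x \<partial>meas m)} =
        (\<Union>(L, r)\<in>{(L, r). L \<in> hat_lists \<and> r \<in> \<rat> \<and> c < r \<and> (\<forall>y. hat L y \<le> f y)}. {m. r < (\<integral>x. hat L x \<partial>meas m)})"
    proof safe
      fix m assume "c < (\<integral>x. f x \<partial>meas m)"
      from hat_integral_approx[OF that this] obtain L where L: "L \<in> hat_lists" "\<forall>y. hat L y \<le> f y"
        "c < (\<integral>x. hat L x \<partial>meas m)" by auto
      obtain r where "r \<in> \<rat>" "c < r" "r < (\<integral>x. hat L x \<partial>meas m)" using Rats_dense_in_real[OF L(3)] by blast
      then show "m \<in> (\<Union>(L, r)\<in>{(L, r). L \<in> hat_lists \<and> r \<in> \<rat> \<and> c < r \<and> (\<forall>y. hat L y \<le> f y)}. {m. r < (\<integral>x. hat L x \<partial>meas m)})"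
        using L by auto
    next
      fix m :: "'a prob_measure" and L and r :: real
      assume *: "L \<in> hat_lists" "r < (\<integral>x. hat L x \<partial>meas m)" "c < r" "\<forall>y. hat L y \<le> f y"
      have "(\<integral>x. hat L x \<partial>meas m) \<le> (\<integral>x. f x \<partial>meas m)"
        using * that by (intro integral_mono integrable_meas_bcont bounded_hat continuous_on_hat) auto
      then show "c < (\<integral>x. f x \<partial>meas m)" using * by linarith
    qed
    also have "generate_topology hat_subbasis \<dots>"
      by (intro gUN) (auto simp: hat_subbasis_def intro!: generate_topology.Basis)
    finally show ?thesis .
  qed
  have gt: "generate_topology hat_subbasis {m. c < (\<integral>x. f x \<partial>meas m)}"
    if f: "continuous_on UNIV f" "bounded (range f)" for f :: "'a \<Rightarrow> real" and c
  proof -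
    obtain C where C: "\<And>x. \<bar>f x\<bar> \<le> C" using f(2) by (auto simp: bounded_iff)
    \<comment> \<open>Adding the bound \<open>C\<close> makes the function nonnegative and, all
      masses being one, raises the integral by exactly \<open>C\<close>.\<close>
    have "generate_topology hat_subbasis {m. c + C < (\<integral>x. f x + C \<partial>meas m)}"
    proof (rule pos)
      show "0 \<le> f x + C" for x using C[of x] by linarith
      show "bounded (range (\<lambda>x. f x + C))"
        unfolding bounded_iff
      proof (intro exI[of _ "2 * C"] ballI)
        fix y assume "y \<in> range (\<lambda>x. f x + C)"
        then obtain x where "y = f x + C" by auto
        then show "norm y \<le> 2 * C" using C[of x] by simp
      qed
    qed (use f in \<open>auto intro!: continuous_intros\<close>)
    moreover have "(\<integral>x. f x + C \<partial>meas m) = (\<integral>x. f x \<partial>meas m) + C" for m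
      using f by (subst Bochner_Integration.integral_add)
        (auto intro!: integrable_meas_bcont finite_measure.integrable_const)
    ultimately show ?thesis by simp
  qed
  {
    assume "open S"
    then show "generate_topology hat_subbasis S"
      unfolding open_prob_measure_def
    proof induction
      case (Basis s)
      from Basis(1) obtain f :: "'a \<Rightarrow> real" and V where f: "s = {m. (\<integral>x. f x \<partial>meas m) \<in> V}" "continuous_on UNIV f"
        "bounded (range f)" "open V" by blast
      have "bounded (range (\<lambda>x. - f x))" using f(3) by (simp add: bounded_iff)
      have lt: "generate_topology hat_subbasis {m. (\<integral>x. f x \<partial>meas m) < c}" for c
        using gt[of "\<lambda>x. - f x" "- c"] f \<open>bounded (range (\<lambda>x. - f x))\<close> by (auto intro!: continuous_intros)
      have "s = (\<Union>(a, b)\<in>{(a, b). {a<..<b} \<subseteq> V}. {m. a < (\<integral>x. f x \<partial>meas m)} \<inter> {m. (\<integral>x. f x \<partial>meas m) < b})"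
      proof safe
        fix m assume "m \<in> s"
        then have "(\<integral>x. f x \<partial>meas m) \<in> V" using f by simp
        from openE[OF f(4) this] obtain e where "e > 0" "ball (\<integral>x. f x \<partial>meas m) e \<subseteq> V" by blast
        then show "m \<in> (\<Union>(a, b)\<in>{(a, b). {a<..<b} \<subseteq> V}. {m. a < (\<integral>x. f x \<partial>meas m)} \<inter> {m. (\<integral>x. f x \<partial>meas m) < b})"
          by (intro UN_I[of "((\<integral>x. f x \<partial>meas m) - e, (\<integral>x. f x \<partial>meas m) + e)"])
            (auto simp: ball_eq_greaterThanLessThan)
      next
        fix m a b assume "{a<..<b} \<subseteq> V" "a < (\<integral>x. f x \<partial>meas m)" "(\<integral>x. f x \<partial>meas m) < b"
        then show "m \<in> s" using f(1) by auto
      qed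
      also have "generate_topology hat_subbasis \<dots>"
        using gt[OF f(2,3)] lt by (intro gUN) (auto intro!: generate_topology.Int)
      finally show ?case .
    qed (auto intro: generate_topology.intros)
  }
  {
    assume "generate_topology hat_subbasis S"
    then show "open S"
    proof induction
      case (Basis s)
      then obtain L r where "L \<in> hat_lists" "s = {m. (\<integral>x. hat L x \<partial>meas m) \<in> {r<..}}"
        by (auto simp: hat_subbasis_def)
      then show ?case unfolding open_prob_measure_def
        using continuous_on_hat[of UNIV L] bounded_hat[of L]
        by (intro generate_topology.Basis CollectI exI[of _ "hat L"] exI[of _ "{r<..}"]) simp
    qed auto
  }
qed

lemma countable_hat_subbasis: "countable (hat_subbasis :: 'a::polish_space prob_measure set set)"
  unfolding hat_subbasis_def by (intro countable_image countable_SIGMA countable_hat_lists countable_rat)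

text \<open>Second countability is used throughout: Borel sets of products with such spaces are
  product measurable, and continuity can be tested on sequences.\<close>

instance prob_measure :: (polish_space) second_countable_topology
  by standard (use open_prob_measure_eq countable_hat_subbasis in blast)

text \<open>Countably many test functions suffice, so almost sure convergence for each of them gives
  almost sure convergence of random laws, with a single null set.\<close>

lemma tendsto_prob_measure_hatI:
  fixes X :: "'i \<Rightarrow> 'a::polish_space prob_measure"
  assumes "\<And>L. L \<in> hat_lists \<Longrightarrow> ((\<lambda>i. \<integral>x. hat L x \<partial>meas (X i)) \<longlongrightarrow> (\<integral>x. hat L x \<partial>meas m)) F"
  shows "(X \<longlongrightarrow> m) F"
proof (rule topological_tendstoI)
  fix S :: "'a prob_measure set"
  assume "open S" "m \<in> S"
  then show "\<forall>\<^sub>F i in F. X i \<in> S"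
    unfolding open_prob_measure_eq
  proof induction
    case (Int a b)
    then show ?case by (auto elim: eventually_elim2)
  next
    case (UN K)
    then obtain k where "k \<in> K" "\<forall>\<^sub>F i in F. X i \<in> k" by auto
    then show ?case by (auto elim!: eventually_mono)
  next
    case (Basis s)
    then obtain L r where "L \<in> hat_lists" "s = {m. r < (\<integral>x. hat L x \<partial>meas m)}"
      by (auto simp: hat_subbasis_def)
    then show ?case using order_tendstoD(1)[OF assms[of L], of r] Basis by auto
  qed simp
qed

lemma measurable_prob_measureI:
  fixes \<kappa> :: "'w \<Rightarrow> 'a::polish_space prob_measure"
  assumes "\<And>L. L \<in> hat_lists \<Longrightarrow> (\<lambda>w. \<integral>x. hat L x \<partial>meas (\<kappa> w)) \<in> borel_measurable M"
  shows "\<kappa> \<in> borel_measurable M"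
  unfolding second_countable_borel_measurable[OF open_prob_measure_eq]
proof (rule measurable_measure_of)
  fix A :: "'a prob_measure set" assume "A \<in> hat_subbasis"
  then obtain L r where "L \<in> hat_lists" "A = {m. r < (\<integral>x. hat L x \<partial>meas m)}"
    by (auto simp: hat_subbasis_def)
  then show "\<kappa> -` A \<inter> space M \<in> sets M"
    using measurable_sets[OF assms[of L], of "{r<..}"] by (simp add: vimage_def)
qed auto

section \<open>Measurable dependence of integrals on the law\<close>

lemma continuous_on_integral_meas:
  fixes f :: "'a::topological_space \<Rightarrow> real"
  assumes "continuous_on UNIV f" "bounded (range f)"
  shows "continuous_on UNIV (\<lambda>m. \<integral>x. f x \<partial>meas m)"
  unfolding continuous_on_def using assms by (auto intro: tendsto_integral_meas)

text \<open>The capped multiples of the distance to the complement increase to the indicator of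
  \<open>V\<close>. The whole space is excluded because \<open>infdist\<close> to the empty set is
  zero by convention.\<close>

lemma measure_meas_open_LIMSEQ:
  fixes V :: "'a::metric_space set"
  assumes "open V" and that: "V \<noteq> UNIV"
  shows "(\<lambda>n. \<integral>x. min 1 (real n * infdist x (- V)) \<partial>meas m) \<longlonglongrightarrow> measure (meas m) V"
proof -
  have "(\<lambda>n. \<integral>x. min 1 (real n * infdist x (- V)) \<partial>meas m) \<longlonglongrightarrow> (\<integral>x. indicator V x \<partial>meas m)"
  proof (rule integral_dominated_convergence[where w="\<lambda>_. 1"])
    show "AE x in meas m. (\<lambda>n. min 1 (real n * infdist x (- V))) \<longlonglongrightarrow> indicator V x"
    proof (rule AE_I2)
      fix x
      show "(\<lambda>n. min 1 (real n * infdist x (- V))) \<longlonglongrightarrow> indicator V x"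
      proof (cases "x \<in> V")
        case True
        have "closed (- V)" "- V \<noteq> {}" using assms by (auto simp: closed_def)
        then have pos: "infdist x (- V) > 0"
          using True in_closed_iff_infdist_zero[of "- V" x] infdist_nonneg[of x "- V"] by force
        then obtain k :: nat where k: "1 / infdist x (- V) < real k" using reals_Archimedean2 by blast
        have "min 1 (real n * infdist x (- V)) = 1" if "n \<ge> k" for n
        proof -
          have "1 / infdist x (- V) < real n" using k that by (meson less_le_trans of_nat_le_iff)
          then show ?thesis using pos by (simp add: field_simps)
        qed
        then show ?thesis using True
          by (intro tendsto_eventually) (auto simp: eventually_sequentially)
      next
        case False
        then show ?thesis by simp
      qed
    qed
    show "(\<lambda>x. min 1 (real n * infdist x (- V))) \<in> borel_measurable (meas m)" for n
      by (simp add: borel_measurable_continuous_onI continuous_intros)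
  qed (use assms in \<open>auto intro!: finite_measure.integrable_const simp: infdist_nonneg\<close>)
  then show ?thesis using assms by simp
qed

text \<open>Links the Borel sets of the weak topology with the sigma-algebra for kernels, so that
  integrals against a random law can be treated as integrals against a kernel. The open sets are an
  intersection-stable generator, hence suffice.\<close>

lemma measurable_meas [measurable]:
  "meas \<in> measurable borel (subprob_algebra (borel :: 'a::polish_space measure))"
proof (rule measurable_subprob_algebra_generated[where \<Omega>=UNIV and G="Collect open"])
  show "sets borel = sigma_sets UNIV (Collect (open :: 'a set \<Rightarrow> bool))"
    by (simp add: borel_def)
  fix A :: "'a set" assume "A \<in> Collect open"
  then have A: "open A" by simp
  have "(\<lambda>m. measure (meas m) A) \<in> borel_measurable borel"
  proof (cases "A = UNIV")
    case False
    show ?thesis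
    proof (rule borel_measurable_LIMSEQ_real)
      show "(\<lambda>n. \<integral>x. min 1 (real n * infdist x (- A)) \<partial>meas m) \<longlonglongrightarrow> measure (meas m) A" for m
        by (rule measure_meas_open_LIMSEQ[OF A False])
      show "(\<lambda>m. \<integral>x. min 1 (real n * infdist x (- A)) \<partial>meas m) \<in> borel_measurable borel" for n
        by (intro borel_measurable_continuous_onI continuous_on_integral_meas)
          (auto intro!: continuous_intros exI[of _ 1] simp: bounded_iff infdist_nonneg)
    qed
  qed simp
  moreover have "emeasure (meas m) A = ennreal (measure (meas m) A)" for m
    by (simp add: finite_measure.emeasure_eq_measure)
  ultimately show "(\<lambda>m. emeasure (meas m) A) \<in> borel_measurable borel" by simp
qed (auto simp: Int_stable_def prob_space_imp_subprob_space)

lemma borel_measurable_integral_meas: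
  fixes f :: "'w \<Rightarrow> 'a::polish_space \<Rightarrow> real"
  assumes f [measurable]: "(\<lambda>(w, x). f w x) \<in> borel_measurable (M \<Otimes>\<^sub>M borel)"
    and \<kappa> [measurable]: "\<kappa> \<in> borel_measurable M"
  shows "(\<lambda>w. \<integral>x. f w x \<partial>meas (\<kappa> w)) \<in> borel_measurable M"
proof -
  have k: "(\<lambda>w. meas (\<kappa> w)) \<in> measurable M (subprob_algebra borel)" by measurable
  have nn: "(\<lambda>w. \<integral>\<^sup>+x. g w x \<partial>meas (\<kappa> w)) \<in> borel_measurable M"
    if "(\<lambda>(w, x). g w x) \<in> borel_measurable (M \<Otimes>\<^sub>M borel)" for g :: "'w \<Rightarrow> 'a \<Rightarrow> ennreal"
    by (rule nn_integral_measurable_subprob_algebra2[OF that k])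
  have [measurable]: "(\<lambda>w. \<integral>\<^sup>+x. ennreal (f w x) \<partial>meas (\<kappa> w)) \<in> borel_measurable M"
    "(\<lambda>w. \<integral>\<^sup>+x. ennreal (- f w x) \<partial>meas (\<kappa> w)) \<in> borel_measurable M"
    "(\<lambda>w. \<integral>\<^sup>+x. ennreal (norm (f w x)) \<partial>meas (\<kappa> w)) \<in> borel_measurable M"
    by (intro nn; measurable)+
  \<comment> \<open>The Bochner integral is zero by convention where \<open>f w\<close> is not
    integrable, hence the case distinction; every piece of it is measurable by the nonnegative
    case.\<close>
  have eq: "(\<integral>x. f w x \<partial>meas (\<kappa> w)) = (if (\<integral>\<^sup>+x. ennreal (norm (f w x)) \<partial>meas (\<kappa> w)) < \<infinity>
      then enn2real (\<integral>\<^sup>+x. ennreal (f w x) \<partial>meas (\<kappa> w)) - enn2real (\<integral>\<^sup>+x. ennreal (- f w x) \<partial>meas (\<kappa> w))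
      else 0)" if "w \<in> space M" for w
  proof -
    have "f w \<in> borel_measurable borel" using that by measurable
    then show ?thesis
      by (auto simp: real_lebesgue_integral_def integrable_iff_bounded not_integrable_integral_eq)
  qed
  show ?thesis
    by (subst measurable_cong[OF eq]) measurable
qed

section \<open>Push-forwards and mixtures of laws\<close>

text \<open>Continuous convergence: the test functions may vary with the index.\<close>


definition push :: "('a::topological_space \<Rightarrow> 'b::topological_space) \<Rightarrow> 'a prob_measure \<Rightarrow> 'b prob_measure" where
  "push f m = Abs_prob_measure (distr (meas m) borel f)"

lemma meas_push [simp]:
  assumes "f \<in> borel_measurable borel"
  shows "meas (push f m) = distr (meas m) borel f"
  unfolding push_def using assms by (intro Abs_prob_measure_inverse) (auto intro: prob_space.prob_space_distr)

lemma integral_push: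
  fixes g :: "'b::topological_space \<Rightarrow> 'c::{banach,second_countable_topology}"
  assumes "f \<in> borel_measurable borel" "g \<in> borel_measurable borel"
  shows "(\<integral>x. g x \<partial>meas (push f m)) = (\<integral>x. g (f x) \<partial>meas m)"
  using assms by (simp add: integral_distr)

lemma prob_measure_eqI:
  assumes "\<And>A. A \<in> sets borel \<Longrightarrow> emeasure (meas m) A = emeasure (meas m') A"
  shows "m = m'"
  using assms by (intro meas_inject[THEN iffD1] measure_eqI) auto

lemma nn_integral_mix:
  assumes "0 \<le> \<theta>" "\<theta> \<le> 1" "f \<in> borel_measurable borel"
  shows "(\<integral>\<^sup>+x. f x \<partial>meas (mix \<theta> m m')) =
    ennreal (1 - \<theta>) * (\<integral>\<^sup>+x. f x \<partial>meas m) + ennreal \<theta> * (\<integral>\<^sup>+x. f x \<partial>meas m')"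
  using assms(3)
proof (induction rule: borel_measurable_induct)
  case (cong f g)
  then have "f = g" by auto
  then show ?case using cong by simp
next
  case (set A)
  then show ?case using assms by (simp add: emeasure_mix)
next
  case (mult u c)
  then show ?case by (simp add: nn_integral_cmult algebra_simps)
next
  case (add u v)
  then show ?case by (simp add: nn_integral_add algebra_simps)
next
  case (seq U)
  have *: "(\<integral>\<^sup>+x. (SUP i. U i) x \<partial>meas n) = (SUP i. \<integral>\<^sup>+x. U i x \<partial>meas n)" for n
    using seq by (simp add: nn_integral_monotone_convergence_SUP image_comp)
  have inc: "incseq (\<lambda>i. \<integral>\<^sup>+x. U i x \<partial>meas n)" for n
    using seq(3) by (auto simp: incseq_def le_fun_def intro!: nn_integral_mono)
  show ?case
    unfolding * using seq inc
    by (simp add: SUP_mult_left_ennreal[symmetric] ennreal_SUP_add incseq_def mult_left_mono)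
qed

text \<open>Reduced to \<open>nn_integral_mix\<close> by adding the bound \<open>C\<close>, which
  makes the integrand nonnegative.\<close>

lemma integral_mix:
  fixes f :: "'a::topological_space \<Rightarrow> real"
  assumes \<theta>: "0 \<le> \<theta>" "\<theta> \<le> 1" and f: "f \<in> borel_measurable borel" "\<And>x. \<bar>f x\<bar> \<le> C"
  shows "(\<integral>x. f x \<partial>meas (mix \<theta> m m')) = (1 - \<theta>) * (\<integral>x. f x \<partial>meas m) + \<theta> * (\<integral>x. f x \<partial>meas m')"
proof -
  have i: "integrable (meas n) f" for n using f by (intro integrable_meas_bounded[where C=C]) auto
  have pos0: "0 \<le> f x + C" for x using f(2)[of x] by linarith
  have nn: "(\<integral>\<^sup>+x. ennreal (f x + C) \<partial>meas n) = ennreal ((\<integral>x. f x \<partial>meas n) + C)" for n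
  proof -
    have "(\<integral>\<^sup>+x. ennreal (f x + C) \<partial>meas n) = ennreal (\<integral>x. f x + C \<partial>meas n)"
      using i pos0 by (intro nn_integral_eq_integral Bochner_Integration.integrable_add
        finite_measure.integrable_const AE_I2) auto
    then show ?thesis using i by (simp add: finite_measure.integrable_const)
  qed
  have pos: "0 \<le> (\<integral>x. f x \<partial>meas n) + C" for n
    using integral_meas_bounded[of f C n] f by auto
  have "ennreal ((\<integral>x. f x \<partial>meas (mix \<theta> m m')) + C) =
      ennreal (1 - \<theta>) * ennreal ((\<integral>x. f x \<partial>meas m) + C) + ennreal \<theta> * ennreal ((\<integral>x. f x \<partial>meas m') + C)"
    unfolding nn[symmetric] using \<theta> f by (intro nn_integral_mix) auto
  also have "\<dots> = ennreal ((1 - \<theta>) * ((\<integral>x. f x \<partial>meas m) + C) + \<theta> * ((\<integral>x. f x \<partial>meas m') + C))"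
    using \<theta> pos by (simp add: ennreal_mult' ennreal_plus)
  finally have "(\<integral>x. f x \<partial>meas (mix \<theta> m m')) + C =
      (1 - \<theta>) * ((\<integral>x. f x \<partial>meas m) + C) + \<theta> * ((\<integral>x. f x \<partial>meas m') + C)"
    using \<theta> pos by (subst (asm) ennreal_inj) (auto intro!: add_nonneg_nonneg mult_nonneg_nonneg)
  then show ?thesis by (simp add: algebra_simps)
qed

lemma mix_0 [simp]: "mix 0 m m' = m"
  by (rule prob_measure_eqI) (simp add: emeasure_mix)

lemma mix_1 [simp]: "mix 1 m m' = m'"
  by (rule prob_measure_eqI) (simp add: emeasure_mix)

text \<open>A subsegment of a segment of laws is again a segment, with an affine change of
  parameter. The defining identity of the derivative speaks of whole segments; this makes it
  available between two interior parameters.\<close>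

lemma mix_mix:
  assumes "0 \<le> a" "a \<le> 1" "0 \<le> b" "b \<le> 1" "0 \<le> s" "s \<le> 1"
  shows "mix s (mix a m m') (mix b m m') = mix (a + s * (b - a)) m m'"
proof (rule prob_measure_eqI)
  fix A :: "'a set" assume A: "A \<in> sets borel"
  have r: "0 \<le> a + s * (b - a)" "a + s * (b - a) \<le> 1"
  proof -
    have "a + s * (b - a) = (1 - s) * a + s * b" by (simp add: algebra_simps)
    moreover have "(1 - s) * a + s * b \<le> (1 - s) * 1 + s * 1"
      using assms by (intro add_mono mult_left_mono) auto
    moreover have "0 \<le> (1 - s) * a + s * b" using assms by simp
    ultimately show "0 \<le> a + s * (b - a)" "a + s * (b - a) \<le> 1" by auto
  qed
  have e: "emeasure (meas n) A = ennreal (measure (meas n) A)" for n :: "'a prob_measure"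
    by (simp add: finite_measure.emeasure_eq_measure)
  show "emeasure (meas (mix s (mix a m m') (mix b m m'))) A = emeasure (meas (mix (a + s * (b - a)) m m')) A"
    using assms r A apply (simp add: emeasure_mix)
    apply (simp add: e flip: ennreal_mult' ennreal_plus)
    apply (simp add: algebra_simps)
    done
qed

lemma push_mix:
  assumes "0 \<le> \<theta>" "\<theta> \<le> 1" and [measurable]: "f \<in> borel_measurable borel"
  shows "push f (mix \<theta> m m') = mix \<theta> (push f m) (push f m')"
proof (rule prob_measure_eqI)
  fix A :: "'b set" assume [measurable]: "A \<in> sets borel"
  have "f -` A \<in> sets borel" using measurable_sets[of f borel borel A] by simp
  then show "emeasure (meas (push f (mix \<theta> m m'))) A = emeasure (meas (mix \<theta> (push f m) (push f m'))) A"
    using assms by (simp add: emeasure_mix emeasure_distr)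
qed

lemma tendsto_mix:
  fixes m m' :: "'i \<Rightarrow> 'a::topological_space prob_measure"
  assumes m: "(m \<longlongrightarrow> m0) F" and m': "(m' \<longlongrightarrow> m0') F" and \<theta>: "(\<theta> \<longlongrightarrow> \<theta>0) F"
    and r: "\<And>i. \<theta> i \<in> {0..1}" "\<theta>0 \<in> {0..1}"
  shows "((\<lambda>i. mix (\<theta> i) (m i) (m' i)) \<longlongrightarrow> mix \<theta>0 m0 m0') F"
  unfolding tendsto_prob_measure_iff
proof (intro allI impI, elim conjE)
  fix f :: "'a \<Rightarrow> real" assume f: "continuous_on UNIV f" "bounded (range f)"
  then obtain C where C: "\<And>x. \<bar>f x\<bar> \<le> C" by (auto simp: bounded_iff)
  have *: "(\<integral>x. f x \<partial>meas (mix \<theta> m m')) = (1 - \<theta>) * (\<integral>x. f x \<partial>meas m) + \<theta> * (\<integral>x. f x \<partial>meas m')"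
    if "\<theta> \<in> {0..1}" for \<theta> m m'
    using that f C by (intro integral_mix) (auto intro: borel_measurable_continuous_onI)
  show "((\<lambda>i. \<integral>x. f x \<partial>meas (mix (\<theta> i) (m i) (m' i))) \<longlongrightarrow> (\<integral>x. f x \<partial>meas (mix \<theta>0 m0 m0'))) F"
    unfolding *[OF r(1)] *[OF r(2)] using f
    by (intro tendsto_intros \<theta> tendsto_integral_meas m m')
qed

lemma abs_convex_combination_diff_le:
  fixes a b c t :: real
  assumes "0 \<le> t" "t \<le> 1"
  shows "\<bar>(1 - t) * a + t * b - c\<bar> \<le> \<bar>a - c\<bar> + \<bar>b - c\<bar>"
proof -
  have "(1 - t) * a + t * b - c = (1 - t) * (a - c) + t * (b - c)" by (simp add: algebra_simps)
  also have "\<bar>\<dots>\<bar> \<le> \<bar>(1 - t) * (a - c)\<bar> + \<bar>t * (b - c)\<bar>" by (rule abs_triangle_ineq)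
  also have "\<dots> \<le> 1 * \<bar>a - c\<bar> + 1 * \<bar>b - c\<bar>"
    unfolding abs_mult using assms by (intro add_mono mult_right_mono) auto
  finally show ?thesis by simp
qed

text \<open>When both end points converge to the same limit, the weights need not converge.\<close>

lemma tendsto_mix_same:
  fixes m m' :: "'i \<Rightarrow> 'a::topological_space prob_measure"
  assumes m: "(m \<longlongrightarrow> m0) F" and m': "(m' \<longlongrightarrow> m0) F"
    and r: "\<And>i. \<theta> i \<in> {0..1}"
  shows "((\<lambda>i. mix (\<theta> i) (m i) (m' i)) \<longlongrightarrow> m0) F"
  unfolding tendsto_prob_measure_iff
proof (intro allI impI, elim conjE)
  fix f :: "'a \<Rightarrow> real" assume f: "continuous_on UNIV f" "bounded (range f)"
  then obtain C where C: "\<And>x. \<bar>f x\<bar> \<le> C" by (auto simp: bounded_iff)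
  let ?I = "\<lambda>m. \<integral>x. f x \<partial>meas m"
  have *: "?I (mix (\<theta> i) (m i) (m' i)) = (1 - \<theta> i) * ?I (m i) + \<theta> i * ?I (m' i)" for i
    using r[of i] f C by (intro integral_mix) (auto intro: borel_measurable_continuous_onI)
  have t: "((\<lambda>i. ?I (m i)) \<longlongrightarrow> ?I m0) F" "((\<lambda>i. ?I (m' i)) \<longlongrightarrow> ?I m0) F"
    using f m m' by (auto intro: tendsto_integral_meas)
  have lim: "((\<lambda>i. \<bar>?I (m i) - ?I m0\<bar> + \<bar>?I (m' i) - ?I m0\<bar>) \<longlongrightarrow> 0) F"
    using t by (auto intro!: tendsto_eq_intros)
  have le: "norm (?I (mix (\<theta> i) (m i) (m' i)) - ?I m0) \<le> \<bar>?I (m i) - ?I m0\<bar> + \<bar>?I (m' i) - ?I m0\<bar>" for i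
    unfolding * real_norm_def by (intro abs_convex_combination_diff_le) (use r[of i] in simp_all)
  have "((\<lambda>i. ?I (mix (\<theta> i) (m i) (m' i)) - ?I m0) \<longlongrightarrow> 0) F"
    by (rule Lim_null_comparison[OF always_eventually[OF allI] lim]) (rule le)
  then show "((\<lambda>i. ?I (mix (\<theta> i) (m i) (m' i))) \<longlongrightarrow> ?I m0) F" by (simp add: LIM_zero_iff)
qed

lemma measurable_mix:
  fixes \<kappa> \<kappa>' :: "'w \<Rightarrow> 'a::polish_space prob_measure"
  assumes [measurable]: "\<kappa> \<in> borel_measurable M" "\<kappa>' \<in> borel_measurable M" "\<theta> \<in> borel_measurable M"
    and r: "\<And>w. w \<in> space M \<Longrightarrow> \<theta> w \<in> {0..1}"
  shows "(\<lambda>w. mix (\<theta> w) (\<kappa> w) (\<kappa>' w)) \<in> borel_measurable M"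
proof (rule measurable_prob_measureI)
  fix L :: "('a \<times> real \<times> real) list" assume L: "L \<in> hat_lists"
  obtain C where "\<And>x. \<bar>hat L x\<bar> \<le> C" using bounded_hat[OF L] by (auto simp: bounded_iff)
  then have *: "(\<integral>x. hat L x \<partial>meas (mix (\<theta> w) (\<kappa> w) (\<kappa>' w))) =
      (1 - \<theta> w) * (\<integral>x. hat L x \<partial>meas (\<kappa> w)) + \<theta> w * (\<integral>x. hat L x \<partial>meas (\<kappa>' w))" if "w \<in> space M" for w
    using r[OF that] by (intro integral_mix) auto
  have [measurable]: "(\<lambda>w. \<integral>x. hat L x \<partial>meas (\<kappa> w)) \<in> borel_measurable M"
    "(\<lambda>w. \<integral>x. hat L x \<partial>meas (\<kappa>' w)) \<in> borel_measurable M"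
    by (intro borel_measurable_integral_meas; measurable)+
  show "(\<lambda>w. \<integral>x. hat L x \<partial>meas (mix (\<theta> w) (\<kappa> w) (\<kappa>' w))) \<in> borel_measurable M"
    by (subst measurable_cong[OF *]) measurable
qed

text \<open>The map itself may be random, as for the translation by an increment of the common
  noise.\<close>

lemma measurable_push:
  fixes \<kappa> :: "'w \<Rightarrow> 'a::polish_space prob_measure" and h :: "'w \<Rightarrow> 'a \<Rightarrow> 'b::polish_space"
  assumes [measurable]: "\<kappa> \<in> borel_measurable M" "(\<lambda>(w, x). h w x) \<in> borel_measurable (M \<Otimes>\<^sub>M borel)"
  shows "(\<lambda>w. push (h w) (\<kappa> w)) \<in> borel_measurable M"
proof (rule measurable_prob_measureI)
  fix L :: "('b \<times> real \<times> real) list" assume L: "L \<in> hat_lists"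
  have *: "(\<integral>x. hat L x \<partial>meas (push (h w) (\<kappa> w))) = (\<integral>x. hat L (h w x) \<partial>meas (\<kappa> w))" if "w \<in> space M" for w
  proof -
    have "h w \<in> borel_measurable borel" using measurable_Pair2[OF assms(2) that] by simp
    then show ?thesis by (rule integral_push[OF _ borel_measurable_hat])
  qed
  have "(\<lambda>(w, x). hat L (h w x)) \<in> borel_measurable (M \<Otimes>\<^sub>M borel)"
    using measurable_compose[OF assms(2) borel_measurable_hat, of L] by (simp add: case_prod_beta')
  then have "(\<lambda>w. \<integral>x. hat L (h w x) \<partial>meas (\<kappa> w)) \<in> borel_measurable M"
    using assms(1) by (rule borel_measurable_integral_meas)
  then show "(\<lambda>w. \<integral>x. hat L x \<partial>meas (push (h w) (\<kappa> w))) \<in> borel_measurable M"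
    by (subst measurable_cong[OF *])
qed

text \<open>Otherwise points with a gap above \<open>e\<close> exist along a subsequence.
  Compactness gives them a limit \<open>x\<close> along a further one, and there continuous
  convergence together with continuity of \<open>g0\<close> closes the gap.\<close>

lemma uniform_of_continuous_convergence:
  fixes g :: "nat \<Rightarrow> 'a::metric_space \<Rightarrow> real"
  assumes conv: "\<And>x X. X \<longlonglongrightarrow> x \<Longrightarrow> x \<in> K \<Longrightarrow> (\<And>n. X n \<in> K) \<Longrightarrow> (\<lambda>n. g n (X n)) \<longlonglongrightarrow> g0 x"
    and g0: "continuous_on K g0" and K: "compact K" and e: "e > 0"
  shows "\<forall>\<^sub>F n in sequentially. \<forall>x\<in>K. \<bar>g n x - g0 x\<bar> \<le> e"
proof (rule ccontr)
  assume "\<not> (\<forall>\<^sub>F n in sequentially. \<forall>x\<in>K. \<bar>g n x - g0 x\<bar> \<le> e)"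
  from not_eventually_sequentiallyD[OF this] obtain r :: "nat \<Rightarrow> nat"
    where r: "strict_mono r" "\<And>n. \<not> (\<forall>x\<in>K. \<bar>g (r n) x - g0 x\<bar> \<le> e)" by auto
  then obtain X where X: "\<And>n. X n \<in> K" "\<And>n. \<bar>g (r n) (X n) - g0 (X n)\<bar> > e"
    by (metis not_le)
  from K X(1) obtain x q where x: "x \<in> K" "strict_mono (q :: nat \<Rightarrow> nat)" "(X \<circ> q) \<longlonglongrightarrow> x"
    unfolding compact_def by metis
  define s where "s = r \<circ> q"
  have s: "strict_mono s" using r(1) x(2) by (simp add: s_def strict_mono_o)
  \<comment> \<open>The hypothesis speaks of full sequences, so the indices outside the subsequence
    are filled with the limit \<open>x\<close>.\<close>
  define Y where "Y n = (if n \<in> range s then (X \<circ> q) (inv s n) else x)" for n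
  have Ys: "Y (s k) = (X \<circ> q) k" for k
    using strict_mono_imp_inj_on[OF s] by (simp add: Y_def)
  have "Y \<longlonglongrightarrow> x"
  proof (rule metric_LIMSEQ_I)
    fix d :: real assume "d > 0"
    from metric_LIMSEQ_D[OF x(3) this] obtain k0 where k0: "\<And>k. k \<ge> k0 \<Longrightarrow> dist ((X \<circ> q) k) x < d" by auto
    have "dist (Y n) x < d" if "n \<ge> s k0" for n
    proof (cases "n \<in> range s")
      case True
      then obtain k where k: "n = s k" by auto
      then have "k \<ge> k0" using that s by (simp add: strict_mono_less_eq)
      then show ?thesis using k0 by (simp add: k Ys)
    next
      case False
      then show ?thesis using \<open>d > 0\<close> by (simp add: Y_def)
    qed
    then show "\<exists>no. \<forall>n\<ge>no. dist (Y n) x < d" by blast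
  qed
  moreover have "Y n \<in> K" for n using X(1) x(1) by (simp add: Y_def)
  ultimately have "(\<lambda>n. g n (Y n)) \<longlonglongrightarrow> g0 x" using x(1) by (intro conv)
  then have "((\<lambda>n. g n (Y n)) \<circ> s) \<longlonglongrightarrow> g0 x"
    using s by (rule LIMSEQ_subseq_LIMSEQ)
  then have 1: "(\<lambda>k. g (s k) ((X \<circ> q) k)) \<longlonglongrightarrow> g0 x" by (simp add: Ys o_def)
  have 2: "(\<lambda>k. g0 ((X \<circ> q) k)) \<longlonglongrightarrow> g0 x"
    using g0 x(3) by (rule continuous_on_tendsto_compose) (use x(1) X(1) in auto)
  have "(\<lambda>k. \<bar>g (s k) ((X \<circ> q) k) - g0 ((X \<circ> q) k)\<bar>) \<longlonglongrightarrow> \<bar>g0 x - g0 x\<bar>"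
    by (intro tendsto_rabs tendsto_diff 1 2)
  then have "(\<lambda>k. \<bar>g (s k) ((X \<circ> q) k) - g0 ((X \<circ> q) k)\<bar>) \<longlonglongrightarrow> 0" by simp
  from order_tendstoD(2)[OF this e] obtain k where "\<bar>g (s k) ((X \<circ> q) k) - g0 ((X \<circ> q) k)\<bar> < e"
    by (auto simp: eventually_sequentially)
  with X(2)[of "q k"] show False by (simp add: s_def)
qed

text \<open>The mass of the tail \<open>norm x \<ge> R + 1\<close> is controlled by a continuous cut-off, hence uniformly
  along a weakly convergent sequence.\<close>

lemma tendsto_integral_continuous_convergence:
  fixes g :: "nat \<Rightarrow> 'a::euclidean_space \<Rightarrow> real"
  assumes \<nu>: "\<nu> \<longlonglongrightarrow> \<nu>0"
    and conv: "\<And>x X. X \<longlonglongrightarrow> x \<Longrightarrow> (\<lambda>n. g n (X n)) \<longlonglongrightarrow> g0 x"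
    and g0: "continuous_on UNIV g0"
    and [measurable]: "\<And>n. g n \<in> borel_measurable borel"
    and C: "\<And>n x. \<bar>g n x\<bar> \<le> C"
  shows "(\<lambda>n. \<integral>x. g n x \<partial>meas (\<nu> n)) \<longlonglongrightarrow> (\<integral>x. g0 x \<partial>meas \<nu>0)"
proof -
  have [measurable]: "g0 \<in> borel_measurable borel" using g0 by (rule borel_measurable_continuous_onI)
  have C0: "\<bar>g0 x\<bar> \<le> C" for x
  proof -
    have "(\<lambda>n. \<bar>g n x\<bar>) \<longlonglongrightarrow> \<bar>g0 x\<bar>" using conv[of "\<lambda>_. x" x] by (intro tendsto_rabs) simp
    then show ?thesis by (rule LIMSEQ_le_const2) (use C in auto)
  qed
  have "0 \<le> C" using C0[of 0] by linarith
  define c :: "real \<Rightarrow> 'a \<Rightarrow> real" where "c R x = max 0 (min 1 (norm x - R))" for R x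
  have c_cont: "continuous_on UNIV (c R)" for R unfolding c_def by (intro continuous_intros)
  then have c_meas [measurable]: "c R \<in> borel_measurable borel" for R by (rule borel_measurable_continuous_onI)
  have c01: "0 \<le> c R x" "c R x \<le> 1" for R x by (auto simp: c_def)
  then have c_bd: "norm (c R x) \<le> 1" for R x by (simp add: abs_of_nonneg)
  have "bounded (range (c R))" for R using c_bd unfolding bounded_iff by blast
  note c_tend = tendsto_integral_meas[OF \<nu> c_cont this]
  have ci: "integrable (meas m) (c R)" for m R using c_bd by (intro integrable_meas_bounded[where C=1]) auto
  have gi: "integrable (meas m) (\<lambda>x. g n x)" "integrable (meas m) g0" for m n
    using C C0 by (auto intro!: integrable_meas_bounded[where C=C])
  have "(\<lambda>R::nat. \<integral>x. c (real R) x \<partial>meas \<nu>0) \<longlonglongrightarrow> (\<integral>x. 0 \<partial>meas \<nu>0)"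
  proof (rule integral_dominated_convergence[where w="\<lambda>_. 1"])
    show "AE x in meas \<nu>0. (\<lambda>R::nat. c (real R) x) \<longlonglongrightarrow> 0"
    proof (rule AE_I2)
      fix x :: 'a
      obtain N :: nat where N: "norm x \<le> real N" using real_arch_simple by blast
      have "c (real R) x = 0" if "R \<ge> N" for R :: nat
        using N that by (auto simp: c_def max_def min_def)
      then show "(\<lambda>R::nat. c (real R) x) \<longlonglongrightarrow> 0"
        by (intro tendsto_eventually) (auto simp: eventually_sequentially)
    qed
  qed (use c_bd in \<open>auto intro!: finite_measure.integrable_const\<close>)
  then have c_lim: "(\<lambda>R::nat. \<integral>x. c (real R) x \<partial>meas \<nu>0) \<longlonglongrightarrow> 0" by simp
  have "(\<lambda>n. (\<integral>x. g n x \<partial>meas (\<nu> n)) - (\<integral>x. g0 x \<partial>meas (\<nu> n))) \<longlonglongrightarrow> 0"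
  proof (rule LIMSEQ_I)
    fix e :: real assume "e > 0"
    \<comment> \<open>Chosen so that the error \<open>d\<close> on the ball plus the tail
      contribution \<open>2 * C * d\<close> stays strictly below \<open>e\<close>, also when
      \<open>C = 0\<close>.\<close>
    define d where "d = e / (2 * C + 2)"
    have d: "d > 0" using \<open>e > 0\<close> \<open>0 \<le> C\<close> by (auto simp: d_def)
    have "(2 * C + 2) * d = e" using \<open>0 \<le> C\<close> by (simp add: d_def)
    then have d2: "d + 2 * C * d < e" using d by (simp add: algebra_simps)
    from order_tendstoD(2)[OF c_lim d] obtain R :: nat where R: "(\<integral>x. c (real R) x \<partial>meas \<nu>0) < d"
      by (auto simp: eventually_sequentially)
    from order_tendstoD(2)[OF c_tend R]
    have e1: "\<forall>\<^sub>F n in sequentially. (\<integral>x. c (real R) x \<partial>meas (\<nu> n)) < d" .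
    have e2: "\<forall>\<^sub>F n in sequentially. \<forall>x\<in>cball 0 (real R + 1). \<bar>g n x - g0 x\<bar> \<le> d"
      by (rule uniform_of_continuous_convergence[OF conv continuous_on_subset[OF g0] _ d]) auto
    from e1 e2 have "\<forall>\<^sub>F n in sequentially. norm ((\<integral>x. g n x \<partial>meas (\<nu> n)) - (\<integral>x. g0 x \<partial>meas (\<nu> n)) - 0) < e"
    proof eventually_elim
      case (elim n)
      have le: "\<bar>g n x - g0 x\<bar> \<le> d + 2 * C * c (real R) x" for x
      proof (cases "norm x \<le> real R + 1")
        case True
        have "0 \<le> 2 * C * c (real R) x" using \<open>0 \<le> C\<close> c01 by simp
        moreover have "\<bar>g n x - g0 x\<bar> \<le> d" using elim(2) True by simp
        ultimately show ?thesis by linarith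
      next
        case False
        then have "c (real R) x = 1" by (simp add: c_def)
        then show ?thesis using C[of n x] C0[of x] d by (simp add: abs_le_iff)
      qed
      have "\<bar>(\<integral>x. g n x \<partial>meas (\<nu> n)) - (\<integral>x. g0 x \<partial>meas (\<nu> n))\<bar> = \<bar>\<integral>x. g n x - g0 x \<partial>meas (\<nu> n)\<bar>"
        using gi by simp
      also have "\<dots> \<le> (\<integral>x. \<bar>g n x - g0 x\<bar> \<partial>meas (\<nu> n))" by (rule integral_abs_bound)
      also have "\<dots> \<le> (\<integral>x. d + 2 * C * c (real R) x \<partial>meas (\<nu> n))"
        using gi ci le by (intro integral_mono) (auto intro!: finite_measure.integrable_const)
      also have "\<dots> = d + 2 * C * (\<integral>x. c (real R) x \<partial>meas (\<nu> n))"
        using ci by (simp add: finite_measure.integrable_const)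
      also have "\<dots> \<le> d + 2 * C * d" using elim(1) \<open>0 \<le> C\<close> by (intro add_left_mono mult_left_mono) auto
      also have "\<dots> < e" by (rule d2)
      finally show ?case by simp
    qed
    then show "\<exists>no. \<forall>n\<ge>no. norm ((\<integral>x. g n x \<partial>meas (\<nu> n)) - (\<integral>x. g0 x \<partial>meas (\<nu> n)) - 0) < e"
      by (simp add: eventually_sequentially)
  qed
  moreover have "(\<lambda>n. \<integral>x. g0 x \<partial>meas (\<nu> n)) \<longlonglongrightarrow> (\<integral>x. g0 x \<partial>meas \<nu>0)"
    using C0 by (intro tendsto_integral_meas \<nu> g0) (auto simp: bounded_iff)
  ultimately show ?thesis using tendsto_add by fastforce
qed

text \<open>The continuous mapping theorem for maps that vary with the index; it serves for the
  projections to growing balls and for translations by vanishing increments.\<close>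

lemma tendsto_push:
  fixes f :: "nat \<Rightarrow> 'a::euclidean_space \<Rightarrow> 'b::topological_space"
  assumes \<nu>: "\<nu> \<longlonglongrightarrow> \<nu>0"
    and conv: "\<And>x X. X \<longlonglongrightarrow> x \<Longrightarrow> (\<lambda>n. f n (X n)) \<longlonglongrightarrow> f0 x"
    and f0: "continuous_on UNIV f0"
    and f: "\<And>n. f n \<in> borel_measurable borel"
  shows "(\<lambda>n. push (f n) (\<nu> n)) \<longlonglongrightarrow> push f0 \<nu>0"
  unfolding tendsto_prob_measure_iff
proof (intro allI impI, elim conjE)
  fix h :: "'b \<Rightarrow> real" assume h: "continuous_on UNIV h" "bounded (range h)"
  then obtain C where C: "\<And>x. \<bar>h x\<bar> \<le> C" by (auto simp: bounded_iff)
  have hm: "h \<in> borel_measurable borel" using h(1) by (rule borel_measurable_continuous_onI)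
  have f0m: "f0 \<in> borel_measurable borel" using f0 by (rule borel_measurable_continuous_onI)
  show "(\<lambda>n. \<integral>x. h x \<partial>meas (push (f n) (\<nu> n))) \<longlonglongrightarrow> (\<integral>x. h x \<partial>meas (push f0 \<nu>0))"
    unfolding integral_push[OF f hm] integral_push[OF f0m hm]
  proof (rule tendsto_integral_continuous_convergence[OF \<nu>])
    show "(\<lambda>n. h (f n (X n))) \<longlonglongrightarrow> h (f0 x)" if "X \<longlonglongrightarrow> x" for x X
      using h(1) conv[OF that] by (rule continuous_on_tendsto_compose) auto
    show "continuous_on UNIV (\<lambda>x. h (f0 x))"
      using continuous_on_compose2[OF h(1) f0] by simp
    show "(\<lambda>x. h (f n x)) \<in> borel_measurable borel" for n
      using measurable_compose[OF f hm] by simp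
    show "\<bar>h (f n x)\<bar> \<le> C" for n x by (rule C)
  qed
qed

section \<open>Differentiation along segments of conditional laws\<close>

text \<open>Projection to a ball is bounded, so a derivative of linear growth becomes bounded, and
  it is 1-Lipschitz, so differences keep a bound independent of \<open>n\<close>. Both are required,
  since the laws need not have moments.\<close>

definition trunc :: "nat \<Rightarrow> 'a::euclidean_space \<Rightarrow> 'a" where
  "trunc n = closest_point (cball 0 (real n))"

lemma norm_trunc_le: "norm (trunc n x) \<le> real n"
  using closest_point_in_set[of "cball (0::'a) (real n)" x] by (auto simp: trunc_def)

lemma trunc_lipschitz: "norm (trunc n x - trunc n y) \<le> norm (x - y)"
  using closest_point_lipschitz[of "cball (0::'a) (real n)" x y] by (simp add: trunc_def dist_norm)

lemma continuous_on_trunc: "continuous_on A (trunc n)"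
  unfolding trunc_def by (rule continuous_on_closest_point) auto

lemma borel_measurable_trunc [measurable]: "trunc n \<in> borel_measurable borel"
  by (intro borel_measurable_continuous_onI continuous_on_trunc)

lemma trunc_tendsto:
  assumes "X \<longlonglongrightarrow> x" shows "(\<lambda>n. trunc n (X n)) \<longlonglongrightarrow> x"
proof -
  obtain N :: nat where N: "norm x < real N" using reals_Archimedean2 by blast
  have "\<forall>\<^sub>F n in sequentially. norm (X n) < real N"
    using assms N by (intro order_tendstoD(2)[OF tendsto_norm])
  moreover have "\<forall>\<^sub>F n in sequentially. n \<ge> N" by (rule eventually_ge_at_top)
  ultimately have "\<forall>\<^sub>F n in sequentially. X n = trunc n (X n)"
  proof eventually_elim
    case (elim n)
    then show ?case unfolding trunc_def by (intro closest_point_self[symmetric]) auto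
  qed
  then show ?thesis using assms by (rule Lim_transform_eventually[rotated])
qed

lemma push_trunc_tendsto: "(\<lambda>n. push (trunc n) \<nu>) \<longlonglongrightarrow> (\<nu> :: 'a::euclidean_space prob_measure)"
proof -
  have "(\<lambda>n. push (trunc n) \<nu>) \<longlonglongrightarrow> push (\<lambda>x. x) \<nu>"
    by (rule tendsto_push) (auto intro: trunc_tendsto continuous_on_id)
  moreover have "push (\<lambda>x. x) \<nu> = \<nu>"
    by (rule prob_measure_eqI) (simp add: emeasure_distr)
  ultimately show ?thesis by simp
qed

text \<open>The properties that the differentiation argument uses. They hold for \<open>U t\<close>
  with \<open>D1 t\<close> and, for each fixed \<open>x\<close>, for \<open>D1\<close> at
  \<open>x\<close> as a function of the law, with derivative \<open>D2\<close>. The value zero at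
  the origin turns the Lipschitz bound into linear growth.\<close>

definition regular_linear_derivative ::
  "((real^'d) prob_measure \<Rightarrow> real) \<Rightarrow> ((real^'d) prob_measure \<Rightarrow> real^'d \<Rightarrow> real) \<Rightarrow> real \<Rightarrow> bool" where
  "regular_linear_derivative \<Phi> D L \<longleftrightarrow> has_linear_derivative \<Phi> D \<and> bounded (range \<Phi>) \<and> continuous_on UNIV \<Phi> \<and>
     (\<forall>m. D m 0 = 0) \<and> (\<forall>m x y. \<bar>D m x - D m y\<bar> \<le> L * norm (x - y)) \<and>
     continuous_on UNIV (\<lambda>(m, x). D m x)"

text \<open>When \<open>\<kappa>\<close> is a function of \<open>Z\<close>, this says that
  \<open>\<kappa>\<close> is the conditional law of \<open>Y\<close> given \<open>Z\<close>. Joint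
  test functions let the integrand depend on random measures that are part of
  \<open>Z\<close>.\<close>

definition disintegrates :: "'w measure \<Rightarrow> ('w \<Rightarrow> 'z::topological_space) \<Rightarrow> ('w \<Rightarrow> (real^'d) prob_measure) \<Rightarrow> ('w \<Rightarrow> real^'d) \<Rightarrow> bool" where
  "disintegrates M Z \<kappa> Y \<longleftrightarrow> (\<forall>g :: 'z \<times> (real^'d) \<Rightarrow> real. g \<in> borel_measurable borel \<longrightarrow> bounded (range g) \<longrightarrow>
     (\<integral>w. g (Z w, Y w) \<partial>M) = (\<integral>w. (\<integral>y. g (Z w, y) \<partial>meas (\<kappa> w)) \<partial>M))"

context
  fixes \<Phi> :: "(real^'d) prob_measure \<Rightarrow> real" and D L
  assumes reg: "regular_linear_derivative \<Phi> D L"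
begin

lemma reg_lip: "\<bar>D m x - D m y\<bar> \<le> L * norm (x - y)"
  and reg_le: "\<bar>D m x\<bar> \<le> L * norm x"
  and reg_L: "0 \<le> L"
proof -
  show l: "\<bar>D m x - D m y\<bar> \<le> L * norm (x - y)" for m x y
    using reg by (simp add: regular_linear_derivative_def)
  have "D m 0 = 0" for m using reg by (simp add: regular_linear_derivative_def)
  then show "\<bar>D m x\<bar> \<le> L * norm x" using l[of m x 0] by simp
  \<comment> \<open>Any unit vector serves: the Lipschitz bound between it and the origin forces the
    constant to be nonnegative.\<close>
  show "0 \<le> L" using l[of undefined "axis undefined 1" 0] by simp
qed

lemma reg_tendsto: "m' \<longlonglongrightarrow> m \<Longrightarrow> x' \<longlonglongrightarrow> x \<Longrightarrow> (\<lambda>n. D (m' n) (x' n)) \<longlonglongrightarrow> D m x"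
  using reg continuous_on_tendsto_compose[where f="\<lambda>(m, x). D m x" and s=UNIV, of "\<lambda>n. (m' n, x' n)" "(m, x)"]
  by (auto simp: regular_linear_derivative_def intro: tendsto_Pair)

lemma reg_measurable: "(\<lambda>(m, x). D m x) \<in> borel_measurable (borel \<Otimes>\<^sub>M borel)"
  using reg by (auto simp: regular_linear_derivative_def borel_prod intro: borel_measurable_continuous_onI)

lemma reg_measurable' [measurable (raw)]:
  "f \<in> borel_measurable N \<Longrightarrow> g \<in> borel_measurable N \<Longrightarrow> (\<lambda>w. D (f w) (g w)) \<in> borel_measurable N"
  using measurable_compose[OF measurable_Pair[of f N borel g borel] reg_measurable] by simp

text \<open>After the projection the integrand is bounded by \<open>L * n\<close>, which verifies
  the integrability premise of the defining identity. The factor \<open>b - a\<close> appears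
  because the end points differ by \<open>b - a\<close> times the difference of the projected
  \<open>m'\<close> and \<open>m\<close>.\<close>

lemma reg_increment_trunc:
  assumes ab: "a \<in> {0..1}" "b \<in> {0..1}"
  shows "\<Phi> (push (trunc n) (mix b m m')) - \<Phi> (push (trunc n) (mix a m m')) =
    (LBINT s:{0..1}. (b - a) * ((\<integral>x. D (push (trunc n) (mix (a + s * (b - a)) m m')) (trunc n x) \<partial>meas m')
       - (\<integral>x. D (push (trunc n) (mix (a + s * (b - a)) m m')) (trunc n x) \<partial>meas m)))"
proof -
  let ?p = "\<lambda>\<theta>. push (trunc n) (mix \<theta> m m')"
  \<comment> \<open>Push-forward commutes with mixing, so the segment between the two projected
    points is part of the projected segment.\<close>
  have mix: "mix s (?p a) (?p b) = ?p (a + s * (b - a))" if "s \<in> {0..1}" for s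
    using that ab by (simp add: push_mix[symmetric] mix_mix)
  have bd: "\<bar>D p (trunc n x)\<bar> \<le> L * real n" for p x
    using reg_le[of p "trunc n x"] norm_trunc_le[of n x] reg_L
    by (meson mult_left_mono order_trans)
  have Dm [measurable]: "D p \<in> borel_measurable borel" for p by measurable
  have int: "(\<integral>x. D p x \<partial>meas (?p \<theta>)) = (1 - \<theta>) * (\<integral>x. D p (trunc n x) \<partial>meas m) + \<theta> * (\<integral>x. D p (trunc n x) \<partial>meas m')"
    if "\<theta> \<in> {0..1}" for p \<theta>
    using that bd by (subst integral_push; (subst integral_mix[where C="L * real n"])?) auto
  have nn: "(\<integral>\<^sup>+x. ennreal (norm (D p x)) \<partial>meas (?p \<theta>)) \<le> ennreal (L * real n)" for p \<theta>
  proof -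
    have "(\<integral>\<^sup>+x. ennreal (norm (D p x)) \<partial>meas (?p \<theta>)) = (\<integral>\<^sup>+x. ennreal (norm (D p (trunc n x))) \<partial>meas (mix \<theta> m m'))"
      by (simp add: nn_integral_distr)
    also have "\<dots> \<le> (\<integral>\<^sup>+x. ennreal (L * real n) \<partial>meas (mix \<theta> m m'))"
      using bd by (intro nn_integral_mono ennreal_leI) simp
    finally show ?thesis by simp
  qed
  have "(\<integral>\<^sup>+\<theta>\<in>{0..1}. ((\<integral>\<^sup>+x. norm (D (mix \<theta> (?p a) (?p b)) x) \<partial>meas (?p b))
                   + (\<integral>\<^sup>+x. norm (D (mix \<theta> (?p a) (?p b)) x) \<partial>meas (?p a))) \<partial>lborel)
      \<le> (\<integral>\<^sup>+\<theta>\<in>{0..1::real}. (ennreal (L * real n) + ennreal (L * real n)) \<partial>lborel)"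
    using nn by (intro nn_integral_mono) (auto split: split_indicator intro!: add_mono)
  also have "\<dots> < \<infinity>"
    by (simp add: nn_integral_cmult_indicator ennreal_mult_less_top)
  finally have "\<Phi> (?p b) - \<Phi> (?p a) = (LBINT \<theta>:{0..1}. (\<integral>x. D (mix \<theta> (?p a) (?p b)) x \<partial>meas (?p b))
                                          - (\<integral>x. D (mix \<theta> (?p a) (?p b)) x \<partial>meas (?p a)))"
    using reg unfolding regular_linear_derivative_def has_linear_derivative_def by blast
  also have "\<dots> = (LBINT s:{0..1}. (b - a) * ((\<integral>x. D (?p (a + s * (b - a))) (trunc n x) \<partial>meas m')
       - (\<integral>x. D (?p (a + s * (b - a))) (trunc n x) \<partial>meas m)))"
  proof (rule set_lebesgue_integral_cong)
    show "\<forall>s. s \<in> {0..1} \<longrightarrow> (\<integral>x. D (mix s (?p a) (?p b)) x \<partial>meas (?p b)) - (\<integral>x. D (mix s (?p a) (?p b)) x \<partial>meas (?p a)) =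
       (b - a) * ((\<integral>x. D (?p (a + s * (b - a))) (trunc n x) \<partial>meas m') - (\<integral>x. D (?p (a + s * (b - a))) (trunc n x) \<partial>meas m))"
      unfolding int[OF ab(1)] int[OF ab(2)] by (auto simp: mix algebra_simps simp del: meas_push)
  qed simp
  finally show ?thesis .
qed

section \<open>Derivative of an expectation along a segment of random laws\<close>

context
  fixes M :: "'w measure" and \<kappa> \<kappa>' :: "'w \<Rightarrow> (real^'d) prob_measure" and Y Y' :: "'w \<Rightarrow> real^'d"
  assumes M: "prob_space M"
    and \<kappa> [measurable]: "\<kappa> \<in> borel_measurable M" "\<kappa>' \<in> borel_measurable M"
    and Y [measurable]: "Y \<in> borel_measurable M" "Y' \<in> borel_measurable M"
    and law: "disintegrates M (\<lambda>w. (\<kappa> w, \<kappa>' w)) \<kappa> Y"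
    and law': "disintegrates M (\<lambda>w. (\<kappa> w, \<kappa>' w)) \<kappa>' Y'"
    and int: "integrable M (\<lambda>w. norm (Y' w - Y w))"
begin

interpretation prob_space M by (rule M)

text \<open>Integration over the parameter as a probability space, so that dominated convergence and
  Fubini with \<open>M\<close> apply.\<close>

private definition "unit_measure = restrict_space lborel {0..1::real}"

private lemma unit_prob: "prob_space unit_measure"
  by (rule prob_spaceI) (simp add: unit_measure_def emeasure_restrict_space space_restrict_space)

private lemma space_unit: "space unit_measure = {0..1}"
  by (simp add: unit_measure_def space_restrict_space)

private lemma set_integral_unit: "(LBINT s:{0..1}. f s) = (\<integral>s. f s \<partial>unit_measure)" for f :: "real \<Rightarrow> real"
  by (simp add: unit_measure_def set_lebesgue_integral_def integral_restrict_space)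

private lemma measurable_unit [measurable]: "(\<lambda>s. s) \<in> borel_measurable unit_measure"
  unfolding unit_measure_def by (intro measurable_restrict_space1) simp

private lemma affine_unit: "a + s * (b - a) \<in> {0..1::real}" if "a \<in> {0..1}" "b \<in> {0..1}" "s \<in> {0..1}"
proof -
  have "a + s * (b - a) = (1 - s) * a + s * b" by (simp add: algebra_simps)
  moreover have "(1 - s) * a + s * b \<le> (1 - s) * 1 + s * 1"
    using that by (intro add_mono mult_left_mono) auto
  moreover have "0 \<le> (1 - s) * a + s * b" using that by simp
  ultimately show ?thesis by auto
qed

text \<open>The claimed derivative, with integrals against the two laws already replaced by
  \<open>Y'\<close> and \<open>Y\<close>. The difference stays under a single integral because only
  the distance of \<open>Y'\<close> and \<open>Y\<close> is assumed integrable.\<close>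

private definition "slope \<theta> = (\<integral>w. D (mix \<theta> (\<kappa> w) (\<kappa>' w)) (Y' w) - D (mix \<theta> (\<kappa> w) (\<kappa>' w)) (Y w) \<partial>M)"

private definition "slope_trunc n \<theta> = (\<integral>w. D (push (trunc n) (mix \<theta> (\<kappa> w) (\<kappa>' w))) (trunc n (Y' w))
   - D (push (trunc n) (mix \<theta> (\<kappa> w) (\<kappa>' w))) (trunc n (Y w)) \<partial>M)"

private lemma mix_meas: "\<theta> \<in> {0..1} \<Longrightarrow> (\<lambda>w. mix \<theta> (\<kappa> w) (\<kappa>' w)) \<in> borel_measurable M"
  by (intro measurable_mix) auto

private lemma push_meas: "\<theta> \<in> {0..1} \<Longrightarrow> (\<lambda>w. push (trunc n) (mix \<theta> (\<kappa> w) (\<kappa>' w))) \<in> borel_measurable M"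
  by (rule measurable_push[where h="\<lambda>_. trunc n"]) (auto intro: mix_meas)

private lemma trunc_bd: "\<bar>D p (trunc n x)\<bar> \<le> L * real n"
  using reg_le[of p "trunc n x"] norm_trunc_le[of n x] reg_L by (meson mult_left_mono order_trans)

private lemma slope_tendsto:
  assumes "\<And>n. \<theta> n \<in> {0..1}" "\<theta>0 \<in> {0..1}" "\<theta> \<longlonglongrightarrow> \<theta>0"
  shows "(\<lambda>n. slope (\<theta> n)) \<longlonglongrightarrow> slope \<theta>0"
  unfolding slope_def
proof (rule integral_dominated_convergence[where w="\<lambda>w. L * norm (Y' w - Y w)"])
  show "integrable M (\<lambda>w. L * norm (Y' w - Y w))" using int by simp
  have [measurable]: "(\<lambda>w. mix (\<theta> n) (\<kappa> w) (\<kappa>' w)) \<in> borel_measurable M"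
    "(\<lambda>w. mix \<theta>0 (\<kappa> w) (\<kappa>' w)) \<in> borel_measurable M" for n
    using assms mix_meas by blast+
  show "(\<lambda>w. D (mix \<theta>0 (\<kappa> w) (\<kappa>' w)) (Y' w) - D (mix \<theta>0 (\<kappa> w) (\<kappa>' w)) (Y w)) \<in> borel_measurable M"
    "(\<lambda>w. D (mix (\<theta> n) (\<kappa> w) (\<kappa>' w)) (Y' w) - D (mix (\<theta> n) (\<kappa> w) (\<kappa>' w)) (Y w)) \<in> borel_measurable M" for n
    by measurable
  show "AE w in M. (\<lambda>n. D (mix (\<theta> n) (\<kappa> w) (\<kappa>' w)) (Y' w) - D (mix (\<theta> n) (\<kappa> w) (\<kappa>' w)) (Y w))
      \<longlonglongrightarrow> D (mix \<theta>0 (\<kappa> w) (\<kappa>' w)) (Y' w) - D (mix \<theta>0 (\<kappa> w) (\<kappa>' w)) (Y w)"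
    using assms by (intro AE_I2 tendsto_diff reg_tendsto tendsto_mix) auto
  show "AE w in M. norm (D (mix (\<theta> n) (\<kappa> w) (\<kappa>' w)) (Y' w) - D (mix (\<theta> n) (\<kappa> w) (\<kappa>' w)) (Y w))
      \<le> L * norm (Y' w - Y w)" for n
    using reg_lip by auto
qed

private lemma slope_trunc_tendsto:
  assumes "\<theta> \<in> {0..1}"
  shows "(\<lambda>n. slope_trunc n \<theta>) \<longlonglongrightarrow> slope \<theta>"
  unfolding slope_def slope_trunc_def
proof (rule integral_dominated_convergence[where w="\<lambda>w. L * norm (Y' w - Y w)"])
  show "integrable M (\<lambda>w. L * norm (Y' w - Y w))" using int by simp
  note [measurable] = mix_meas[OF assms] push_meas[OF assms]
  show "(\<lambda>w. D (mix \<theta> (\<kappa> w) (\<kappa>' w)) (Y' w) - D (mix \<theta> (\<kappa> w) (\<kappa>' w)) (Y w)) \<in> borel_measurable M"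
    "(\<lambda>w. D (push (trunc n) (mix \<theta> (\<kappa> w) (\<kappa>' w))) (trunc n (Y' w)) - D (push (trunc n) (mix \<theta> (\<kappa> w) (\<kappa>' w))) (trunc n (Y w)))
       \<in> borel_measurable M" for n
    by measurable
  show "AE w in M. (\<lambda>n. D (push (trunc n) (mix \<theta> (\<kappa> w) (\<kappa>' w))) (trunc n (Y' w)) - D (push (trunc n) (mix \<theta> (\<kappa> w) (\<kappa>' w))) (trunc n (Y w)))
      \<longlonglongrightarrow> D (mix \<theta> (\<kappa> w) (\<kappa>' w)) (Y' w) - D (mix \<theta> (\<kappa> w) (\<kappa>' w)) (Y w)"
    by (intro AE_I2 tendsto_diff reg_tendsto push_trunc_tendsto trunc_tendsto tendsto_const)
  show "AE w in M. norm (D (push (trunc n) (mix \<theta> (\<kappa> w) (\<kappa>' w))) (trunc n (Y' w)) - D (push (trunc n) (mix \<theta> (\<kappa> w) (\<kappa>' w))) (trunc n (Y w)))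
      \<le> L * norm (Y' w - Y w)" for n
  proof (rule AE_I2)
    fix w
    let ?p = "push (trunc n) (mix \<theta> (\<kappa> w) (\<kappa>' w))"
    have "norm (D ?p (trunc n (Y' w)) - D ?p (trunc n (Y w))) \<le> L * norm (trunc n (Y' w) - trunc n (Y w))"
      using reg_lip by simp
    also have "\<dots> \<le> L * norm (Y' w - Y w)" by (intro mult_left_mono trunc_lipschitz reg_L)
    finally show "norm (D ?p (trunc n (Y' w)) - D ?p (trunc n (Y w))) \<le> L * norm (Y' w - Y w)" .
  qed
qed

private lemma slope_trunc_le: "\<bar>slope_trunc n \<theta>\<bar> \<le> L * (\<integral>w. norm (Y' w - Y w) \<partial>M)" if "\<theta> \<in> {0..1}"
proof -
  note [measurable] = mix_meas[OF that] push_meas[OF that]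
  have "\<bar>slope_trunc n \<theta>\<bar> \<le> (\<integral>w. \<bar>D (push (trunc n) (mix \<theta> (\<kappa> w) (\<kappa>' w))) (trunc n (Y' w))
   - D (push (trunc n) (mix \<theta> (\<kappa> w) (\<kappa>' w))) (trunc n (Y w))\<bar> \<partial>M)"
    unfolding slope_trunc_def by (rule integral_abs_bound)
  also have "\<dots> \<le> (\<integral>w. L * norm (Y' w - Y w) \<partial>M)"
  proof (rule integral_mono)
    show "integrable M (\<lambda>w. \<bar>D (push (trunc n) (mix \<theta> (\<kappa> w) (\<kappa>' w))) (trunc n (Y' w))
     - D (push (trunc n) (mix \<theta> (\<kappa> w) (\<kappa>' w))) (trunc n (Y w))\<bar>)"
      using trunc_bd by (intro integrable_abs Bochner_Integration.integrable_diff integrable_const_bound[where B="L * real n"]) auto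
    show "integrable M (\<lambda>w. L * norm (Y' w - Y w))" using int by simp
    fix w
    let ?p = "push (trunc n) (mix \<theta> (\<kappa> w) (\<kappa>' w))"
    have "\<bar>D ?p (trunc n (Y' w)) - D ?p (trunc n (Y w))\<bar> \<le> L * norm (trunc n (Y' w) - trunc n (Y w))"
      by (rule reg_lip)
    also have "\<dots> \<le> L * norm (Y' w - Y w)" by (intro mult_left_mono trunc_lipschitz reg_L)
    finally show "\<bar>D ?p (trunc n (Y' w)) - D ?p (trunc n (Y w))\<bar> \<le> L * norm (Y' w - Y w)" .
  qed
  finally show ?thesis by simp
qed

text \<open>The measure argument of \<open>D\<close> is a function of the two laws, so both
  disintegrations apply and turn the inner integrals of \<open>reg_increment_trunc\<close> into
  values at \<open>Y'\<close> and \<open>Y\<close>. Fubini exchanges the parameter with the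
  expectation.\<close>

private lemma expectation_increment_trunc:
  assumes ab: "a \<in> {0..1}" "b \<in> {0..1}"
  shows "(\<integral>w. \<Phi> (push (trunc n) (mix b (\<kappa> w) (\<kappa>' w))) - \<Phi> (push (trunc n) (mix a (\<kappa> w) (\<kappa>' w))) \<partial>M)
    = (b - a) * (\<integral>s. slope_trunc n (a + s * (b - a)) \<partial>unit_measure)"
    "(\<lambda>s. slope_trunc n (a + s * (b - a))) \<in> borel_measurable unit_measure"
proof -
  interpret unit: prob_space unit_measure by (rule unit_prob)
  interpret pair_sigma_finite unit_measure M by standard
  define p where "p s w = push (trunc n) (mix (a + s * (b - a)) (\<kappa> w) (\<kappa>' w))" for s w
  have pm [measurable]: "(\<lambda>z. p (fst z) (snd z)) \<in> borel_measurable (unit_measure \<Otimes>\<^sub>M M)"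
    unfolding p_def
  proof (rule measurable_push[where h="\<lambda>_. trunc n"])
    show "(\<lambda>z. mix (a + fst z * (b - a)) (\<kappa> (snd z)) (\<kappa>' (snd z))) \<in> borel_measurable (unit_measure \<Otimes>\<^sub>M M)"
      using affine_unit[OF ab] by (intro measurable_mix) (auto simp: space_pair_measure space_unit)
  qed measurable
  have bd: "\<bar>(\<integral>x. D q (trunc n x) \<partial>meas m)\<bar> \<le> L * real n" for q m
    using integral_meas_bounded[of "\<lambda>x. D q (trunc n x)" "L * real n" m] trunc_bd by simp
  have int_meas: "(\<lambda>z. \<integral>x. D (p (fst z) (snd z)) (trunc n x) \<partial>meas (k (snd z))) \<in> borel_measurable (unit_measure \<Otimes>\<^sub>M M)"
    if [measurable]: "k \<in> borel_measurable M" for k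
    by (intro borel_measurable_integral_meas) measurable
  define q where "q s w = (\<integral>x. D (p s w) (trunc n x) \<partial>meas (\<kappa>' w)) - (\<integral>x. D (p s w) (trunc n x) \<partial>meas (\<kappa> w))" for s w
  have q_meas: "(\<lambda>(s, w). q s w) \<in> borel_measurable (unit_measure \<Otimes>\<^sub>M M)"
    unfolding q_def case_prod_beta by (intro borel_measurable_diff int_meas) auto
  have q_bd: "\<bar>q s w\<bar> \<le> L * real n + L * real n" for s w
    unfolding q_def by (rule order_trans[OF abs_triangle_ineq4 add_mono[OF bd bd]])
  have q_int: "integrable (unit_measure \<Otimes>\<^sub>M M) (\<lambda>(s, w). q s w)"
  proof -
    interpret P: pair_prob_space unit_measure M by standard
    show ?thesis using q_meas q_bd
      by (intro P.P.integrable_const_bound[where B="L * real n + L * real n"]) (auto simp: case_prod_beta)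
  qed
  have q_slope: "(\<integral>w. q s w \<partial>M) = slope_trunc n (a + s * (b - a))" if "s \<in> {0..1}" for s
  proof -
    let ?\<theta> = "a + s * (b - a)"
    have \<theta>: "?\<theta> \<in> {0..1}" by (rule affine_unit[OF ab that])
    note [measurable] = mix_meas[OF \<theta>] push_meas[OF \<theta>]
    \<comment> \<open>Test function of \<open>((k, k'), y)\<close>: the mixture and its projection
      are Borel functions of the pair of laws.\<close>
    define g where "g = (\<lambda>((k, k'), y). D (push (trunc n) (mix ?\<theta> k k')) (trunc n y))"
    have "(\<lambda>z. mix ?\<theta> (fst (fst z)) (snd (fst z))) \<in> borel_measurable
       (borel :: (((real^'d) prob_measure \<times> (real^'d) prob_measure) \<times> (real^'d)) measure)"
      using \<theta> by (intro measurable_mix borel_measurable_continuous_onI continuous_intros) auto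
    then have "(\<lambda>z. push (trunc n) (mix ?\<theta> (fst (fst z)) (snd (fst z)))) \<in> borel_measurable
       (borel :: (((real^'d) prob_measure \<times> (real^'d) prob_measure) \<times> (real^'d)) measure)"
      by (rule measurable_push[where h="\<lambda>_. trunc n"]) measurable
    moreover have "(\<lambda>z. trunc n (snd z)) \<in> borel_measurable
       (borel :: (((real^'d) prob_measure \<times> (real^'d) prob_measure) \<times> (real^'d)) measure)"
      by (intro borel_measurable_continuous_onI continuous_on_compose2[OF continuous_on_trunc[of UNIV]] continuous_intros) auto
    ultimately have "g \<in> borel_measurable borel" unfolding g_def case_prod_beta by (rule reg_measurable')
    moreover have "bounded (range g)"
      unfolding bounded_iff by (intro exI[of _ "L * real n"]) (auto simp: g_def trunc_bd)
    ultimately have E: "(\<integral>w. g ((\<kappa> w, \<kappa>' w), Y w) \<partial>M) = (\<integral>w. (\<integral>y. g ((\<kappa> w, \<kappa>' w), y) \<partial>meas (\<kappa> w)) \<partial>M)"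
       "(\<integral>w. g ((\<kappa> w, \<kappa>' w), Y' w) \<partial>M) = (\<integral>w. (\<integral>y. g ((\<kappa> w, \<kappa>' w), y) \<partial>meas (\<kappa>' w)) \<partial>M)"
      using law law' unfolding disintegrates_def by blast+
    have i: "integrable M (\<lambda>w. \<integral>x. D (p s w) (trunc n x) \<partial>meas (k w))" if [measurable]: "k \<in> borel_measurable M" for k
    proof (rule integrable_const_bound[where B="L * real n"])
      show "(\<lambda>w. \<integral>x. D (p s w) (trunc n x) \<partial>meas (k w)) \<in> borel_measurable M"
        unfolding p_def by (intro borel_measurable_integral_meas) measurable
    qed (use bd in auto)
    have j: "integrable M (\<lambda>w. D (p s w) (trunc n (y w)))" if [measurable]: "y \<in> borel_measurable M" for y
    proof (rule integrable_const_bound[where B="L * real n"])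
      show "(\<lambda>w. D (p s w) (trunc n (y w))) \<in> borel_measurable M"
        unfolding p_def by measurable
    qed (use trunc_bd in auto)
    show ?thesis
      unfolding slope_trunc_def q_def p_def[symmetric]
      using E i[of \<kappa>] i[of \<kappa>'] j[of Y] j[of Y'] by (simp add: g_def p_def)
  qed
  have "(\<integral>w. \<Phi> (push (trunc n) (mix b (\<kappa> w) (\<kappa>' w))) - \<Phi> (push (trunc n) (mix a (\<kappa> w) (\<kappa>' w))) \<partial>M)
    = (\<integral>w. (\<integral>s. (b - a) * q s w \<partial>unit_measure) \<partial>M)"
    unfolding reg_increment_trunc[OF ab] set_integral_unit q_def p_def ..
  also have "\<dots> = (b - a) * (\<integral>w. (\<integral>s. q s w \<partial>unit_measure) \<partial>M)" by simp
  also have "(\<integral>w. (\<integral>s. q s w \<partial>unit_measure) \<partial>M) = (\<integral>s. (\<integral>w. q s w \<partial>M) \<partial>unit_measure)"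
    using q_int by (rule Fubini_integral)
  also have "\<dots> = (\<integral>s. slope_trunc n (a + s * (b - a)) \<partial>unit_measure)"
    by (intro Bochner_Integration.integral_cong) (auto simp: space_unit q_slope)
  finally show "(\<integral>w. \<Phi> (push (trunc n) (mix b (\<kappa> w) (\<kappa>' w))) - \<Phi> (push (trunc n) (mix a (\<kappa> w) (\<kappa>' w))) \<partial>M)
    = (b - a) * (\<integral>s. slope_trunc n (a + s * (b - a)) \<partial>unit_measure)" .
  have "(\<lambda>s. \<integral>w. q s w \<partial>M) \<in> borel_measurable unit_measure"
    using sigma_finite_measure.borel_measurable_lebesgue_integral[OF prob_space_imp_sigma_finite[OF M] q_meas] .
  moreover have "(\<integral>w. q s w \<partial>M) = slope_trunc n (a + s * (b - a))" if "s \<in> space unit_measure" for s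
    using that q_slope by (simp add: space_unit)
  ultimately show "(\<lambda>s. slope_trunc n (a + s * (b - a))) \<in> borel_measurable unit_measure"
    by (simp cong: measurable_cong)
qed

private lemma reg_bdd: obtains C where "\<And>m. \<bar>\<Phi> m\<bar> \<le> C"
  using reg unfolding regular_linear_derivative_def bounded_iff by auto

private lemma reg_\<Phi>_measurable [measurable]: "\<Phi> \<in> borel_measurable borel"
  using reg by (auto simp: regular_linear_derivative_def intro: borel_measurable_continuous_onI)

private lemma reg_\<Phi>_tendsto: "m' \<longlonglongrightarrow> m \<Longrightarrow> (\<lambda>n. \<Phi> (m' n)) \<longlonglongrightarrow> \<Phi> m"
  using reg by (auto simp: regular_linear_derivative_def intro: continuous_on_tendsto_compose)

text \<open>Here the projection is removed. The left side converges because \<open>\<Phi>\<close> is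
  bounded and continuous; on the right \<open>slope_trunc n\<close> converges and is bounded by
  \<open>L\<close> times the mean distance of \<open>Y'\<close> and \<open>Y\<close>, uniformly in
  \<open>n\<close>.\<close>

private lemma expectation_increment:
  assumes ab: "a \<in> {0..1}" "b \<in> {0..1}"
  shows "(\<integral>w. \<Phi> (mix b (\<kappa> w) (\<kappa>' w)) \<partial>M) - (\<integral>w. \<Phi> (mix a (\<kappa> w) (\<kappa>' w)) \<partial>M)
    = (b - a) * (\<integral>s. slope (a + s * (b - a)) \<partial>unit_measure)"
proof -
  interpret unit: prob_space unit_measure by (rule unit_prob)
  obtain C where C: "\<And>m. \<bar>\<Phi> m\<bar> \<le> C" using reg_bdd by blast
  note [measurable] = mix_meas[OF ab(1)] mix_meas[OF ab(2)] push_meas[OF ab(1)] push_meas[OF ab(2)]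
  have "(\<lambda>n. \<integral>w. \<Phi> (push (trunc n) (mix b (\<kappa> w) (\<kappa>' w))) - \<Phi> (push (trunc n) (mix a (\<kappa> w) (\<kappa>' w))) \<partial>M)
     \<longlonglongrightarrow> (\<integral>w. \<Phi> (mix b (\<kappa> w) (\<kappa>' w)) - \<Phi> (mix a (\<kappa> w) (\<kappa>' w)) \<partial>M)"
  proof (rule integral_dominated_convergence[where w="\<lambda>_. 2 * C"])
    show "AE w in M. norm (\<Phi> (push (trunc n) (mix b (\<kappa> w) (\<kappa>' w))) - \<Phi> (push (trunc n) (mix a (\<kappa> w) (\<kappa>' w)))) \<le> 2 * C" for n
    proof (rule AE_I2)
      fix w
      show "norm (\<Phi> (push (trunc n) (mix b (\<kappa> w) (\<kappa>' w))) - \<Phi> (push (trunc n) (mix a (\<kappa> w) (\<kappa>' w)))) \<le> 2 * C"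
        using C[of "push (trunc n) (mix b (\<kappa> w) (\<kappa>' w))"] C[of "push (trunc n) (mix a (\<kappa> w) (\<kappa>' w))"]
        unfolding real_norm_def by linarith
    qed
    show "AE w in M. (\<lambda>n. \<Phi> (push (trunc n) (mix b (\<kappa> w) (\<kappa>' w))) - \<Phi> (push (trunc n) (mix a (\<kappa> w) (\<kappa>' w))))
      \<longlonglongrightarrow> \<Phi> (mix b (\<kappa> w) (\<kappa>' w)) - \<Phi> (mix a (\<kappa> w) (\<kappa>' w))"
      by (intro AE_I2 tendsto_diff reg_\<Phi>_tendsto push_trunc_tendsto)
  qed measurable
  moreover have "(\<lambda>n. (b - a) * (\<integral>s. slope_trunc n (a + s * (b - a)) \<partial>unit_measure))
      \<longlonglongrightarrow> (b - a) * (\<integral>s. slope (a + s * (b - a)) \<partial>unit_measure)"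
  proof (intro tendsto_mult_left integral_dominated_convergence[where w="\<lambda>_. L * (\<integral>w. norm (Y' w - Y w) \<partial>M)"])
    have lim: "(\<lambda>n. slope_trunc n (a + s * (b - a))) \<longlonglongrightarrow> slope (a + s * (b - a))" if "s \<in> space unit_measure" for s
      using that by (intro slope_trunc_tendsto affine_unit ab) (simp add: space_unit)
    then show "AE s in unit_measure. (\<lambda>n. slope_trunc n (a + s * (b - a))) \<longlonglongrightarrow> slope (a + s * (b - a))" by auto
    show "(\<lambda>s. slope_trunc n (a + s * (b - a))) \<in> borel_measurable unit_measure" for n
      by (rule expectation_increment_trunc(2)[OF ab])
    with lim show "(\<lambda>s. slope (a + s * (b - a))) \<in> borel_measurable unit_measure"
      by (rule borel_measurable_LIMSEQ_real)
    show "AE s in unit_measure. norm (slope_trunc n (a + s * (b - a))) \<le> L * (\<integral>w. norm (Y' w - Y w) \<partial>M)" for n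
    proof (rule AE_I2)
      fix s assume "s \<in> space unit_measure"
      then have "a + s * (b - a) \<in> {0..1}" by (intro affine_unit ab) (simp add: space_unit)
      then show "norm (slope_trunc n (a + s * (b - a))) \<le> L * (\<integral>w. norm (Y' w - Y w) \<partial>M)"
        unfolding real_norm_def by (rule slope_trunc_le)
    qed
  qed simp
  ultimately have "(\<integral>w. \<Phi> (mix b (\<kappa> w) (\<kappa>' w)) - \<Phi> (mix a (\<kappa> w) (\<kappa>' w)) \<partial>M)
    = (b - a) * (\<integral>s. slope (a + s * (b - a)) \<partial>unit_measure)"
    unfolding expectation_increment_trunc[OF ab] by (rule LIMSEQ_unique)
  moreover have "integrable M (\<lambda>w. \<Phi> (mix b (\<kappa> w) (\<kappa>' w)))" "integrable M (\<lambda>w. \<Phi> (mix a (\<kappa> w) (\<kappa>' w)))"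
    using C by (auto intro!: integrable_const_bound[where B=C])
  ultimately show ?thesis by simp
qed

text \<open>By \<open>expectation_increment\<close> the difference quotient is the average of
  \<open>slope\<close> over the parameters between \<open>\<theta>\<close> and \<open>X i\<close>,
  which converges because \<open>slope\<close> is continuous and bounded.\<close>

lemma expectation_mix_has_derivative:
  assumes \<theta>: "\<theta> \<in> {0..1}"
  shows "((\<lambda>\<theta>. \<integral>w. \<Phi> (mix \<theta> (\<kappa> w) (\<kappa>' w)) \<partial>M) has_real_derivative
    (\<integral>w. D (mix \<theta> (\<kappa> w) (\<kappa>' w)) (Y' w) - D (mix \<theta> (\<kappa> w) (\<kappa>' w)) (Y w) \<partial>M)) (at \<theta> within {0..1})"
  unfolding has_field_derivative_iff tendsto_at_iff_sequentially comp_def slope_def[symmetric]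
proof (intro allI impI)
  fix X assume X: "\<forall>i. X i \<in> {0..1} - {\<theta>}" "X \<longlonglongrightarrow> \<theta>"
  interpret unit: prob_space unit_measure by (rule unit_prob)
  have "(\<lambda>i. \<integral>s. slope (\<theta> + s * (X i - \<theta>)) \<partial>unit_measure) \<longlonglongrightarrow> (\<integral>s. slope \<theta> \<partial>unit_measure)"
  proof (rule integral_dominated_convergence[where w="\<lambda>_. L * (\<integral>w. norm (Y' w - Y w) \<partial>M)"])
    have Xi: "X i \<in> {0..1}" for i using X(1) by auto
    \<comment> \<open>Measurability in the parameter is inherited from \<open>slope_trunc n\<close>
      in the limit.\<close>
    show "(\<lambda>s. slope (\<theta> + s * (X i - \<theta>))) \<in> borel_measurable unit_measure" for i
    proof (rule borel_measurable_LIMSEQ_real)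
      show "(\<lambda>n. slope_trunc n (\<theta> + s * (X i - \<theta>))) \<longlonglongrightarrow> slope (\<theta> + s * (X i - \<theta>))" if "s \<in> space unit_measure" for s
        using that by (intro slope_trunc_tendsto affine_unit \<theta> Xi) (simp add: space_unit)
    qed (rule expectation_increment_trunc(2)[OF \<theta> Xi[of i]])
    show "AE s in unit_measure. (\<lambda>i. slope (\<theta> + s * (X i - \<theta>))) \<longlonglongrightarrow> slope \<theta>"
    proof (rule AE_I2)
      fix s assume "s \<in> space unit_measure"
      then have s: "s \<in> {0..1}" by (simp add: space_unit)
      have "(\<lambda>i. \<theta> + s * (X i - \<theta>)) \<longlonglongrightarrow> \<theta> + s * (\<theta> - \<theta>)" by (intro tendsto_intros X)
      then show "(\<lambda>i. slope (\<theta> + s * (X i - \<theta>))) \<longlonglongrightarrow> slope \<theta>"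
        by (intro slope_tendsto affine_unit \<theta> Xi s) simp
    qed
    show "AE s in unit_measure. norm (slope (\<theta> + s * (X i - \<theta>))) \<le> L * (\<integral>w. norm (Y' w - Y w) \<partial>M)" for i
    proof (rule AE_I2)
      fix s assume "s \<in> space unit_measure"
      then have m: "\<theta> + s * (X i - \<theta>) \<in> {0..1}" by (intro affine_unit \<theta> Xi) (simp add: space_unit)
      have "(\<lambda>n. \<bar>slope_trunc n (\<theta> + s * (X i - \<theta>))\<bar>) \<longlonglongrightarrow> \<bar>slope (\<theta> + s * (X i - \<theta>))\<bar>"
        by (intro tendsto_rabs slope_trunc_tendsto m)
      then show "norm (slope (\<theta> + s * (X i - \<theta>))) \<le> L * (\<integral>w. norm (Y' w - Y w) \<partial>M)"
        unfolding real_norm_def by (rule LIMSEQ_le_const2) (use slope_trunc_le[OF m] in auto)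
    qed
  qed auto
  then have "(\<lambda>i. \<integral>s. slope (\<theta> + s * (X i - \<theta>)) \<partial>unit_measure) \<longlonglongrightarrow> slope \<theta>"
    using unit.prob_space by simp
  moreover have "(\<integral>s. slope (\<theta> + s * (X i - \<theta>)) \<partial>unit_measure) =
      ((\<integral>w. \<Phi> (mix (X i) (\<kappa> w) (\<kappa>' w)) \<partial>M) - (\<integral>w. \<Phi> (mix \<theta> (\<kappa> w) (\<kappa>' w)) \<partial>M)) / (X i - \<theta>)" for i
    using X(1) by (subst expectation_increment[OF \<theta>]) auto
  ultimately show "(\<lambda>i. ((\<integral>w. \<Phi> (mix (X i) (\<kappa> w) (\<kappa>' w)) \<partial>M) - (\<integral>w. \<Phi> (mix \<theta> (\<kappa> w) (\<kappa>' w)) \<partial>M)) / (X i - \<theta>)) \<longlonglongrightarrow> slope \<theta>"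
    by simp
qed

text \<open>The mean value form; it keeps integrals over \<open>\<theta>\<close> out of the later estimates.\<close>

lemma expectation_coupling_mvt:
  "\<exists>\<theta>\<in>{0..1}. (\<integral>w. \<Phi> (\<kappa>' w) \<partial>M) - (\<integral>w. \<Phi> (\<kappa> w) \<partial>M) =
     (\<integral>w. D (mix \<theta> (\<kappa> w) (\<kappa>' w)) (Y' w) - D (mix \<theta> (\<kappa> w) (\<kappa>' w)) (Y w) \<partial>M)"
proof -
  have "((\<lambda>\<theta>. \<integral>w. \<Phi> (mix \<theta> (\<kappa> w) (\<kappa>' w)) \<partial>M) has_derivative (*) (slope x)) (at x within {0..1})"
    if "0 \<le> x" "x \<le> 1" for x
    using expectation_mix_has_derivative[of x] that unfolding slope_def[symmetric] has_field_derivative_def by simp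
  from mvt_simple[OF _ this] obtain z where "z \<in> {0<..<1}"
    "(\<integral>w. \<Phi> (mix 1 (\<kappa> w) (\<kappa>' w)) \<partial>M) - (\<integral>w. \<Phi> (mix 0 (\<kappa> w) (\<kappa>' w)) \<partial>M) = slope z * (1 - 0)"
    by auto
  then show ?thesis by (intro bexI[of _ z]) (auto simp: slope_def)
qed

declare measurable_unit [measurable del] reg_\<Phi>_measurable [measurable del]

end

declare reg_measurable' [measurable del]

end

section \<open>Second-order expansion along translations\<close>

lemma linear_eq_inner_axis:
  fixes f :: "real^'n \<Rightarrow> real"
  assumes "linear f"
  shows "f h = (\<chi> i. f (axis i 1)) \<bullet> h"
proof -
  have "f h = f (\<Sum>i\<in>UNIV. (h $ i) *\<^sub>R axis i 1)"
    using basis_expansion[of h] by (simp add: scalar_mult_eq_scaleR)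
  also have "\<dots> = (\<Sum>i\<in>UNIV. (h $ i) * f (axis i 1))"
    using assms by (simp add: linear_sum linear_scale)
  finally show ?thesis by (simp add: inner_vec_def mult.commute)
qed

lemma grad_has_derivative:
  assumes "f differentiable at x"
  shows "(f has_derivative (\<lambda>h. grad f x \<bullet> h)) (at x)"
proof -
  have d: "(f has_derivative frechet_derivative f (at x)) (at x)"
    using assms frechet_derivative_works by blast
  then have "linear (frechet_derivative f (at x))" by (rule has_derivative_linear)
  then have "frechet_derivative f (at x) = (\<lambda>h. grad f x \<bullet> h)"
    unfolding grad_def using linear_eq_inner_axis by blast
  with d show ?thesis by simp
qed

lemma jac_has_derivative:
  assumes "f differentiable at x"
  shows "(f has_derivative (\<lambda>h. jac f x *v h)) (at x)"
proof -
  have d: "(f has_derivative frechet_derivative f (at x)) (at x)"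
    using assms frechet_derivative_works by blast
  then have "linear (frechet_derivative f (at x))" by (rule has_derivative_linear)
  then have "frechet_derivative f (at x) = (\<lambda>h. jac f x *v h)"
    unfolding jac_def by (auto simp: matrix_works)
  with d show ?thesis by simp
qed

lemma grad_const: "grad (\<lambda>_. c) x = 0"
  by (simp add: grad_def frechet_derivative_const vec_eq_iff)

lemma has_derivative_along_line:
  fixes f :: "'a::real_normed_vector \<Rightarrow> 'b::real_normed_vector"
  assumes "(f has_derivative f') (at (x + s *\<^sub>R a))"
  shows "((\<lambda>s. f (x + s *\<^sub>R a)) has_vector_derivative f' a) (at s within S)"
proof -
  have l: "linear f'" using assms by (rule has_derivative_linear)
  have "((\<lambda>s. x + s *\<^sub>R a) has_derivative (\<lambda>h. h *\<^sub>R a)) (at s within S)"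
    by (auto intro!: derivative_eq_intros)
  from has_derivative_compose[OF this assms] show ?thesis
    unfolding has_vector_derivative_def by (simp add: linear_scale[OF l])
qed

lemma real_derivative_along_line:
  fixes f :: "real^'n \<Rightarrow> real"
  assumes "f differentiable at (x + s *\<^sub>R a)"
  shows "((\<lambda>s. f (x + s *\<^sub>R a)) has_real_derivative grad f (x + s *\<^sub>R a) \<bullet> a) (at s within S)"
  using has_derivative_along_line[OF grad_has_derivative[OF assms]]
  by (simp add: has_real_derivative_iff_has_vector_derivative)

lemma mvt_within:
  fixes h :: "real \<Rightarrow> real"
  assumes "a < b" "\<And>s. s \<in> {a..b} \<Longrightarrow> (h has_real_derivative h' s) (at s within {a..b})"
  shows "\<exists>s\<in>{a<..<b}. h b - h a = h' s * (b - a)"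
proof (rule mvt_simple[OF assms(1)])
  show "(h has_derivative (\<lambda>t. h' x * t)) (at x within {a..b})" if "a \<le> x" "x \<le> b" for x
    using assms(2)[of x] that by (simp add: has_field_derivative_def)
qed

lemma mvt_unit:
  fixes h :: "real \<Rightarrow> real"
  assumes "\<And>s. s \<in> {0..1} \<Longrightarrow> (h has_real_derivative h' s) (at s within {0..1})"
  obtains s where "s \<in> {0..1}" "h 1 - h 0 = h' s"
proof -
  have "\<exists>s\<in>{0<..<1}. h 1 - h 0 = h' s * (1 - 0)" by (rule mvt_within) (simp_all add: assms)
  then obtain s where "s \<in> {0<..<1}" "h 1 - h 0 = h' s" by auto
  then show thesis using that[of s] by simp
qed

lemma taylor2_unit:
  fixes h :: "real \<Rightarrow> real"
  assumes h: "\<And>s. s \<in> {0..1} \<Longrightarrow> (h has_real_derivative h' s) (at s within {0..1})"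
    and h': "\<And>s. s \<in> {0..1} \<Longrightarrow> (h' has_real_derivative h'' s) (at s within {0..1})"
  obtains s where "s \<in> {0..1}" "h 1 = h 0 + h' 0 + h'' s / 2"
proof -
  define c where "c = h 1 - h 0 - h' 0"
  \<comment> \<open>\<open>g 0 = g 1\<close> and \<open>g' 0 = 0\<close>, so Rolle applies to \<open>g\<close> and then to \<open>g'\<close>.\<close>
  define g where "g s = h s - h 0 - h' 0 * s - c * s\<^sup>2" for s
  define g' where "g' s = h' s - h' 0 - 2 * c * s" for s
  have g: "(g has_real_derivative g' s) (at s within {0..1})" if "s \<in> {0..1}" for s
    unfolding g_def g'_def by (auto intro!: derivative_eq_intros h that)
  have g': "(g' has_real_derivative h'' s - 2 * c) (at s within {0..1})" if "s \<in> {0..1}" for s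
    unfolding g'_def by (auto intro!: derivative_eq_intros h' that)
  have "\<exists>s\<in>{0<..<1}. g' s = 0"
    using mvt_within[of 0 1 g g', OF _ g] by (simp add: g_def c_def)
  then obtain s where s: "s \<in> {0<..<1}" "g' s = 0" by auto
  have "(g' has_real_derivative h'' x - 2 * c) (at x within {0..s})" if "x \<in> {0..s}" for x
    using g'[of x] that s by (auto intro: DERIV_subset)
  from mvt_within[of 0 s, OF _ this] s obtain r where "r \<in> {0<..<s}" "(h'' r - 2 * c) * s = 0"
    by (auto simp: g'_def)
  then have "h'' r = 2 * c" "r \<in> {0..1}" using s by auto
  then show thesis using that[of r] by (simp add: c_def field_simps)
qed

text \<open>Continuous convergence makes the derivatives converge uniformly on the unit interval,
  and the mean value theorem carries convergence from \<open>0\<close> to \<open>1\<close>. This is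
  how continuity of a function is obtained from that of its derivative and its known behaviour at
  one end.\<close>

lemma tendsto_from_derivative:
  fixes h :: "nat \<Rightarrow> real \<Rightarrow> real"
  assumes d: "\<And>n s. s \<in> {0..1} \<Longrightarrow> (h n has_real_derivative h' n s) (at s within {0..1})"
    and d0: "\<And>s. s \<in> {0..1} \<Longrightarrow> (k has_real_derivative k' s) (at s within {0..1})"
    and conv: "\<And>s X. X \<longlonglongrightarrow> s \<Longrightarrow> s \<in> {0..1} \<Longrightarrow> (\<And>n. X n \<in> {0..1}) \<Longrightarrow> (\<lambda>n. h' n (X n)) \<longlonglongrightarrow> k' s"
    and k': "continuous_on {0..1} k'" and 0: "(\<lambda>n. h n 0) \<longlonglongrightarrow> k 0"
  shows "(\<lambda>n. h n 1) \<longlonglongrightarrow> k 1"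
proof -
  have "(\<lambda>n. (h n 1 - h n 0) - (k 1 - k 0)) \<longlonglongrightarrow> 0"
  proof (rule LIMSEQ_I)
    fix e :: real assume "e > 0"
    have "\<forall>\<^sub>F n in sequentially. \<forall>x\<in>{0..1}. \<bar>h' n x - k' x\<bar> \<le> e / 2"
      using \<open>e > 0\<close> by (intro uniform_of_continuous_convergence[OF conv k']) auto
    then have "\<forall>\<^sub>F n in sequentially. norm ((h n 1 - h n 0) - (k 1 - k 0) - 0) < e"
    proof eventually_elim
      case (elim n)
      have d: "((\<lambda>s. h n s - k s) has_real_derivative (h' n s - k' s)) (at s within {0..1})" if "s \<in> {0..1}" for s
        using DERIV_diff[OF d d0] that by blast
      obtain s where s: "s \<in> {0..1}" "(h n 1 - k 1) - (h n 0 - k 0) = h' n s - k' s"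
        by (rule mvt_unit[of "\<lambda>s. h n s - k s", OF d]) auto
      have "\<bar>h' n s - k' s\<bar> \<le> e / 2" using elim s(1) by blast
      then have "\<bar>(h n 1 - k 1) - (h n 0 - k 0)\<bar> < e" unfolding s(2) using \<open>e > 0\<close> by linarith
      then show ?case by (simp add: algebra_simps)
    qed
    then show "\<exists>no. \<forall>n\<ge>no. norm ((h n 1 - h n 0) - (k 1 - k 0) - 0) < e" by (simp add: eventually_sequentially)
  qed
  from tendsto_add[OF tendsto_add[OF this 0] tendsto_const[of "k 1 - k 0"]] show ?thesis by simp
qed

text \<open>The bound on the derivative also bounds the difference quotients, by the mean value
  inequality, and so dominates them.\<close>

lemma has_derivative_integral_bounded:
  fixes f :: "real \<Rightarrow> 'a \<Rightarrow> real"
  assumes M: "finite_measure M"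
    and d: "\<And>s x. s \<in> {0..1} \<Longrightarrow> ((\<lambda>s. f s x) has_real_derivative f' s x) (at s within {0..1})"
    and C: "\<And>s x. s \<in> {0..1} \<Longrightarrow> \<bar>f' s x\<bar> \<le> C"
    and i: "\<And>s. s \<in> {0..1} \<Longrightarrow> integrable M (f s)" and s: "s \<in> {0..1}"
    and m: "f' s \<in> borel_measurable M"
  shows "((\<lambda>s. \<integral>x. f s x \<partial>M) has_real_derivative (\<integral>x. f' s x \<partial>M)) (at s within {0..1})"
  unfolding has_field_derivative_iff tendsto_at_iff_sequentially comp_def
proof (intro allI impI)
  fix X assume X: "\<forall>i. X i \<in> {0..1} - {s}" "X \<longlonglongrightarrow> s"
  interpret finite_measure M by (rule M)
  have Xi: "X n \<in> {0..1}" "X n \<noteq> s" for n using X(1) by auto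
  have "(\<lambda>n. \<integral>x. (f (X n) x - f s x) / (X n - s) \<partial>M) \<longlonglongrightarrow> (\<integral>x. f' s x \<partial>M)"
  proof (rule integral_dominated_convergence[where w="\<lambda>_. C"])
    show "AE x in M. (\<lambda>n. (f (X n) x - f s x) / (X n - s)) \<longlonglongrightarrow> f' s x"
      using d[OF s] X unfolding has_field_derivative_iff tendsto_at_iff_sequentially comp_def by auto
    show "AE x in M. norm ((f (X n) x - f s x) / (X n - s)) \<le> C" for n
    proof (rule AE_I2)
      fix x
      have "norm (f (X n) x - f s x) \<le> C * norm (X n - s)"
        using d C Xi(1) s by (intro field_differentiable_bound[of "{0..1}" "\<lambda>s. f s x" "\<lambda>s. f' s x"]) auto
      then show "norm ((f (X n) x - f s x) / (X n - s)) \<le> C"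
        using Xi(2)[of n] by (simp add: divide_le_eq)
    qed
  qed (use m i[OF Xi(1)] i[OF s] in auto)
  then show "(\<lambda>n. ((\<integral>x. f (X n) x \<partial>M) - (\<integral>x. f s x \<partial>M)) / (X n - s)) \<longlonglongrightarrow> (\<integral>x. f' s x \<partial>M)"
    using i[OF Xi(1)] i[OF s] by simp
qed

lemma matrix_vector_norm_le: "norm (A *v v) \<le> norm (A :: real^'n^'m) * norm v"
proof -
  have "norm (A *v v) = L2_set (\<lambda>i. norm ((A *v v) $ i)) UNIV" by (simp add: norm_vec_def)
  also have "\<dots> \<le> L2_set (\<lambda>i. norm (A $ i) * norm v) UNIV"
    by (intro L2_set_mono) (simp_all add: matrix_vector_mul_component Cauchy_Schwarz_ineq2)
  also have "\<dots> = norm A * norm v" by (simp add: norm_vec_def[of A] L2_set_left_distrib)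
  finally show ?thesis .
qed

lemma inner_matrix_le: "\<bar>a \<bullet> (A *v b)\<bar> \<le> norm (A :: real^'n^'m) * (norm a * norm b)"
proof -
  have "\<bar>a \<bullet> (A *v b)\<bar> \<le> norm a * norm (A *v b)" by (rule Cauchy_Schwarz_ineq2)
  also have "\<dots> \<le> norm a * (norm A * norm b)" by (intro mult_left_mono matrix_vector_norm_le) auto
  finally show ?thesis by (simp add: ac_simps)
qed

lemma inner_matrix_diff: "a \<bullet> (A *v b) - a \<bullet> (B *v b) = a \<bullet> ((A - B) *v b)" for A B :: "real^'n^'m"
  by (simp add: matrix_vector_mult_diff_rdistrib inner_diff_right)

lemma bounded_linear_inner_matrix: "bounded_linear (\<lambda>A. a \<bullet> ((A :: real^'n^'m) *v b))"
  by (rule bounded_linear_intro[where K="norm a * norm b"])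
    (auto simp: matrix_vector_mult_add_rdistrib inner_add_right scaleR_matrix_vector_assoc[symmetric] inner_matrix_le)


text \<open>Meant for the space of laws as domain: it is second countable, hence first countable, so
  sequences decide continuity without a metric.\<close>

lemma continuous_on_UNIV_sequentiallyI:
  fixes f :: "'a::first_countable_topology \<Rightarrow> 'b::topological_space"
  assumes "\<And>u a. u \<longlonglongrightarrow> a \<Longrightarrow> (\<lambda>n. f (u n)) \<longlonglongrightarrow> f a"
  shows "continuous_on UNIV f"
  unfolding continuous_on_def
proof (intro ballI)
  fix a
  show "(f \<longlongrightarrow> f a) (at a within UNIV)"
    using assms[unfolded tendsto_def[where l = "f _"]] unfolding tendsto_def[where l = "f a"]
    by (auto intro!: sequentially_imp_eventually_within)
qed

text \<open>\<open>smooth_with\<close> states continuity and bounds for the time derivative and the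
  gradients; the bounded continuous terminal value is the starting point from which continuity and
  boundedness of \<open>U\<close> itself follow. One constant \<open>K\<close> serves for all four
  bounds.\<close>

locale smooth_function =
  fixes T K :: real and U Ut :: "real \<Rightarrow> (real^'d) prob_measure \<Rightarrow> real"
    and D1 :: "real \<Rightarrow> (real^'d) prob_measure \<Rightarrow> real^'d \<Rightarrow> real"
    and D2 :: "real \<Rightarrow> (real^'d) prob_measure \<Rightarrow> real^'d \<Rightarrow> real^'d \<Rightarrow> real"
  assumes T: "0 < T" and smooth: "smooth_with T U Ut D1 D2" and terminal: "bounded_continuous_on UNIV (U T)"
    and Ut_le: "t \<in> {0..T} \<Longrightarrow> \<bar>Ut t m\<bar> \<le> K"
    and grad_le: "t \<in> {0..T} \<Longrightarrow> norm (grad (D1 t m) x) \<le> K"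
    and hess_le: "t \<in> {0..T} \<Longrightarrow> norm (jac (grad (D1 t m)) x) \<le> K"
    and mixed_le: "t \<in> {0..T} \<Longrightarrow> norm (mixed_grad (D2 t m) x y) \<le> K"
begin

lemma K_nonneg: "0 \<le> K"
  using Ut_le[of 0 undefined] T by auto

lemma zeros: "t \<in> {0..T} \<Longrightarrow> D1 t m 0 = 0" "t \<in> {0..T} \<Longrightarrow> D2 t m x 0 = 0" "t \<in> {0..T} \<Longrightarrow> D2 t m 0 y = 0"
  and time_derivative: "t \<in> {0..T} \<Longrightarrow> ((\<lambda>s. U s m) has_real_derivative Ut t m) (at t within {0..T})"
  and linear_U: "t \<in> {0..T} \<Longrightarrow> has_linear_derivative (U t) (D1 t)"
  and linear_D1: "t \<in> {0..T} \<Longrightarrow> has_linear_derivative (\<lambda>m. D1 t m x) (\<lambda>m y. D2 t m x y)"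
  and differentiable: "t \<in> {0..T} \<Longrightarrow> D1 t m differentiable at x" "t \<in> {0..T} \<Longrightarrow> grad (D1 t m) differentiable at x"
    "t \<in> {0..T} \<Longrightarrow> (\<lambda>x'. D2 t m x' y) differentiable at x"
    "t \<in> {0..T} \<Longrightarrow> (\<lambda>y'. grad (\<lambda>x'. D2 t m x' y') x) differentiable at y"
  using smooth unfolding smooth_with_def by blast+

lemma Ut_tendsto:
  assumes "t \<longlonglongrightarrow> s" "\<And>n. t n \<in> {0..T}" "s \<in> {0..T}" "m' \<longlonglongrightarrow> m"
  shows "(\<lambda>n. Ut (t n) (m' n)) \<longlonglongrightarrow> Ut s m"
proof -
  have "continuous_on ({0..T} \<times> UNIV) (\<lambda>(t, m). Ut t m)"
    using smooth by (simp add: smooth_with_def bounded_continuous_on_def)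
  from continuous_on_tendsto_compose[OF this tendsto_Pair[OF assms(1,4)]] show ?thesis
    using assms by simp
qed

lemma grad_tendsto:
  assumes "t \<longlonglongrightarrow> s" "\<And>n. t n \<in> {0..T}" "s \<in> {0..T}" "m' \<longlonglongrightarrow> m" "x' \<longlonglongrightarrow> x"
  shows "(\<lambda>n. grad (D1 (t n) (m' n)) (x' n)) \<longlonglongrightarrow> grad (D1 s m) x"
proof -
  have "continuous_on ({0..T} \<times> UNIV \<times> UNIV) (\<lambda>(t, m, x). grad (D1 t m) x)"
    using smooth by (simp add: smooth_with_def bounded_continuous_on_def)
  from continuous_on_tendsto_compose[OF this tendsto_Pair[OF assms(1) tendsto_Pair[OF assms(4,5)]]] show ?thesis
    using assms by simp
qed

lemma hess_tendsto:
  assumes "t \<longlonglongrightarrow> s" "\<And>n. t n \<in> {0..T}" "s \<in> {0..T}" "m' \<longlonglongrightarrow> m" "x' \<longlonglongrightarrow> x"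
  shows "(\<lambda>n. jac (grad (D1 (t n) (m' n))) (x' n)) \<longlonglongrightarrow> jac (grad (D1 s m)) x"
proof -
  have "continuous_on ({0..T} \<times> UNIV \<times> UNIV) (\<lambda>(t, m, x). jac (grad (D1 t m)) x)"
    using smooth by (simp add: smooth_with_def bounded_continuous_on_def)
  from continuous_on_tendsto_compose[OF this tendsto_Pair[OF assms(1) tendsto_Pair[OF assms(4,5)]]] show ?thesis
    using assms by simp
qed

lemma mixed_tendsto:
  assumes "t \<longlonglongrightarrow> s" "\<And>n. t n \<in> {0..T}" "s \<in> {0..T}" "m' \<longlonglongrightarrow> m" "x' \<longlonglongrightarrow> x" "y' \<longlonglongrightarrow> y"
  shows "(\<lambda>n. mixed_grad (D2 (t n) (m' n)) (x' n) (y' n)) \<longlonglongrightarrow> mixed_grad (D2 s m) x y"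
proof -
  have "continuous_on ({0..T} \<times> UNIV \<times> UNIV \<times> UNIV) (\<lambda>(t, m, x, y). mixed_grad (D2 t m) x y)"
    using smooth by (simp add: smooth_with_def bounded_continuous_on_def)
  from continuous_on_tendsto_compose[OF this tendsto_Pair[OF assms(1) tendsto_Pair[OF assms(4) tendsto_Pair[OF assms(5,6)]]]]
  show ?thesis using assms by simp
qed

lemma U_time_mvt:
  assumes "u \<in> {0..T}" "v \<in> {0..T}" "u < v"
  shows "\<exists>s\<in>{u..v}. U v m - U u m = Ut s m * (v - u)"
proof -
  have "\<exists>s\<in>{u<..<v}. U v m - U u m = Ut s m * (v - u)"
    using assms by (intro mvt_within) (auto intro!: DERIV_subset[OF time_derivative])
  then show ?thesis by force
qed

lemma U_time_lipschitz:
  assumes "u \<in> {0..T}" "v \<in> {0..T}"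
  shows "\<bar>U v m - U u m\<bar> \<le> K * \<bar>v - u\<bar>"
proof -
  have *: "\<bar>U v m - U u m\<bar> \<le> K * \<bar>v - u\<bar>" if uv: "u \<in> {0..T}" "v \<in> {0..T}" "u < v" for u v
  proof -
    obtain s where s: "s \<in> {u..v}" "U v m - U u m = Ut s m * (v - u)" using U_time_mvt[OF uv] by blast
    have "\<bar>Ut s m\<bar> \<le> K" using s uv by (intro Ut_le) auto
    then show ?thesis unfolding s(2) abs_mult by (intro mult_right_mono) auto
  qed
  consider "u < v" | "v < u" | "u = v" by linarith
  then show ?thesis using *[of u v] *[of v u] assms by cases (auto simp: abs_minus_commute)
qed

lemma U_bounded: "\<exists>C. \<forall>t\<in>{0..T}. \<forall>m. \<bar>U t m\<bar> \<le> C"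
proof -
  obtain C where C: "\<And>m. \<bar>U T m\<bar> \<le> C" using terminal by (auto simp: bounded_continuous_on_def bounded_iff)
  have "\<bar>U t m\<bar> \<le> C + K * T" if "t \<in> {0..T}" for t m
  proof -
    have "\<bar>U T m - U t m\<bar> \<le> K * \<bar>T - t\<bar>" using that T by (intro U_time_lipschitz) auto
    also have "\<dots> \<le> K * T" using that K_nonneg by (intro mult_left_mono) auto
    finally show ?thesis using C[of m] by linarith
  qed
  then show ?thesis by blast
qed

text \<open>Continuity in the measure is carried from time \<open>T\<close> to time \<open>t\<close>
  by the continuous time derivative, along the affine path \<open>T + r * (t - T)\<close>.\<close>

lemma U_tendsto_fixed:
  assumes t: "t \<in> {0..T}" and m: "m' \<longlonglongrightarrow> m"
  shows "(\<lambda>n. U t (m' n)) \<longlonglongrightarrow> U t m"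
proof -
  have r: "T + r * (t - T) \<in> {0..T}" if "r \<in> {0..1}" for r
  proof -
    have "r * (T - t) \<le> 1 * (T - t)" using that t by (intro mult_right_mono) auto
    moreover have "0 \<le> r * (T - t)" using that t by simp
    ultimately show ?thesis using t by (auto simp: algebra_simps)
  qed
  have d: "((\<lambda>r. U (T + r * (t - T)) m) has_real_derivative Ut (T + r * (t - T)) m * (t - T)) (at r within {0..1})"
    if "r \<in> {0..1}" for r m
  proof -
    have "((\<lambda>r. T + r * (t - T)) has_real_derivative (t - T)) (at r within {0..1})"
      by (auto intro!: derivative_eq_intros)
    moreover have "((\<lambda>s. U s m) has_real_derivative Ut (T + r * (t - T)) m) (at (T + r * (t - T)) within (\<lambda>r. T + r * (t - T)) ` {0..1})"
      using r by (intro DERIV_subset[OF time_derivative[OF r[OF that]]]) blast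
    ultimately show ?thesis using DERIV_image_chain by (fastforce simp: comp_def)
  qed
  have "(\<lambda>n. U (T + 1 * (t - T)) (m' n)) \<longlonglongrightarrow> U (T + 1 * (t - T)) m"
  proof (rule tendsto_from_derivative[OF d d])
    show "(\<lambda>n. Ut (T + X n * (t - T)) (m' n) * (t - T)) \<longlonglongrightarrow> Ut (T + s * (t - T)) m * (t - T)"
      if "X \<longlonglongrightarrow> s" "s \<in> {0..1}" "\<And>n. X n \<in> {0..1}" for s X
      using that by (intro tendsto_mult_right Ut_tendsto r m tendsto_intros)
    show "continuous_on {0..1} (\<lambda>s. Ut (T + s * (t - T)) m * (t - T))"
      unfolding continuous_on_sequentially comp_def
      by (auto intro!: tendsto_mult_right Ut_tendsto r tendsto_intros)
    show "(\<lambda>n. U (T + 0 * (t - T)) (m' n)) \<longlonglongrightarrow> U (T + 0 * (t - T)) m"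
      using terminal m by (auto simp: bounded_continuous_on_def intro: continuous_on_tendsto_compose)
  qed
  then show ?thesis by simp
qed

lemma U_tendsto:
  assumes "t \<longlonglongrightarrow> s" "\<And>n. t n \<in> {0..T}" "s \<in> {0..T}" "m' \<longlonglongrightarrow> m"
  shows "(\<lambda>n. U (t n) (m' n)) \<longlonglongrightarrow> U s m"
proof -
  have "(\<lambda>n. U (t n) (m' n) - U s (m' n)) \<longlonglongrightarrow> 0"
  proof (rule Lim_null_comparison[OF always_eventually[OF allI]])
    show "norm (U (t n) (m' n) - U s (m' n)) \<le> K * \<bar>t n - s\<bar>" for n
      using U_time_lipschitz[OF assms(3) assms(2)] by simp
    show "(\<lambda>n. K * \<bar>t n - s\<bar>) \<longlonglongrightarrow> 0" using assms(1) by (auto intro!: tendsto_eq_intros)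
  qed
  from tendsto_add[OF this U_tendsto_fixed[OF assms(3,4)]] show ?thesis by simp
qed

lemma D1_line:
  assumes "t \<in> {0..T}"
  shows "((\<lambda>s. D1 t m (x + s *\<^sub>R a)) has_real_derivative grad (D1 t m) (x + s *\<^sub>R a) \<bullet> a) (at s within S)"
  by (rule real_derivative_along_line) (rule differentiable(1)[OF assms])

lemma D1_lipschitz:
  assumes "t \<in> {0..T}"
  shows "\<bar>D1 t m x - D1 t m y\<bar> \<le> K * norm (x - y)"
proof -
  obtain s where "s \<in> {0..1}" "D1 t m (y + 1 *\<^sub>R (x - y)) - D1 t m (y + 0 *\<^sub>R (x - y)) = grad (D1 t m) (y + s *\<^sub>R (x - y)) \<bullet> (x - y)"
    by (rule mvt_unit[OF D1_line[OF assms]])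
  then have "\<bar>D1 t m x - D1 t m y\<bar> = \<bar>grad (D1 t m) (y + s *\<^sub>R (x - y)) \<bullet> (x - y)\<bar>" by simp
  also have "\<dots> \<le> norm (grad (D1 t m) (y + s *\<^sub>R (x - y))) * norm (x - y)" by (rule Cauchy_Schwarz_ineq2)
  also have "\<dots> \<le> K * norm (x - y)" by (intro mult_right_mono grad_le assms) auto
  finally show ?thesis .
qed

lemma D1_taylor:
  assumes t: "t \<in> {0..T}"
  shows "\<exists>s\<in>{0..1}. D1 t m (x + a) = D1 t m x + grad (D1 t m) x \<bullet> a + a \<bullet> (jac (grad (D1 t m)) (x + s *\<^sub>R a) *v a) / 2"
proof -
  have d2: "((\<lambda>s. grad (D1 t m) (x + s *\<^sub>R a) \<bullet> a) has_real_derivative a \<bullet> (jac (grad (D1 t m)) (x + s *\<^sub>R a) *v a)) (at s within {0..1})" for s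
    unfolding has_real_derivative_iff_has_vector_derivative
    using bounded_linear.has_vector_derivative[OF bounded_linear_inner_left[of a]
      has_derivative_along_line[OF jac_has_derivative[OF differentiable(2)[OF t]]]] by (simp add: inner_commute)
  show ?thesis
    by (rule taylor2_unit[OF D1_line[OF t, of m x a] d2]) (auto intro!: bexI)
qed

text \<open>The gradient is followed along the ray from the origin, where \<open>D1\<close> vanishes
  for every time and every law; this normalisation supplies convergence at the starting
  point.\<close>

lemma D1_tendsto:
  assumes "t \<longlonglongrightarrow> s" "\<And>n. t n \<in> {0..T}" "s \<in> {0..T}" "m' \<longlonglongrightarrow> m" "x' \<longlonglongrightarrow> x"
  shows "(\<lambda>n. D1 (t n) (m' n) (x' n)) \<longlonglongrightarrow> D1 s m x"
proof -
  have "(\<lambda>n. D1 (t n) (m' n) (0 + 1 *\<^sub>R x' n)) \<longlonglongrightarrow> D1 s m (0 + 1 *\<^sub>R x)"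
  proof (rule tendsto_from_derivative[OF D1_line D1_line])
    show "(\<lambda>n. grad (D1 (t n) (m' n)) (0 + X n *\<^sub>R x' n) \<bullet> x' n) \<longlonglongrightarrow> grad (D1 s m) (0 + r *\<^sub>R x) \<bullet> x"
      if "X \<longlonglongrightarrow> r" for r X
      using that assms by (intro tendsto_inner grad_tendsto tendsto_intros)
    show "continuous_on {0..1} (\<lambda>r. grad (D1 s m) (0 + r *\<^sub>R x) \<bullet> x)"
      unfolding continuous_on_sequentially comp_def
      using assms(3) by (auto intro!: tendsto_inner grad_tendsto tendsto_intros)
  qed (use assms zeros in auto)
  then show ?thesis by simp
qed

definition D2x :: "real \<Rightarrow> (real^'d) prob_measure \<Rightarrow> real^'d \<Rightarrow> real^'d \<Rightarrow> real^'d" where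
  "D2x t m x y = grad (\<lambda>x'. D2 t m x' y) x"

lemma D2x_line:
  assumes "t \<in> {0..T}"
  shows "((\<lambda>s. a \<bullet> D2x t m x (y + s *\<^sub>R b)) has_real_derivative a \<bullet> (mixed_grad (D2 t m) x (y + s *\<^sub>R b) *v b)) (at s within S)"
proof -
  have "((\<lambda>y. D2x t m x y) has_derivative (\<lambda>h. mixed_grad (D2 t m) x y *v h)) (at y)" for y
    unfolding D2x_def mixed_grad_def using assms by (intro jac_has_derivative differentiable)
  then show ?thesis
    unfolding has_real_derivative_iff_has_vector_derivative
    by (intro bounded_linear.has_vector_derivative[OF bounded_linear_inner_right] has_derivative_along_line)
qed

lemma D2_line:
  assumes "t \<in> {0..T}"
  shows "((\<lambda>s. D2 t m (x + s *\<^sub>R a) y) has_real_derivative a \<bullet> D2x t m (x + s *\<^sub>R a) y) (at s within S)"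
proof -
  have "(\<lambda>x'. D2 t m x' y) differentiable at (x + s *\<^sub>R a)" by (rule differentiable(3)[OF assms])
  from real_derivative_along_line[OF this, of S] show ?thesis by (simp add: D2x_def inner_commute)
qed

lemma D2x_0: "t \<in> {0..T} \<Longrightarrow> D2x t m x 0 = 0"
  unfolding D2x_def by (simp add: zeros grad_const)

text \<open>Starts at \<open>y = 0\<close>, where \<open>D2x\<close> vanishes because
  \<open>D2\<close> is zero there for all \<open>x\<close>, and follows the mixed gradient along the
  ray to \<open>y\<close>. Components are treated one at a time, as
  \<open>tendsto_from_derivative\<close> is about real functions.\<close>

lemma D2x_tendsto:
  assumes "t \<longlonglongrightarrow> s" "\<And>n. t n \<in> {0..T}" "s \<in> {0..T}" "m' \<longlonglongrightarrow> m" "x' \<longlonglongrightarrow> x" "y' \<longlonglongrightarrow> y"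
  shows "(\<lambda>n. D2x (t n) (m' n) (x' n) (y' n)) \<longlonglongrightarrow> D2x s m x y"
proof (rule vec_tendstoI)
  fix i
  have mv: "(\<lambda>n. A n *v b n) \<longlonglongrightarrow> A0 *v b0" if "A \<longlonglongrightarrow> A0" "b \<longlonglongrightarrow> b0" for A :: "nat \<Rightarrow> real^'d^'d" and A0 b b0
    using that unfolding matrix_vector_mult_def
    by (intro vec_tendstoI) (auto intro!: tendsto_sum tendsto_mult tendsto_vec_nth)
  have "(\<lambda>n. axis i 1 \<bullet> D2x (t n) (m' n) (x' n) (0 + 1 *\<^sub>R y' n)) \<longlonglongrightarrow> axis i 1 \<bullet> D2x s m x (0 + 1 *\<^sub>R y)"
  proof (rule tendsto_from_derivative[OF D2x_line D2x_line])
    show "(\<lambda>n. axis i 1 \<bullet> (mixed_grad (D2 (t n) (m' n)) (x' n) (0 + X n *\<^sub>R y' n) *v y' n))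
        \<longlonglongrightarrow> axis i 1 \<bullet> (mixed_grad (D2 s m) x (0 + r *\<^sub>R y) *v y)" if "X \<longlonglongrightarrow> r" for r X
      using that assms by (intro tendsto_inner mv mixed_tendsto tendsto_intros)
    show "continuous_on {0..1} (\<lambda>r. axis i 1 \<bullet> (mixed_grad (D2 s m) x (0 + r *\<^sub>R y) *v y))"
      unfolding continuous_on_sequentially comp_def
      using assms(3) by (auto intro!: tendsto_inner mv mixed_tendsto tendsto_intros)
  qed (use assms D2x_0 in auto)
  then show "(\<lambda>n. D2x (t n) (m' n) (x' n) (y' n) $ i) \<longlonglongrightarrow> D2x s m x y $ i"
    by (simp add: inner_axis' )
qed

text \<open>Starts at \<open>x = 0\<close>, where \<open>D2\<close> is zero for all
  \<open>y\<close>. Together with \<open>D2x_tendsto\<close>, the two normalisations recover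
  \<open>D2\<close> from its mixed gradient.\<close>

lemma D2_tendsto:
  assumes "t \<longlonglongrightarrow> s" "\<And>n. t n \<in> {0..T}" "s \<in> {0..T}" "m' \<longlonglongrightarrow> m" "x' \<longlonglongrightarrow> x" "y' \<longlonglongrightarrow> y"
  shows "(\<lambda>n. D2 (t n) (m' n) (x' n) (y' n)) \<longlonglongrightarrow> D2 s m x y"
proof -
  have "(\<lambda>n. D2 (t n) (m' n) (0 + 1 *\<^sub>R x' n) (y' n)) \<longlonglongrightarrow> D2 s m (0 + 1 *\<^sub>R x) y"
  proof (rule tendsto_from_derivative[OF D2_line D2_line])
    show "(\<lambda>n. x' n \<bullet> D2x (t n) (m' n) (0 + X n *\<^sub>R x' n) (y' n)) \<longlonglongrightarrow> x \<bullet> D2x s m (0 + r *\<^sub>R x) y"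
      if "X \<longlonglongrightarrow> r" for r X
      using that assms by (intro tendsto_inner D2x_tendsto tendsto_intros)
    show "continuous_on {0..1} (\<lambda>r. x \<bullet> D2x s m (0 + r *\<^sub>R x) y)"
      unfolding continuous_on_sequentially comp_def
      using assms(3) by (auto intro!: tendsto_inner D2x_tendsto tendsto_intros)
  qed (use assms zeros in auto)
  then show ?thesis by simp
qed

text \<open>The mixed second difference. Terms that depend on only one of the two space variables
  cancel in it, which is why the mixed gradient alone controls it.\<close>

definition rect :: "real \<Rightarrow> (real^'d) prob_measure \<Rightarrow> real^'d \<Rightarrow> real^'d \<Rightarrow> real^'d \<Rightarrow> real^'d \<Rightarrow> real" where
  "rect t m x y a b = (D2 t m (x + a) (y + b) - D2 t m (x + a) y) - (D2 t m x (y + b) - D2 t m x y)"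

lemma rect_mvt:
  assumes t: "t \<in> {0..T}"
  shows "\<exists>s\<in>{0..1}. \<exists>r\<in>{0..1}. rect t m x y a b = a \<bullet> (mixed_grad (D2 t m) (x + s *\<^sub>R a) (y + r *\<^sub>R b) *v b)"
proof -
  have "((\<lambda>s. D2 t m (x + s *\<^sub>R a) (y + b) - D2 t m (x + s *\<^sub>R a) y) has_real_derivative
      a \<bullet> D2x t m (x + s *\<^sub>R a) (y + b) - a \<bullet> D2x t m (x + s *\<^sub>R a) y) (at s within {0..1})" for s
    by (intro DERIV_diff D2_line t)
  from mvt_unit[OF this] obtain s where s: "s \<in> {0..1}"
    "rect t m x y a b = a \<bullet> D2x t m (x + s *\<^sub>R a) (y + 1 *\<^sub>R b) - a \<bullet> D2x t m (x + s *\<^sub>R a) (y + 0 *\<^sub>R b)"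
    unfolding rect_def by auto
  from mvt_unit[OF D2x_line[OF t]] s show ?thesis by metis
qed

lemma rect_le:
  assumes t: "t \<in> {0..T}"
  shows "\<bar>rect t m x y a b\<bar> \<le> K * (norm a * norm b)"
proof -
  obtain s r where "rect t m x y a b = a \<bullet> (mixed_grad (D2 t m) (x + s *\<^sub>R a) (y + r *\<^sub>R b) *v b)"
    using rect_mvt[OF t] by blast
  then have "\<bar>rect t m x y a b\<bar> \<le> norm (mixed_grad (D2 t m) (x + s *\<^sub>R a) (y + r *\<^sub>R b)) * (norm a * norm b)"
    using inner_matrix_le by simp
  also have "\<dots> \<le> K * (norm a * norm b)" by (intro mult_right_mono mixed_le t) auto
  finally show ?thesis .
qed

text \<open>With one edge at \<open>x = 0\<close>, where \<open>D2\<close> vanishes, the mixed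
  second difference reduces to a difference in \<open>y\<close>. The constant grows with
  \<open>norm x\<close>, since it is the mixed gradient that is bounded.\<close>

lemma D2_lipschitz:
  assumes t: "t \<in> {0..T}"
  shows "\<bar>D2 t m x y - D2 t m x y'\<bar> \<le> K * norm x * norm (y - y')"
  using rect_le[OF t, of m 0 y' x "y - y'"] t by (simp add: rect_def zeros ac_simps)

lemma regular_U:
  assumes t: "t \<in> {0..T}"
  shows "regular_linear_derivative (U t) (D1 t) K"
  unfolding regular_linear_derivative_def
proof (intro conjI allI)
  obtain C where "\<And>m. \<bar>U t m\<bar> \<le> C" using U_bounded t by blast
  then show "bounded (range (U t))" by (auto simp: bounded_iff)
  show "continuous_on UNIV (U t)" "continuous_on UNIV (\<lambda>(m, x). D1 t m x)"
    using t by (auto intro!: continuous_on_UNIV_sequentiallyI U_tendsto D1_tendsto tendsto_const dest: tendsto_fst tendsto_snd simp: case_prod_beta)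
qed (use t in \<open>auto simp: linear_U zeros D1_lipschitz\<close>)

text \<open>For fixed \<open>x\<close>, vanishing at the origin bounds \<open>D1\<close> by
  \<open>K * norm x\<close>. Thus \<open>D1\<close> can be differentiated in the law by the same
  theorem as \<open>U\<close>, which is what a second-order expansion requires.\<close>

lemma regular_D1:
  assumes t: "t \<in> {0..T}"
  shows "regular_linear_derivative (\<lambda>m. D1 t m x) (\<lambda>m y. D2 t m x y) (K * norm x)"
  unfolding regular_linear_derivative_def
proof (intro conjI allI)
  have "\<bar>D1 t m x\<bar> \<le> K * norm x" for m using D1_lipschitz[OF t, of m x 0] t by (simp add: zeros)
  then show "bounded (range (\<lambda>m. D1 t m x))" by (auto simp: bounded_iff)
  show "continuous_on UNIV (\<lambda>m. D1 t m x)" "continuous_on UNIV (\<lambda>(m, y). D2 t m x y)"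
    using t by (auto intro!: continuous_on_UNIV_sequentiallyI D2_tendsto D1_tendsto tendsto_const dest: tendsto_fst tendsto_snd simp: case_prod_beta)
qed (use t in \<open>auto simp: linear_D1 zeros D2_lipschitz\<close>)

text \<open>Each of these is jointly continuous in the law and the space variables, hence Borel on
  the product by second countability.\<close>

lemma measurable_derivatives:
  assumes t: "t \<in> {0..T}" and [measurable]: "f \<in> borel_measurable N" "g \<in> borel_measurable N" "h \<in> borel_measurable N"
  shows "(\<lambda>w. U t (f w)) \<in> borel_measurable N"
    "(\<lambda>w. D1 t (f w) (g w)) \<in> borel_measurable N"
    "(\<lambda>w. D2 t (f w) (g w) (h w)) \<in> borel_measurable N"
    "(\<lambda>w. grad (D1 t (f w)) (g w)) \<in> borel_measurable N"
    "(\<lambda>w. jac (grad (D1 t (f w))) (g w)) \<in> borel_measurable N"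
    "(\<lambda>w. mixed_grad (D2 t (f w)) (g w) (h w)) \<in> borel_measurable N"
proof -
  have 2: "(\<lambda>w. F (f w) (g w)) \<in> borel_measurable N"
    if "\<And>m x m' x'. m' \<longlonglongrightarrow> m \<Longrightarrow> x' \<longlonglongrightarrow> x \<Longrightarrow> (\<lambda>n. F (m' n) (x' n)) \<longlonglongrightarrow> F m x"
    for F :: "(real^'d) prob_measure \<Rightarrow> real^'d \<Rightarrow> 'e::{metric_space, second_countable_topology}"
  proof -
    have "continuous_on UNIV (\<lambda>(m, x). F m x)"
      by (auto intro!: continuous_on_UNIV_sequentiallyI that dest: tendsto_fst tendsto_snd simp: case_prod_beta)
    then have "(\<lambda>(m, x). F m x) \<in> borel_measurable (borel \<Otimes>\<^sub>M borel)"
      unfolding borel_prod by (rule borel_measurable_continuous_onI)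
    from measurable_compose[OF measurable_Pair[OF assms(2,3)] this] show ?thesis by simp
  qed
  have 3: "(\<lambda>w. F (f w) (g w) (h w)) \<in> borel_measurable N"
    if "\<And>m x y m' x' y'. m' \<longlonglongrightarrow> m \<Longrightarrow> x' \<longlonglongrightarrow> x \<Longrightarrow> y' \<longlonglongrightarrow> y \<Longrightarrow> (\<lambda>n. F (m' n) (x' n) (y' n)) \<longlonglongrightarrow> F m x y"
    for F :: "(real^'d) prob_measure \<Rightarrow> real^'d \<Rightarrow> real^'d \<Rightarrow> 'e::{metric_space, second_countable_topology}"
  proof -
    have "continuous_on UNIV (\<lambda>(m, x, y). F m x y)"
      by (auto intro!: continuous_on_UNIV_sequentiallyI that dest: tendsto_fst tendsto_snd simp: case_prod_beta)
    then have "(\<lambda>(m, x, y). F m x y) \<in> borel_measurable (borel \<Otimes>\<^sub>M borel \<Otimes>\<^sub>M borel)"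
      unfolding borel_prod by (rule borel_measurable_continuous_onI)
    from measurable_compose[OF measurable_Pair[OF assms(2) measurable_Pair[OF assms(3,4)]] this] show ?thesis by simp
  qed
  show "(\<lambda>w. D1 t (f w) (g w)) \<in> borel_measurable N"
    by (rule 2[of "D1 t"]) (use t in \<open>intro D1_tendsto tendsto_const\<close>)
  show "(\<lambda>w. U t (f w)) \<in> borel_measurable N"
    by (rule 2[of "\<lambda>m x. U t m"]) (use t in \<open>intro U_tendsto tendsto_const\<close>)
  show "(\<lambda>w. D2 t (f w) (g w) (h w)) \<in> borel_measurable N"
    by (rule 3[of "D2 t"]) (use t in \<open>intro D2_tendsto tendsto_const\<close>)
  show "(\<lambda>w. grad (D1 t (f w)) (g w)) \<in> borel_measurable N"
    by (rule 2[of "\<lambda>m. grad (D1 t m)"]) (use t in \<open>intro grad_tendsto tendsto_const\<close>)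
  show "(\<lambda>w. jac (grad (D1 t (f w))) (g w)) \<in> borel_measurable N"
    by (rule 2[of "\<lambda>m. jac (grad (D1 t m))"]) (use t in \<open>intro hess_tendsto tendsto_const\<close>)
  show "(\<lambda>w. mixed_grad (D2 t (f w)) (g w) (h w)) \<in> borel_measurable N"
    by (rule 3[of "\<lambda>m. mixed_grad (D2 t m)"]) (use t in \<open>intro mixed_tendsto tendsto_const\<close>)
qed

section \<open>Expansion of the value under translation of a deterministic law\<close>

lemma translation_law:
  fixes a :: "real^'d"
  shows "disintegrates (meas \<nu>) (\<lambda>x. (\<nu>, push (\<lambda>x. x + a) \<nu>)) (\<lambda>_. \<nu>) (\<lambda>x. x)"
    "disintegrates (meas \<nu>) (\<lambda>x. (\<nu>, push (\<lambda>x. x + a) \<nu>)) (\<lambda>_. push (\<lambda>x. x + a) \<nu>) (\<lambda>x. x + a)"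
proof -
  have *: "(\<lambda>y. g (z, y)) \<in> borel_measurable borel"
    if "g \<in> borel_measurable borel" for g :: "((real^'d) prob_measure \<times> (real^'d) prob_measure) \<times> (real^'d) \<Rightarrow> real" and z
    using that by (intro measurable_compose[OF _ that] borel_measurable_continuous_onI continuous_intros)
  show "disintegrates (meas \<nu>) (\<lambda>x. (\<nu>, push (\<lambda>x. x + a) \<nu>)) (\<lambda>_. \<nu>) (\<lambda>x. x)"
    by (simp add: disintegrates_def)
  show "disintegrates (meas \<nu>) (\<lambda>x. (\<nu>, push (\<lambda>x. x + a) \<nu>)) (\<lambda>_. push (\<lambda>x. x + a) \<nu>) (\<lambda>x. x + a)"
    unfolding disintegrates_def
  proof (intro allI impI)
    fix g :: "((real^'d) prob_measure \<times> (real^'d) prob_measure) \<times> (real^'d) \<Rightarrow> real"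
    assume "g \<in> borel_measurable borel"
    then show "(\<integral>x. g ((\<nu>, push (\<lambda>x. x + a) \<nu>), x + a) \<partial>meas \<nu>) =
      (\<integral>x. (\<integral>y. g ((\<nu>, push (\<lambda>x. x + a) \<nu>), y) \<partial>meas (push (\<lambda>x. x + a) \<nu>)) \<partial>meas \<nu>)"
      using * by (subst integral_push) auto
  qed
qed

text \<open>The theorem on random laws, read for deterministic ones: the probability space is
  \<open>meas \<nu>\<close> itself, both laws are constant on it, and the coupling is
  \<open>x\<close> with \<open>x + a\<close>, whose distance is constant. The outer expectation then
  disappears.\<close>

lemma mix_translation_has_derivative:
  fixes \<Phi> :: "(real^'d) prob_measure \<Rightarrow> real"
  assumes reg: "regular_linear_derivative \<Phi> D L" and \<theta>: "\<theta> \<in> {0..1}"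
  shows "((\<lambda>\<theta>. \<Phi> (mix \<theta> \<nu> (push (\<lambda>x. x + a) \<nu>))) has_real_derivative
    (\<integral>x. D (mix \<theta> \<nu> (push (\<lambda>x. x + a) \<nu>)) (x + a) - D (mix \<theta> \<nu> (push (\<lambda>x. x + a) \<nu>)) x \<partial>meas \<nu>)) (at \<theta> within {0..1})"
  using expectation_mix_has_derivative[OF reg prob_space_meas _ _ _ _ translation_law[of \<nu> a] _ \<theta>] by (simp add: finite_measure.integrable_const)

text \<open>The error of the expansion of order two in the translation \<open>a\<close>. Its
  quadratic part has two sources: the curvature of \<open>D1\<close> in \<open>x\<close> and,
  through \<open>D2\<close>, the change of \<open>D1\<close> as the law itself moves.\<close>

definition remainder :: "real \<Rightarrow> (real^'d) prob_measure \<Rightarrow> real^'d \<Rightarrow> real" where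
  "remainder t \<nu> a = U t (push (\<lambda>x. x + a) \<nu>) - U t \<nu> - (\<integral>x. grad (D1 t \<nu>) x \<bullet> a \<partial>meas \<nu>)
     - ((\<integral>x. a \<bullet> (jac (grad (D1 t \<nu>)) x *v a) \<partial>meas \<nu>)
       + (\<integral>x. (\<integral>y. a \<bullet> (mixed_grad (D2 t \<nu>) x y *v a) \<partial>meas \<nu>) \<partial>meas \<nu>)) / 2"

definition taylor_rem :: "real \<Rightarrow> (real^'d) prob_measure \<Rightarrow> real^'d \<Rightarrow> real^'d \<Rightarrow> real" where
  "taylor_rem t \<nu> a x = D1 t \<nu> (x + a) - D1 t \<nu> x - grad (D1 t \<nu>) x \<bullet> a - a \<bullet> (jac (grad (D1 t \<nu>)) x *v a) / 2"

definition rect_rem :: "real \<Rightarrow> (real^'d) prob_measure \<Rightarrow> (real^'d) prob_measure \<Rightarrow> real^'d \<Rightarrow> real^'d \<Rightarrow> real^'d \<Rightarrow> real" where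
  "rect_rem t \<nu>' \<nu> a x y = rect t \<nu>' x y a a - a \<bullet> (mixed_grad (D2 t \<nu>) x y *v a)"

lemma borel_measurable_inner_matrix [measurable (raw)]:
  fixes A :: "'x \<Rightarrow> real^'n^'m"
  assumes [measurable]: "A \<in> borel_measurable N"
  shows "(\<lambda>w. a \<bullet> (A w *v b)) \<in> borel_measurable N"
  using measurable_compose[OF assms borel_measurable_continuous_onI[OF linear_continuous_on[OF bounded_linear_inner_matrix]]] .

lemma measurable_forms:
  assumes t: "t \<in> {0..T}" and f: "f \<in> borel_measurable N" and g: "g \<in> borel_measurable N"
  shows "(\<lambda>w. grad (D1 t (f w)) (g w) \<bullet> a) \<in> borel_measurable N"
    "(\<lambda>w. a \<bullet> (jac (grad (D1 t (f w))) (g w) *v b)) \<in> borel_measurable N"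
    "h \<in> borel_measurable N \<Longrightarrow> (\<lambda>w. a \<bullet> (mixed_grad (D2 t (f w)) (g w) (h w) *v b)) \<in> borel_measurable N"
    "(\<lambda>w. D1 t (f w) (g w)) \<in> borel_measurable N"
    "(\<lambda>w. U t (f w)) \<in> borel_measurable N"
  by (intro borel_measurable_inner borel_measurable_const measurable_derivatives[OF t f g g])
    (intro borel_measurable_inner_matrix measurable_derivatives[OF t f g g]
      measurable_derivatives(1,2)[OF t f g g] measurable_derivatives(6)[OF t f g]; assumption)+

lemma measurable_rem:
  assumes t: "t \<in> {0..T}" and g [measurable]: "g \<in> borel_measurable N"
  shows "(\<lambda>w. taylor_rem t \<nu> a (g w)) \<in> borel_measurable N"
    "h \<in> borel_measurable N \<Longrightarrow> (\<lambda>w. rect t \<nu> (g w) (h w) a b) \<in> borel_measurable N"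
    "h \<in> borel_measurable N \<Longrightarrow> (\<lambda>w. rect_rem t \<nu>' \<nu> a (g w) (h w)) \<in> borel_measurable N"
proof -
  have c [measurable]: "(\<lambda>_. \<mu>) \<in> borel_measurable N" for \<mu> :: "(real^'d) prob_measure" by simp
  have ga: "(\<lambda>w. g w + a) \<in> borel_measurable N" by measurable
  show "(\<lambda>w. taylor_rem t \<nu> a (g w)) \<in> borel_measurable N"
    unfolding taylor_rem_def
    by (intro borel_measurable_diff borel_measurable_divide measurable_forms[OF t c g] measurable_forms[OF t c ga] borel_measurable_const)
  show r: "(\<lambda>w. rect t \<nu> (g w) (h w) a b) \<in> borel_measurable N"
    if [measurable]: "h \<in> borel_measurable N" for \<nu> b
  proof -
    have "(\<lambda>w. h w + b) \<in> borel_measurable N" by measurable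
    then show ?thesis unfolding rect_def
      by (intro borel_measurable_diff measurable_derivatives(3)[OF t c g] measurable_derivatives(3)[OF t c ga] that)
  qed
  show "(\<lambda>w. rect_rem t \<nu>' \<nu> a (g w) (h w)) \<in> borel_measurable N" if "h \<in> borel_measurable N"
    unfolding rect_rem_def by (intro borel_measurable_diff r measurable_forms(3)[OF t c g] that)
qed

lemma measurable_rem_pair:
  assumes t: "t \<in> {0..T}"
  shows "(\<lambda>x. taylor_rem t \<nu> a x) \<in> borel_measurable borel"
    "(\<lambda>y. rect t \<nu> x y a b) \<in> borel_measurable borel"
    "(\<lambda>y. rect_rem t \<nu>' \<nu> a x y) \<in> borel_measurable borel"
    "(\<lambda>x. \<integral>y. rect t \<nu> x y a b \<partial>meas \<mu>) \<in> borel_measurable borel"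
    "(\<lambda>x. \<integral>y. rect_rem t \<nu>' \<nu> a x y \<partial>meas \<mu>) \<in> borel_measurable borel"
proof -
  show "(\<lambda>x. taylor_rem t \<nu> a x) \<in> borel_measurable borel"
    "(\<lambda>y. rect t \<nu> x y a b) \<in> borel_measurable borel"
    "(\<lambda>y. rect_rem t \<nu>' \<nu> a x y) \<in> borel_measurable borel"
    by (intro measurable_rem[OF t]; simp)+
  have m: "(\<lambda>(x, y). rect t \<nu> x y a b) \<in> borel_measurable (borel \<Otimes>\<^sub>M borel)"
    "(\<lambda>(x, y). rect_rem t \<nu>' \<nu> a x y) \<in> borel_measurable (borel \<Otimes>\<^sub>M borel)"
    unfolding case_prod_beta by (intro measurable_rem[OF t] measurable_fst measurable_snd)+
  show "(\<lambda>x. \<integral>y. rect t \<nu> x y a b \<partial>meas \<mu>) \<in> borel_measurable borel"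
    "(\<lambda>x. \<integral>y. rect_rem t \<nu>' \<nu> a x y \<partial>meas \<mu>) \<in> borel_measurable borel"
    by (rule borel_measurable_integral_meas[OF m(1)] borel_measurable_integral_meas[OF m(2)]; simp)+
qed

lemma measurable_form_pair:
  assumes t: "t \<in> {0..T}"
  shows "(\<lambda>x. grad (D1 t \<nu>) x \<bullet> a) \<in> borel_measurable borel"
    "(\<lambda>x. a \<bullet> (jac (grad (D1 t \<nu>)) x *v b)) \<in> borel_measurable borel"
    "(\<lambda>y. a \<bullet> (mixed_grad (D2 t \<nu>) x y *v b)) \<in> borel_measurable borel"
    "(\<lambda>x. \<integral>y. a \<bullet> (mixed_grad (D2 t \<nu>) x y *v b) \<partial>meas \<mu>) \<in> borel_measurable borel"
proof -
  show "(\<lambda>x. grad (D1 t \<nu>) x \<bullet> a) \<in> borel_measurable borel"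
    "(\<lambda>x. a \<bullet> (jac (grad (D1 t \<nu>)) x *v b)) \<in> borel_measurable borel"
    "(\<lambda>y. a \<bullet> (mixed_grad (D2 t \<nu>) x y *v b)) \<in> borel_measurable borel"
    by (intro measurable_forms[OF t]; simp)+
  have "(\<lambda>(x, y). a \<bullet> (mixed_grad (D2 t \<nu>) x y *v b)) \<in> borel_measurable (borel \<Otimes>\<^sub>M borel)"
    unfolding case_prod_beta by (intro measurable_forms(3)[OF t] measurable_fst measurable_snd measurable_const) simp
  then show "(\<lambda>x. \<integral>y. a \<bullet> (mixed_grad (D2 t \<nu>) x y *v b) \<partial>meas \<mu>) \<in> borel_measurable borel"
    by (rule borel_measurable_integral_meas) simp
qed

lemma hess_form_le: "t \<in> {0..T} \<Longrightarrow> \<bar>a \<bullet> (jac (grad (D1 t m)) x *v b)\<bar> \<le> K * (norm a * norm b)"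
  and mixed_form_le: "t \<in> {0..T} \<Longrightarrow> \<bar>a \<bullet> (mixed_grad (D2 t m) x y *v b)\<bar> \<le> K * (norm a * norm b)"
  by (rule order_trans[OF inner_matrix_le mult_right_mono[OF hess_le]] order_trans[OF inner_matrix_le mult_right_mono[OF mixed_le]]; simp)+

lemma taylor_rem_eq:
  assumes t: "t \<in> {0..T}"
  shows "\<exists>s\<in>{0..1}. taylor_rem t \<nu> a x = a \<bullet> ((jac (grad (D1 t \<nu>)) (x + s *\<^sub>R a) - jac (grad (D1 t \<nu>)) x) *v a) / 2"
proof -
  obtain s where "s \<in> {0..1}" "D1 t \<nu> (x + a) = D1 t \<nu> x + grad (D1 t \<nu>) x \<bullet> a + a \<bullet> (jac (grad (D1 t \<nu>)) (x + s *\<^sub>R a) *v a) / 2"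
    using D1_taylor[OF t] by blast
  then show ?thesis by (intro bexI[of _ s]) (auto simp: taylor_rem_def inner_matrix_diff[symmetric] diff_divide_distrib)
qed

lemma rect_rem_eq:
  assumes t: "t \<in> {0..T}"
  shows "\<exists>s\<in>{0..1}. \<exists>r\<in>{0..1}. rect_rem t \<nu>' \<nu> a x y =
    a \<bullet> ((mixed_grad (D2 t \<nu>') (x + s *\<^sub>R a) (y + r *\<^sub>R a) - mixed_grad (D2 t \<nu>) x y) *v a)"
  using rect_mvt[OF t, of \<nu>' x y a a] by (auto simp: rect_rem_def inner_matrix_diff[symmetric])

lemma taylor_rem_le:
  assumes t: "t \<in> {0..T}"
  shows "\<bar>taylor_rem t \<nu> a x\<bar> \<le> K * (norm a)\<^sup>2"
proof -
  obtain s where s: "taylor_rem t \<nu> a x = a \<bullet> ((jac (grad (D1 t \<nu>)) (x + s *\<^sub>R a) - jac (grad (D1 t \<nu>)) x) *v a) / 2"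
    using taylor_rem_eq[OF t] by blast
  have "\<bar>a \<bullet> (jac (grad (D1 t \<nu>)) (x + s *\<^sub>R a) *v a) - a \<bullet> (jac (grad (D1 t \<nu>)) x *v a)\<bar> \<le>
      K * (norm a * norm a) + K * (norm a * norm a)"
    by (rule order_trans[OF abs_triangle_ineq4 add_mono]; rule hess_form_le[OF t])
  then show ?thesis unfolding s inner_matrix_diff[symmetric] power2_eq_square by simp
qed

lemma rect_rem_le:
  assumes t: "t \<in> {0..T}"
  shows "\<bar>rect_rem t \<nu>' \<nu> a x y\<bar> \<le> 2 * K * (norm a)\<^sup>2"
proof -
  have "\<bar>rect_rem t \<nu>' \<nu> a x y\<bar> \<le> K * (norm a * norm a) + K * (norm a * norm a)"
    unfolding rect_rem_def by (rule order_trans[OF abs_triangle_ineq4 add_mono]) (rule rect_le[OF t] mixed_form_le[OF t])+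
  then show ?thesis by (simp add: power2_eq_square)
qed

text \<open>Taylor formula of order two for \<open>U\<close> along the segment from
  \<open>\<nu>\<close> to its translate. The first derivative is the integral of the increments of
  \<open>D1\<close> under \<open>x \<mapsto> x + a\<close>; differentiating once more in the law
  gives the double integral of \<open>rect\<close>. At parameter zero the first derivative is then
  expanded in \<open>x\<close>.\<close>

lemma remainder_eq:
  assumes t: "t \<in> {0..T}"
  shows "\<exists>\<theta>\<in>{0..1}. remainder t \<nu> a = (\<integral>x. taylor_rem t \<nu> a x \<partial>meas \<nu>)
     + (\<integral>x. (\<integral>y. rect_rem t (mix \<theta> \<nu> (push (\<lambda>x. x + a) \<nu>)) \<nu> a x y \<partial>meas \<nu>) \<partial>meas \<nu>) / 2"
proof -
  let ?N = "\<lambda>\<theta>. mix \<theta> \<nu> (push (\<lambda>x. x + a) \<nu>)"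
  let ?f = "\<lambda>\<theta> x. D1 t (?N \<theta>) (x + a) - D1 t (?N \<theta>) x"
  let ?f' = "\<lambda>\<theta> x. \<integral>y. rect t (?N \<theta>) x y a a \<partial>meas \<nu>"
  have f_int: "integrable (meas \<nu>) (?f \<theta>)" for \<theta>
  proof (rule integrable_meas_bounded[where C="K * norm a"])
    show "norm (?f \<theta> x) \<le> K * norm a" for x using D1_lipschitz[OF t, of "?N \<theta>" "x + a" x] by simp
    show "?f \<theta> \<in> borel_measurable borel"
      by (intro borel_measurable_diff measurable_forms[OF t]) auto
  qed
  have rect_int: "integrable (meas \<nu>) (\<lambda>y. rect t \<mu> x y a a)" for \<mu> x
    by (rule integrable_meas_bounded[where C="K * (norm a * norm a)"]) (auto intro: rect_le[OF t] measurable_rem_pair[OF t])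
  have f'_meas: "?f' \<theta> \<in> borel_measurable borel" for \<theta>
    by (rule measurable_rem_pair[OF t])
  have f'_bd: "\<bar>?f' \<theta> x\<bar> \<le> K * (norm a * norm a)" for \<theta> x
    using integral_meas_bounded[of "\<lambda>y. rect t (?N \<theta>) x y a a" "K * (norm a * norm a)" \<nu>] rect_le[OF t] measurable_rem_pair[OF t]
    by simp
  have d1: "((\<lambda>\<theta>. U t (?N \<theta>)) has_real_derivative (\<integral>x. ?f \<theta> x \<partial>meas \<nu>)) (at \<theta> within {0..1})" if "\<theta> \<in> {0..1}" for \<theta>
    by (rule mix_translation_has_derivative[OF regular_U[OF t] that])
  have d2: "((\<lambda>\<theta>. \<integral>x. ?f \<theta> x \<partial>meas \<nu>) has_real_derivative (\<integral>x. ?f' \<theta> x \<partial>meas \<nu>)) (at \<theta> within {0..1})" if \<theta>: "\<theta> \<in> {0..1}" for \<theta>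
  proof (rule has_derivative_integral_bounded[OF finite_measure_meas _ f'_bd f_int \<theta>])
    show "((\<lambda>\<theta>. ?f \<theta> x) has_real_derivative ?f' \<theta> x) (at \<theta> within {0..1})" if \<theta>: "\<theta> \<in> {0..1}" for \<theta> x
    proof -
      have D2_int: "integrable (meas \<nu>) (\<lambda>y. D2 t \<mu> z (y + a) - D2 t \<mu> z y)" for \<mu> z
      proof (rule integrable_meas_bounded[where C="K * norm z * norm a"])
        show "norm (D2 t \<mu> z (y + a) - D2 t \<mu> z y) \<le> K * norm z * norm a" for y
          using D2_lipschitz[OF t, of \<mu> z "y + a" y] by simp
      qed (intro borel_measurable_diff measurable_derivatives[OF t]; simp)
      \<comment> \<open>The derivative of \<open>D1\<close> at a point \<open>z\<close> is the
        integral of \<open>D2\<close> at \<open>(z, y + a)\<close> minus \<open>D2\<close> at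
        \<open>(z, y)\<close>; the difference between \<open>z = x + a\<close> and
        \<open>z = x\<close> produces \<open>rect\<close>.\<close>
      have eq: "?f' \<theta> x = (\<integral>y. D2 t (?N \<theta>) (x + a) (y + a) - D2 t (?N \<theta>) (x + a) y \<partial>meas \<nu>)
          - (\<integral>y. D2 t (?N \<theta>) x (y + a) - D2 t (?N \<theta>) x y \<partial>meas \<nu>)"
        unfolding rect_def by (rule Bochner_Integration.integral_diff[OF D2_int D2_int])
      show ?thesis unfolding eq
        by (rule DERIV_diff[OF mix_translation_has_derivative[OF regular_D1[OF t] \<theta>] mix_translation_has_derivative[OF regular_D1[OF t] \<theta>]])
    qed
  qed (use f'_meas in simp)
  obtain \<theta> where \<theta>: "\<theta> \<in> {0..1}" "U t (?N 1) = U t (?N 0) + (\<integral>x. ?f 0 x \<partial>meas \<nu>) + (\<integral>x. ?f' \<theta> x \<partial>meas \<nu>) / 2"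
    using taylor2_unit[OF d1 d2] by blast
  have hi: "integrable (meas \<nu>) (\<lambda>x. a \<bullet> (jac (grad (D1 t \<nu>)) x *v a))"
    by (rule integrable_meas_bounded[where C="K * (norm a * norm a)"])
      (use hess_form_le[OF t] measurable_form_pair[OF t] in auto)
  have gi: "integrable (meas \<nu>) (\<lambda>x. grad (D1 t \<nu>) x \<bullet> a)"
  proof (rule integrable_meas_bounded[where C="K * norm a"])
    show "norm (grad (D1 t \<nu>) x \<bullet> a) \<le> K * norm a" for x
      using order_trans[OF Cauchy_Schwarz_ineq2 mult_right_mono[OF grad_le[OF t]]] by simp
  qed (rule measurable_form_pair[OF t])
  have mi: "integrable (meas \<nu>) (\<lambda>y. a \<bullet> (mixed_grad (D2 t \<nu>) x y *v a))" for x
    by (rule integrable_meas_bounded[where C="K * (norm a * norm a)"])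
      (use mixed_form_le[OF t] measurable_form_pair[OF t] in auto)
  have mii: "integrable (meas \<nu>) (\<lambda>x. \<integral>y. a \<bullet> (mixed_grad (D2 t \<nu>) x y *v a) \<partial>meas \<nu>)"
  proof (rule integrable_meas_bounded[where C="K * (norm a * norm a)"])
    show "(\<lambda>x. \<integral>y. a \<bullet> (mixed_grad (D2 t \<nu>) x y *v a) \<partial>meas \<nu>) \<in> borel_measurable borel"
      by (rule measurable_form_pair[OF t])
    show "norm (\<integral>y. a \<bullet> (mixed_grad (D2 t \<nu>) x y *v a) \<partial>meas \<nu>) \<le> K * (norm a * norm a)" for x
      by (rule integral_meas_bounded) (use mixed_form_le[OF t] measurable_form_pair[OF t] in auto)
  qed
  have f'i: "integrable (meas \<nu>) (?f' \<theta>)"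
    using f'_meas f'_bd by (intro integrable_meas_bounded[where C="K * (norm a * norm a)"]) auto
  have 1: "(\<integral>x. taylor_rem t \<nu> a x \<partial>meas \<nu>) = (\<integral>x. ?f 0 x \<partial>meas \<nu>) - (\<integral>x. grad (D1 t \<nu>) x \<bullet> a \<partial>meas \<nu>)
      - (\<integral>x. a \<bullet> (jac (grad (D1 t \<nu>)) x *v a) \<partial>meas \<nu>) / 2"
    unfolding taylor_rem_def using f_int[of 0] gi hi by simp
  have 2: "(\<integral>x. (\<integral>y. rect_rem t (?N \<theta>) \<nu> a x y \<partial>meas \<nu>) \<partial>meas \<nu>) = (\<integral>x. ?f' \<theta> x \<partial>meas \<nu>)
     - (\<integral>x. (\<integral>y. a \<bullet> (mixed_grad (D2 t \<nu>) x y *v a) \<partial>meas \<nu>) \<partial>meas \<nu>)"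
    unfolding rect_rem_def using rect_int mi mii f'i by simp
  have "remainder t \<nu> a = (\<integral>x. taylor_rem t \<nu> a x \<partial>meas \<nu>)
     + (\<integral>x. (\<integral>y. rect_rem t (?N \<theta>) \<nu> a x y \<partial>meas \<nu>) \<partial>meas \<nu>) / 2"
    unfolding 1 2 remainder_def using \<theta>(2) by (simp add: field_simps)
  with \<theta>(1) show ?thesis by blast
qed

lemma remainder_le:
  assumes t: "t \<in> {0..T}"
  shows "\<bar>remainder t \<nu> a\<bar> \<le> 2 * K * (norm a)\<^sup>2"
proof -
  obtain \<theta> where \<theta>: "remainder t \<nu> a = (\<integral>x. taylor_rem t \<nu> a x \<partial>meas \<nu>)
     + (\<integral>x. (\<integral>y. rect_rem t (mix \<theta> \<nu> (push (\<lambda>x. x + a) \<nu>)) \<nu> a x y \<partial>meas \<nu>) \<partial>meas \<nu>) / 2"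
    using remainder_eq[OF t] by blast
  have 1: "norm (\<integral>x. taylor_rem t \<nu> a x \<partial>meas \<nu>) \<le> K * (norm a)\<^sup>2"
    by (rule integral_meas_bounded) (use measurable_rem_pair[OF t] taylor_rem_le[OF t] in auto)
  have 2: "norm (\<integral>x. (\<integral>y. rect_rem t \<mu> \<nu> a x y \<partial>meas \<nu>) \<partial>meas \<nu>) \<le> 2 * K * (norm a)\<^sup>2" for \<mu>
  proof (rule integral_meas_bounded)
    show "(\<lambda>x. \<integral>y. rect_rem t \<mu> \<nu> a x y \<partial>meas \<nu>) \<in> borel_measurable borel"
      by (rule measurable_rem_pair[OF t])
    show "norm (\<integral>y. rect_rem t \<mu> \<nu> a x y \<partial>meas \<nu>) \<le> 2 * K * (norm a)\<^sup>2" for x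
      by (rule integral_meas_bounded) (use measurable_rem_pair[OF t] rect_rem_le[OF t] in auto)
  qed
  show ?thesis unfolding \<theta> using 1 2[of "mix \<theta> \<nu> (push (\<lambda>x. x + a) \<nu>)"] unfolding real_norm_def by linarith
qed

text \<open>The quotient is bounded by the norm of the matrix; indices with \<open>a n = 0\<close>
  are harmless because division by zero yields zero.\<close>

lemma inner_matrix_quotient_tendsto_0:
  fixes A :: "nat \<Rightarrow> real^'d^'d"
  assumes "A \<longlonglongrightarrow> 0"
  shows "(\<lambda>n. (a n \<bullet> (A n *v a n)) / (norm (a n))\<^sup>2) \<longlonglongrightarrow> 0"
proof (rule Lim_null_comparison[OF always_eventually[OF allI]])
  show "norm ((a n \<bullet> (A n *v a n)) / (norm (a n))\<^sup>2) \<le> norm (A n)" for n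
    using inner_matrix_le[of "a n" "A n" "a n"] by (cases "a n = 0") (auto simp: divide_le_eq power2_eq_square)
  show "(\<lambda>n. norm (A n)) \<longlonglongrightarrow> 0" using assms by (rule tendsto_norm_zero)
qed

lemma tendsto_scaled_zero:
  fixes a :: "nat \<Rightarrow> 'e::real_normed_vector"
  assumes "a \<longlonglongrightarrow> 0" "\<And>n. s n \<in> {0..1::real}"
  shows "(\<lambda>n. s n *\<^sub>R a n) \<longlonglongrightarrow> 0"
proof (rule Lim_null_comparison[OF always_eventually[OF allI]])
  show "norm (s n *\<^sub>R a n) \<le> norm (a n)" for n
    using assms(2)[of n] by (simp add: mult_left_le_one_le)
qed (use assms in \<open>simp add: tendsto_norm_zero\<close>)

lemma taylor_rem_tendsto:
  assumes "t \<longlonglongrightarrow> s" "\<And>n. t n \<in> {0..T}" "s \<in> {0..T}" "\<nu> \<longlonglongrightarrow> \<nu>0" "a \<longlonglongrightarrow> 0" "x \<longlonglongrightarrow> x0"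
  shows "(\<lambda>n. taylor_rem (t n) (\<nu> n) (a n) (x n) / (norm (a n))\<^sup>2) \<longlonglongrightarrow> 0"
proof -
  have "\<forall>n. \<exists>r. r \<in> {0..1} \<and> taylor_rem (t n) (\<nu> n) (a n) (x n) =
     a n \<bullet> ((jac (grad (D1 (t n) (\<nu> n))) (x n + r *\<^sub>R a n) - jac (grad (D1 (t n) (\<nu> n))) (x n)) *v a n) / 2"
    using taylor_rem_eq[OF assms(2)] by blast
  from choice[OF this] obtain r where r: "\<And>n. r n \<in> {0..1}" "\<And>n. taylor_rem (t n) (\<nu> n) (a n) (x n) =
     a n \<bullet> ((jac (grad (D1 (t n) (\<nu> n))) (x n + r n *\<^sub>R a n) - jac (grad (D1 (t n) (\<nu> n))) (x n)) *v a n) / 2"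
    by blast
  have x: "(\<lambda>n. x n + r n *\<^sub>R a n) \<longlonglongrightarrow> x0"
    using tendsto_add[OF assms(6) tendsto_scaled_zero[OF assms(5) r(1)]] by simp
  have "(\<lambda>n. jac (grad (D1 (t n) (\<nu> n))) (x n + r n *\<^sub>R a n) - jac (grad (D1 (t n) (\<nu> n))) (x n)) \<longlonglongrightarrow> 0"
    using tendsto_diff[OF hess_tendsto[OF assms(1-4) x] hess_tendsto[OF assms(1-4,6)]] by simp
  from tendsto_divide[OF inner_matrix_quotient_tendsto_0[OF this, of a] tendsto_const[of 2]] show ?thesis
    by (simp add: r(2) mult.commute)
qed

lemma rect_rem_tendsto:
  assumes "t \<longlonglongrightarrow> s" "\<And>n. t n \<in> {0..T}" "s \<in> {0..T}" "\<nu> \<longlonglongrightarrow> \<nu>0" "\<nu>' \<longlonglongrightarrow> \<nu>0" "a \<longlonglongrightarrow> 0" "x \<longlonglongrightarrow> x0" "y \<longlonglongrightarrow> y0"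
  shows "(\<lambda>n. rect_rem (t n) (\<nu>' n) (\<nu> n) (a n) (x n) (y n) / (norm (a n))\<^sup>2) \<longlonglongrightarrow> 0"
proof -
  \<comment> \<open>The two mean value parameters are packed into a pair, so that a single
    application of \<open>choice\<close> selects both.\<close>
  have "\<forall>n. \<exists>p. fst p \<in> {0..1} \<and> snd p \<in> {0..1} \<and> rect_rem (t n) (\<nu>' n) (\<nu> n) (a n) (x n) (y n) =
     a n \<bullet> ((mixed_grad (D2 (t n) (\<nu>' n)) (x n + fst p *\<^sub>R a n) (y n + snd p *\<^sub>R a n) - mixed_grad (D2 (t n) (\<nu> n)) (x n) (y n)) *v a n)"
  proof
    fix n
    obtain r q where "r \<in> {0..1}" "q \<in> {0..1}" "rect_rem (t n) (\<nu>' n) (\<nu> n) (a n) (x n) (y n) =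
     a n \<bullet> ((mixed_grad (D2 (t n) (\<nu>' n)) (x n + r *\<^sub>R a n) (y n + q *\<^sub>R a n) - mixed_grad (D2 (t n) (\<nu> n)) (x n) (y n)) *v a n)"
      using rect_rem_eq[OF assms(2)] by blast
    then show "\<exists>p. fst p \<in> {0..1} \<and> snd p \<in> {0..1} \<and> rect_rem (t n) (\<nu>' n) (\<nu> n) (a n) (x n) (y n) =
     a n \<bullet> ((mixed_grad (D2 (t n) (\<nu>' n)) (x n + fst p *\<^sub>R a n) (y n + snd p *\<^sub>R a n) - mixed_grad (D2 (t n) (\<nu> n)) (x n) (y n)) *v a n)"
      by (intro exI[of _ "(r, q)"]) simp
  qed
  from choice[OF this] obtain p where r: "\<And>n. fst (p n) \<in> {0..1}" "\<And>n. snd (p n) \<in> {0..1}" "\<And>n. rect_rem (t n) (\<nu>' n) (\<nu> n) (a n) (x n) (y n) =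
     a n \<bullet> ((mixed_grad (D2 (t n) (\<nu>' n)) (x n + fst (p n) *\<^sub>R a n) (y n + snd (p n) *\<^sub>R a n) - mixed_grad (D2 (t n) (\<nu> n)) (x n) (y n)) *v a n)"
    by blast
  define r q where "r n = fst (p n)" and "q n = snd (p n)" for n
  note r = r[folded r_def q_def]
  have x: "(\<lambda>n. x n + r n *\<^sub>R a n) \<longlonglongrightarrow> x0" and y: "(\<lambda>n. y n + q n *\<^sub>R a n) \<longlonglongrightarrow> y0"
    using tendsto_add[OF assms(7) tendsto_scaled_zero[OF assms(6) r(1)]]
      tendsto_add[OF assms(8) tendsto_scaled_zero[OF assms(6) r(2)]] by simp_all
  have "(\<lambda>n. mixed_grad (D2 (t n) (\<nu>' n)) (x n + r n *\<^sub>R a n) (y n + q n *\<^sub>R a n) - mixed_grad (D2 (t n) (\<nu> n)) (x n) (y n)) \<longlonglongrightarrow> 0"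
    using tendsto_diff[OF mixed_tendsto[OF assms(1-3,5) x y] mixed_tendsto[OF assms(1-4,7,8)]] by simp
  from inner_matrix_quotient_tendsto_0[OF this, of a] show ?thesis
    by (simp add: r(3))
qed

lemma push_translate_tendsto:
  fixes a :: "nat \<Rightarrow> real^'d"
  assumes "\<nu> \<longlonglongrightarrow> \<nu>0" "a \<longlonglongrightarrow> 0"
  shows "(\<lambda>n. push (\<lambda>x. x + a n) (\<nu> n)) \<longlonglongrightarrow> \<nu>0"
proof -
  have "(\<lambda>n. push (\<lambda>x. x + a n) (\<nu> n)) \<longlonglongrightarrow> push (\<lambda>x. x + 0) \<nu>0"
    using assms by (intro tendsto_push tendsto_add continuous_intros) auto
  moreover have "push (\<lambda>x. x + 0) \<nu>0 = \<nu>0"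
    by (rule prob_measure_eqI) (simp add: emeasure_distr)
  ultimately show ?thesis by simp
qed

text \<open>The weights \<open>\<theta> n\<close> of the intermediate laws are unknown, but both
  ends of the segments tend to \<open>\<nu>0\<close>, so \<open>tendsto_mix_same\<close> applies.
  The rescaled pointwise errors are bounded and converge continuously to zero, hence so do their
  integrals against the varying laws.\<close>

lemma remainder_tendsto:
  assumes t: "t \<longlonglongrightarrow> s" "\<And>n. t n \<in> {0..T}" "s \<in> {0..T}" and \<nu>: "\<nu> \<longlonglongrightarrow> \<nu>0" and a: "a \<longlonglongrightarrow> 0"
  shows "(\<lambda>n. remainder (t n) (\<nu> n) (a n) / (norm (a n))\<^sup>2) \<longlonglongrightarrow> 0"
proof -
  have "\<forall>n. \<exists>\<theta>. \<theta> \<in> {0..1} \<and> remainder (t n) (\<nu> n) (a n) = (\<integral>x. taylor_rem (t n) (\<nu> n) (a n) x \<partial>meas (\<nu> n))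
     + (\<integral>x. (\<integral>y. rect_rem (t n) (mix \<theta> (\<nu> n) (push (\<lambda>x. x + a n) (\<nu> n))) (\<nu> n) (a n) x y \<partial>meas (\<nu> n)) \<partial>meas (\<nu> n)) / 2"
    using remainder_eq[OF t(2)] by blast
  from choice[OF this] obtain \<theta> where \<theta>: "\<And>n. \<theta> n \<in> {0..1}" "\<And>n. remainder (t n) (\<nu> n) (a n) = (\<integral>x. taylor_rem (t n) (\<nu> n) (a n) x \<partial>meas (\<nu> n))
     + (\<integral>x. (\<integral>y. rect_rem (t n) (mix (\<theta> n) (\<nu> n) (push (\<lambda>x. x + a n) (\<nu> n))) (\<nu> n) (a n) x y \<partial>meas (\<nu> n)) \<partial>meas (\<nu> n)) / 2"
    by blast
  define \<nu>' where "\<nu>' n = mix (\<theta> n) (\<nu> n) (push (\<lambda>x. x + a n) (\<nu> n))" for n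
  have \<nu>': "\<nu>' \<longlonglongrightarrow> \<nu>0"
    unfolding \<nu>'_def by (rule tendsto_mix_same[OF \<nu> push_translate_tendsto[OF \<nu> a] \<theta>(1)])
  have q1: "\<bar>taylor_rem (t n) (\<nu> n) (a n) x / (norm (a n))\<^sup>2\<bar> \<le> K" for n x
    using taylor_rem_le[OF t(2), of n "\<nu> n" "a n" x] K_nonneg by (cases "a n = 0") (auto simp: divide_le_eq)
  have q2: "\<bar>rect_rem (t n) (\<nu>' n) (\<nu> n) (a n) x y / (norm (a n))\<^sup>2\<bar> \<le> 2 * K" for n x y
    using rect_rem_le[OF t(2), of n "\<nu>' n" "\<nu> n" "a n" x y] K_nonneg by (cases "a n = 0") (auto simp: divide_le_eq)
  have 1: "(\<lambda>n. \<integral>x. taylor_rem (t n) (\<nu> n) (a n) x / (norm (a n))\<^sup>2 \<partial>meas (\<nu> n)) \<longlonglongrightarrow> (\<integral>x. 0 \<partial>meas \<nu>0)"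
  proof (rule tendsto_integral_continuous_convergence[OF \<nu> _ continuous_on_const _ q1])
    show "(\<lambda>n. taylor_rem (t n) (\<nu> n) (a n) (X n) / (norm (a n))\<^sup>2) \<longlonglongrightarrow> 0" if "X \<longlonglongrightarrow> x" for X x
      by (rule taylor_rem_tendsto[OF t \<nu> a that])
  qed (intro borel_measurable_divide measurable_rem_pair[OF t(2)] borel_measurable_const)
  have 2: "(\<lambda>n. \<integral>x. (\<integral>y. rect_rem (t n) (\<nu>' n) (\<nu> n) (a n) x y / (norm (a n))\<^sup>2 \<partial>meas (\<nu> n)) \<partial>meas (\<nu> n)) \<longlonglongrightarrow> (\<integral>x. 0 \<partial>meas \<nu>0)"
  proof (rule tendsto_integral_continuous_convergence[OF \<nu> _ continuous_on_const])
    show "(\<lambda>n. \<integral>y. rect_rem (t n) (\<nu>' n) (\<nu> n) (a n) (X n) y / (norm (a n))\<^sup>2 \<partial>meas (\<nu> n)) \<longlonglongrightarrow> 0" if X: "X \<longlonglongrightarrow> x" for X x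
    proof -
      have "(\<lambda>n. \<integral>y. rect_rem (t n) (\<nu>' n) (\<nu> n) (a n) (X n) y / (norm (a n))\<^sup>2 \<partial>meas (\<nu> n)) \<longlonglongrightarrow> (\<integral>y. 0 \<partial>meas \<nu>0)"
      proof (rule tendsto_integral_continuous_convergence[OF \<nu> _ continuous_on_const _ q2])
        show "(\<lambda>n. rect_rem (t n) (\<nu>' n) (\<nu> n) (a n) (X n) (Y n) / (norm (a n))\<^sup>2) \<longlonglongrightarrow> 0" if "Y \<longlonglongrightarrow> y" for Y y
          by (rule rect_rem_tendsto[OF t \<nu> \<nu>' a X that])
      qed (intro borel_measurable_divide measurable_rem_pair[OF t(2)] borel_measurable_const)
      then show ?thesis by simp
    qed
    show "(\<lambda>x. \<integral>y. rect_rem (t n) (\<nu>' n) (\<nu> n) (a n) x y / (norm (a n))\<^sup>2 \<partial>meas (\<nu> n)) \<in> borel_measurable borel" for n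
      using measurable_rem_pair(5)[OF t(2)] by simp
    show "\<bar>\<integral>y. rect_rem (t n) (\<nu>' n) (\<nu> n) (a n) x y / (norm (a n))\<^sup>2 \<partial>meas (\<nu> n)\<bar> \<le> 2 * K" for n x
      using integral_meas_bounded[of "\<lambda>y. rect_rem (t n) (\<nu>' n) (\<nu> n) (a n) x y / (norm (a n))\<^sup>2" "2 * K" "\<nu> n"] q2
        measurable_rem_pair(3)[OF t(2)] by simp
  qed
  have "(\<lambda>n. (\<integral>x. taylor_rem (t n) (\<nu> n) (a n) x / (norm (a n))\<^sup>2 \<partial>meas (\<nu> n)) +
     (\<integral>x. (\<integral>y. rect_rem (t n) (\<nu>' n) (\<nu> n) (a n) x y / (norm (a n))\<^sup>2 \<partial>meas (\<nu> n)) \<partial>meas (\<nu> n)) / 2) \<longlonglongrightarrow> 0"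
    using tendsto_add[OF 1 tendsto_divide[OF 2 tendsto_const[of 2]]] by simp
  then show ?thesis by (simp add: \<theta>(2) \<nu>'_def add_divide_distrib mult.commute)
qed

definition hess_form :: "real \<Rightarrow> (real^'d) prob_measure \<Rightarrow> real^'d \<Rightarrow> real^'d \<Rightarrow> real" where
  "hess_form t \<nu> a b = (\<integral>x. a \<bullet> (jac (grad (D1 t \<nu>)) x *v b) \<partial>meas \<nu>)"

definition mixed_form :: "real \<Rightarrow> (real^'d) prob_measure \<Rightarrow> real^'d \<Rightarrow> real^'d \<Rightarrow> real" where
  "mixed_form t \<nu> a b = (\<integral>x. (\<integral>y. a \<bullet> (mixed_grad (D2 t \<nu>) x y *v b) \<partial>meas \<nu>) \<partial>meas \<nu>)"

lemma inner_matrix_tendsto: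
  fixes A :: "nat \<Rightarrow> real^'n^'m"
  shows "A \<longlonglongrightarrow> A0 \<Longrightarrow> (\<lambda>n. a \<bullet> (A n *v b)) \<longlonglongrightarrow> a \<bullet> (A0 *v b)"
  by (rule bounded_linear.tendsto[OF bounded_linear_inner_matrix])

lemma hess_form_tendsto:
  assumes t: "t \<longlonglongrightarrow> s" "\<And>n. t n \<in> {0..T}" "s \<in> {0..T}" and \<nu>: "\<nu> \<longlonglongrightarrow> \<nu>0"
  shows "(\<lambda>n. hess_form (t n) (\<nu> n) a b) \<longlonglongrightarrow> hess_form s \<nu>0 a b"
  unfolding hess_form_def
proof (rule tendsto_integral_continuous_convergence[OF \<nu> _ _ measurable_form_pair(2)[OF t(2)] hess_form_le[OF t(2)]])
  show "continuous_on UNIV (\<lambda>x. a \<bullet> (jac (grad (D1 s \<nu>0)) x *v b))"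
    by (intro continuous_on_UNIV_sequentiallyI inner_matrix_tendsto hess_tendsto tendsto_const t(3))
  show "(\<lambda>n. a \<bullet> (jac (grad (D1 (t n) (\<nu> n))) (X n) *v b)) \<longlonglongrightarrow> a \<bullet> (jac (grad (D1 s \<nu>0)) x *v b)"
    if "X \<longlonglongrightarrow> x" for X x
    by (intro inner_matrix_tendsto hess_tendsto[OF t \<nu> that])
qed

lemma mixed_inner_le:
  assumes t: "t \<in> {0..T}"
  shows "\<bar>\<integral>y. a \<bullet> (mixed_grad (D2 t \<nu>) x y *v b) \<partial>meas \<nu>\<bar> \<le> K * (norm a * norm b)"
  unfolding real_norm_def[symmetric]
  by (rule integral_meas_bounded) (use mixed_form_le[OF t] measurable_form_pair[OF t] in auto)

lemma mixed_form_tendsto: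
  assumes t: "t \<longlonglongrightarrow> s" "\<And>n. t n \<in> {0..T}" "s \<in> {0..T}" and \<nu>: "\<nu> \<longlonglongrightarrow> \<nu>0"
  shows "(\<lambda>n. mixed_form (t n) (\<nu> n) a b) \<longlonglongrightarrow> mixed_form s \<nu>0 a b"
  unfolding mixed_form_def
proof (rule tendsto_integral_continuous_convergence[OF \<nu> _ _ measurable_form_pair(4)[OF t(2)] mixed_inner_le[OF t(2)]])
  have inner: "(\<lambda>n. \<integral>y. a \<bullet> (mixed_grad (D2 (t n) (\<nu> n)) (X n) y *v b) \<partial>meas (\<nu> n)) \<longlonglongrightarrow> (\<integral>y. a \<bullet> (mixed_grad (D2 s \<nu>0) x y *v b) \<partial>meas \<nu>0)"
    if t: "t \<longlonglongrightarrow> s" "\<And>n. t n \<in> {0..T}" "s \<in> {0..T}" and \<nu>: "\<nu> \<longlonglongrightarrow> \<nu>0" and X: "X \<longlonglongrightarrow> x" for t s \<nu> \<nu>0 X x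
  proof (rule tendsto_integral_continuous_convergence[OF \<nu> _ _ measurable_form_pair(3)[OF t(2)] mixed_form_le[OF t(2)]])
    show "continuous_on UNIV (\<lambda>y. a \<bullet> (mixed_grad (D2 s \<nu>0) x y *v b))"
      by (intro continuous_on_UNIV_sequentiallyI inner_matrix_tendsto mixed_tendsto tendsto_const t(3))
    show "(\<lambda>n. a \<bullet> (mixed_grad (D2 (t n) (\<nu> n)) (X n) (Y n) *v b)) \<longlonglongrightarrow> a \<bullet> (mixed_grad (D2 s \<nu>0) x y *v b)"
      if "Y \<longlonglongrightarrow> y" for Y y
      by (intro inner_matrix_tendsto mixed_tendsto[OF t \<nu> X that])
  qed
  show "continuous_on UNIV (\<lambda>x. \<integral>y. a \<bullet> (mixed_grad (D2 s \<nu>0) x y *v b) \<partial>meas \<nu>0)"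
    by (intro continuous_on_UNIV_sequentiallyI inner tendsto_const t(3))
  show "(\<lambda>n. \<integral>y. a \<bullet> (mixed_grad (D2 (t n) (\<nu> n)) (X n) y *v b) \<partial>meas (\<nu> n)) \<longlonglongrightarrow> (\<integral>y. a \<bullet> (mixed_grad (D2 s \<nu>0) x y *v b) \<partial>meas \<nu>0)"
    if "X \<longlonglongrightarrow> x" for X x by (rule inner[OF t \<nu> that])
qed

lemma hess_form_bound: "t \<in> {0..T} \<Longrightarrow> \<bar>hess_form t \<nu> a b\<bar> \<le> K * (norm a * norm b)"
  unfolding hess_form_def real_norm_def[symmetric]
  by (rule integral_meas_bounded) (use measurable_form_pair hess_form_le in auto)

lemma mixed_form_bound: "t \<in> {0..T} \<Longrightarrow> \<bar>mixed_form t \<nu> a b\<bar> \<le> K * (norm a * norm b)"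
  unfolding mixed_form_def real_norm_def[symmetric]
  by (rule integral_meas_bounded) (use measurable_form_pair mixed_inner_le in auto)

end

section \<open>Conditional laws and independence\<close>

text \<open>Rectangles are an intersection-stable generator. The identity extends from them to
  product measurable sets, then to nonnegative functions by monotone approximation, and to bounded
  ones by adding a constant.\<close>

lemma disintegratesI:
  fixes Z :: "'w \<Rightarrow> 'z::second_countable_topology"
  assumes M: "prob_space M" and \<kappa> [measurable]: "\<kappa> \<in> borel_measurable M"
    and Z [measurable]: "Z \<in> borel_measurable M" and X [measurable]: "X \<in> borel_measurable M"
    and rect: "\<And>A B. A \<in> sets borel \<Longrightarrow> B \<in> sets borel \<Longrightarrow>
      (\<integral>w. indicator A (Z w) * indicator B (X w) \<partial>M) = (\<integral>w. indicator A (Z w) * measure (meas (\<kappa> w)) B \<partial>M)"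
  shows "disintegrates M Z \<kappa> X"
proof -
  interpret prob_space M by (rule M)
  have [measurable]: "(\<lambda>w. meas (\<kappa> w)) \<in> measurable M (subprob_algebra borel)" by measurable
  have nn_meas [measurable]: "(\<lambda>w. \<integral>\<^sup>+y. f (Z w, y) \<partial>meas (\<kappa> w)) \<in> borel_measurable M"
    if [measurable]: "f \<in> borel_measurable (borel \<Otimes>\<^sub>M borel)" for f :: "'z \<times> (real^'a) \<Rightarrow> ennreal"
    by (rule nn_integral_measurable_subprob_algebra2[where N=borel]) measurable
  have sec: "(\<lambda>y. f (z, y)) \<in> borel_measurable borel"
    if "f \<in> borel_measurable (borel \<Otimes>\<^sub>M borel)" for f :: "'z \<times> (real^'a) \<Rightarrow> 'c::topological_space" and z
    using measurable_compose[OF measurable_Pair1' that, of z] by simp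
  have base: "(\<integral>\<^sup>+w. indicator Q (Z w, X w) \<partial>M) = (\<integral>\<^sup>+w. (\<integral>\<^sup>+y. indicator Q (Z w, y) \<partial>meas (\<kappa> w)) \<partial>M)"
    if "Q \<in> sets (borel \<Otimes>\<^sub>M borel)" for Q :: "('z \<times> (real^'a)) set"
    using that unfolding sets_pair_measure
  proof (induction rule: sigma_sets_induct_disjoint[OF Int_stable_pair_measure_generator pair_measure_closed, consumes 1])
    case (1 Q)
    then obtain A B where Q: "Q = A \<times> B" and [measurable]: "A \<in> sets borel" "B \<in> sets borel" by auto
    have [measurable]: "(\<lambda>w. measure (meas (\<kappa> w)) B) \<in> borel_measurable M"
      by (rule measure_measurable_subprob_algebra2[where N=borel]) measurable
    have le1: "measure (meas m) B \<le> 1" for m :: "(real^'a) prob_measure"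
      by (intro prob_space.prob_le_1 prob_space_meas)
    have "(\<integral>\<^sup>+w. indicator Q (Z w, X w) \<partial>M) = (\<integral>\<^sup>+w. ennreal (indicator A (Z w) * indicator B (X w)) \<partial>M)"
      by (intro nn_integral_cong) (auto simp: Q indicator_def)
    also have "\<dots> = ennreal (\<integral>w. indicator A (Z w) * indicator B (X w) \<partial>M)"
      by (intro nn_integral_eq_integral integrable_const_bound[where B=1]) (auto simp: indicator_def)
    also have "\<dots> = ennreal (\<integral>w. indicator A (Z w) * measure (meas (\<kappa> w)) B \<partial>M)"
      by (subst rect) auto
    also have "\<dots> = (\<integral>\<^sup>+w. ennreal (indicator A (Z w) * measure (meas (\<kappa> w)) B) \<partial>M)"
      using le1 by (intro nn_integral_eq_integral[symmetric] integrable_const_bound[where B=1]) (auto simp: indicator_def)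
    also have "\<dots> = (\<integral>\<^sup>+w. (\<integral>\<^sup>+y. indicator Q (Z w, y) \<partial>meas (\<kappa> w)) \<partial>M)"
    proof (intro nn_integral_cong)
      fix w
      have "(\<integral>\<^sup>+y. indicator Q (Z w, y) \<partial>meas (\<kappa> w)) = (\<integral>\<^sup>+y. indicator A (Z w) * indicator B y \<partial>meas (\<kappa> w))"
        by (intro nn_integral_cong) (auto simp: Q indicator_def)
      also have "\<dots> = indicator A (Z w) * emeasure (meas (\<kappa> w)) B"
        by (simp add: nn_integral_cmult)
      also have "\<dots> = ennreal (indicator A (Z w) * measure (meas (\<kappa> w)) B)"
        by (simp add: finite_measure.emeasure_eq_measure indicator_def)
      finally show "ennreal (indicator A (Z w) * measure (meas (\<kappa> w)) B) = (\<integral>\<^sup>+y. indicator Q (Z w, y) \<partial>meas (\<kappa> w))" by simp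
    qed
    finally show ?case .
  next
    case 2
    then show ?case by simp
  next
    case (3 Q)
    then have [measurable]: "Q \<in> sets (borel \<Otimes>\<^sub>M borel)" by (simp add: sets_pair_measure)
    have c: "indicator (space borel \<times> space borel - Q) z = (1 - indicator Q z :: ennreal)" for z
      by (auto simp: indicator_def)
    have i1: "(\<integral>\<^sup>+y. indicator Q (Z w, y) \<partial>meas (\<kappa> w)) \<le> 1" for w
    proof -
      have "(\<integral>\<^sup>+y. indicator Q (Z w, y) \<partial>meas (\<kappa> w)) \<le> (\<integral>\<^sup>+y. 1 \<partial>meas (\<kappa> w))"
        by (intro nn_integral_mono) (auto simp: indicator_def)
      then show ?thesis by simp
    qed
    have "(\<integral>\<^sup>+w. 1 - indicator Q (Z w, X w) \<partial>M) = 1 - (\<integral>\<^sup>+w. indicator Q (Z w, X w) \<partial>M)"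
    proof (subst nn_integral_diff)
      have "(\<integral>\<^sup>+w. indicator Q (Z w, X w) \<partial>M) \<le> (\<integral>\<^sup>+w. 1 \<partial>M)"
        by (intro nn_integral_mono) (auto simp: indicator_def)
      then show "(\<integral>\<^sup>+w. indicator Q (Z w, X w) \<partial>M) \<noteq> \<infinity>" by (auto simp: emeasure_space_1 top_unique)
    qed (auto simp: emeasure_space_1 indicator_def)
    moreover have "(\<integral>\<^sup>+w. (\<integral>\<^sup>+y. 1 - indicator Q (Z w, y) \<partial>meas (\<kappa> w)) \<partial>M)
       = 1 - (\<integral>\<^sup>+w. (\<integral>\<^sup>+y. indicator Q (Z w, y) \<partial>meas (\<kappa> w)) \<partial>M)"
    proof -
      have "(\<integral>\<^sup>+y. 1 - indicator Q (Z w, y) \<partial>meas (\<kappa> w)) = 1 - (\<integral>\<^sup>+y. indicator Q (Z w, y) \<partial>meas (\<kappa> w))" for w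
      proof (subst nn_integral_diff)
        show "(\<integral>\<^sup>+y. indicator Q (Z w, y) \<partial>meas (\<kappa> w)) \<noteq> \<infinity>" using i1[of w] by (auto simp: top_unique)
        show "(\<lambda>y. indicator Q (Z w, y) :: ennreal) \<in> borel_measurable (meas (\<kappa> w))"
          unfolding borel_measurable_meas_iff by (rule sec) measurable
      qed (auto simp: indicator_def)
      moreover have "(\<integral>\<^sup>+w. 1 - (\<integral>\<^sup>+y. indicator Q (Z w, y) \<partial>meas (\<kappa> w)) \<partial>M)
          = 1 - (\<integral>\<^sup>+w. (\<integral>\<^sup>+y. indicator Q (Z w, y) \<partial>meas (\<kappa> w)) \<partial>M)"
      proof (subst nn_integral_diff)
        have "(\<integral>\<^sup>+w. (\<integral>\<^sup>+y. indicator Q (Z w, y) \<partial>meas (\<kappa> w)) \<partial>M) \<le> (\<integral>\<^sup>+w. 1 \<partial>M)"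
          by (intro nn_integral_mono i1)
        then show "(\<integral>\<^sup>+w. (\<integral>\<^sup>+y. indicator Q (Z w, y) \<partial>meas (\<kappa> w)) \<partial>M) \<noteq> \<infinity>" by (auto simp: emeasure_space_1 top_unique)
      qed (use i1 in \<open>auto simp: emeasure_space_1\<close>)
      ultimately show ?thesis by simp
    qed
    ultimately show ?case unfolding c using 3(2) by simp
  next
    case (4 Q)
    then have Q [measurable]: "Q i \<in> sets (borel \<Otimes>\<^sub>M borel)" for i by (auto simp: sets_pair_measure)
    have s: "indicator (\<Union>i. Q i) z = (\<Sum>i. indicator (Q i) z :: ennreal)" for z
      using suminf_indicator[OF 4(1), of z] by simp
    have m: "(\<lambda>y. indicator (Q i) (z, y) :: ennreal) \<in> borel_measurable (meas k)" for i z k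
      unfolding borel_measurable_meas_iff by (rule sec) measurable
    have n: "(\<lambda>w. \<integral>\<^sup>+y. indicator (Q i) (Z w, y) \<partial>meas (\<kappa> w)) \<in> borel_measurable M" for i
      by (rule nn_meas) measurable
    show ?case unfolding s using 4(3) by (simp add: nn_integral_suminf m n)
  qed
  have nn: "(\<integral>\<^sup>+w. f (Z w, X w) \<partial>M) = (\<integral>\<^sup>+w. (\<integral>\<^sup>+y. f (Z w, y) \<partial>meas (\<kappa> w)) \<partial>M)"
    if "f \<in> borel_measurable (borel \<Otimes>\<^sub>M borel)" for f :: "'z \<times> (real^'a) \<Rightarrow> ennreal"
    using that
  proof (induction rule: borel_measurable_induct)
    case (cong f g)
    then have "f = g" by (auto simp: space_pair_measure)
    then show ?case using cong by simp
  next
    case (set A)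
    then show ?case by (rule base)
  next
    case (mult u c)
    note [measurable] = mult(2)
    have "(\<integral>\<^sup>+y. c * u (Z w, y) \<partial>meas (\<kappa> w)) = c * (\<integral>\<^sup>+y. u (Z w, y) \<partial>meas (\<kappa> w))" for w
      by (intro nn_integral_cmult) (simp add: sec[OF mult(2)])
    then show ?case using mult by (simp add: nn_integral_cmult)
  next
    case (add u v)
    note [measurable] = add.hyps(1,3)
    have "(\<integral>\<^sup>+y. v (Z w, y) + u (Z w, y) \<partial>meas (\<kappa> w)) = (\<integral>\<^sup>+y. v (Z w, y) \<partial>meas (\<kappa> w)) + (\<integral>\<^sup>+y. u (Z w, y) \<partial>meas (\<kappa> w))" for w
      by (intro nn_integral_add) (simp_all add: sec[OF add.hyps(1)] sec[OF add.hyps(3)])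
    then show ?case using add by (simp add: nn_integral_add nn_meas)
  next
    case (seq U)
    note [measurable] = seq(1)
    have U: "(\<integral>\<^sup>+y. (SUP i. U i) (Z w, y) \<partial>meas (\<kappa> w)) = (SUP i. \<integral>\<^sup>+y. U i (Z w, y) \<partial>meas (\<kappa> w))" for w
    proof -
      have "incseq (\<lambda>i y. U i (Z w, y))" using seq(3) by (auto simp: incseq_def le_fun_def)
      from nn_integral_monotone_convergence_SUP[OF this, of "meas (\<kappa> w)"] show ?thesis
        by (simp add: sec[OF seq(1)] image_comp)
    qed
    have inc1: "incseq (\<lambda>i w. U i (Z w, X w))" using seq(3) by (auto simp: incseq_def le_fun_def)
    have inc2: "incseq (\<lambda>i w. \<integral>\<^sup>+y. U i (Z w, y) \<partial>meas (\<kappa> w))"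
      using seq(3) by (auto simp: incseq_def le_fun_def intro!: nn_integral_mono)
    have "(\<integral>\<^sup>+w. (SUP i. U i) (Z w, X w) \<partial>M) = (SUP i. \<integral>\<^sup>+w. U i (Z w, X w) \<partial>M)"
      using nn_integral_monotone_convergence_SUP[OF inc1, of M] by (simp add: image_comp)
    also have "\<dots> = (SUP i. \<integral>\<^sup>+w. (\<integral>\<^sup>+y. U i (Z w, y) \<partial>meas (\<kappa> w)) \<partial>M)"
      using seq.IH by simp
    also have "\<dots> = (\<integral>\<^sup>+w. (SUP i. \<integral>\<^sup>+y. U i (Z w, y) \<partial>meas (\<kappa> w)) \<partial>M)"
      using nn_integral_monotone_convergence_SUP[OF inc2, of M] by (simp add: image_comp)
    finally show ?case unfolding U .
  qed
  show ?thesis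
    unfolding disintegrates_def
  proof (intro allI impI)
    fix g :: "'z \<times> (real^'a) \<Rightarrow> real" assume "g \<in> borel_measurable borel" and "bounded (range g)"
    then obtain C where C: "\<And>z. \<bar>g z\<bar> \<le> C" by (auto simp: bounded_iff)
    have g [measurable]: "g \<in> borel_measurable (borel \<Otimes>\<^sub>M borel)" using \<open>g \<in> borel_measurable borel\<close> by (simp add: borel_prod)
    have p: "0 \<le> g z + C" for z using C[of z] by linarith
    have gi: "integrable (meas k) (\<lambda>y. g (z, y))" for z k
      using C by (intro integrable_meas_bounded[where C=C] sec[OF g]) auto
    have gm: "(\<lambda>w. \<integral>y. g (Z w, y) \<partial>meas (\<kappa> w)) \<in> borel_measurable M"
      by (intro borel_measurable_integral_meas) measurable
    have gb: "\<bar>\<integral>y. g (z, y) \<partial>meas k\<bar> \<le> C" for z k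
      using integral_meas_bounded[OF sec[OF g], of z C k] C by simp
    have "ennreal ((\<integral>w. g (Z w, X w) \<partial>M) + C) = (\<integral>\<^sup>+w. ennreal (g (Z w, X w) + C) \<partial>M)"
    proof -
      have i: "integrable M (\<lambda>w. g (Z w, X w))" using C by (intro integrable_const_bound[where B=C]) auto
      then have "(\<integral>\<^sup>+w. ennreal (g (Z w, X w) + C) \<partial>M) = ennreal (\<integral>w. g (Z w, X w) + C \<partial>M)"
        using p by (intro nn_integral_eq_integral) auto
      then show ?thesis using i by (simp add: prob_space)
    qed
    also have "\<dots> = (\<integral>\<^sup>+w. (\<integral>\<^sup>+y. ennreal (g (Z w, y) + C) \<partial>meas (\<kappa> w)) \<partial>M)"
      by (rule nn) measurable
    also have "\<dots> = (\<integral>\<^sup>+w. ennreal ((\<integral>y. g (Z w, y) \<partial>meas (\<kappa> w)) + C) \<partial>M)"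
    proof (intro nn_integral_cong)
      fix w
      have "(\<integral>\<^sup>+y. ennreal (g (Z w, y) + C) \<partial>meas (\<kappa> w)) = ennreal (\<integral>y. g (Z w, y) + C \<partial>meas (\<kappa> w))"
        using p gi by (intro nn_integral_eq_integral) (auto intro!: finite_measure.integrable_const)
      then show "(\<integral>\<^sup>+y. ennreal (g (Z w, y) + C) \<partial>meas (\<kappa> w)) = ennreal ((\<integral>y. g (Z w, y) \<partial>meas (\<kappa> w)) + C)"
        using gi by (simp add: finite_measure.integrable_const)
    qed
    also have "\<dots> = ennreal ((\<integral>w. (\<integral>y. g (Z w, y) \<partial>meas (\<kappa> w)) \<partial>M) + C)"
    proof -
      have i: "integrable M (\<lambda>w. \<integral>y. g (Z w, y) \<partial>meas (\<kappa> w))" using gb gm by (intro integrable_const_bound[where B=C]) auto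
      have "0 \<le> (\<integral>y. g (Z w, y) \<partial>meas (\<kappa> w)) + C" for w
      proof -
        have "\<bar>\<integral>y. g (Z w, y) \<partial>meas (\<kappa> w)\<bar> \<le> C" by (rule gb)
        then show ?thesis by linarith
      qed
      then have "(\<integral>\<^sup>+w. ennreal ((\<integral>y. g (Z w, y) \<partial>meas (\<kappa> w)) + C) \<partial>M) = ennreal (\<integral>w. (\<integral>y. g (Z w, y) \<partial>meas (\<kappa> w)) + C \<partial>M)"
        using i by (intro nn_integral_eq_integral) auto
      then show ?thesis using i by (simp add: prob_space)
    qed
    finally have *: "ennreal ((\<integral>w. g (Z w, X w) \<partial>M) + C) = ennreal ((\<integral>w. (\<integral>y. g (Z w, y) \<partial>meas (\<kappa> w)) \<partial>M) + C)" .
    have bnd: "0 \<le> (\<integral>w. f w \<partial>M) + C" if "\<And>w. \<bar>f w\<bar> \<le> C" "f \<in> borel_measurable M" for f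
    proof -
      have i: "integrable M f" using that by (intro integrable_const_bound[where B=C]) auto
      have "0 \<le> (\<integral>w. f w + C \<partial>M)"
        using that(1) by (intro Bochner_Integration.integral_nonneg) (smt (verit) abs_le_D2)
      then show ?thesis using i by (simp add: prob_space)
    qed
    have "0 \<le> (\<integral>w. g (Z w, X w) \<partial>M) + C" "0 \<le> (\<integral>w. (\<integral>y. g (Z w, y) \<partial>meas (\<kappa> w)) \<partial>M) + C"
      using C gb gm by (intro bnd; simp)+
    with * show "(\<integral>w. g (Z w, X w) \<partial>M) = (\<integral>w. (\<integral>y. g (Z w, y) \<partial>meas (\<kappa> w)) \<partial>M)"
      by (simp add: ennreal_inj)
  qed
qed

lemma indep_expectation:
  fixes h :: "'b::topological_space \<Rightarrow> real"
  assumes M: "prob_space M" and ind: "prob_space.indep_set M (sets K) (sets (vimage_algebra (space M) \<Delta> borel))"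
    and K: "subalgebra M K" and \<Delta>: "\<Delta> \<in> borel_measurable M"
    and f: "f \<in> borel_measurable K" "integrable M f" and h: "h \<in> borel_measurable borel" "integrable M (\<lambda>w. h (\<Delta> w))"
  shows "(\<integral>w. f w * h (\<Delta> w) \<partial>M) = (\<integral>w. f w \<partial>M) * (\<integral>w. h (\<Delta> w) \<partial>M)"
    "integrable M (\<lambda>w. f w * h (\<Delta> w))"
proof -
  interpret prob_space M by (rule M)
  have "indep_var borel f borel (\<lambda>w. h (\<Delta> w))"
    unfolding indep_var_eq
  proof (intro conjI)
    show "random_variable borel f" "random_variable borel (\<lambda>w. h (\<Delta> w))" using f h by auto
    have 1: "sigma_sets (space M) {f -` A \<inter> space M |A. A \<in> sets borel} \<subseteq> sets K"
    proof -
      have "{f -` A \<inter> space M |A. A \<in> sets borel} \<subseteq> sets K"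
        using measurable_sets[OF f(1)] K by (auto simp: subalgebra_def)
      then show ?thesis using K sets.sigma_sets_subset[of _ K] by (simp add: subalgebra_def)
    qed
    have 2: "sigma_sets (space M) {(\<lambda>w. h (\<Delta> w)) -` A \<inter> space M |A. A \<in> sets borel} \<subseteq> sets (vimage_algebra (space M) \<Delta> borel)"
    proof -
      have "(\<lambda>w. h (\<Delta> w)) \<in> borel_measurable (vimage_algebra (space M) \<Delta> borel)"
        by (rule measurable_compose[OF measurable_vimage_algebra1 h(1)]) simp
      from measurable_sets[OF this] have "{(\<lambda>w. h (\<Delta> w)) -` A \<inter> space M |A. A \<in> sets borel} \<subseteq> sets (vimage_algebra (space M) \<Delta> borel)"
        by auto
      then show ?thesis using sets.sigma_sets_subset[of _ "vimage_algebra (space M) \<Delta> borel"] by simp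
    qed
    show "indep_set (sigma_sets (space M) {f -` A \<inter> space M |A. A \<in> sets borel})
        (sigma_sets (space M) {(\<lambda>w. h (\<Delta> w)) -` A \<inter> space M |A. A \<in> sets borel})"
      using ind 1 2 unfolding indep_sets2_eq by blast
  qed
  from indep_var_lebesgue_integral[OF this f(2) h(2)] indep_var_integrable[OF this f(2) h(2)]
  show "(\<integral>w. f w * h (\<Delta> w) \<partial>M) = (\<integral>w. f w \<partial>M) * (\<integral>w. h (\<Delta> w) \<partial>M)"
    "integrable M (\<lambda>w. f w * h (\<Delta> w))" by auto
qed

text \<open>The sigma-algebras in use need not contain the null sets of \<open>M\<close>, whereas a
  solution satisfies its equation only almost surely.\<close>

definition almost_measurable :: "'w measure \<Rightarrow> 'w measure \<Rightarrow> ('w \<Rightarrow> 'b::topological_space) \<Rightarrow> bool" where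
  "almost_measurable M H Z \<longleftrightarrow> (\<exists>Z'\<in>borel_measurable H. AE w in M. Z w = Z' w)"

lemma almost_measurableI: "Z \<in> borel_measurable H \<Longrightarrow> almost_measurable M H Z"
  unfolding almost_measurable_def by (intro bexI[of _ Z]) auto

lemma almost_measurable_cong:
  assumes "almost_measurable M H Z" "AE w in M. Z w = Y w"
  shows "almost_measurable M H Y"
proof -
  obtain Z' where "Z' \<in> borel_measurable H" "AE w in M. Z w = Z' w" using assms(1) by (auto simp: almost_measurable_def)
  with assms(2) show ?thesis unfolding almost_measurable_def by (intro bexI[of _ Z']) auto
qed

lemma almost_measurable_compose:
  "almost_measurable M H Z \<Longrightarrow> f \<in> borel_measurable borel \<Longrightarrow> almost_measurable M H (\<lambda>w. f (Z w))"
  unfolding almost_measurable_def by (force intro!: measurable_compose[of _ _ borel f])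

lemma almost_measurable_Pair:
  fixes Y :: "'w \<Rightarrow> 'a::second_countable_topology" and Z :: "'w \<Rightarrow> 'b::second_countable_topology"
  assumes "almost_measurable M H Y" "almost_measurable M H Z"
  shows "almost_measurable M H (\<lambda>w. (Y w, Z w))"
proof -
  obtain Y' Z' where "Y' \<in> borel_measurable H" "AE w in M. Y w = Y' w" "Z' \<in> borel_measurable H" "AE w in M. Z w = Z' w"
    using assms by (auto simp: almost_measurable_def)
  then show ?thesis unfolding almost_measurable_def
    by (intro bexI[of _ "\<lambda>w. (Y' w, Z' w)"] borel_measurable_Pair) auto
qed

text \<open>Measurable representatives may fail to converge on a null set; \<open>lim\<close> is
  total and still defines a measurable function there.\<close>

lemma almost_measurable_LIMSEQ:
  fixes Z :: "nat \<Rightarrow> 'w \<Rightarrow> 'b::{banach,second_countable_topology}"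
  assumes "\<And>n. almost_measurable M H (Z n)" "AE w in M. (\<lambda>n. Z n w) \<longlonglongrightarrow> Y w"
  shows "almost_measurable M H Y"
proof -
  have "\<forall>n. \<exists>Z'. Z' \<in> borel_measurable H \<and> (AE w in M. Z n w = Z' w)" using assms(1) by (auto simp: almost_measurable_def)
  from choice[OF this] obtain Z' where Z': "\<And>n. Z' n \<in> borel_measurable H" "\<And>n. AE w in M. Z n w = Z' n w" by blast
  have "AE w in M. \<forall>n. Z n w = Z' n w" using Z'(2) by (simp add: AE_all_countable)
  with assms(2) have "AE w in M. Y w = lim (\<lambda>n. Z' n w)"
  proof eventually_elim
    case (elim w)
    then show ?case using limI by fastforce
  qed
  moreover have "(\<lambda>w. lim (\<lambda>n. Z' n w)) \<in> borel_measurable H" using Z'(1) by (rule borel_measurable_lim_metric)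
  ultimately show ?thesis unfolding almost_measurable_def
    by (intro bexI[of _ "\<lambda>w. lim (\<lambda>n. Z' n w)"])
qed

text \<open>A time integral of adapted variables is adapted up to a null set without progressive
  measurability: test \<open>Y - E[Y | H]\<close> against each integrand and use Fubini.\<close>

lemma almost_measurable_time_integral:
  fixes h :: "'t \<Rightarrow> 'w \<Rightarrow> real"
  assumes M: "prob_space M" and N: "finite_measure N" and H: "subalgebra M H"
    and h [measurable]: "(\<lambda>(s, w). h s w) \<in> borel_measurable (N \<Otimes>\<^sub>M M)" and C: "\<And>s w. \<bar>h s w\<bar> \<le> C"
    and a: "\<And>s. s \<in> space N \<Longrightarrow> almost_measurable M H (h s)"
  shows "almost_measurable M H (\<lambda>w. \<integral>s. h s w \<partial>N)"
proof -
  interpret M: prob_space M by (rule M)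
  interpret N: finite_measure N by (rule N)
  interpret P: pair_sigma_finite N M by standard
  interpret F: finite_measure_subalgebra M H by unfold_locales (rule H)
  define Y where "Y w = (\<integral>s. h s w \<partial>N)" for w
  have "(\<lambda>(w, s). h s w) \<in> borel_measurable (M \<Otimes>\<^sub>M N)"
    using measurable_pair_swap[OF h] by simp
  then have Ym [measurable]: "Y \<in> borel_measurable M"
    unfolding Y_def by (rule N.borel_measurable_lebesgue_integral)
  define c where "c = C * measure N (space N)"
  have Yb: "\<bar>Y w\<bar> \<le> c" for w
  proof -
    have "\<bar>Y w\<bar> \<le> (\<integral>s. \<bar>h s w\<bar> \<partial>N)" unfolding Y_def by (rule integral_abs_bound)
    also have "\<dots> \<le> (\<integral>s. C \<partial>N)"
    proof (cases "integrable N (\<lambda>s. \<bar>h s w\<bar>)")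
      case True
      then show ?thesis by (rule integral_mono) (auto intro: C)
    next
      case False
      moreover have "0 \<le> C" using C[of undefined w] by linarith
      ultimately show ?thesis by (simp add: not_integrable_integral_eq)
    qed
    finally show ?thesis by (simp add: c_def mult.commute)
  qed
  have Yi: "integrable M Y" using Yb by (intro M.integrable_const_bound[where B=c]) auto
  define Z where "Z = real_cond_exp M H Y"
  have Zm: "Z \<in> borel_measurable H" by (simp add: Z_def)
  have [measurable]: "Z \<in> borel_measurable M" by (simp add: Z_def)
  have Zi: "integrable M Z" unfolding Z_def using Yi by (rule F.real_cond_exp_int)
  have YZi: "integrable M (\<lambda>w. Z w * Y w)"
  proof (rule Bochner_Integration.integrable_bound[OF integrable_mult_right[OF Zi, of c]])
    show "AE w in M. norm (Z w * Y w) \<le> norm (c * Z w)"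
    proof (rule AE_I2)
      fix w
      have "\<bar>Z w\<bar> * \<bar>Y w\<bar> \<le> \<bar>Z w\<bar> * \<bar>c\<bar>" using Yb[of w] by (intro mult_left_mono) auto
      then show "norm (Z w * Y w) \<le> norm (c * Z w)" by (simp add: abs_mult mult.commute)
    qed
  qed measurable
  have ZZ: "integrable M (\<lambda>w. Z w * Z w)" "(\<integral>w. Z w * Z w \<partial>M) = (\<integral>w. Z w * Y w \<partial>M)"
    using F.real_cond_exp_intg[OF YZi Zm Ym] by (simp_all add: Z_def)
  have YYi: "integrable M (\<lambda>w. Y w * Y w)"
  proof (rule M.integrable_const_bound[where B="c * c"])
    show "AE w in M. norm (Y w * Y w) \<le> c * c"
      unfolding real_norm_def abs_mult
      by (rule AE_I2) (rule mult_mono[OF Yb Yb order_trans[OF abs_ge_zero Yb] abs_ge_zero])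
  qed measurable
  have test: "(\<integral>w. (Y w - Z w) * h s w \<partial>M) = 0" if s: "s \<in> space N" for s
  proof -
    obtain h' where h': "h' \<in> borel_measurable H" "AE w in M. h s w = h' w" using a[OF s] by (auto simp: almost_measurable_def)
    have [measurable]: "h s \<in> borel_measurable M" using measurable_Pair2[OF h s] by simp
    have [measurable]: "h' \<in> borel_measurable M" by (rule measurable_from_subalg[OF H h'(1)])
    have hY: "integrable M (\<lambda>w. h s w * Y w)"
    proof (rule M.integrable_const_bound[where B="C * c"])
      show "AE w in M. norm (h s w * Y w) \<le> C * c"
        unfolding real_norm_def abs_mult
        by (rule AE_I2) (rule mult_mono[OF C Yb order_trans[OF abs_ge_zero C] abs_ge_zero])
    qed measurable
    then have "integrable M (\<lambda>w. h' w * Y w)" by (rule integrable_cong_AE_imp) (use h'(2) in auto)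
    note E = F.real_cond_exp_intg[OF this h'(1) Ym, folded Z_def]
    have "(\<integral>w. (Y w - Z w) * h s w \<partial>M) = (\<integral>w. h' w * Y w - h' w * Z w \<partial>M)"
      by (rule integral_cong_AE) (use h'(2) in \<open>auto simp: algebra_simps\<close>)
    also have "\<dots> = 0" using E \<open>integrable M (\<lambda>w. h' w * Y w)\<close> by simp
    finally show ?thesis .
  qed
  have fub: "integrable (N \<Otimes>\<^sub>M M) (\<lambda>(s, w). (Y w - Z w) * h s w)"
  proof (rule Bochner_Integration.integrable_bound[where f="\<lambda>(s, w). C * (Y w - Z w)"])
    show "integrable (N \<Otimes>\<^sub>M M) (\<lambda>(s, w). C * (Y w - Z w))"
    proof (rule P.Fubini_integrable)
      show "integrable N (\<lambda>s. \<integral>w. norm (case (s, w) of (s, w) \<Rightarrow> C * (Y w - Z w)) \<partial>M)" by simp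
      show "AE s in N. integrable M (\<lambda>w. case (s, w) of (s, w) \<Rightarrow> C * (Y w - Z w))" using Yi Zi by simp
    qed measurable
    show "AE z in N \<Otimes>\<^sub>M M. norm (case z of (s, w) \<Rightarrow> (Y w - Z w) * h s w) \<le> norm (case z of (s, w) \<Rightarrow> C * (Y w - Z w))"
    proof (rule AE_I2, clarify)
      fix s w
      have "\<bar>Y w - Z w\<bar> * \<bar>h s w\<bar> \<le> \<bar>Y w - Z w\<bar> * \<bar>C\<bar>" using C[of s w] by (intro mult_left_mono) auto
      then show "norm ((Y w - Z w) * h s w) \<le> norm (C * (Y w - Z w))" by (simp add: abs_mult mult.commute)
    qed
  qed measurable
  have "(\<integral>w. (Y w - Z w) * Y w \<partial>M) = (\<integral>w. (\<integral>s. (Y w - Z w) * h s w \<partial>N) \<partial>M)"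
    unfolding Y_def by simp
  also have "\<dots> = (\<integral>s. (\<integral>w. (Y w - Z w) * h s w \<partial>M) \<partial>N)" by (rule P.Fubini_integral[OF fub])
  also have "\<dots> = (\<integral>s. 0 \<partial>N)" by (rule Bochner_Integration.integral_cong) (auto simp: test)
  finally have "(\<integral>w. (Y w - Z w) * Y w \<partial>M) = 0" by simp
  \<comment> \<open>The residual \<open>Y - Z\<close> is orthogonal to \<open>Y\<close>, by the
    computation above, and to \<open>Z\<close>, by conditioning; its square therefore has mean
    zero.\<close>
  moreover have sq: "(Y w - Z w)\<^sup>2 = (Y w - Z w) * Y w - (Z w * Y w - Z w * Z w)" for w
    by (simp add: power2_eq_square algebra_simps)
  moreover have YZYi: "integrable M (\<lambda>w. (Y w - Z w) * Y w)"
    using YZi YYi by (simp add: left_diff_distrib)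
  moreover have "(\<integral>w. (Y w - Z w)\<^sup>2 \<partial>M) = (\<integral>w. (Y w - Z w) * Y w \<partial>M)"
    unfolding sq using YZYi YZi ZZ by simp
  ultimately have 0: "(\<integral>w. (Y w - Z w)\<^sup>2 \<partial>M) = 0" by simp
  have "integrable M (\<lambda>w. (Y w - Z w)\<^sup>2)"
    unfolding sq using YZYi YZi ZZ(1) by (intro Bochner_Integration.integrable_diff)
  from integral_nonneg_eq_0_iff_AE[OF this] 0 have "AE w in M. (Y w - Z w)\<^sup>2 = 0" by simp
  then have "AE w in M. Y w = Z w" by eventually_elim simp
  then show ?thesis using Zm unfolding almost_measurable_def Y_def by blast
qed

text \<open>If \<open>A\<close> is independent of \<open>B\<close> and \<open>G\<close> is contained in \<open>B\<close>, conditioning an event of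
  \<open>\<sigma>(A, G)\<close> on \<open>B\<close> is the same as conditioning it on \<open>G\<close>.\<close>

lemma indep_integral_eq_cond_exp:
  assumes M: "prob_space M" and A: "subalgebra M A" and B: "subalgebra M B" and G: "subalgebra B G"
    and ind: "prob_space.indep_set M (sets A) (sets B)"
    and b: "b \<in> sets B" and Q: "Q \<in> sigma_sets (space M) {a \<inter> e | a e. a \<in> sets A \<and> e \<in> sets G}"
  shows "(\<integral>w. indicator Q w * indicator b w \<partial>M) = (\<integral>w. indicator Q w * real_cond_exp M G (indicator b) w \<partial>M)"
proof -
  interpret prob_space M by (rule M)
  have GM: "subalgebra M G" using B G by (auto simp: subalgebra_def)
  interpret F: finite_measure_subalgebra M G by unfold_locales (rule GM)
  have bM [measurable]: "b \<in> sets M" using b B by (auto simp: subalgebra_def)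
  define c where "c = real_cond_exp M G (indicator b)"
  have cm: "c \<in> borel_measurable G" "c \<in> borel_measurable M" by (simp_all add: c_def)
  have bi: "integrable M (indicator b :: _ \<Rightarrow> real)" by (simp add: emeasure_eq_measure)
  have ci: "integrable M c" unfolding c_def using bi by (rule F.real_cond_exp_int)
  define d where "d w = indicator b w - c w" for w
  have di: "integrable M d" unfolding d_def using bi ci by simp
  have gen: "Int_stable {a \<inter> e | a e. a \<in> sets A \<and> e \<in> sets G}"
  proof (rule Int_stableI)
    fix p q assume "p \<in> {a \<inter> e | a e. a \<in> sets A \<and> e \<in> sets G}" "q \<in> {a \<inter> e | a e. a \<in> sets A \<and> e \<in> sets G}"
    then obtain a e a' e' where "p = a \<inter> e" "q = a' \<inter> e'" "a \<in> sets A" "e \<in> sets G" "a' \<in> sets A" "e' \<in> sets G" by auto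
    then show "p \<inter> q \<in> {a \<inter> e | a e. a \<in> sets A \<and> e \<in> sets G}"
      by (intro CollectI exI[of _ "a \<inter> a'"] exI[of _ "e \<inter> e'"]) auto
  qed
  have sub: "{a \<inter> e | a e. a \<in> sets A \<and> e \<in> sets G} \<subseteq> sets M"
    using A GM by (auto simp: subalgebra_def)
  have pow: "{a \<inter> e | a e. a \<in> sets A \<and> e \<in> sets G} \<subseteq> Pow (space M)"
    using sub sets.sets_into_space by blast
  have subM: "sigma_sets (space M) {a \<inter> e | a e. a \<in> sets A \<and> e \<in> sets G} \<subseteq> sets M"
    using sub by (rule sets.sigma_sets_subset)
  have dq: "integrable M (\<lambda>w. indicator q w * d w)" if "q \<in> sets M" for q
    using integrable_mult_indicator[OF that di] by simp
  have "(\<integral>w. indicator Q w * d w \<partial>M) = 0"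
    using Q
  proof (induction rule: sigma_sets_induct_disjoint[OF gen pow, consumes 1])
    case (1 q)
    then obtain a e where q: "q = a \<inter> e" "a \<in> sets A" "e \<in> sets G" by auto
    have aM: "a \<in> sets M" and eM: "e \<in> sets M" and eB: "e \<in> sets B" using q A G GM by (auto simp: subalgebra_def)
    have em: "(indicator e :: _ \<Rightarrow> real) \<in> borel_measurable G" using q(3) by simp
    have ebi: "integrable M (\<lambda>w. indicator e w * indicator b w :: real)"
      using integrable_mult_indicator[OF eM bi] by simp
    note E = F.real_cond_exp_intg[OF ebi em] 
    have E1: "integrable M (\<lambda>w. indicator e w * c w)" "(\<integral>w. indicator e w * c w \<partial>M) = (\<integral>w. indicator e w * indicator b w \<partial>M)"
      using E by (simp_all add: c_def)
    have eB': "(\<lambda>w. indicator e w * d w) \<in> borel_measurable B"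
    proof -
      have "c \<in> borel_measurable B" using measurable_from_subalg[OF G cm(1)] .
      then show ?thesis unfolding d_def using eB b by simp
    qed
    have ei: "integrable M (\<lambda>w. indicator e w * d w)" by (rule dq[OF eM])
    have iv: "indep_var borel (indicator a :: _ \<Rightarrow> real) borel (\<lambda>w. indicator e w * d w)"
      unfolding indep_var_eq
    proof (intro conjI)
      show "random_variable borel (indicator a :: _ \<Rightarrow> real)" using aM by simp
      show "random_variable borel (\<lambda>w. indicator e w * d w)" using ei by auto
      have 1: "sigma_sets (space M) {(indicator a :: _ \<Rightarrow> real) -` S \<inter> space M |S. S \<in> sets borel} \<subseteq> sets A"
      proof -
        have "(indicator a :: _ \<Rightarrow> real) \<in> borel_measurable A" using q(2) by simp
        from measurable_sets[OF this] have "{(indicator a :: _ \<Rightarrow> real) -` S \<inter> space M |S. S \<in> sets borel} \<subseteq> sets A"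
          using A by (auto simp: subalgebra_def)
        then show ?thesis using A sets.sigma_sets_subset[of _ A] by (simp add: subalgebra_def)
      qed
      have 2: "sigma_sets (space M) {(\<lambda>w. indicator e w * d w) -` S \<inter> space M |S. S \<in> sets borel} \<subseteq> sets B"
      proof -
        from measurable_sets[OF eB'] have "{(\<lambda>w. indicator e w * d w) -` S \<inter> space M |S. S \<in> sets borel} \<subseteq> sets B"
          using B by (auto simp: subalgebra_def)
        then show ?thesis using B sets.sigma_sets_subset[of _ B] by (simp add: subalgebra_def)
      qed
      show "indep_set (sigma_sets (space M) {(indicator a :: _ \<Rightarrow> real) -` S \<inter> space M |S. S \<in> sets borel})
         (sigma_sets (space M) {(\<lambda>w. indicator e w * d w) -` S \<inter> space M |S. S \<in> sets borel})"
        using ind 1 2 unfolding indep_sets2_eq by blast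
    qed
    have "(\<integral>w. indicator q w * d w \<partial>M) = (\<integral>w. indicator a w * (indicator e w * d w) \<partial>M)"
      unfolding q by (intro Bochner_Integration.integral_cong) (auto simp: indicator_def)
    also have "\<dots> = (\<integral>w. indicator a w \<partial>M) * (\<integral>w. indicator e w * d w \<partial>M)"
      by (rule indep_var_lebesgue_integral[OF iv _ ei]) (use aM in \<open>simp add: emeasure_eq_measure\<close>)
    also have "(\<integral>w. indicator e w * d w \<partial>M) = 0"
      using E1 ebi unfolding d_def by (simp add: right_diff_distrib)
    finally show ?case by simp
  next
    case 2
    then show ?case by simp
  next
    case (3 q)
    then have qM: "q \<in> sets M" using subM by blast
    have "(\<integral>w. d w \<partial>M) = 0"
      unfolding d_def using bi ci F.real_cond_exp_int(2)[OF bi] by (simp add: c_def)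
    moreover have "(\<integral>w. indicator (space M - q) w * d w \<partial>M) = (\<integral>w. d w - indicator q w * d w \<partial>M)"
      by (intro Bochner_Integration.integral_cong) (auto simp: indicator_def)
    ultimately show ?case using 3 di dq[OF qM] by simp
  next
    case (4 q)
    then have qM: "q i \<in> sets M" for i using subM by blast
    have "(LINT w:(\<Union>i. q i)|M. d w) = (\<Sum>i. (LINT w:(q i)|M. d w))"
    proof (rule lebesgue_integral_countable_add)
      show "set_integrable M (\<Union>i. q i) d"
        unfolding set_integrable_def using qM by (intro integrable_mult_indicator di) auto
    qed (use qM 4(1) in \<open>auto simp: disjoint_family_on_def\<close>)
    then show ?case using 4(3) by (simp add: set_lebesgue_integral_def)
  qed
  moreover have "Q \<in> sets M" using Q subM by blast
  then have "(\<integral>w. indicator Q w * d w \<partial>M) = (\<integral>w. indicator Q w * indicator b w \<partial>M) - (\<integral>w. indicator Q w * c w \<partial>M)"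
    using integrable_mult_indicator[OF \<open>Q \<in> sets M\<close> bi] integrable_mult_indicator[OF \<open>Q \<in> sets M\<close> ci]
    unfolding d_def by (simp add: right_diff_distrib)
  ultimately show ?thesis by (simp add: c_def)
qed

text \<open>The law is given relative to \<open>G\<close>, but it will be paired with functions of
  the larger \<open>B\<close>. Since \<open>S\<close> is built from \<open>G\<close> and from
  information independent of \<open>B\<close>, conditioning on \<open>B\<close> yields the same
  law.\<close>

lemma conditional_law_disintegrates:
  fixes S :: "'w \<Rightarrow> real^'d" and Z :: "'w \<Rightarrow> 'z::second_countable_topology"
  assumes M: "prob_space M" and A: "subalgebra M A" and B: "subalgebra M B" and G: "subalgebra B G"
    and ind: "prob_space.indep_set M (sets A) (sets B)"
    and S: "S \<in> borel_measurable M"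
    and S': "almost_measurable M (sigma (space M) {a \<inter> e | a e. a \<in> sets A \<and> e \<in> sets G}) S"
    and law: "is_conditional_law M G S \<kappa>" and Z: "Z \<in> borel_measurable B"
  shows "disintegrates M Z \<kappa> S"
proof (rule disintegratesI[OF M])
  interpret prob_space M by (rule M)
  have GM: "subalgebra M G" using B G by (auto simp: subalgebra_def)
  interpret F: finite_measure_subalgebra M G by unfold_locales (rule GM)
  have \<kappa>G: "\<kappa> \<in> borel_measurable G" using law by (simp add: is_conditional_law_def)
  show \<kappa> [measurable]: "\<kappa> \<in> borel_measurable M" by (rule measurable_from_subalg[OF GM \<kappa>G])
  show [measurable]: "Z \<in> borel_measurable M" by (rule measurable_from_subalg[OF B Z])
  show [measurable]: "S \<in> borel_measurable M" by fact
  let ?P = "{a \<inter> e | a e. a \<in> sets A \<and> e \<in> sets G}"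
  fix U :: "'z set" and V :: "(real^'d) set" assume [measurable]: "U \<in> sets borel" "V \<in> sets borel"
  define b where "b = Z -` U \<inter> space M"
  have b: "b \<in> sets B" using measurable_sets[OF Z, of U] B by (simp add: b_def subalgebra_def)
  then have [measurable]: "b \<in> sets M" using B by (auto simp: subalgebra_def)
  obtain S' where S': "S' \<in> borel_measurable (sigma (space M) ?P)" "AE w in M. S w = S' w"
    using S' by (auto simp: almost_measurable_def)
  have P: "?P \<subseteq> Pow (space M)" using A GM sets.sets_into_space[of _ M] by (auto simp: subalgebra_def)
  define Q where "Q = S' -` V \<inter> space M"
  have Q: "Q \<in> sigma_sets (space M) ?P" using measurable_sets[OF S'(1), of V] P by (simp add: Q_def)
  have PM: "?P \<subseteq> sets M" using A GM by (auto simp: subalgebra_def)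
  have [measurable]: "Q \<in> sets M" using Q sets.sigma_sets_subset[OF PM] by blast
  define f :: "'w \<Rightarrow> real" where "f w = indicator V (S w)" for w
  have [measurable]: "f \<in> borel_measurable M" unfolding f_def by measurable
  have fQ: "AE w in M. f w = indicator Q w"
    using S'(2) AE_space by eventually_elim (auto simp: f_def Q_def indicator_def)
  have f1: "\<bar>f w\<bar> \<le> 1" for w by (simp add: f_def indicator_def)
  have fi: "integrable M f" using f1 by (intro integrable_const_bound[where B=1]) auto
  let ?c = "real_cond_exp M G (indicator b)" and ?cf = "real_cond_exp M G f"
  have bi: "integrable M (indicator b :: _ \<Rightarrow> real)" by (simp add: emeasure_eq_measure)
  have i1: "integrable M (\<lambda>w. ?c w * f w)"
  proof (rule Bochner_Integration.integrable_bound[OF F.real_cond_exp_int(1)[OF bi]])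
    show "AE w in M. norm (?c w * f w) \<le> norm (?c w)"
      using f1 by (intro AE_I2) (simp add: abs_mult mult_left_le)
  qed measurable
  have i2: "integrable M (\<lambda>w. ?cf w * indicator b w)"
    using integrable_mult_indicator[OF _ F.real_cond_exp_int(1)[OF fi], of b] by (simp add: mult.commute)
  \<comment> \<open>Chain of conditionings: \<open>b\<close> is replaced by its conditional
    expectation given \<open>G\<close>, the conditioning is then moved onto \<open>f\<close>, and
    \<open>b\<close> returns. The conditional expectation of \<open>f\<close> is the mass that
    \<open>\<kappa>\<close> gives to \<open>V\<close>.\<close>
  have "(\<integral>w. indicator U (Z w) * (indicator V (S w) :: real) \<partial>M) = (\<integral>w. indicator Q w * indicator b w \<partial>M)"
  proof (rule integral_cong_AE)
    show "AE w in M. indicator U (Z w) * indicator V (S w) = (indicator Q w * indicator b w :: real)"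
      using fQ AE_space
    proof eventually_elim
      case (elim w)
      have "indicator b w = (indicator U (Z w) :: real)" using elim(2) by (simp add: b_def indicator_def)
      then show ?case using elim(1) by (simp add: f_def mult.commute)
    qed
  qed measurable
  also have "\<dots> = (\<integral>w. indicator Q w * ?c w \<partial>M)"
    by (rule indep_integral_eq_cond_exp[OF M A B G ind b Q])
  also have "\<dots> = (\<integral>w. ?c w * f w \<partial>M)"
    by (rule integral_cong_AE) (use fQ in auto)
  also have "\<dots> = (\<integral>w. ?c w * ?cf w \<partial>M)"
    by (rule F.real_cond_exp_intg(2)[OF i1, symmetric]) auto
  also have "\<dots> = (\<integral>w. ?cf w * indicator b w \<partial>M)"
    using F.real_cond_exp_intg(2)[OF i2] by (simp add: mult.commute)
  also have "\<dots> = (\<integral>w. indicator U (Z w) * measure (meas (\<kappa> w)) V \<partial>M)"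
  proof (rule integral_cong_AE)
    show "(\<lambda>w. indicator U (Z w) * measure (meas (\<kappa> w)) V) \<in> borel_measurable M"
      by (intro borel_measurable_times measure_measurable_subprob_algebra2[where N=borel]) measurable
    have "AE w in M. measure (meas (\<kappa> w)) V = ?cf w"
      using law unfolding is_conditional_law_def f_def by auto
    then show "AE w in M. ?cf w * indicator b w = indicator U (Z w) * measure (meas (\<kappa> w)) V"
      using AE_space by eventually_elim (auto simp: b_def indicator_def)
  qed measurable
  finally show "(\<integral>w. indicator U (Z w) * indicator V (S w) \<partial>M) = (\<integral>w. indicator U (Z w) * measure (meas (\<kappa> w)) V \<partial>M)" .
qed

section \<open>Moments of Gaussian increments\<close>

definition normal_moment :: "real \<Rightarrow> nat \<Rightarrow> real" where
  "normal_moment h k = (\<integral>x. normal_density 0 (sqrt h) x * x ^ k \<partial>lborel)"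

lemma normal_moment_values:
  assumes h: "0 < h"
  shows "normal_moment h 0 = 1" "normal_moment h 1 = 0" "normal_moment h 2 = h" "normal_moment h 4 = 3 * h\<^sup>2"
proof -
  have s: "0 < sqrt h" using h by simp
  show "normal_moment h 0 = 1" using integral_normal_density[OF s] by (simp add: normal_moment_def)
  show "normal_moment h 1 = 0" using integral_normal_moment_odd[OF s, of 0 0] by (simp add: normal_moment_def)
  show "normal_moment h 2 = h" using integral_normal_moment_even[OF s, of 0 1] h by (simp add: normal_moment_def fact_numeral)
  show "normal_moment h 4 = 3 * h\<^sup>2"
    using integral_normal_moment_even[OF s, of 0 2] h
    by (simp add: normal_moment_def fact_numeral power2_eq_square field_simps)
qed

text \<open>Lebesgue measure on the vector space is the image of a product over
  \<open>Basis\<close>. Density and monomial factor over the coordinates, so the moment is a product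
  of one-dimensional ones.\<close>

lemma gaussian_moments:
  fixes p :: "'n::finite \<Rightarrow> nat"
  assumes h: "0 < h"
    and D: "distr M borel \<Delta> = density lborel (\<lambda>x :: real^'n. ennreal (\<Prod>i\<in>UNIV. normal_density 0 (sqrt h) (x $ i)))"
    and \<Delta>: "\<Delta> \<in> borel_measurable M"
  shows "integrable M (\<lambda>w. \<Prod>i\<in>UNIV. (\<Delta> w $ i) ^ p i)"
    "(\<integral>w. (\<Prod>i\<in>UNIV. (\<Delta> w $ i) ^ p i) \<partial>M) = (\<Prod>i\<in>UNIV. normal_moment h (p i))"
proof -
  interpret product_sigma_finite "\<lambda>_ :: real^'n. lborel :: real measure" ..
  have s: "0 < sqrt h" using h by simp
  define \<phi> where "\<phi> i x = normal_density 0 (sqrt h) x * x ^ p i" for i x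
  have \<phi>i: "integrable lborel (\<phi> i)" for i
    using integrable_normal_moment[OF s, of 0 "p i"] by (simp add: \<phi>_def[abs_def])
  define P where "P x = (\<Prod>i\<in>UNIV. (x $ i) ^ p i)" for x :: "real^'n"
  define d where "d x = (\<Prod>i\<in>UNIV. normal_density 0 (sqrt h) (x $ i))" for x :: "real^'n"
  have [measurable]: "(\<lambda>x :: real^'n. x $ i) \<in> borel_measurable borel" for i
    by (intro borel_measurable_continuous_onI continuous_intros)
  have Pm [measurable]: "P \<in> borel_measurable borel" and dm [measurable]: "d \<in> borel_measurable borel"
    unfolding P_def d_def by measurable
  have d0: "0 \<le> d x" for x by (simp add: d_def prod_nonneg)
  have B: "(Basis :: (real^'n) set) = range (\<lambda>i. axis i 1)" by (auto simp: Basis_vec_def)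
  have coord: "(\<Sum>b\<in>Basis. f b *\<^sub>R b) $ i = f (axis i 1)" for f :: "real^'n \<Rightarrow> real" and i
  proof -
    have "axis i 1 \<in> (Basis :: (real^'n) set)" by (simp add: B)
    then show ?thesis by (simp only: cart_eq_inner_axis inner_sum_left_Basis)
  qed
  have prod: "d (\<Sum>b\<in>Basis. f b *\<^sub>R b) * P (\<Sum>b\<in>Basis. f b *\<^sub>R b) = (\<Prod>b\<in>Basis. \<phi> (axis_index b) (f b))"
    for f :: "real^'n \<Rightarrow> real"
  proof -
    have "(\<Prod>b\<in>Basis. \<phi> (axis_index b) (f b)) = (\<Prod>i\<in>UNIV. \<phi> i (f (axis i 1)))"
      unfolding B by (subst prod.reindex) (auto simp: inj_on_def axis_eq_axis)
    then show ?thesis by (simp only: d_def P_def coord \<phi>_def prod.distrib)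
  qed
  have sm [measurable]: "(\<lambda>f. \<Sum>b\<in>Basis. f b *\<^sub>R b) \<in> measurable (\<Pi>\<^sub>M b\<in>(Basis :: (real^'n) set). lborel) borel"
    by measurable
  have "integrable (\<Pi>\<^sub>M b\<in>(Basis :: (real^'n) set). lborel) (\<lambda>f. \<Prod>b\<in>Basis. \<phi> (axis_index b) (f b))"
    by (intro product_integrable_prod \<phi>i) simp
  then have i: "integrable lborel (\<lambda>x. d x * P x)"
    unfolding lborel_eq[where 'a="real^'n"] using sm by (subst integrable_distr_eq) (auto simp: prod)
  have "(\<integral>x. d x * P x \<partial>lborel) = (\<integral>f. (\<Prod>b\<in>Basis. \<phi> (axis_index b) (f b)) \<partial>(\<Pi>\<^sub>M b\<in>(Basis :: (real^'n) set). lborel))"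
    unfolding lborel_eq[where 'a="real^'n"] using sm by (subst integral_distr) (auto simp: prod)
  also have "\<dots> = (\<Prod>b\<in>(Basis :: (real^'n) set). integral\<^sup>L lborel (\<phi> (axis_index b)))"
    by (intro product_integral_prod \<phi>i) simp
  also have "\<dots> = (\<Prod>i\<in>UNIV. normal_moment h (p i))"
    unfolding B by (subst prod.reindex) (auto simp: inj_on_def axis_eq_axis \<phi>_def[abs_def] normal_moment_def)
  finally have v: "(\<integral>x. d x * P x \<partial>lborel) = (\<Prod>i\<in>UNIV. normal_moment h (p i))" .
  have D': "distr M borel \<Delta> = density lborel (\<lambda>x. ennreal (d x))" unfolding D d_def ..
  have "integrable (distr M borel \<Delta>) P"
    unfolding D' using i d0 by (subst integrable_density) auto
  then show "integrable M (\<lambda>w. \<Prod>i\<in>UNIV. (\<Delta> w $ i) ^ p i)"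
    using \<Delta> by (subst (asm) integrable_distr_eq) (auto simp: P_def)
  have "(\<integral>w. P (\<Delta> w) \<partial>M) = (\<integral>x. P x \<partial>distr M borel \<Delta>)" using \<Delta> by (subst integral_distr) auto
  also have "\<dots> = (\<integral>x. d x * P x \<partial>lborel)" unfolding D' using d0 by (subst integral_density) auto
  finally show "(\<integral>w. (\<Prod>i\<in>UNIV. (\<Delta> w $ i) ^ p i) \<partial>M) = (\<Prod>i\<in>UNIV. normal_moment h (p i))"
    using v by (simp add: P_def)
qed

text \<open>The fourth power of the norm expands into \<open>CARD('n) ^ 2\<close> products of two
  squared coordinates, each of mean at most \<open>3 * h\<^sup>2\<close>, the fourth moment of one
  coordinate. In the proof exponents are sums of \<open>if\<close> terms, so that coinciding indices
  add up.\<close>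

lemma gaussian_low_moments:
  assumes h: "0 < h"
    and D: "distr M borel \<Delta> = density lborel (\<lambda>x :: real^'n. ennreal (\<Prod>i\<in>UNIV. normal_density 0 (sqrt h) (x $ i)))"
    and \<Delta>: "\<Delta> \<in> borel_measurable M"
  shows "integrable M (\<lambda>w. \<Delta> w $ i)" "(\<integral>w. \<Delta> w $ i \<partial>M) = 0"
    "integrable M (\<lambda>w. \<Delta> w $ i * \<Delta> w $ j)" "(\<integral>w. \<Delta> w $ i * \<Delta> w $ j \<partial>M) = (if i = j then h else 0)"
    "integrable M (\<lambda>w. norm (\<Delta> w) ^ 4)" "(\<integral>w. norm (\<Delta> w) ^ 4 \<partial>M) \<le> 3 * real CARD('n) ^ 2 * h\<^sup>2"
proof -
  note mom = gaussian_moments[OF h D \<Delta>]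
  note val = normal_moment_values[OF h]
  have single: "(\<Prod>k\<in>UNIV. x k ^ (if k = i then n else 0)) = x i ^ n" for x :: "'n \<Rightarrow> real" and i n
  proof -
    have "(\<Prod>k\<in>UNIV. x k ^ (if k = i then n else 0)) = (\<Prod>k\<in>UNIV. if k = i then x k ^ n else 1)"
      by (intro prod.cong) auto
    then show ?thesis by simp
  qed
  have pair: "(\<Prod>k\<in>UNIV. x k ^ ((if k = i then n else 0) + (if k = j then n else 0))) = x i ^ n * x j ^ n" for x :: "'n \<Rightarrow> real" and i j n
    unfolding power_add prod.distrib single ..
  have single_m: "(\<Prod>k\<in>UNIV. normal_moment h (if k = i then n else 0)) = normal_moment h n" for i :: 'n and n
  proof -
    have "(\<Prod>k\<in>UNIV. normal_moment h (if k = i then n else 0)) = (\<Prod>k\<in>UNIV. if k = i then normal_moment h n else 1)"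
      by (intro prod.cong) (auto simp: val)
    then show ?thesis by simp
  qed
  show "integrable M (\<lambda>w. \<Delta> w $ i)" "(\<integral>w. \<Delta> w $ i \<partial>M) = 0"
    using mom[of "\<lambda>k. if k = i then 1 else 0"] unfolding single single_m val by simp_all
  have pair_m: "(\<Prod>k\<in>UNIV. normal_moment h ((if k = i then n else 0) + (if k = j then n else 0))) =
     (if i = j then normal_moment h (2 * n) else normal_moment h n * normal_moment h n)" for i j :: 'n and n
  proof (cases "i = j")
    case True
    have "(\<Prod>k\<in>UNIV. normal_moment h ((if k = i then n else 0) + (if k = j then n else 0))) =
       (\<Prod>k\<in>UNIV. normal_moment h (if k = i then n + n else 0))"
      using True by (intro prod.cong) auto
    then show ?thesis unfolding single_m using True by (simp add: mult_2)
  next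
    case False
    have "(\<Prod>k\<in>UNIV. normal_moment h ((if k = i then n else 0) + (if k = j then n else 0))) =
       (\<Prod>k\<in>UNIV. normal_moment h (if k = i then n else 0) * normal_moment h (if k = j then n else 0))"
      using False by (intro prod.cong) (auto simp: val)
    then show ?thesis using False by (simp only: prod.distrib single_m if_False)
  qed
  show "integrable M (\<lambda>w. \<Delta> w $ i * \<Delta> w $ j)" "(\<integral>w. \<Delta> w $ i * \<Delta> w $ j \<partial>M) = (if i = j then h else 0)"
    using mom[of "\<lambda>k. (if k = i then 1 else 0) + (if k = j then 1 else 0)"] unfolding pair pair_m
    using val by (simp_all add: numeral_2_eq_2[symmetric])
  have sq: "integrable M (\<lambda>w. (\<Delta> w $ i)\<^sup>2 * (\<Delta> w $ j)\<^sup>2)" "(\<integral>w. (\<Delta> w $ i)\<^sup>2 * (\<Delta> w $ j)\<^sup>2 \<partial>M) \<le> 3 * h\<^sup>2" for i j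
  proof -
    note m2 = mom[of "\<lambda>k. (if k = i then 2 else 0) + (if k = j then 2 else 0)", unfolded pair pair_m]
    show "integrable M (\<lambda>w. (\<Delta> w $ i)\<^sup>2 * (\<Delta> w $ j)\<^sup>2)" by (rule m2(1))
    show "(\<integral>w. (\<Delta> w $ i)\<^sup>2 * (\<Delta> w $ j)\<^sup>2 \<partial>M) \<le> 3 * h\<^sup>2"
      unfolding m2(2) using val by (simp add: power2_eq_square)
  qed
  have n4: "norm x ^ 4 = (\<Sum>i\<in>UNIV. \<Sum>j\<in>UNIV. (x $ i)\<^sup>2 * (x $ j)\<^sup>2)" for x :: "real^'n"
  proof -
    have "norm x ^ 4 = ((norm x)\<^sup>2)\<^sup>2" by (simp add: power_mult[symmetric])
    also have "(norm x)\<^sup>2 = (\<Sum>i\<in>UNIV. (x $ i)\<^sup>2)"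
      unfolding power2_norm_eq_inner inner_vec_def by (simp add: power2_eq_square)
    finally show ?thesis by (simp add: power2_eq_square sum_product)
  qed
  show "integrable M (\<lambda>w. norm (\<Delta> w) ^ 4)" unfolding n4 using sq(1) by (intro Bochner_Integration.integrable_sum)
  have "(\<integral>w. norm (\<Delta> w) ^ 4 \<partial>M) = (\<Sum>i\<in>UNIV. \<Sum>j\<in>UNIV. (\<integral>w. (\<Delta> w $ i)\<^sup>2 * (\<Delta> w $ j)\<^sup>2 \<partial>M))"
    unfolding n4 using sq(1) by (simp add: Bochner_Integration.integral_sum)
  also have "\<dots> \<le> (\<Sum>i\<in>(UNIV::'n set). \<Sum>j\<in>(UNIV::'n set). 3 * h\<^sup>2)"
    by (intro sum_mono sq(2))
  also have "\<dots> = 3 * real CARD('n) ^ 2 * h\<^sup>2" by (simp add: power2_eq_square)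
  finally show "(\<integral>w. norm (\<Delta> w) ^ 4 \<partial>M) \<le> 3 * real CARD('n) ^ 2 * h\<^sup>2" .
qed

section \<open>Continuity in time of conditional laws\<close>

text \<open>Conditional dominated convergence. The tail suprema \<open>D k\<close> are bounded and
  tend to zero, so their means vanish. Their conditional expectations dominate the differences to be
  estimated.\<close>

lemma cond_exp_dominated_tendsto:
  fixes f :: "nat \<Rightarrow> 'w \<Rightarrow> real"
  assumes M: "prob_space M" and B: "subalgebra M B"
    and f [measurable]: "\<And>n. f n \<in> borel_measurable M" "f0 \<in> borel_measurable M"
    and C: "\<And>n w. \<bar>f n w\<bar> \<le> C" "\<And>w. \<bar>f0 w\<bar> \<le> C"
    and lim: "\<And>w. w \<in> space M \<Longrightarrow> (\<lambda>n. f n w) \<longlonglongrightarrow> f0 w"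
  shows "AE w in M. (\<lambda>n. real_cond_exp M B (f n) w) \<longlonglongrightarrow> real_cond_exp M B f0 w"
proof -
  interpret prob_space M by (rule M)
  interpret F: finite_measure_subalgebra M B by unfold_locales (rule B)
  have fi: "integrable M (f n)" "integrable M f0" for n using C by (auto intro!: integrable_const_bound[where B=C])
  define D where "D k w = (SUP j\<in>{k..}. \<bar>f j w - f0 w\<bar>)" for k :: nat and w
  have le2: "\<bar>f j w - f0 w\<bar> \<le> 2 * C" for j w
    using order_trans[OF abs_triangle_ineq4 add_mono[OF C(1)[of j w] C(2)[of w]]] by simp
  then have bdd: "bdd_above ((\<lambda>j. \<bar>f j w - f0 w\<bar>) ` {k..})" for k w
    by (intro bdd_aboveI[where M="2 * C"]) auto
  have Dm [measurable]: "D k \<in> borel_measurable M" for k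
    unfolding D_def using bdd by (intro borel_measurable_cSUP) auto
  have D_ge: "\<bar>f j w - f0 w\<bar> \<le> D k w" if "k \<le> j" for j k w
    unfolding D_def using that bdd by (intro cSUP_upper) auto
  have D_le: "D k w \<le> 2 * C" for k w
    unfolding D_def using le2 by (intro cSUP_least) auto
  have D0: "0 \<le> D k w" for k w using D_ge[of k k w] by linarith
  have Db: "norm (D k w) \<le> 2 * C" for k w using D_le D0 by simp
  have Di: "integrable M (D k)" for k using Db by (intro integrable_const_bound[where B="2 * C"]) auto
  have "(\<lambda>k. \<integral>w. D k w \<partial>M) \<longlonglongrightarrow> (\<integral>w. 0 \<partial>M)"
  proof (rule integral_dominated_convergence[where w="\<lambda>_. 2 * C"])
    show "AE w in M. (\<lambda>k. D k w) \<longlonglongrightarrow> 0"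
    proof (rule AE_I2, rule LIMSEQ_I)
      fix w and e :: real assume "w \<in> space M" "e > 0"
      from LIMSEQ_D[OF lim[OF this(1)], of "e / 2"] this(2) obtain N where N: "\<And>n. n \<ge> N \<Longrightarrow> \<bar>f n w - f0 w\<bar> < e / 2"
        by auto
      have "norm (D k w - 0) < e" if "k \<ge> N" for k
      proof -
        have "D k w \<le> e / 2" unfolding D_def using N that by (intro cSUP_least) (auto intro: less_imp_le)
        then show ?thesis using D0[of k w] \<open>e > 0\<close> by simp
      qed
      then show "\<exists>no. \<forall>n\<ge>no. norm (D n w - 0) < e" by blast
    qed
  qed (use Db in auto)
  then have ED: "(\<lambda>k. \<integral>w. D k w \<partial>M) \<longlonglongrightarrow> 0" by simp
  define d where "d k = real_cond_exp M B (D k)" for k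
  have dm [measurable]: "d k \<in> borel_measurable M" for k by (simp add: d_def)
  have d0: "AE w in M. 0 \<le> d k w" for k unfolding d_def using D0 by (intro F.real_cond_exp_pos) auto
  have dom: "AE w in M. \<bar>real_cond_exp M B (f j) w - real_cond_exp M B f0 w\<bar> \<le> d k w" if kj: "k \<le> j" for k j
  proof -
    have "AE w in M. real_cond_exp M B (\<lambda>w. f j w - f0 w) w \<le> d k w"
      unfolding d_def using D_ge[OF kj] fi Di by (intro F.real_cond_exp_mono AE_I2) (auto simp: abs_le_iff)
    moreover have "AE w in M. real_cond_exp M B (\<lambda>w. f0 w - f j w) w \<le> d k w"
      unfolding d_def using D_ge[OF kj] fi Di by (intro F.real_cond_exp_mono AE_I2) (auto simp: abs_le_iff)
    moreover have "AE w in M. real_cond_exp M B (\<lambda>w. f j w - f0 w) w = real_cond_exp M B (f j) w - real_cond_exp M B f0 w"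
      using fi by (intro F.real_cond_exp_diff)
    moreover have "AE w in M. real_cond_exp M B (\<lambda>w. f0 w - f j w) w = real_cond_exp M B f0 w - real_cond_exp M B (f j) w"
      using fi by (intro F.real_cond_exp_diff)
    ultimately show ?thesis by eventually_elim (simp add: abs_le_iff)
  qed
  \<comment> \<open>With the infimum no limit of \<open>d k\<close> has to be established: it has
    integral zero, so at almost every point some \<open>d k\<close> lies below any given positive
    number, and this \<open>d k\<close> dominates all later differences.\<close>
  define I where "I w = (INF k. ennreal (d k w))" for w
  have [measurable]: "I \<in> borel_measurable M" unfolding I_def by measurable
  have "(\<integral>\<^sup>+w. I w \<partial>M) \<le> ennreal (\<integral>w. D k w \<partial>M)" for k
  proof -
    have "(\<integral>\<^sup>+w. I w \<partial>M) \<le> (\<integral>\<^sup>+w. ennreal (d k w) \<partial>M)"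
      unfolding I_def by (intro nn_integral_mono INF_lower) simp
    also have "\<dots> = ennreal (\<integral>w. d k w \<partial>M)"
      using d0 F.real_cond_exp_int(1)[OF Di] by (intro nn_integral_eq_integral) (auto simp: d_def)
    also have "(\<integral>w. d k w \<partial>M) = (\<integral>w. D k w \<partial>M)"
      unfolding d_def by (rule F.real_cond_exp_int(2)[OF Di])
    finally show ?thesis .
  qed
  then have "(\<integral>\<^sup>+w. I w \<partial>M) \<le> ennreal 0"
    by (intro LIMSEQ_le_const[OF tendsto_ennrealI[OF ED]]) auto
  then have "AE w in M. I w = 0" by (simp add: nn_integral_0_iff_AE)
  moreover have "AE w in M. \<forall>k j. k \<le> j \<longrightarrow> \<bar>real_cond_exp M B (f j) w - real_cond_exp M B f0 w\<bar> \<le> d k w"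
    using dom by (simp add: AE_all_countable)
  ultimately show ?thesis
  proof eventually_elim
    case (elim w)
    show ?case
    proof (rule LIMSEQ_I)
      fix e :: real assume "e > 0"
      then have "I w < ennreal e" using elim(1) by simp
      then obtain k where k: "ennreal (d k w) < ennreal e" unfolding I_def by (auto simp: INF_less_iff)
      then have "d k w < e" using \<open>e > 0\<close> by (simp add: ennreal_less_iff ennreal_lessI not_le[symmetric] ennreal_leI) (meson ennreal_leI not_le)
      then show "\<exists>no. \<forall>n\<ge>no. norm (real_cond_exp M B (f n) w - real_cond_exp M B f0 w) < e"
        using elim(2) by (intro exI[of _ k]) (force intro: le_less_trans)
    qed
  qed
qed

text \<open>All laws are conditional laws given one sigma-algebra \<open>B\<close>, so conditional
  dominated convergence applies to each hat. The hats are countable and generate the topology, which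
  leaves one null set.\<close>

lemma conditional_laws_tendsto:
  fixes Y :: "nat \<Rightarrow> 'w \<Rightarrow> real^'d"
  assumes M: "prob_space M" and B: "subalgebra M B"
    and \<kappa>: "\<And>n. \<kappa> n \<in> borel_measurable B" "\<kappa>0 \<in> borel_measurable B"
    and Y: "\<And>n. Y n \<in> borel_measurable M" "Y0 \<in> borel_measurable M"
    and dis: "\<And>n Z. Z \<in> borel_measurable B \<Longrightarrow> disintegrates M (Z :: 'w \<Rightarrow> real) (\<kappa> n) (Y n)"
      "\<And>Z. Z \<in> borel_measurable B \<Longrightarrow> disintegrates M (Z :: 'w \<Rightarrow> real) \<kappa>0 Y0"
    and lim: "\<And>w. w \<in> space M \<Longrightarrow> (\<lambda>n. Y n w) \<longlonglongrightarrow> Y0 w"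
  shows "AE w in M. (\<lambda>n. \<kappa> n w) \<longlonglongrightarrow> \<kappa>0 w"
proof -
  interpret prob_space M by (rule M)
  interpret F: finite_measure_subalgebra M B by unfold_locales (rule B)
  have cond: "AE w in M. real_cond_exp M B (\<lambda>w. g (y w)) w = (\<integral>x. g x \<partial>meas (k w))"
    if k: "k \<in> borel_measurable B" and y [measurable]: "y \<in> borel_measurable M"
      and dis: "\<And>Z. Z \<in> borel_measurable B \<Longrightarrow> disintegrates M (Z :: 'w \<Rightarrow> real) k y"
      and g [measurable]: "g \<in> borel_measurable borel" and C: "\<And>x. \<bar>g x\<bar> \<le> C"
    for k and y :: "'w \<Rightarrow> real^'d" and g :: "real^'d \<Rightarrow> real" and C
  proof -
    have [measurable]: "k \<in> borel_measurable M" by (rule measurable_from_subalg[OF B k])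
    have kg: "(\<lambda>w. \<integral>x. g x \<partial>meas (k w)) \<in> borel_measurable B"
      by (rule borel_measurable_integral_meas[OF _ k]) (simp add: case_prod_beta measurable_compose[OF measurable_snd g])
    have bd: "\<bar>\<integral>x. g x \<partial>meas n\<bar> \<le> C" for n using integral_meas_bounded[of g C n] C by simp
    show ?thesis
    proof (rule F.real_cond_exp_charact)
      show "integrable M (\<lambda>w. g (y w))" using C by (intro integrable_const_bound[where B=C]) auto
      show "integrable M (\<lambda>w. \<integral>x. g x \<partial>meas (k w))"
        using bd measurable_from_subalg[OF B kg] by (intro integrable_const_bound[where B=C]) auto
      show "(\<lambda>w. \<integral>x. g x \<partial>meas (k w)) \<in> borel_measurable B" by (rule kg)
      fix A assume A: "A \<in> sets B"
      \<comment> \<open>With \<open>indicator A\<close> as conditioning variable this test function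
        evaluates to \<open>indicator A w * g x\<close>; real-valued \<open>Z\<close> are thus
        enough for all sets \<open>A\<close> of \<open>B\<close>.\<close>
      define G where "G = (\<lambda>(z::real, x). indicator {1} z * g x)"
      have "(\<lambda>z :: real \<times> (real^'d). indicator {1} (fst z) * g (snd z)) \<in> borel_measurable (borel \<Otimes>\<^sub>M borel)"
        by measurable
      then have "G \<in> borel_measurable borel" by (simp add: G_def case_prod_beta borel_prod)
      moreover have "bounded (range G)" unfolding bounded_iff
        by (intro exI[of _ C]) (use C order_trans[OF abs_ge_zero C] in \<open>auto simp: G_def indicator_def\<close>)
      moreover have "(indicator A :: _ \<Rightarrow> real) \<in> borel_measurable B" using A by simp
      ultimately have "(\<integral>w. G (indicator A w, y w) \<partial>M) = (\<integral>w. (\<integral>x. G (indicator A w, x) \<partial>meas (k w)) \<partial>M)"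
        using dis unfolding disintegrates_def by blast
      moreover have "G (indicator A w, x) = indicator A w * g x" for w x
        by (simp add: G_def indicator_def)
      ultimately show "(\<integral>w\<in>A. g (y w) \<partial>M) = (\<integral>w\<in>A. (\<integral>x. g x \<partial>meas (k w)) \<partial>M)"
        by (simp add: set_lebesgue_integral_def)
    qed
  qed
  have "AE w in M. (\<lambda>n. \<integral>x. hat L x \<partial>meas (\<kappa> n w)) \<longlonglongrightarrow> (\<integral>x. hat L x \<partial>meas (\<kappa>0 w))" if L: "L \<in> hat_lists" for L
  proof -
    obtain C where C: "\<And>x. \<bar>hat L x\<bar> \<le> C" using bounded_hat[OF L] by (auto simp: bounded_iff)
    have "AE w in M. (\<lambda>n. real_cond_exp M B (\<lambda>w. hat L (Y n w)) w) \<longlonglongrightarrow> real_cond_exp M B (\<lambda>w. hat L (Y0 w)) w"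
    proof (rule cond_exp_dominated_tendsto[OF M B _ _ C C])
      show "(\<lambda>n. hat L (Y n w)) \<longlonglongrightarrow> hat L (Y0 w)" if "w \<in> space M" for w
        using continuous_on_hat[of UNIV L] lim[OF that] by (rule continuous_on_tendsto_compose) auto
    qed (use Y in auto)
    moreover have "AE w in M. \<forall>n. real_cond_exp M B (\<lambda>w. hat L (Y n w)) w = (\<integral>x. hat L x \<partial>meas (\<kappa> n w))"
      unfolding AE_all_countable by (intro allI cond[OF \<kappa>(1) Y(1) dis(1) _ C]) auto
    moreover have "AE w in M. real_cond_exp M B (\<lambda>w. hat L (Y0 w)) w = (\<integral>x. hat L x \<partial>meas (\<kappa>0 w))"
      by (intro cond[OF \<kappa>(2) Y(2) dis(2) _ C]) auto
    ultimately show ?thesis by eventually_elim simp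
  qed
  then have "AE w in M. \<forall>L\<in>hat_lists. (\<lambda>n. \<integral>x. hat L x \<partial>meas (\<kappa> n w)) \<longlonglongrightarrow> (\<integral>x. hat L x \<partial>meas (\<kappa>0 w))"
    by (subst AE_ball_countable[OF countable_hat_lists]) auto
  then show ?thesis by eventually_elim (auto intro: tendsto_prob_measure_hatI)
qed

text \<open>Sampling at the left neighbour on the grid of mesh \<open>1 / Suc n\<close> gives
  jointly measurable approximations with countably many sampling times; continuity of the paths
  gives the limit.\<close>

lemma measurable_continuous_process:
  fixes f :: "real \<Rightarrow> 'w \<Rightarrow> 'b::metric_space"
  assumes f: "\<And>s. f s \<in> borel_measurable M" and c: "\<And>w. w \<in> space M \<Longrightarrow> continuous_on UNIV (\<lambda>s. f s w)"
  shows "(\<lambda>(s, w). f s w) \<in> borel_measurable ((borel :: real measure) \<Otimes>\<^sub>M M)"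
proof -
  define r where "r n s = real_of_int \<lfloor>real (Suc n) * s\<rfloor> / real (Suc n)" for n s
  have r: "(\<lambda>n. r n s) \<longlonglongrightarrow> s" for s
  proof (rule LIMSEQ_I)
    fix e :: real assume "e > 0"
    then obtain N where N: "1 / real (Suc N) < e" using nat_approx_posE by blast
    have "norm (r n s - s) < e" if "n \<ge> N" for n
    proof -
      have 1: "\<bar>real_of_int \<lfloor>real (Suc n) * s\<rfloor> - real (Suc n) * s\<bar> \<le> 1" by linarith
      have "r n s - s = (real_of_int \<lfloor>real (Suc n) * s\<rfloor> - real (Suc n) * s) / real (Suc n)"
        unfolding r_def by (simp add: diff_divide_distrib)
      then have "\<bar>r n s - s\<bar> = \<bar>real_of_int \<lfloor>real (Suc n) * s\<rfloor> - real (Suc n) * s\<bar> / real (Suc n)"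
        by (simp only: abs_divide abs_of_nat)
      also have "\<dots> \<le> 1 / real (Suc n)" by (rule divide_right_mono[OF 1]) simp
      also have "1 / real (Suc n) \<le> 1 / real (Suc N)" using that by (intro divide_left_mono) auto
      also have "\<dots> < e" by (rule N)
      finally show ?thesis by simp
    qed
    then show "\<exists>no. \<forall>n\<ge>no. norm (r n s - s) < e" by blast
  qed
  have m: "(\<lambda>z. f (r n (fst z)) (snd z)) \<in> borel_measurable ((borel :: real measure) \<Otimes>\<^sub>M M)" for n
    unfolding r_def
  proof (rule measurable_compose_countable[where f="\<lambda>i z. f (real_of_int i / real (Suc n)) (snd z)"])
    show "(\<lambda>z. f (real_of_int i / real (Suc n)) (snd z)) \<in> borel_measurable ((borel :: real measure) \<Otimes>\<^sub>M M)" for i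
      using measurable_compose[OF measurable_snd f] .
    show "(\<lambda>z. \<lfloor>real (Suc n) * fst z\<rfloor>) \<in> (borel :: real measure) \<Otimes>\<^sub>M M \<rightarrow>\<^sub>M count_space UNIV" by measurable
  qed
  show ?thesis unfolding case_prod_beta
  proof (rule borel_measurable_LIMSEQ_metric[OF m])
    fix z assume "z \<in> space ((borel :: real measure) \<Otimes>\<^sub>M M)"
    then have "continuous_on UNIV (\<lambda>s. f s (snd z))" by (intro c) (auto simp: space_pair_measure)
    from continuous_on_tendsto_compose[OF this r] show "(\<lambda>n. f (r n (fst z)) (snd z)) \<longlonglongrightarrow> f (fst z) (snd z)" by simp
  qed
qed


section \<open>Adaptedness of solutions\<close>

lemma almost_measurable_vec:
  fixes Z :: "'w \<Rightarrow> real^'n"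
  assumes "\<And>i. almost_measurable M H (\<lambda>w. Z w $ i)"
  shows "almost_measurable M H Z"
proof -
  have "\<forall>i. \<exists>Z'. Z' \<in> borel_measurable H \<and> (AE w in M. Z w $ i = Z' w)" using assms by (auto simp: almost_measurable_def)
  from choice[OF this] obtain Z' where Z': "\<And>i. Z' i \<in> borel_measurable H" "\<And>i. AE w in M. Z w $ i = Z' i w" by blast
  have "AE w in M. \<forall>i. Z w $ i = Z' i w" using Z'(2) by (subst AE_all_countable) auto
  define V :: "'w \<Rightarrow> real^'n" where "V w = (\<Sum>i\<in>UNIV. Z' i w *\<^sub>R axis i 1)" for w
  have "AE w in M. Z w = V w"
    using \<open>AE w in M. \<forall>i. Z w $ i = Z' i w\<close>
  proof eventually_elim
    case (elim w)
    then show ?case using basis_expansion[of "Z w"] by (simp add: V_def scalar_mult_eq_scaleR)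
  qed
  moreover have "V \<in> borel_measurable H"
    unfolding V_def using Z'(1) by (intro borel_measurable_sum borel_measurable_scaleR) auto
  ultimately show ?thesis unfolding almost_measurable_def
    by (intro bexI[of _ V])
qed

lemma almost_measurable_add:
  fixes Y Z :: "'w \<Rightarrow> 'b::{second_countable_topology, topological_monoid_add}"
  assumes "almost_measurable M H Y" "almost_measurable M H Z"
  shows "almost_measurable M H (\<lambda>w. Y w + Z w)"
proof -
  have "(\<lambda>z :: 'b \<times> 'b. fst z + snd z) \<in> borel_measurable borel"
    by (intro borel_measurable_continuous_onI continuous_intros)
  from almost_measurable_compose[OF almost_measurable_Pair[OF assms] this] show ?thesis by simp
qed

text \<open>The exponential weight of the Picard iteration: integrating it up to \<open>s\<close>
  costs a division by \<open>c\<close>, which absorbs the Lipschitz constant.\<close>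

lemma set_integral_exp_le:
  fixes c t s :: real
  assumes "0 < c" "t \<le> s"
  shows "(LBINT \<tau>:{t..s}. exp (c * (\<tau> - t))) \<le> exp (c * (s - t)) / c"
    "set_integrable lborel {t..s} (\<lambda>\<tau>. exp (c * (\<tau> - t)))"
proof -
  have "(LBINT \<tau>:{t..s}. exp (c * (\<tau> - t))) = exp (c * (s - t)) / c - exp (c * (t - t)) / c"
  proof -
    have "(\<integral>\<tau>. exp (c * (\<tau> - t)) * indicator {t..s} \<tau> \<partial>lborel) = exp (c * (s - t)) / c - exp (c * (t - t)) / c"
    proof (rule integral_FTC_Icc_real[OF assms(2)])
      show "((\<lambda>\<tau>. exp (c * (\<tau> - t)) / c) has_real_derivative exp (c * (x - t))) (at x)" for x
        using assms(1) by (auto intro!: derivative_eq_intros)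
      show "isCont (\<lambda>\<tau>. exp (c * (\<tau> - t))) x" for x by (intro continuous_intros)
    qed
    then show ?thesis by (simp add: set_lebesgue_integral_def mult.commute)
  qed
  then show "(LBINT \<tau>:{t..s}. exp (c * (\<tau> - t))) \<le> exp (c * (s - t)) / c" using assms(1) by simp
  show "set_integrable lborel {t..s} (\<lambda>\<tau>. exp (c * (\<tau> - t)))"
    by (intro borel_integrable_atLeastAtMost') (intro continuous_intros)
qed

lemma set_integrable_bounded_Icc:
  fixes f :: "real \<Rightarrow> 'b::{banach,second_countable_topology}"
  assumes "f \<in> borel_measurable borel" "\<And>\<tau>. norm (f \<tau>) \<le> C"
  shows "set_integrable lborel {t..s} f"
  unfolding set_integrable_def
proof (rule Bochner_Integration.integrable_bound[where f="\<lambda>\<tau>. C * indicator {t..s} \<tau>"])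
  show "AE \<tau> in lborel. norm (indicator {t..s} \<tau> *\<^sub>R f \<tau>) \<le> norm (C * indicator {t..s} \<tau>)"
    using assms(2) by (intro AE_I2) (auto simp: indicator_def intro: order_trans[OF _ abs_ge_self])
qed (use assms(1) in \<open>auto simp: emeasure_lborel_Icc_eq\<close>)

section \<open>Picard iteration for an equation with additive noise\<close>

context
  fixes M H :: "'w measure" and b :: "real \<Rightarrow> 'w \<Rightarrow> real^'d \<Rightarrow> real^'d" and N S :: "real \<Rightarrow> 'w \<Rightarrow> real^'d"
    and t r C L :: real
  assumes M: "prob_space M" and H: "subalgebra M H" and tr: "t \<le> r" and L: "0 < L"
    and b_meas: "(\<lambda>((s, w), x). b s w x) \<in> borel_measurable ((borel \<Otimes>\<^sub>M M) \<Otimes>\<^sub>M borel)"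
    and b_bound: "\<And>s w x. norm (b s w x) \<le> C"
    and b_lip: "\<And>s w x y. norm (b s w x - b s w y) \<le> L * norm (x - y)"
    and b_adapted: "\<And>s Z. s \<in> {t..r} \<Longrightarrow> almost_measurable M H Z \<Longrightarrow> almost_measurable M H (\<lambda>w. b s w (Z w))"
    and N_meas: "\<And>s. N s \<in> borel_measurable M"
    and N_cont: "\<And>w. w \<in> space M \<Longrightarrow> continuous_on UNIV (\<lambda>s. N s w)"
    and N_adapted: "\<And>s. s \<in> {t..r} \<Longrightarrow> almost_measurable M H (N s)"
    and S_meas: "\<And>s. S s \<in> borel_measurable M"
    and S_cont: "\<And>w. w \<in> space M \<Longrightarrow> continuous_on UNIV (\<lambda>s. S s w)"
    and S_eq: "AE w in M. \<forall>s\<in>{t..r}. S s w = N s w + (LBINT \<tau>:{t..s}. b \<tau> w (S \<tau> w))"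
begin

text \<open>Picard iterates. Each is adapted up to null sets, being built from time integrals of
  adapted variables, and they converge to the given solution, which inherits adaptedness in the
  limit.\<close>

private primrec P :: "nat \<Rightarrow> real \<Rightarrow> 'w \<Rightarrow> real^'d" where
  "P 0 = N"
| "P (Suc k) = (\<lambda>s w. N s w + (LBINT \<tau>:{t..s}. b \<tau> w (P k \<tau> w)))"

private lemma b_measurable:
  assumes "Y \<in> measurable Q (borel \<Otimes>\<^sub>M M)" "Z \<in> borel_measurable Q"
  shows "(\<lambda>q. b (fst (Y q)) (snd (Y q)) (Z q)) \<in> borel_measurable Q"
  using measurable_compose[OF measurable_Pair[OF assms] b_meas] by (simp add: case_prod_beta)

private lemma P_meas: "(\<lambda>(s, w). P k s w) \<in> borel_measurable (borel \<Otimes>\<^sub>M M)"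
proof (induction k)
  case 0
  show ?case using measurable_continuous_process[OF N_meas N_cont] by simp
next
  case (Suc k)
  have "(\<lambda>z. (\<tau> z, snd (fst z))) \<in> measurable ((borel \<Otimes>\<^sub>M M) \<Otimes>\<^sub>M lborel) (borel \<Otimes>\<^sub>M M)"
    if "\<tau> \<in> measurable ((borel \<Otimes>\<^sub>M M) \<Otimes>\<^sub>M lborel) borel" for \<tau> :: "(real \<times> 'w) \<times> real \<Rightarrow> real"
    using that by measurable
  from this[of snd] have Y: "(\<lambda>z. (snd z, snd (fst z))) \<in> measurable ((borel \<Otimes>\<^sub>M M) \<Otimes>\<^sub>M lborel) ((borel :: real measure) \<Otimes>\<^sub>M M)"
    by simp
  have Z: "(\<lambda>z. P k (snd z) (snd (fst z))) \<in> borel_measurable (((borel :: real measure) \<Otimes>\<^sub>M M) \<Otimes>\<^sub>M lborel)"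
    using measurable_compose[OF Y Suc] by simp
  have f: "(\<lambda>z. b (snd z) (snd (fst z)) (P k (snd z) (snd (fst z)))) \<in> borel_measurable (((borel :: real measure) \<Otimes>\<^sub>M M) \<Otimes>\<^sub>M lborel)"
    using b_measurable[OF Y Z] by simp
  have "(\<lambda>z. (if t \<le> snd z \<and> snd z \<le> fst (fst z) then 1 else 0 :: real)) \<in> borel_measurable (((borel :: real measure) \<Otimes>\<^sub>M M) \<Otimes>\<^sub>M lborel)"
    by measurable
  moreover have "indicator {t..fst (fst z)} (snd z) = (if t \<le> snd z \<and> snd z \<le> fst (fst z) then 1 else 0 :: real)" for z :: "(real \<times> 'w) \<times> real"
    by (simp add: indicator_def)
  ultimately have "(\<lambda>z. indicator {t..fst (fst z)} (snd z) :: real) \<in> borel_measurable (((borel :: real measure) \<Otimes>\<^sub>M M) \<Otimes>\<^sub>M lborel)"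
    by simp
  from borel_measurable_scaleR[OF this f]
  have "(\<lambda>(z, \<tau>). indicator {t..fst z} \<tau> *\<^sub>R b \<tau> (snd z) (P k \<tau> (snd z))) \<in> borel_measurable (((borel :: real measure) \<Otimes>\<^sub>M M) \<Otimes>\<^sub>M lborel)"
    by (simp add: case_prod_beta')
  from lborel.borel_measurable_lebesgue_integral[OF this]
  have "(\<lambda>z. LBINT \<tau>:{t..fst z}. b \<tau> (snd z) (P k \<tau> (snd z))) \<in> borel_measurable ((borel :: real measure) \<Otimes>\<^sub>M M)"
    by (simp add: set_lebesgue_integral_def)
  moreover have "(\<lambda>z. N (fst z) (snd z)) \<in> borel_measurable ((borel :: real measure) \<Otimes>\<^sub>M M)"
    using measurable_continuous_process[OF N_meas N_cont] by (simp add: case_prod_beta)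
  ultimately show ?case by (simp add: case_prod_beta)
qed

private lemma bP_meas: "(\<lambda>(s, w). b s w (P k s w)) \<in> borel_measurable (borel \<Otimes>\<^sub>M M)"
  using b_measurable[where Q="borel \<Otimes>\<^sub>M M" and Y="\<lambda>z. z" and Z="\<lambda>z. P k (fst z) (snd z)"] P_meas[of k]
  by (simp add: case_prod_beta)

private lemma bP_section: "w \<in> space M \<Longrightarrow> (\<lambda>s. b s w (P k s w)) \<in> borel_measurable borel"
  using measurable_Pair1[OF bP_meas] by simp

private lemma bS_section: "w \<in> space M \<Longrightarrow> (\<lambda>s. b s w (S s w)) \<in> borel_measurable borel"
proof -
  assume w: "w \<in> space M"
  have "(\<lambda>s. (s, w)) \<in> measurable borel ((borel :: real measure) \<Otimes>\<^sub>M M)" using w by measurable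
  moreover have "(\<lambda>s. S s w) \<in> borel_measurable borel"
    using S_cont[OF w] by (rule borel_measurable_continuous_onI)
  ultimately show ?thesis using b_measurable[of "\<lambda>s. (s, w)" borel "\<lambda>s. S s w"] by simp
qed

private lemma P_adapted: "s \<in> {t..r} \<Longrightarrow> almost_measurable M H (P k s)"
proof (induction k arbitrary: s)
  case 0
  then show ?case by (simp add: N_adapted)
next
  case (Suc k)
  define T where "T = restrict_space lborel {t..s}"
  have T: "finite_measure T" by (rule finite_measureI) (simp add: T_def emeasure_restrict_space space_restrict_space emeasure_lborel_Icc_eq)
  have "almost_measurable M H (\<lambda>w. LBINT \<tau>:{t..s}. b \<tau> w (P k \<tau> w))"
  proof (rule almost_measurable_vec)
    fix i
    have "almost_measurable M H (\<lambda>w. \<integral>\<tau>. b \<tau> w (P k \<tau> w) $ i \<partial>T)"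
    proof (rule almost_measurable_time_integral[OF M T H])
      have "(\<lambda>\<tau>. \<tau>) \<in> measurable T borel" unfolding T_def by (intro measurable_restrict_space1) simp
      then have "(\<lambda>z. (fst z, snd z)) \<in> measurable (T \<Otimes>\<^sub>M M) (borel \<Otimes>\<^sub>M M)" by measurable
      from measurable_compose[OF this bP_meas[of k]]
      have "(\<lambda>z. b (fst z) (snd z) (P k (fst z) (snd z))) \<in> borel_measurable (T \<Otimes>\<^sub>M M)" by simp
      from measurable_compose[OF this, of "\<lambda>x. x $ i"]
      show "(\<lambda>(s, w). b s w (P k s w) $ i) \<in> borel_measurable (T \<Otimes>\<^sub>M M)"
        by (simp add: case_prod_beta borel_measurable_continuous_onI continuous_intros)
      show "\<bar>b \<tau> w (P k \<tau> w) $ i\<bar> \<le> C" for \<tau> w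
        using component_le_norm_cart b_bound order_trans by blast
      fix \<tau> assume "\<tau> \<in> space T"
      then have "\<tau> \<in> {t..r}" using Suc.prems by (auto simp: T_def space_restrict_space)
      from almost_measurable_compose[OF b_adapted[OF this Suc.IH[OF this]], of "\<lambda>x. x $ i"]
      show "almost_measurable M H (\<lambda>w. b \<tau> w (P k \<tau> w) $ i)"
        by (simp add: borel_measurable_continuous_onI continuous_intros)
    qed
    moreover have "AE w in M. (\<integral>\<tau>. b \<tau> w (P k \<tau> w) $ i \<partial>T) = (LBINT \<tau>:{t..s}. b \<tau> w (P k \<tau> w)) $ i"
    proof (rule AE_I2)
      fix w assume "w \<in> space M"
      have "integrable lborel (\<lambda>\<tau>. indicator {t..s} \<tau> *\<^sub>R b \<tau> w (P k \<tau> w))"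
        using set_integrable_bounded_Icc[OF bP_section[OF \<open>w \<in> space M\<close>] b_bound] by (simp add: set_integrable_def)
      from integral_bounded_linear[OF bounded_linear_vec_nth[of i] this]
      show "(\<integral>\<tau>. b \<tau> w (P k \<tau> w) $ i \<partial>T) = (LBINT \<tau>:{t..s}. b \<tau> w (P k \<tau> w)) $ i"
        by (simp add: T_def integral_restrict_space set_lebesgue_integral_def)
    qed
    ultimately show "almost_measurable M H (\<lambda>w. (LBINT \<tau>:{t..s}. b \<tau> w (P k \<tau> w)) $ i)"
      by (rule almost_measurable_cong)
  qed
  from almost_measurable_add[OF N_adapted[OF Suc.prems] this] show ?case by simp
qed

text \<open>Induction with the weight \<open>exp (2 * L * (s - t))\<close>: integrating
  \<open>L\<close> times the weight returns at most half of it, hence the factor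
  \<open>1 / 2\<close> per iteration. The starting constant \<open>C * (r - t)\<close> bounds the
  whole time integral of the drift.\<close>

private lemma P_error:
  assumes w: "w \<in> space M" and eq: "\<forall>s\<in>{t..r}. S s w = N s w + (LBINT \<tau>:{t..s}. b \<tau> w (S \<tau> w))"
  shows "s \<in> {t..r} \<Longrightarrow> norm (P k s w - S s w) \<le> C * (r - t) / 2 ^ k * exp (2 * L * (s - t))"
proof (induction k arbitrary: s)
  have C0: "0 \<le> C" using b_bound[of undefined undefined undefined] norm_ge_zero order_trans by blast
  case 0
  have "norm (P 0 s w - S s w) = norm (LBINT \<tau>:{t..s}. b \<tau> w (S \<tau> w))" using eq 0 by simp
  also have "\<dots> \<le> (LBINT \<tau>:{t..s}. norm (b \<tau> w (S \<tau> w)))"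
    by (rule set_integral_norm_bound[OF set_integrable_bounded_Icc[OF bS_section[OF w] b_bound]])
  also have "\<dots> \<le> (LBINT \<tau>:{t..s}. C)"
  proof (rule set_integral_mono)
    show "set_integrable lborel {t..s} (\<lambda>\<tau>. norm (b \<tau> w (S \<tau> w)))"
      by (rule set_integrable_norm[OF set_integrable_bounded_Icc[OF bS_section[OF w] b_bound]])
    show "set_integrable lborel {t..s} (\<lambda>\<tau>. C)"
      by (rule set_integrable_bounded_Icc[where C=C]) (auto simp: C0)
  qed (rule b_bound)
  also have "\<dots> = C * (s - t)" using 0 by (simp add: set_lebesgue_integral_def)
  also have "\<dots> \<le> C * (r - t) * 1" using 0 C0 by (auto intro!: mult_left_mono)
  also have "\<dots> \<le> C * (r - t) * exp (2 * L * (s - t))"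
    using 0 C0 L tr by (intro mult_left_mono) auto
  finally show ?case by simp
next
  have C0: "0 \<le> C" using b_bound[of undefined undefined undefined] norm_ge_zero order_trans by blast
  case (Suc k)
  define A where "A = C * (r - t) / 2 ^ k"
  have A0: "0 \<le> A" using C0 tr by (simp add: A_def)
  have ts: "t \<le> s" using Suc.prems by simp
  note iP = set_integrable_bounded_Icc[OF bP_section[OF w, of k] b_bound, of t s]
  note iS = set_integrable_bounded_Icc[OF bS_section[OF w] b_bound, of t s]
  have "norm (P (Suc k) s w - S s w) = norm ((LBINT \<tau>:{t..s}. b \<tau> w (P k \<tau> w)) - (LBINT \<tau>:{t..s}. b \<tau> w (S \<tau> w)))"
    using eq Suc.prems by simp
  also have "\<dots> = norm (LBINT \<tau>:{t..s}. b \<tau> w (P k \<tau> w) - b \<tau> w (S \<tau> w))"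
    using set_integral_diff(2)[OF iP iS] by simp
  also have "\<dots> \<le> (LBINT \<tau>:{t..s}. norm (b \<tau> w (P k \<tau> w) - b \<tau> w (S \<tau> w)))"
    by (rule set_integral_norm_bound[OF set_integral_diff(1)[OF iP iS]])
  also have "\<dots> \<le> (LBINT \<tau>:{t..s}. (L * A) * exp ((2 * L) * (\<tau> - t)))"
  proof (rule set_integral_mono)
    show "set_integrable lborel {t..s} (\<lambda>\<tau>. norm (b \<tau> w (P k \<tau> w) - b \<tau> w (S \<tau> w)))"
      by (rule set_integrable_norm[OF set_integral_diff(1)[OF iP iS]])
    show "set_integrable lborel {t..s} (\<lambda>\<tau>. (L * A) * exp ((2 * L) * (\<tau> - t)))"
      using set_integral_exp_le(2)[of "2 * L" t s] L ts by (intro set_integrable_mult_right) auto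
    fix \<tau> assume "\<tau> \<in> {t..s}"
    then have \<tau>: "\<tau> \<in> {t..r}" using Suc.prems by auto
    have "norm (b \<tau> w (P k \<tau> w) - b \<tau> w (S \<tau> w)) \<le> L * norm (P k \<tau> w - S \<tau> w)" by (rule b_lip)
    also have "\<dots> \<le> L * (A * exp (2 * L * (\<tau> - t)))"
      using Suc.IH[OF \<tau>] L unfolding A_def by (intro mult_left_mono) auto
    finally show "norm (b \<tau> w (P k \<tau> w) - b \<tau> w (S \<tau> w)) \<le> (L * A) * exp ((2 * L) * (\<tau> - t))"
      by (simp add: mult.assoc)
  qed
  also have "\<dots> = (L * A) * (LBINT \<tau>:{t..s}. exp ((2 * L) * (\<tau> - t)))" by (rule set_integral_mult_right)
  also have "\<dots> \<le> (L * A) * (exp ((2 * L) * (s - t)) / (2 * L))"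
    using set_integral_exp_le(1)[of "2 * L" t s] L ts A0 by (intro mult_left_mono) auto
  also have "\<dots> = C * (r - t) / 2 ^ Suc k * exp (2 * L * (s - t))" using L by (simp add: A_def)
  finally show ?case .
qed

lemma solution_almost_measurable: "almost_measurable M H (S r)"
proof (rule almost_measurable_LIMSEQ[OF P_adapted])
  show "r \<in> {t..r}" using tr by simp
  show "AE w in M. (\<lambda>k. P k r w) \<longlonglongrightarrow> S r w"
    using S_eq AE_space
  proof eventually_elim
    case (elim w)
    have "(\<lambda>k. norm (P k r w - S r w)) \<longlonglongrightarrow> 0"
    proof (rule tendsto_sandwich[OF always_eventually always_eventually tendsto_const])
      show "\<forall>k. norm (P k r w - S r w) \<le> C * (r - t) * exp (2 * L * (r - t)) * (1 / 2) ^ k"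
      proof
        fix k
        have "norm (P k r w - S r w) \<le> C * (r - t) / 2 ^ k * exp (2 * L * (r - t))"
          by (rule P_error[OF elim(2,1)]) (use tr in simp)
        then show "norm (P k r w - S r w) \<le> C * (r - t) * exp (2 * L * (r - t)) * (1 / 2) ^ k"
          by (simp add: power_one_over field_simps)
      qed
      show "(\<lambda>k. C * (r - t) * exp (2 * L * (r - t)) * (1 / 2) ^ k) \<longlonglongrightarrow> 0"
        by (intro tendsto_mult_right_zero LIMSEQ_realpow_zero) auto
    qed auto
    then show ?case by (simp add: tendsto_norm_zero_iff LIM_zero_iff)
  qed
qed

end

section \<open>Structure of a solution\<close>

lemma sets_vimage_algebra_subset:
  assumes "f \<in> measurable Q N" "space Q = \<Omega>"
  shows "sets (vimage_algebra \<Omega> f N) \<subseteq> sets Q"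
  unfolding sets_vimage_algebra using assms measurable_sets[OF assms(1)]
  by (intro sets.sigma_sets_subset[of _ Q, simplified assms(2)]) auto

lemma measurable_sets_mono:
  assumes "f \<in> measurable A N" "sets A \<subseteq> sets Q" "space A = space Q"
  shows "f \<in> measurable Q N"
  using assms(1) by (rule measurable_from_subalg[rotated]) (simp add: subalgebra_def assms(2,3))

lemma jac_bounded_lipschitz:
  fixes f :: "real^'n \<Rightarrow> real^'m"
  assumes "\<And>x. f differentiable at x" "\<And>x. norm (jac f x) \<le> C"
  shows "norm (f x - f y) \<le> C * norm (x - y)"
proof (rule differentiable_bound[of UNIV f "\<lambda>x h. jac f x *v h"])
  show "(f has_derivative (\<lambda>h. jac f z *v h)) (at z within UNIV)" for z using jac_has_derivative[OF assms(1)] by simp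
  show "onorm (\<lambda>h. jac f z *v h) \<le> C" for z
  proof (rule onorm_le)
    show "norm (jac f z *v h) \<le> C * norm h" for h
      by (rule order_trans[OF matrix_vector_norm_le mult_right_mono[OF assms(2)]]) simp
  qed
qed auto

locale mckean_vlasov_solution =
  fixes M :: "'w measure" and F :: "real \<Rightarrow> 'w measure" and T :: real
    and W W0 :: "real \<Rightarrow> 'w \<Rightarrow> real^'d" and \<sigma> :: "real^'d^'d"
    and B :: "real \<Rightarrow> real^'d \<Rightarrow> (real^'d) prob_measure \<Rightarrow> real^'d"
    and t :: real and m :: "(real^'d) prob_measure"
    and X :: "'w \<Rightarrow> real^'d" and S :: "real \<Rightarrow> 'w \<Rightarrow> real^'d" and \<mu> :: "real \<Rightarrow> 'w \<Rightarrow> (real^'d) prob_measure"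
  assumes T0: "0 < T" and filtered: "filtered_prob_space M F T"
    and W: "brownian_motion M F T W" and W0: "brownian_motion M F T W0"
    and WW0: "independent_processes M T W W0"
    and assm_B: "assumption_B T B" and t: "t \<in> {0..T}"
    and flow: "mckean_vlasov_flow M T B \<sigma> W W0 t m X S \<mu>"
begin

lemma prob_M: "prob_space M" using filtered by (simp add: filtered_prob_space_def)

sublocale prob_space M by (rule prob_M)

abbreviation G :: "real \<Rightarrow> 'w measure" where "G r \<equiv> common_noise_algebra M \<sigma> W0 r"

lemma F_sub: "r \<in> {0..T} \<Longrightarrow> subalgebra M (F r)"
  and F_mono: "0 \<le> r \<Longrightarrow> r \<le> s \<Longrightarrow> s \<le> T \<Longrightarrow> sets (F r) \<subseteq> sets (F s)"
  using filtered by (auto simp: filtered_prob_space_def)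

lemma F_subalgebra:
  assumes "0 \<le> r" "r \<le> s" "s \<le> T" shows "subalgebra (F s) (F r)"
proof -
  have "r \<in> {0..T}" "s \<in> {0..T}" using assms by simp_all
  then have "space (F r) = space M" "space (F s) = space M" using F_sub unfolding subalgebra_def by blast+
  then show ?thesis unfolding subalgebra_def using F_mono[OF assms] by simp
qed

lemma W_adapted: "r \<in> {0..T} \<Longrightarrow> W r \<in> borel_measurable (F r)" "r \<in> {0..T} \<Longrightarrow> W0 r \<in> borel_measurable (F r)"
  and W_cont: "w \<in> space M \<Longrightarrow> continuous_on {0..T} (\<lambda>r. W r w)" "w \<in> space M \<Longrightarrow> continuous_on {0..T} (\<lambda>r. W0 r w)"
  and W_indep: "0 \<le> r \<Longrightarrow> r < s \<Longrightarrow> s \<le> T \<Longrightarrow> indep_set (sets (F r)) (sets (vimage_algebra (space M) (\<lambda>w. W s w - W r w) borel))"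
    "0 \<le> r \<Longrightarrow> r < s \<Longrightarrow> s \<le> T \<Longrightarrow> indep_set (sets (F r)) (sets (vimage_algebra (space M) (\<lambda>w. W0 s w - W0 r w) borel))"
  and W_law: "0 \<le> r \<Longrightarrow> r < s \<Longrightarrow> s \<le> T \<Longrightarrow> distr M borel (\<lambda>w. W s w - W r w) =
      density lborel (\<lambda>x. ennreal (\<Prod>i\<in>UNIV. normal_density 0 (sqrt (s - r)) (x $ i)))"
    "0 \<le> r \<Longrightarrow> r < s \<Longrightarrow> s \<le> T \<Longrightarrow> distr M borel (\<lambda>w. W0 s w - W0 r w) =
      density lborel (\<lambda>x. ennreal (\<Prod>i\<in>UNIV. normal_density 0 (sqrt (s - r)) (x $ i)))"
  using W W0 unfolding brownian_motion_def by auto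

lemma W_meas: "r \<in> {0..T} \<Longrightarrow> W r \<in> borel_measurable M" "r \<in> {0..T} \<Longrightarrow> W0 r \<in> borel_measurable M"
  using measurable_from_subalg[OF F_sub] W_adapted by blast+

lemma X_law: "distr M borel X = meas m"
  and X_indep: "independent_rvs M borel X (\<Pi>\<^sub>M r\<in>{0..T}. borel) (\<lambda>w. \<lambda>r\<in>{0..T}. (W r w, W0 r w))"
  and S_meas: "r \<in> {0..T} \<Longrightarrow> S r \<in> borel_measurable M"
  and S_cont: "w \<in> space M \<Longrightarrow> continuous_on {0..T} (\<lambda>r. S r w)"
  and \<mu>_law: "r \<in> {0..T} \<Longrightarrow> is_conditional_law M (G r) (S r) (\<mu> r)"
  and \<mu>_joint: "(\<lambda>(r, w). \<mu> r w) \<in> measurable (restrict_space borel {0..T} \<Otimes>\<^sub>M M) borel"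
  and S_eq: "AE w in M. (\<forall>r\<in>{0..t}. S r w = X w) \<and>
        (\<forall>r\<in>{t..T}. S r w = X w + (LBINT s:{t..r}. B s (S s w) (\<mu> s w)) + (W r w - W t w) + \<sigma> *v (W0 r w - W0 t w))"
  using flow unfolding mckean_vlasov_flow_def by auto

section \<open>Sigma-algebras of the noises and their independence\<close>

definition path :: "(real \<Rightarrow> 'w \<Rightarrow> 'x::topological_space) \<Rightarrow> 'w measure" where
  "path Y = vimage_algebra (space M) (\<lambda>w. \<lambda>r\<in>{0..T}. Y r w) (\<Pi>\<^sub>M r\<in>{0..T}. borel)"

lemma space_path [simp]: "space (path Y) = space M"
  by (simp add: path_def)

lemma path_component: "r \<in> {0..T} \<Longrightarrow> Y r \<in> borel_measurable (path Y)"
proof -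
  assume r: "r \<in> {0..T}"
  have "(\<lambda>w. \<lambda>r\<in>{0..T}. Y r w) \<in> measurable (path Y) (\<Pi>\<^sub>M r\<in>{0..T}. borel)"
    unfolding path_def by (rule measurable_vimage_algebra1) (auto simp: space_PiM)
  from measurable_compose[OF this measurable_component_singleton[OF r]] show ?thesis using r by simp
qed

lemma path_subset:
  assumes "\<And>r. r \<in> {0..T} \<Longrightarrow> Y r \<in> borel_measurable Q" "space Q = space M"
  shows "sets (path Y) \<subseteq> sets Q"
  unfolding path_def by (rule sets_vimage_algebra_subset[OF _ assms(2)]) (intro measurable_restrict assms(1))

definition XA :: "'w measure" where "XA = vimage_algebra (space M) X borel"

lemma X_meas: "X \<in> borel_measurable M" using X_indep by (simp add: independent_rvs_def)

lemma path_sub: "subalgebra M (path W)" "subalgebra M (path W0)" "subalgebra M XA"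
  unfolding subalgebra_def using path_subset[of W M] path_subset[of W0 M] W_meas sets_vimage_algebra_subset[OF X_meas refl]
  by (auto simp: XA_def)

text \<open>The sigma-algebra of the pair of paths, from which the flow requires \<open>X\<close> to
  be independent; it contains those of \<open>W\<close> and of \<open>W0\<close> by
  projection.\<close>

definition WP :: "'w measure" where "WP = path (\<lambda>r w. (W r w, W0 r w))"

lemma path_WP: "sets (path W) \<subseteq> sets WP" "sets (path W0) \<subseteq> sets WP"
proof -
  have "(\<lambda>w. (W r w, W0 r w)) \<in> borel_measurable WP" if "r \<in> {0..T}" for r
    unfolding WP_def using path_component[OF that, of "\<lambda>r w. (W r w, W0 r w)"] by simp
  from measurable_compose[OF this, of _ fst] measurable_compose[OF this, of _ snd]
  have "W r \<in> borel_measurable WP" "W0 r \<in> borel_measurable WP" if "r \<in> {0..T}" for r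
    using that by (auto simp: borel_measurable_continuous_onI continuous_on_fst continuous_on_snd)
  then show "sets (path W) \<subseteq> sets WP" "sets (path W0) \<subseteq> sets WP"
    by (intro path_subset; simp add: WP_def)+
qed

lemma indep_X: "a \<in> sets XA \<Longrightarrow> b \<in> sets WP \<Longrightarrow> prob (a \<inter> b) = prob a * prob b"
  using X_indep indep_setD unfolding independent_rvs_def XA_def WP_def path_def by blast

lemma indep_W: "a \<in> sets (path W) \<Longrightarrow> b \<in> sets (path W0) \<Longrightarrow> prob (a \<inter> b) = prob a * prob b"
  using WW0 indep_setD unfolding independent_processes_def independent_rvs_def path_def by blast

text \<open>Independence of \<open>X\<close> from the pair of paths and of \<open>W\<close> from
  \<open>W0\<close> combine into mutual independence of the three.\<close>

lemma indep_triple: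
  assumes "a \<in> sets XA" "b \<in> sets (path W)" "c \<in> sets (path W0)"
  shows "prob (a \<inter> b \<inter> c) = prob a * prob b * prob c"
proof -
  have "b \<inter> c \<in> sets WP" using assms path_WP by blast
  then have "prob (a \<inter> (b \<inter> c)) = prob a * prob (b \<inter> c)" by (rule indep_X[OF assms(1)])
  then show ?thesis using indep_W[OF assms(2,3)] by (simp add: Int_assoc)
qed

text \<open>All the randomness of a particle that does not come from the common noise: the initial
  value and the path of \<open>W\<close>.\<close>

definition idio :: "'w measure" where
  "idio = sigma (space M) {a \<inter> b | a b. a \<in> sets XA \<and> b \<in> sets (path W)}"

text \<open>The join of two sigma-algebras through an intersection-stable generator, the form in
  which independence can be checked and then extended.\<close>

lemma sigma_Int:
  fixes A E :: "'w measure"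
  assumes "subalgebra M A" "subalgebra M E"
  shows "subalgebra M (sigma (space M) {a \<inter> b | a b. a \<in> sets A \<and> b \<in> sets E})"
    "sets (sigma (space M) {a \<inter> b | a b. a \<in> sets A \<and> b \<in> sets E}) = sigma_sets (space M) {a \<inter> b | a b. a \<in> sets A \<and> b \<in> sets E}"
    "sets A \<subseteq> sets (sigma (space M) {a \<inter> b | a b. a \<in> sets A \<and> b \<in> sets E})"
    "sets E \<subseteq> sets (sigma (space M) {a \<inter> b | a b. a \<in> sets A \<and> b \<in> sets E})"
    "Int_stable {a \<inter> b | a b. a \<in> sets A \<and> b \<in> sets E}"
proof -
  let ?P = "{a \<inter> b | a b. a \<in> sets A \<and> b \<in> sets E}"
  have PM: "?P \<subseteq> sets M" using assms by (auto simp: subalgebra_def)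
  then have "?P \<subseteq> Pow (space M)" using sets.sets_into_space by blast
  then show e: "sets (sigma (space M) ?P) = sigma_sets (space M) ?P" by simp
  show "subalgebra M (sigma (space M) ?P)"
    unfolding subalgebra_def e using sets.sigma_sets_subset[OF PM] by (simp add: space_measure_of_conv)
  have sp: "space M \<in> sets A" "space M \<in> sets E" using assms sets.top by (metis subalgebra_def)+
  have sA: "a \<inter> space M = a" if "a \<in> sets A" for a using that assms sets.sets_into_space by (fastforce simp: subalgebra_def)
  have sB: "space M \<inter> b = b" if "b \<in> sets E" for b using that assms sets.sets_into_space by (fastforce simp: subalgebra_def)
  show "sets A \<subseteq> sets (sigma (space M) ?P)"
  proof
    fix a assume a: "a \<in> sets A"
    then have "a \<inter> space M \<in> ?P" using sp by blast
    then show "a \<in> sets (sigma (space M) ?P)" unfolding e sA[OF a] by (rule sigma_sets.Basic)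
  qed
  show "sets E \<subseteq> sets (sigma (space M) ?P)"
  proof
    fix b assume b: "b \<in> sets E"
    then have "space M \<inter> b \<in> ?P" using sp by blast
    then show "b \<in> sets (sigma (space M) ?P)" unfolding e sB[OF b] by (rule sigma_sets.Basic)
  qed
  show "Int_stable ?P"
  proof (rule Int_stableI)
    fix p q assume "p \<in> ?P" "q \<in> ?P"
    then obtain a e a' e' where "p = a \<inter> e" "q = a' \<inter> e'" "a \<in> sets A" "e \<in> sets E" "a' \<in> sets A" "e' \<in> sets E" by auto
    then show "p \<inter> q \<in> ?P" by (intro CollectI exI[of _ "a \<inter> a'"] exI[of _ "e \<inter> e'"]) auto
  qed
qed

lemma idio_sub: "subalgebra M idio" and XA_idio: "sets XA \<subseteq> sets idio" and W_idio: "sets (path W) \<subseteq> sets idio"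
  unfolding idio_def using sigma_Int[OF path_sub(3,1)] by blast+

lemma indep_set_sigmaI:
  assumes "subalgebra M C" "Int_stable P" "P \<subseteq> sets M" "\<And>p c. p \<in> P \<Longrightarrow> c \<in> sets C \<Longrightarrow> prob (p \<inter> c) = prob p * prob c"
  shows "indep_set (sets (sigma (space M) P)) (sets C)"
proof -
  have P: "P \<subseteq> Pow (space M)" using assms(3) sets.sets_into_space by blast
  have "indep_set P (sets C)"
    unfolding indep_sets2_eq using assms by (auto simp: subalgebra_def)
  from indep_set_sigma_sets[OF this assms(2) sets.Int_stable]
  have "indep_set (sigma_sets (space M) P) (sigma_sets (space M) (sets C))" .
  moreover have "sigma_sets (space M) (sets C) = sets C"
    using assms(1) sets.sigma_sets_eq[of C] by (simp add: subalgebra_def)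
  ultimately show ?thesis using P by simp
qed

lemma idio_indep: "indep_set (sets idio) (sets (path W0))"
  unfolding idio_def
proof (rule indep_set_sigmaI[OF path_sub(2) sigma_Int(5)[OF path_sub(3,1)]])
  show "{a \<inter> b |a b. a \<in> sets XA \<and> b \<in> sets (path W)} \<subseteq> sets M"
    using path_sub by (auto simp: subalgebra_def)
  fix p c assume "p \<in> {a \<inter> b |a b. a \<in> sets XA \<and> b \<in> sets (path W)}" "c \<in> sets (path W0)"
  then obtain a b where "p = a \<inter> b" "a \<in> sets XA" "b \<in> sets (path W)" "c \<in> sets (path W0)" by auto
  moreover have "prob (a \<inter> b) = prob a * prob b" using calculation path_WP(1) by (intro indep_X) auto
  ultimately show "prob (p \<inter> c) = prob p * prob c" using indep_triple by simp
qed

definition W_past :: "real \<Rightarrow> 'w measure" where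
  "W_past u = vimage_algebra (space M) (\<lambda>w. \<lambda>r\<in>{0..u}. W r w) (\<Pi>\<^sub>M r\<in>{0..u}. borel)"

definition idio_past :: "real \<Rightarrow> 'w measure" where
  "idio_past u = sigma (space M) {a \<inter> b | a b. a \<in> sets XA \<and> b \<in> sets (W_past u)}"

text \<open>Including the whole path of the common noise makes all conditional laws measurable, at
  every time, while the increments of \<open>W\<close> after \<open>u\<close> remain independent.\<close>

definition past :: "real \<Rightarrow> 'w measure" where
  "past u = sigma (space M) {a \<inter> b | a b. a \<in> sets (idio_past u) \<and> b \<in> sets (path W0)}"

context
  fixes u assumes u: "u \<in> {0..T}"
begin

lemma W_past_subset:
  assumes "\<And>r. r \<in> {0..u} \<Longrightarrow> W r \<in> borel_measurable Q" "space Q = space M"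
  shows "sets (W_past u) \<subseteq> sets Q"
  unfolding W_past_def by (rule sets_vimage_algebra_subset[OF _ assms(2)]) (intro measurable_restrict assms(1))

lemma W_past_sub: "sets (W_past u) \<subseteq> sets (F u)" "sets (W_past u) \<subseteq> sets (path W)" "subalgebra M (W_past u)"
proof -
  show F: "sets (W_past u) \<subseteq> sets (F u)"
  proof (rule W_past_subset)
    fix r assume r: "r \<in> {0..u}"
    have "subalgebra (F u) (F r)" using r u by (intro F_subalgebra) auto
    moreover have "W r \<in> borel_measurable (F r)" using r u by (intro W_adapted) auto
    ultimately show "W r \<in> borel_measurable (F u)" by (rule measurable_from_subalg)
  qed (use F_sub[OF u] in \<open>simp add: subalgebra_def\<close>)
  show "sets (W_past u) \<subseteq> sets (path W)" using u by (intro W_past_subset path_component) auto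
  show "subalgebra M (W_past u)" using F F_sub[OF u] by (auto simp: subalgebra_def W_past_def)
qed

lemma idio_past_sub: "subalgebra M (idio_past u)" "sets (idio_past u) \<subseteq> sets idio"
proof -
  show "subalgebra M (idio_past u)" unfolding idio_past_def by (rule sigma_Int(1)[OF path_sub(3) W_past_sub(3)])
  have "{a \<inter> b | a b. a \<in> sets XA \<and> b \<in> sets (W_past u)} \<subseteq> {a \<inter> b | a b. a \<in> sets XA \<and> b \<in> sets (path W)}"
    using W_past_sub(2) by blast
  then show "sets (idio_past u) \<subseteq> sets idio"
    unfolding idio_past_def idio_def sigma_Int(2)[OF path_sub(3) W_past_sub(3)] sigma_Int(2)[OF path_sub(3) path_sub(1)]
    by (rule sigma_sets_mono')
qed

lemma past_sub: "subalgebra M (past u)" "sets (path W0) \<subseteq> sets (past u)"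
  "X \<in> borel_measurable (past u)" "r \<in> {0..u} \<Longrightarrow> W r \<in> borel_measurable (past u)"
proof -
  note s = sigma_Int[OF idio_past_sub(1) path_sub(2)]
  show sub: "subalgebra M (past u)" "sets (path W0) \<subseteq> sets (past u)" unfolding past_def by (rule s)+
  have ip: "sets (idio_past u) \<subseteq> sets (past u)" unfolding past_def by (rule s)
  note i = sigma_Int[OF path_sub(3) W_past_sub(3)]
  have sets: "sets XA \<subseteq> sets (idio_past u)" "sets (W_past u) \<subseteq> sets (idio_past u)"
    unfolding idio_past_def by (rule i)+
  have spc: "space (past u) = space M" using sub(1) by (simp add: subalgebra_def)
  have "X \<in> borel_measurable XA" unfolding XA_def by (rule measurable_vimage_algebra1) simp
  then show "X \<in> borel_measurable (past u)"
    by (rule measurable_sets_mono[OF _ order_trans[OF sets(1) ip]]) (simp add: spc XA_def)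
  assume r: "r \<in> {0..u}"
  have "(\<lambda>w. \<lambda>r\<in>{0..u}. W r w) \<in> measurable (W_past u) (\<Pi>\<^sub>M r\<in>{0..u}. borel)"
    unfolding W_past_def by (rule measurable_vimage_algebra1) (simp add: space_PiM)
  from measurable_compose[OF this measurable_component_singleton[OF r]] r have "W r \<in> borel_measurable (W_past u)" by simp
  then show "W r \<in> borel_measurable (past u)"
    by (rule measurable_sets_mono[OF _ order_trans[OF sets(2) ip]]) (simp add: spc W_past_def)
qed

text \<open>Three independences are stacked: increments of \<open>W\<close> are independent of the
  past of \<open>W\<close>, by the filtration; \<open>X\<close> is independent of both paths
  together; and everything formed from \<open>X\<close> and \<open>W\<close> is independent of the
  common noise.\<close>

lemma past_indep:
  assumes v: "u < v" "v \<le> T"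
  shows "indep_set (sets (past u)) (sets (vimage_algebra (space M) (\<lambda>w. W v w - W u w) borel))"
proof -
  let ?D = "vimage_algebra (space M) (\<lambda>w. W v w - W u w) borel"
  have "(\<lambda>w. W v w - W u w) \<in> borel_measurable (path W)"
    using u v by (intro borel_measurable_diff path_component) auto
  then have DW: "sets ?D \<subseteq> sets (path W)" by (rule sets_vimage_algebra_subset) simp
  have DM: "subalgebra M ?D" using DW path_sub(1) by (auto simp: subalgebra_def)
  have Wd: "prob (b \<inter> d) = prob b * prob d" if "b \<in> sets (W_past u)" "d \<in> sets ?D" for b d
    using indep_setD[OF W_indep(1)[of u v]] that W_past_sub(1) u v by auto
  have "indep_set (sets (idio_past u)) (sets ?D)"
    unfolding idio_past_def
  proof (rule indep_set_sigmaI[OF DM sigma_Int(5)[OF path_sub(3) W_past_sub(3)]])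
    show "{a \<inter> b |a b. a \<in> sets XA \<and> b \<in> sets (W_past u)} \<subseteq> sets M"
      using path_sub W_past_sub by (auto simp: subalgebra_def)
    fix p d assume "p \<in> {a \<inter> b |a b. a \<in> sets XA \<and> b \<in> sets (W_past u)}" and d: "d \<in> sets ?D"
    then obtain a b where p: "p = a \<inter> b" "a \<in> sets XA" "b \<in> sets (W_past u)" by auto
    have "b \<inter> d \<in> sets WP" "b \<in> sets WP" using p d W_past_sub(2) DW path_WP(1) by blast+
    then have "prob (a \<inter> (b \<inter> d)) = prob a * prob (b \<inter> d)" "prob (a \<inter> b) = prob a * prob b"
      using indep_X[OF p(2)] by auto
    then show "prob (p \<inter> d) = prob p * prob d" using Wd[OF p(3) d] by (simp add: p(1) Int_assoc)
  qed
  then have pd: "prob (p \<inter> d) = prob p * prob d" if "p \<in> sets (idio_past u)" "d \<in> sets ?D" for p d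
    using indep_setD that by blast
  show ?thesis
    unfolding past_def
  proof (rule indep_set_sigmaI[OF DM sigma_Int(5)[OF idio_past_sub(1) path_sub(2)]])
    show "{a \<inter> b |a b. a \<in> sets (idio_past u) \<and> b \<in> sets (path W0)} \<subseteq> sets M"
      using path_sub idio_past_sub by (auto simp: subalgebra_def)
    fix q d assume "q \<in> {a \<inter> b |a b. a \<in> sets (idio_past u) \<and> b \<in> sets (path W0)}" and d: "d \<in> sets ?D"
    then obtain p c where q: "q = p \<inter> c" "p \<in> sets (idio_past u)" "c \<in> sets (path W0)" by auto
    have "p \<in> sets idio" "p \<inter> d \<in> sets idio" using q(2) idio_past_sub(2) d DW W_idio by blast+
    then have "prob (p \<inter> c) = prob p * prob c" "prob ((p \<inter> d) \<inter> c) = prob (p \<inter> d) * prob c"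
      using indep_setD[OF idio_indep] q(3) by auto
    moreover have "q \<inter> d = (p \<inter> d) \<inter> c" using q(1) by blast
    ultimately show "prob (q \<inter> d) = prob q * prob d" using pd[OF q(2) d] by (simp add: q(1))
  qed
qed

end

section \<open>The common noise, adaptedness of the solution and its conditional laws\<close>

lemma common_noise_measurable:
  assumes "Y \<in> borel_measurable Q" shows "(\<lambda>w. \<sigma> *v Y w) \<in> borel_measurable Q"
  using measurable_compose[OF assms borel_measurable_continuous_onI[OF matrix_vector_mult_linear_continuous_on]] .

lemma space_G [simp]: "space (G r) = space M"
  by (simp add: common_noise_algebra_def space_measure_of_conv)

lemma G_subset:
  assumes "\<And>s. s \<in> {0..r} \<Longrightarrow> W0 s \<in> borel_measurable Q" "space Q = space M"
  shows "sets (G r) \<subseteq> sets Q"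
proof -
  have "{(\<lambda>w. \<sigma> *v W0 s w) -` A \<inter> space M | s A. s \<in> {0..r} \<and> A \<in> sets borel} \<subseteq> sets Q"
    using measurable_sets[OF common_noise_measurable[OF assms(1)]] assms(2) by auto
  moreover have "{(\<lambda>w. \<sigma> *v W0 s w) -` A \<inter> space M | s A. s \<in> {0..r} \<and> A \<in> sets borel} \<subseteq> Pow (space M)" by auto
  ultimately show ?thesis
    unfolding common_noise_algebra_def using sets.sigma_sets_subset[of _ Q] assms(2) by simp
qed

lemma G_sub:
  assumes r: "r \<in> {0..T}"
  shows "subalgebra (path W0) (G r)" "subalgebra M (G r)" "subalgebra (F r) (G r)"
proof -
  have 1: "sets (G r) \<subseteq> sets (path W0)" using r by (intro G_subset path_component) auto
  then show "subalgebra (path W0) (G r)" by (simp add: subalgebra_def)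
  then show "subalgebra M (G r)" using path_sub(2) by (auto simp: subalgebra_def)
  have "sets (G r) \<subseteq> sets (F r)"
  proof (rule G_subset)
    fix s assume s: "s \<in> {0..r}"
    have "subalgebra (F r) (F s)" using r s by (intro F_subalgebra) auto
    moreover have "W0 s \<in> borel_measurable (F s)" using r s by (intro W_adapted) auto
    ultimately show "W0 s \<in> borel_measurable (F r)" by (rule measurable_from_subalg)
  qed (use F_sub[OF r] in \<open>simp add: subalgebra_def\<close>)
  then show "subalgebra (F r) (G r)" using F_sub[OF r] by (auto simp: subalgebra_def)
qed

lemma noise_G: "s \<in> {0..r} \<Longrightarrow> (\<lambda>w. \<sigma> *v W0 s w) \<in> borel_measurable (G r)"
proof (rule measurableI)
  fix A :: "(real^'d) set" assume "s \<in> {0..r}" "A \<in> sets borel"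
  moreover have "{(\<lambda>w. \<sigma> *v W0 s w) -` A \<inter> space M | s A. s \<in> {0..r} \<and> A \<in> sets borel} \<subseteq> Pow (space M)" by auto
  ultimately show "(\<lambda>w. \<sigma> *v W0 s w) -` A \<inter> space (G r) \<in> sets (G r)"
    unfolding space_G by (simp add: common_noise_algebra_def) (rule sigma_sets.Basic, blast)
qed simp

lemma G_mono: "s \<le> r \<Longrightarrow> sets (G s) \<subseteq> sets (G r)"
proof -
  assume "s \<le> r"
  then have "{(\<lambda>w. \<sigma> *v W0 q w) -` A \<inter> space M | q A. q \<in> {0..s} \<and> A \<in> sets borel} \<subseteq>
    {(\<lambda>w. \<sigma> *v W0 q w) -` A \<inter> space M | q A. q \<in> {0..r} \<and> A \<in> sets borel}" by force
  moreover have "{(\<lambda>w. \<sigma> *v W0 q w) -` A \<inter> space M | q A. q \<in> {0..r'} \<and> A \<in> sets borel} \<subseteq> Pow (space M)" for r' by auto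
  ultimately show ?thesis unfolding common_noise_algebra_def by (simp add: sigma_sets_mono')
qed

lemma \<mu>_G: "r \<in> {0..T} \<Longrightarrow> \<mu> r \<in> borel_measurable (G r)"
  using \<mu>_law by (simp add: is_conditional_law_def)

lemma \<mu>_path: "r \<in> {0..T} \<Longrightarrow> \<mu> r \<in> borel_measurable (path W0)"
  using measurable_from_subalg[OF G_sub(1) \<mu>_G] .

lemma \<mu>_meas: "r \<in> {0..T} \<Longrightarrow> \<mu> r \<in> borel_measurable M"
  using measurable_from_subalg[OF G_sub(2) \<mu>_G] .

text \<open>Extends processes from \<open>[0, T]\<close> to the whole line without changing them
  there, so that statements about processes indexed by all reals apply.\<close>

definition clip :: "real \<Rightarrow> real" where "clip s = max 0 (min T s)"

lemma clip [simp]: "0 \<le> clip s" "clip s \<le> T" "s \<in> {0..T} \<Longrightarrow> clip s = s"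
  using T0 by (auto simp: clip_def)

lemma clip_cont: "continuous_on A clip"
  unfolding clip_def by (intro continuous_intros)

lemma B_bounds: obtains C L where "\<And>s x n. s \<in> {0..T} \<Longrightarrow> norm (B s x n) \<le> C" "0 < L"
  "\<And>s x y n. s \<in> {0..T} \<Longrightarrow> norm (B s x n - B s y n) \<le> L * norm (x - y)"
proof -
  have "bounded ((\<lambda>(t, x, m). B t x m) ` ({0..T} \<times> UNIV \<times> UNIV))"
    "bounded ((\<lambda>(t, x, m). jac (\<lambda>x'. B t x' m) x) ` ({0..T} \<times> UNIV \<times> UNIV))"
    using assm_B unfolding assumption_B_def by blast+
  then obtain C L where C: "\<And>s x n. s \<in> {0..T} \<Longrightarrow> norm (B s x n) \<le> C"
    and L: "\<And>s x n. s \<in> {0..T} \<Longrightarrow> norm (jac (\<lambda>x'. B s x' n) x) \<le> L"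
    unfolding bounded_iff by fastforce
  \<comment> \<open>The maximum with one makes the Lipschitz constant strictly positive, as the
    exponential weight of the Picard iteration requires.\<close>
  have "norm (B s x n - B s y n) \<le> max L 1 * norm (x - y)" if s: "s \<in> {0..T}" for s x y n
  proof (rule jac_bounded_lipschitz)
    show "(\<lambda>x. B s x n) differentiable at x" for x using assm_B s unfolding assumption_B_def by blast
    show "norm (jac (\<lambda>x. B s x n) x) \<le> max L 1" for x using L[OF s, of n x] by simp
  qed
  then show thesis using that[of C "max L 1"] C by simp
qed

lemma B_cont: "s \<in> {0..T} \<Longrightarrow> continuous_on UNIV (\<lambda>(x, m). B s x m)"
  using assm_B unfolding assumption_B_def by blast

lemma B_measurable:
  assumes s: "s \<in> borel_measurable Q" "\<And>q. q \<in> space Q \<Longrightarrow> s q \<in> {0..T}"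
    and x: "x \<in> borel_measurable Q" and n: "n \<in> borel_measurable Q"
  shows "(\<lambda>q. B (s q) (x q) (n q)) \<in> borel_measurable Q"
proof -
  have "s \<in> measurable Q (restrict_space borel {0..T})"
    using s by (intro measurable_restrict_space2) auto
  from measurable_Pair[OF this measurable_Pair[OF x n]]
  have "(\<lambda>q. (s q, x q, n q)) \<in> measurable Q (restrict_space borel {0..T} \<Otimes>\<^sub>M borel \<Otimes>\<^sub>M borel)" .
  moreover have "(\<lambda>(t, x, m). B t x m) \<in> borel_measurable (restrict_space borel {0..T} \<Otimes>\<^sub>M borel \<Otimes>\<^sub>M borel)"
    using assm_B unfolding assumption_B_def by blast
  ultimately have "(\<lambda>q. (\<lambda>(t, x, m). B t x m) (s q, x q, n q)) \<in> borel_measurable Q" by (rule measurable_compose)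
  then show ?thesis by simp
qed

lemma \<mu>_clip: "(\<lambda>(s, w). \<mu> (clip s) w) \<in> borel_measurable (borel \<Otimes>\<^sub>M M)"
proof -
  have "clip \<in> borel_measurable borel" by (intro borel_measurable_continuous_onI clip_cont)
  then have "clip \<in> measurable borel (restrict_space borel {0..T})" by (intro measurable_restrict_space2) auto
  then have "(\<lambda>z. (clip (fst z), snd z)) \<in> measurable (borel \<Otimes>\<^sub>M M) (restrict_space borel {0..T} \<Otimes>\<^sub>M M)" by measurable
  from measurable_compose[OF this \<mu>_joint] show ?thesis by (simp add: case_prod_beta)
qed

lemma S_clip: "(\<lambda>(s, w). S (clip s) w) \<in> borel_measurable (borel \<Otimes>\<^sub>M M)"
proof (rule measurable_continuous_process)
  show "S (clip s) \<in> borel_measurable M" for s by (intro S_meas) simp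
  show "continuous_on UNIV (\<lambda>s. S (clip s) w)" if "w \<in> space M" for w
    by (rule continuous_on_compose2[OF S_cont[OF that] clip_cont]) auto
qed

text \<open>Meant for two choices of \<open>H\<close>: \<open>past u\<close>, and the join of
  \<open>idio\<close> with \<open>G r\<close>. In both, the laws up to time \<open>r\<close> are
  measurable, and once these are given the equation is an ordinary one with Lipschitz drift.\<close>

lemma solution_adapted:
  assumes r: "r \<in> {0..T}" and H: "subalgebra M H" and XH: "X \<in> borel_measurable H"
    and WH: "\<And>s. s \<in> {0..r} \<Longrightarrow> W s \<in> borel_measurable H" and GH: "sets (G r) \<subseteq> sets H"
  shows "almost_measurable M H (S r)"
proof (cases "r \<le> t")
  case True
  have "AE w in M. X w = S r w" using S_eq by eventually_elim (use True r in auto)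
  then show ?thesis by (rule almost_measurable_cong[OF almost_measurableI[OF XH]])
next
  case False
  then have tr: "t \<le> r" by simp
  have sH: "space H = space M" using H by (simp add: subalgebra_def)
  \<comment> \<open>Freezing time outside \<open>[t, r]\<close> gives an equation on the whole line
    in which only laws up to time \<open>r\<close> occur; these are measurable for
    \<open>G r\<close> and hence for \<open>H\<close>.\<close>
  define c where "c s = max t (min r s)" for s
  have c: "c s \<in> {t..r}" "c s \<in> {0..T}" "c s \<in> {0..r}" for s using tr r t by (auto simp: c_def)
  have c_id: "c s = s" if "s \<in> {t..r}" for s using that by (auto simp: c_def)
  have c_cont: "continuous_on A c" for A unfolding c_def by (intro continuous_intros)
  then have c_meas [measurable]: "c \<in> borel_measurable borel" by (rule borel_measurable_continuous_onI)
  obtain C L where C: "\<And>s x n. s \<in> {0..T} \<Longrightarrow> norm (B s x n) \<le> C" and L: "0 < L"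
    and lip: "\<And>s x y n. s \<in> {0..T} \<Longrightarrow> norm (B s x n - B s y n) \<le> L * norm (x - y)"
    by (rule B_bounds) (rule that)
  define N where "N s w = X w + (W (c s) w - W t w) + (\<sigma> *v W0 (c s) w - \<sigma> *v W0 t w)" for s w
  have NH: "N s \<in> borel_measurable H" for s
  proof -
    have "(\<lambda>w. \<sigma> *v W0 q w) \<in> borel_measurable H" if "q \<in> {0..r}" for q
      using noise_G[OF that] by (rule measurable_from_subalg[rotated]) (use GH sH in \<open>simp add: subalgebra_def\<close>)
    moreover have "t \<in> {0..r}" using tr t by simp
    ultimately show ?thesis unfolding N_def using c
      by (intro borel_measurable_add borel_measurable_diff XH WH) auto
  qed
  have "almost_measurable M H ((\<lambda>s. S (c s)) r)"
  proof (rule solution_almost_measurable[where b="\<lambda>s w x. B (c s) x (\<mu> (c s) w)" and t=t and N=N and C=C and L=L, OF prob_M H tr L])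
    have "(\<lambda>q :: (real \<times> 'w) \<times> (real^'d). \<mu> (c (fst (fst q))) (snd (fst q))) \<in> borel_measurable ((borel \<Otimes>\<^sub>M M) \<Otimes>\<^sub>M borel)"
    proof -
      have "(\<lambda>q :: (real \<times> 'w) \<times> (real^'d). (c (fst (fst q)), snd (fst q))) \<in> measurable ((borel \<Otimes>\<^sub>M M) \<Otimes>\<^sub>M borel) (borel \<Otimes>\<^sub>M M)"
        by measurable
      from measurable_compose[OF this \<mu>_clip] show ?thesis using c by simp
    qed
    then have "(\<lambda>q :: (real \<times> 'w) \<times> (real^'d). B (c (fst (fst q))) (snd q) (\<mu> (c (fst (fst q))) (snd (fst q)))) \<in> borel_measurable ((borel \<Otimes>\<^sub>M M) \<Otimes>\<^sub>M borel)"
      using c by (intro B_measurable) auto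
    then show "(\<lambda>((s, w), x). B (c s) x (\<mu> (c s) w)) \<in> borel_measurable ((borel \<Otimes>\<^sub>M M) \<Otimes>\<^sub>M borel)"
      by (simp add: case_prod_unfold)
    show "norm (B (c s) x (\<mu> (c s) w)) \<le> C" "norm (B (c s) x (\<mu> (c s) w) - B (c s) y (\<mu> (c s) w)) \<le> L * norm (x - y)" for s w x y
      using C lip c by auto
    show "almost_measurable M H (\<lambda>w. B (c s) (Z w) (\<mu> (c s) w))" if "almost_measurable M H Z" for s Z
    proof -
      have "\<mu> (c s) \<in> borel_measurable H"
        using \<mu>_G[OF c(2)] by (rule measurable_from_subalg[rotated])
          (use G_mono[of "c s" r] GH sH c in \<open>auto simp: subalgebra_def\<close>)
      from almost_measurable_compose[OF almost_measurable_Pair[OF that almost_measurableI[OF this]]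
        borel_measurable_continuous_onI[OF B_cont[OF c(2)]]]
      show ?thesis by simp
    qed
    show "N s \<in> borel_measurable M" "almost_measurable M H (N s)" for s
      using NH measurable_from_subalg[OF H NH] by (auto intro: almost_measurableI)
    show "S (c s) \<in> borel_measurable M" for s using c by (intro S_meas) auto
    show "continuous_on UNIV (\<lambda>s. N s w)" "continuous_on UNIV (\<lambda>s. S (c s) w)" if "w \<in> space M" for w
    proof -
      have 0: "continuous_on UNIV (\<lambda>s. f (c s))" if "continuous_on {0..T} f" for f :: "real \<Rightarrow> real^'d"
        by (rule continuous_on_compose2[OF that c_cont]) (use c in blast)
      show "continuous_on UNIV (\<lambda>s. S (c s) w)" by (rule 0[OF S_cont[OF that]])
      have "continuous_on UNIV (\<lambda>s. \<sigma> *v W0 (c s) w)"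
        using continuous_on_compose2[OF matrix_vector_mult_linear_continuous_on 0[OF W_cont(2)[OF that]]] by auto
      then show "continuous_on UNIV (\<lambda>s. N s w)"
        unfolding N_def using 0[OF W_cont(1)[OF that]] by (intro continuous_intros)
    qed
    show "AE w in M. \<forall>s\<in>{t..r}. S (c s) w = N s w + (LBINT \<tau>:{t..s}. B (c \<tau>) (S (c \<tau>) w) (\<mu> (c \<tau>) w))"
      using S_eq
    proof eventually_elim
      case (elim w)
      show ?case
      proof
        fix s assume s: "s \<in> {t..r}"
        have "(LBINT \<tau>:{t..s}. B (c \<tau>) (S (c \<tau>) w) (\<mu> (c \<tau>) w)) = (LBINT \<tau>:{t..s}. B \<tau> (S \<tau> w) (\<mu> \<tau> w))"
          by (rule set_lebesgue_integral_cong) (use s c_id in auto)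
        then show "S (c s) w = N s w + (LBINT \<tau>:{t..s}. B (c \<tau>) (S (c \<tau>) w) (\<mu> (c \<tau>) w))"
          using elim s r by (simp add: c_id[OF s] N_def matrix_vector_mult_diff_distrib)
      qed
    qed
  qed
  moreover have "c r = r" using tr by (simp add: c_def)
  ultimately show ?thesis by simp
qed

lemma solution_past: "u \<in> {0..T} \<Longrightarrow> almost_measurable M (past u) (S u)"
proof -
  assume u: "u \<in> {0..T}"
  show ?thesis
  proof (rule solution_adapted[OF u past_sub(1,3,4)[OF u]])
    show "sets (G u) \<subseteq> sets (past u)"
      using G_sub(1)[OF u] past_sub(2)[OF u] by (simp add: subalgebra_def)
  qed
qed

text \<open>The flow provides \<open>\<mu> r\<close> as a law given the common noise up to
  \<open>r\<close>. As \<open>S r\<close> is, up to null sets, a function of \<open>X\<close>,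
  \<open>W\<close> and that noise, knowledge of the later noise changes nothing, and
  \<open>Z\<close> may depend on the whole path.\<close>

lemma \<mu>_disintegrates:
  fixes Z :: "'w \<Rightarrow> 'z::second_countable_topology"
  assumes r: "r \<in> {0..T}" and Z: "Z \<in> borel_measurable (path W0)"
  shows "disintegrates M Z (\<mu> r) (S r)"
proof (rule conditional_law_disintegrates[OF prob_M idio_sub path_sub(2) G_sub(1)[OF r] idio_indep S_meas[OF r] _ \<mu>_law[OF r] Z])
  note s = sigma_Int[OF idio_sub G_sub(2)[OF r]]
  let ?H = "sigma (space M) {a \<inter> e |a e. a \<in> sets idio \<and> e \<in> sets (G r)}"
  have spc: "space ?H = space M" using s(1) unfolding subalgebra_def by blast
  have XX: "X \<in> borel_measurable XA" unfolding XA_def by (rule measurable_vimage_algebra1) simp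
  show "almost_measurable M ?H (S r)"
  proof (rule solution_adapted[OF r s(1) _ _ s(4)])
    show "X \<in> borel_measurable ?H"
      by (rule measurable_sets_mono[OF XX order_trans[OF XA_idio s(3)]]) (simp only: spc, simp add: XA_def)
    show "W q \<in> borel_measurable ?H" if "q \<in> {0..r}" for q
    proof (rule measurable_sets_mono[OF path_component order_trans[OF W_idio s(3)]])
      show "q \<in> {0..T}" using that r by auto
    qed (simp only: spc space_path)
  qed
qed

text \<open>The whole common noise conditions all times at once, so continuity of the paths of
  \<open>S\<close> passes to the laws. The exceptional null set may depend on the sequence of
  times.\<close>

lemma \<mu>_tendsto:
  assumes r: "r \<longlonglongrightarrow> s" "\<And>n. r n \<in> {0..T}" "s \<in> {0..T}"
  shows "AE w in M. (\<lambda>n. \<mu> (r n) w) \<longlonglongrightarrow> \<mu> s w"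
proof (rule conditional_laws_tendsto[OF prob_M path_sub(2)])
  show "(\<lambda>n. S (r n) w) \<longlonglongrightarrow> S s w" if "w \<in> space M" for w
    by (rule continuous_on_tendsto_compose[OF S_cont[OF that] r(1)]) (use r in auto)
qed (use r in \<open>auto intro: \<mu>_path S_meas \<mu>_disintegrates\<close>)

text \<open>At time \<open>t\<close> the solution equals \<open>X\<close> almost surely, and
  \<open>X\<close> is independent of the common noise, so the constant \<open>m\<close> is another
  version of the conditional law. The conclusion is phrased through a continuous real
  \<open>f\<close>, for whose values limits are unique.\<close>

lemma \<mu>_initial: 
  assumes "continuous_on UNIV (f :: (real^'d) prob_measure \<Rightarrow> real)"
  shows "AE w in M. f (\<mu> t w) = f m"
proof -
  have St: "AE w in M. S t w = X w" using S_eq by eventually_elim (use t in auto)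
  have dis: "disintegrates M Z (\<lambda>_. m) (S t)" if Z: "Z \<in> borel_measurable (path W0)" for Z :: "'w \<Rightarrow> real"
  proof (rule disintegratesI[OF prob_M _ measurable_from_subalg[OF path_sub(2) Z] S_meas[OF t]])
    fix A :: "real set" and E :: "(real^'d) set" assume A: "A \<in> sets borel" and E: "E \<in> sets borel"
    have ZM: "Z \<in> borel_measurable M" by (rule measurable_from_subalg[OF path_sub(2) Z])
    let ?a = "X -` E \<inter> space M" and ?c = "Z -` A \<inter> space M"
    have a: "?a \<in> sets XA" unfolding XA_def using E by (intro in_vimage_algebra)
    have c: "?c \<in> sets WP" using measurable_sets[OF Z A] path_WP(2) by auto
    have aM: "?a \<in> sets M" "?c \<in> sets M" using measurable_sets[OF X_meas E] measurable_sets[OF ZM A] by auto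
    have "(\<integral>w. indicator A (Z w) * indicator E (S t w) \<partial>M) = (\<integral>w. indicator (?a \<inter> ?c) w \<partial>M :: real)"
    proof (rule integral_cong_AE)
      show "AE w in M. indicator A (Z w) * indicator E (S t w) = (indicator (?a \<inter> ?c) w :: real)"
        using St AE_space by eventually_elim (auto simp: indicator_def)
    qed (use ZM S_meas[OF t] A E aM in measurable)
    also have "\<dots> = prob (?a \<inter> ?c)" using aM by simp
    also have "\<dots> = prob ?a * prob ?c" by (rule indep_X[OF a c])
    also have "prob ?a = measure (meas m) E"
      unfolding X_law[symmetric] using X_meas E by (subst measure_distr) auto
    also have "measure (meas m) E * prob ?c = (\<integral>w. indicator ?c w * measure (meas m) E \<partial>M)"
      using aM by simp
    also have "\<dots> = (\<integral>w. indicator A (Z w) * measure (meas m) E \<partial>M)"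
      by (intro Bochner_Integration.integral_cong) (auto simp: indicator_def)
    finally show "(\<integral>w. indicator A (Z w) * indicator E (S t w) \<partial>M) = (\<integral>w. indicator A (Z w) * measure (meas m) E \<partial>M)" .
  qed simp
  \<comment> \<open>Almost sure convergence of a constant sequence to \<open>\<mu> t\<close>
    expresses that the two versions agree.\<close>
  have "AE w in M. (\<lambda>n::nat. m) \<longlonglongrightarrow> \<mu> t w"
    by (rule conditional_laws_tendsto[where Y="\<lambda>_::nat. S t" and ?Y0.0="S t", OF prob_M path_sub(2) _ \<mu>_path[OF t] S_meas[OF t] S_meas[OF t] dis \<mu>_disintegrates[OF t]]) auto
  then show ?thesis
  proof eventually_elim
    case (elim w)
    have "(\<lambda>n::nat. f m) \<longlonglongrightarrow> f (\<mu> t w)" by (rule continuous_on_tendsto_compose[OF assms elim]) auto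
    then show ?case using LIMSEQ_unique tendsto_const by blast
  qed
qed

end

section \<open>Small time expansions\<close>

lemma norm_integral_le_integral:
  fixes f :: "'w \<Rightarrow> 'b::{banach,second_countable_topology}"
  assumes "integrable M f" "integrable M g" "AE x in M. norm (f x) \<le> g x"
  shows "norm (\<integral>x. f x \<partial>M) \<le> (\<integral>x. g x \<partial>M)"
  using order_trans[OF integral_norm_bound integral_mono_AE[OF integrable_norm[OF assms(1)] assms(2,3)]] .

lemma (in prob_space) bounded_expectation_tendsto:
  fixes f :: "nat \<Rightarrow> 'a \<Rightarrow> real"
  assumes "\<And>n. f n \<in> borel_measurable M" "f0 \<in> borel_measurable M" "\<And>n. AE x in M. \<bar>f n x\<bar> \<le> C"
    "AE x in M. (\<lambda>n. f n x) \<longlonglongrightarrow> f0 x"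
  shows "(\<lambda>n. \<integral>x. f n x \<partial>M) \<longlonglongrightarrow> (\<integral>x. f0 x \<partial>M)"
  by (rule integral_dominated_convergence[where w="\<lambda>_. C"]) (use assms in simp_all)

text \<open>The ratio of the error to the squared increment is bounded and tends to zero, while the
  squared increment divided by \<open>h\<close> has bounded second moment. Young's inequality with a
  small weight \<open>\<eta>\<close> separates the two factors, which may be dependent.\<close>

lemma quad_error_tendsto:
  fixes e :: "nat \<Rightarrow> 'w \<Rightarrow> real" and \<Delta> :: "nat \<Rightarrow> 'w \<Rightarrow> real^'d"
  assumes M: "prob_space M" and [measurable]: "\<And>n. e n \<in> borel_measurable M" "\<And>n. \<Delta> n \<in> borel_measurable M"
    and le: "\<And>n w. \<bar>e n w\<bar> \<le> K * (norm (\<Delta> n w))\<^sup>2"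
    and lim: "AE w in M. (\<lambda>n. e n w / (norm (\<Delta> n w))\<^sup>2) \<longlonglongrightarrow> 0"
    and h: "\<And>n. 0 < h n" and int: "\<And>n. integrable M (\<lambda>w. norm (\<Delta> n w) ^ 4)"
    and c: "\<And>n. (\<integral>w. norm (\<Delta> n w) ^ 4 \<partial>M) \<le> c * (h n)\<^sup>2"
  shows "(\<lambda>n. (\<integral>w. e n w \<partial>M) / h n) \<longlonglongrightarrow> 0"
proof (rule LIMSEQ_I)
  interpret prob_space M by (rule M)
  fix \<epsilon> :: real assume \<epsilon>: "\<epsilon> > 0"
  have "0 \<le> (\<integral>w. norm (\<Delta> 0 w) ^ 4 \<partial>M)" by simp
  with c[of 0] have "0 \<le> c * (h 0)\<^sup>2" by linarith
  then have c0: "0 \<le> c" using h[of 0] by (simp add: zero_le_mult_iff)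
  define r where "r n w = e n w / (norm (\<Delta> n w))\<^sup>2" for n w
  have [measurable]: "r n \<in> borel_measurable M" for n unfolding r_def by measurable
  \<comment> \<open>Where the increment vanishes the bound forces \<open>e n w = 0\<close>, and
    \<open>r n w\<close> is zero by the convention for division.\<close>
  have er: "e n w = r n w * (norm (\<Delta> n w))\<^sup>2" for n w
    using le[of n w] by (cases "\<Delta> n w = 0") (auto simp: r_def)
  have rK: "\<bar>r n w\<bar> \<le> max K 0" for n w
    using le[of n w] by (cases "\<Delta> n w = 0") (auto simp: r_def divide_simps le_max_iff_disj)
  have r2K: "(r n w)\<^sup>2 \<le> (max K 0)\<^sup>2" for n w
    using power_mono[OF rK abs_ge_zero, of n w 2] by simp
  have r2: "integrable M (\<lambda>w. (r n w)\<^sup>2)" for n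
    by (rule integrable_const_bound[where B="(max K 0)\<^sup>2"]) (use r2K in auto)
  have "(\<lambda>n. \<integral>w. (r n w)\<^sup>2 \<partial>M) \<longlonglongrightarrow> (\<integral>w. 0 \<partial>M)"
  proof (rule integral_dominated_convergence[where w="\<lambda>_. (max K 0)\<^sup>2"])
    show "AE w in M. (\<lambda>n. (r n w)\<^sup>2) \<longlonglongrightarrow> 0"
      using lim
    proof eventually_elim
      case (elim w)
      from tendsto_power[OF elim, of 2] show ?case by (simp add: r_def)
    qed
    show "AE w in M. norm ((r n w)\<^sup>2) \<le> (max K 0)\<^sup>2" for n using r2K by simp
  qed simp_all
  then have lim2: "(\<lambda>n. \<integral>w. (r n w)\<^sup>2 \<partial>M) \<longlonglongrightarrow> 0" by simp
  \<comment> \<open>The contribution of the fourth moment is at most \<open>\<eta> * c\<close>,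
    which this keeps below \<open>\<epsilon> / 2\<close> for every \<open>n\<close>; the summand one
    covers \<open>c = 0\<close>.\<close>
  define \<eta> where "\<eta> = \<epsilon> / (2 * (c + 1))"
  have \<eta>: "0 < \<eta>" using \<epsilon> c0 by (simp add: \<eta>_def)
  have \<eta>c: "\<eta> * c < \<epsilon> / 2"
  proof -
    have "\<eta> * c < \<eta> * (c + 1)" using \<eta> by simp
    also have "\<dots> = \<epsilon> / 2" using c0 by (simp add: \<eta>_def divide_simps)
    finally show ?thesis .
  qed
  obtain N where N: "\<And>n. n \<ge> N \<Longrightarrow> \<bar>\<integral>w. (r n w)\<^sup>2 \<partial>M\<bar> < \<epsilon> / 2 * \<eta>"
    using LIMSEQ_D[OF lim2, of "\<epsilon> / 2 * \<eta>"] \<epsilon> \<eta> by auto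
  show "\<exists>N. \<forall>n\<ge>N. norm ((\<integral>w. e n w \<partial>M) / h n - 0) < \<epsilon>"
  proof (intro exI[of _ N] allI impI)
    fix n assume n: "n \<ge> N"
    have pw: "norm (e n w / h n) \<le> (r n w)\<^sup>2 / \<eta> + \<eta> / (h n)\<^sup>2 * norm (\<Delta> n w) ^ 4" for w
    proof -
      define x where "x = (norm (\<Delta> n w))\<^sup>2 / h n"
      have x: "0 \<le> x" "\<eta> / (h n)\<^sup>2 * norm (\<Delta> n w) ^ 4 = \<eta> * x\<^sup>2"
        using h[of n] by (simp_all add: x_def power_divide flip: power_mult)
      have "norm (e n w / h n) = \<bar>r n w\<bar> * x" using h[of n] by (simp add: er x_def abs_mult)
      \<comment> \<open>Completing the square: this nonnegative quantity is the bound to be shown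
        minus twice \<open>\<bar>r n w\<bar> * x\<close>.\<close>
      moreover have "0 \<le> (\<bar>r n w\<bar> - \<eta> * x)\<^sup>2 / \<eta>" using \<eta> by simp
      moreover have "(\<bar>r n w\<bar> - \<eta> * x)\<^sup>2 / \<eta> = (r n w)\<^sup>2 / \<eta> + \<eta> * x\<^sup>2 - 2 * (\<bar>r n w\<bar> * x)"
        using \<eta> by (simp add: field_simps power2_eq_square)
      moreover have "0 \<le> \<bar>r n w\<bar> * x" using x by simp
      ultimately show ?thesis unfolding x(2) by linarith
    qed
    have wi: "integrable M (\<lambda>w. (r n w)\<^sup>2 / \<eta> + \<eta> / (h n)\<^sup>2 * norm (\<Delta> n w) ^ 4)"
      using r2 int by (intro Bochner_Integration.integrable_add integrable_divide integrable_mult_right)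
    have ei: "integrable M (\<lambda>w. e n w / h n)"
    proof (rule Bochner_Integration.integrable_bound[OF wi])
      show "AE w in M. norm (e n w / h n) \<le> norm ((r n w)\<^sup>2 / \<eta> + \<eta> / (h n)\<^sup>2 * norm (\<Delta> n w) ^ 4)"
        using pw order_trans[OF _ abs_ge_self] unfolding real_norm_def by (intro AE_I2) blast
    qed measurable
    have "\<bar>\<integral>w. e n w / h n \<partial>M\<bar> \<le> (\<integral>w. (r n w)\<^sup>2 / \<eta> + \<eta> / (h n)\<^sup>2 * norm (\<Delta> n w) ^ 4 \<partial>M)"
      unfolding real_norm_def[symmetric] by (rule norm_integral_le_integral[OF ei wi AE_I2[OF pw]])
    also have "\<dots> = (\<integral>w. (r n w)\<^sup>2 \<partial>M) / \<eta> + \<eta> / (h n)\<^sup>2 * (\<integral>w. norm (\<Delta> n w) ^ 4 \<partial>M)"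
      using r2 int by simp
    also have "\<dots> < \<epsilon> / 2 + \<epsilon> / 2"
    proof (rule add_strict_mono)
      show "(\<integral>w. (r n w)\<^sup>2 \<partial>M) / \<eta> < \<epsilon> / 2" using N[OF n] \<eta> by (simp add: divide_simps)
      have "\<eta> / (h n)\<^sup>2 * (\<integral>w. norm (\<Delta> n w) ^ 4 \<partial>M) \<le> \<eta> / (h n)\<^sup>2 * (c * (h n)\<^sup>2)"
        using c \<eta> by (intro mult_left_mono) auto
      also have "\<dots> = \<eta> * c" using h[of n] by simp
      also note \<eta>c
      finally show "\<eta> / (h n)\<^sup>2 * (\<integral>w. norm (\<Delta> n w) ^ 4 \<partial>M) < \<epsilon> / 2" .
    qed
    finally show "norm ((\<integral>w. e n w \<partial>M) / h n - 0) < \<epsilon>" by simp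
  qed
qed

context
  fixes M H :: "'w measure" and \<Delta> :: "'w \<Rightarrow> real^'d" and h :: real
  assumes M: "prob_space M" and H: "subalgebra M H" and h: "0 < h" and \<Delta>: "\<Delta> \<in> borel_measurable M"
    and ind: "prob_space.indep_set M (sets H) (sets (vimage_algebra (space M) \<Delta> borel))"
    and law: "distr M borel \<Delta> = density lborel (\<lambda>x. ennreal (\<Prod>i\<in>UNIV. normal_density 0 (sqrt h) (x $ i)))"
begin

text \<open>The coefficient is exchanged for an \<open>H\<close>-measurable representative; the
  increment is independent of the latter, so the expectations factor.\<close>

lemma indep_gaussian_moments:
  assumes q: "almost_measurable M H q" "q \<in> borel_measurable M" "\<And>w. \<bar>q w\<bar> \<le> C"
  shows "integrable M (\<lambda>w. q w * \<Delta> w $ i)" "(\<integral>w. q w * \<Delta> w $ i \<partial>M) = 0"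
    "integrable M (\<lambda>w. q w * (\<Delta> w $ i * \<Delta> w $ j))"
    "(\<integral>w. q w * (\<Delta> w $ i * \<Delta> w $ j) \<partial>M) = (if i = j then h * (\<integral>w. q w \<partial>M) else 0)"
proof -
  interpret prob_space M by (rule M)
  note mom = gaussian_low_moments[OF h law \<Delta>]
  obtain p where p: "p \<in> borel_measurable H" and qp: "AE w in M. q w = p w"
    using q(1) by (auto simp: almost_measurable_def)
  have pM [measurable]: "p \<in> borel_measurable M" by (rule measurable_from_subalg[OF H p])
  note [measurable] = q(2) \<Delta>
  have pi: "integrable M p"
  proof (rule integrable_const_bound[where B=C])
    show "AE w in M. norm (p w) \<le> C" using qp by eventually_elim (use q(3) in \<open>metis real_norm_def\<close>)
  qed simp
  have qpi: "(\<integral>w. q w \<partial>M) = (\<integral>w. p w \<partial>M)" by (rule integral_cong_AE) (use qp in auto)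
  have *: "integrable M (\<lambda>w. q w * g (\<Delta> w)) \<and> (\<integral>w. q w * g (\<Delta> w) \<partial>M) = (\<integral>w. q w \<partial>M) * (\<integral>w. g (\<Delta> w) \<partial>M)"
    if g [measurable]: "g \<in> borel_measurable borel" and gi: "integrable M (\<lambda>w. g (\<Delta> w))" for g
  proof
    note e = indep_expectation[OF M ind H \<Delta> p pi g gi]
    have ae: "AE w in M. q w * g (\<Delta> w) = p w * g (\<Delta> w)" using qp by eventually_elim simp
    show "integrable M (\<lambda>w. q w * g (\<Delta> w))" by (subst integrable_cong_AE[OF _ _ ae]) (use e(2) in auto)
    have "(\<integral>w. q w * g (\<Delta> w) \<partial>M) = (\<integral>w. p w * g (\<Delta> w) \<partial>M)" by (rule integral_cong_AE[OF _ _ ae]) auto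
    then show "(\<integral>w. q w * g (\<Delta> w) \<partial>M) = (\<integral>w. q w \<partial>M) * (\<integral>w. g (\<Delta> w) \<partial>M)"
      using e(1) by (simp add: qpi)
  qed
  show "integrable M (\<lambda>w. q w * \<Delta> w $ i)" "(\<integral>w. q w * \<Delta> w $ i \<partial>M) = 0"
    using *[of "\<lambda>x. x $ i"] mom(1,2)[of i] by auto
  show "integrable M (\<lambda>w. q w * (\<Delta> w $ i * \<Delta> w $ j))"
    "(\<integral>w. q w * (\<Delta> w $ i * \<Delta> w $ j) \<partial>M) = (if i = j then h * (\<integral>w. q w \<partial>M) else 0)"
    using *[of "\<lambda>x. x $ i * x $ j"] mom(3,4)[of i j] by auto
qed

lemma indep_gaussian_linear:
  assumes q: "\<And>i. almost_measurable M H (q i)" "\<And>i. q i \<in> borel_measurable M" "\<And>i w. \<bar>q i w\<bar> \<le> C"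
  shows "integrable M (\<lambda>w. \<Sum>i\<in>UNIV. q i w * \<Delta> w $ i)" "(\<integral>w. (\<Sum>i\<in>UNIV. q i w * \<Delta> w $ i) \<partial>M) = 0"
proof -
  note i = indep_gaussian_moments(1,2)[OF q]
  show "integrable M (\<lambda>w. \<Sum>i\<in>UNIV. q i w * \<Delta> w $ i)" by (intro Bochner_Integration.integrable_sum i)
  show "(\<integral>w. (\<Sum>i\<in>UNIV. q i w * \<Delta> w $ i) \<partial>M) = 0" by (subst Bochner_Integration.integral_sum) (simp_all add: i)
qed

lemma indep_gaussian_quadratic:
  assumes q: "\<And>i j. almost_measurable M H (q i j)" "\<And>i j. q i j \<in> borel_measurable M" "\<And>i j w. \<bar>q i j w\<bar> \<le> C"
  shows "integrable M (\<lambda>w. \<Sum>i\<in>UNIV. \<Sum>j\<in>UNIV. q i j w * (\<Delta> w $ i * \<Delta> w $ j))"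
    "(\<integral>w. (\<Sum>i\<in>UNIV. \<Sum>j\<in>UNIV. q i j w * (\<Delta> w $ i * \<Delta> w $ j)) \<partial>M) = h * (\<Sum>i\<in>UNIV. \<integral>w. q i i w \<partial>M)"
proof -
  note i = indep_gaussian_moments(3,4)[OF q]
  show "integrable M (\<lambda>w. \<Sum>i\<in>UNIV. \<Sum>j\<in>UNIV. q i j w * (\<Delta> w $ i * \<Delta> w $ j))"
    by (intro Bochner_Integration.integrable_sum i)
  have "(\<integral>w. (\<Sum>i\<in>UNIV. \<Sum>j\<in>UNIV. q i j w * (\<Delta> w $ i * \<Delta> w $ j)) \<partial>M)
      = (\<Sum>i\<in>UNIV. \<Sum>j\<in>UNIV. (if i = j then h * (\<integral>w. q i j w \<partial>M) else 0))"
    by (subst Bochner_Integration.integral_sum, (intro Bochner_Integration.integrable_sum i),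
      subst Bochner_Integration.integral_sum) (simp_all add: i)
  then show "(\<integral>w. (\<Sum>i\<in>UNIV. \<Sum>j\<in>UNIV. q i j w * (\<Delta> w $ i * \<Delta> w $ j)) \<partial>M) = h * (\<Sum>i\<in>UNIV. \<integral>w. q i i w \<partial>M)"
    by (simp add: sum_distrib_left)
qed

end

text \<open>Expresses the form at a transformed Gaussian vector through products of two coordinates
  of the vector itself, so that coordinate moments can be inserted.\<close>

lemma inner_matrix_column_sum:
  fixes A s :: "real^'n^'n"
  shows "(s *v z) \<bullet> (A *v (s *v z)) = (\<Sum>i\<in>UNIV. \<Sum>j\<in>UNIV. (column i s \<bullet> (A *v column j s)) * (z $ i * z $ j))"
proof -
  have 1: "s *v z = (\<Sum>i\<in>UNIV. z $ i *\<^sub>R column i s)"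
    by (simp add: matrix_mult_sum scalar_mult_eq_scaleR)
  have 2: "A *v (\<Sum>i\<in>UNIV. z $ i *\<^sub>R column i s) = (\<Sum>i\<in>UNIV. z $ i *\<^sub>R (A *v column i s))"
    by (simp add: linear_sum[OF matrix_vector_mul_linear] matrix_vector_mult_scaleR)
  show ?thesis
    unfolding 1 2 inner_sum_left unfolding inner_sum_right
    by (intro sum.cong) (simp_all add: mult_ac)
qed

lemma inner_column_sum:
  fixes s :: "real^'n^'n"
  shows "g \<bullet> (s *v z) = (\<Sum>i\<in>UNIV. (g \<bullet> column i s) * z $ i)"
  by (simp add: matrix_mult_sum scalar_mult_eq_scaleR inner_sum_right mult.commute)

text \<open>Matches the traces in \<open>generator\<close> with the sums over columns that Gaussian
  second moments produce.\<close>

lemma trace_mult_transpose: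
  fixes A s :: "real^'n^'n"
  shows "trace (A ** (s ** transpose s)) = (\<Sum>k\<in>UNIV. column k s \<bullet> (A *v column k s))"
proof -
  have "(\<Sum>k\<in>UNIV. column k s \<bullet> (A *v column k s)) = (\<Sum>k\<in>UNIV. \<Sum>i\<in>UNIV. \<Sum>j\<in>UNIV. A $ i $ j * (s $ j $ k * s $ i $ k))"
    by (simp add: inner_vec_def column_def matrix_vector_mult_def sum_distrib_left mult_ac)
  also have "\<dots> = (\<Sum>i\<in>UNIV. \<Sum>k\<in>UNIV. \<Sum>j\<in>UNIV. A $ i $ j * (s $ j $ k * s $ i $ k))" by (rule sum.swap)
  also have "\<dots> = (\<Sum>i\<in>UNIV. \<Sum>j\<in>UNIV. \<Sum>k\<in>UNIV. A $ i $ j * (s $ j $ k * s $ i $ k))"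
    by (intro sum.cong[OF refl] sum.swap)
  also have "\<dots> = trace (A ** (s ** transpose s))"
    by (simp add: trace_def matrix_matrix_mult_def transpose_def sum_distrib_left)
  finally show ?thesis by simp
qed

lemma disintegrates_integral:
  fixes g :: "'z::topological_space \<Rightarrow> real^'d \<Rightarrow> real"
  assumes "disintegrates M Z \<kappa> Y" "(\<lambda>(z, y). g z y) \<in> borel_measurable borel" "\<And>z y. \<bar>g z y\<bar> \<le> C"
  shows "(\<integral>w. g (Z w) (Y w) \<partial>M) = (\<integral>w. (\<integral>y. g (Z w) y \<partial>meas (\<kappa> w)) \<partial>M)"
proof -
  have "bounded (range (\<lambda>(z, y). g z y))" unfolding bounded_iff by (rule exI[of _ C]) (use assms(3) in auto)
  then show ?thesis using assms(1,2) unfolding disintegrates_def by force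
qed

text \<open>The translation has to be known together with \<open>Z\<close>, because the translated
  test function depends on both.\<close>

lemma disintegrates_translate:
  fixes Z :: "'w \<Rightarrow> 'z::second_countable_topology" and Y a :: "'w \<Rightarrow> real^'d"
  assumes "disintegrates M (\<lambda>w. (Z w, a w)) \<kappa> Y"
  shows "disintegrates M Z (\<lambda>w. push (\<lambda>x. x + a w) (\<kappa> w)) (\<lambda>w. Y w + a w)"
  unfolding disintegrates_def
proof (intro allI impI)
  fix g :: "'z \<times> (real^'d) \<Rightarrow> real" assume g: "g \<in> borel_measurable borel" and b: "bounded (range g)"
  have pb: "(borel :: ('z \<times> (real^'d)) measure) = borel \<Otimes>\<^sub>M borel" by (simp add: borel_prod)
  obtain C where C: "\<And>p. \<bar>g p\<bar> \<le> C" using b by (auto simp: bounded_iff)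
  have "(\<lambda>(p :: 'z \<times> (real^'d), y). (fst p, y + snd p)) \<in> (borel \<Otimes>\<^sub>M borel) \<Otimes>\<^sub>M borel \<rightarrow>\<^sub>M (borel \<Otimes>\<^sub>M borel)"
    by measurable
  from measurable_compose[OF this, of g borel] g
  have "(\<lambda>(p :: 'z \<times> (real^'d), y). g (fst p, y + snd p)) \<in> borel_measurable borel"
    by (simp add: borel_prod case_prod_beta' split_beta')
  from disintegrates_integral[OF assms this C]
  have "(\<integral>w. g (Z w, Y w + a w) \<partial>M) = (\<integral>w. (\<integral>y. g (Z w, y + a w) \<partial>meas (\<kappa> w)) \<partial>M)" by simp
  also have "\<dots> = (\<integral>w. (\<integral>y. g (Z w, y) \<partial>meas (push (\<lambda>x. x + a w) (\<kappa> w))) \<partial>M)"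
  proof (rule Bochner_Integration.integral_cong[OF refl])
    fix w
    have "(\<lambda>y. g (Z w, y)) \<in> borel_measurable borel"
      by (rule measurable_compose[OF _ g]) (simp add: pb)
    then show "(\<integral>y. g (Z w, y + a w) \<partial>meas (\<kappa> w)) = (\<integral>y. g (Z w, y) \<partial>meas (push (\<lambda>x. x + a w) (\<kappa> w)))"
      by (subst integral_push) simp_all
  qed
  finally show "(\<integral>w. g (Z w, Y w + a w) \<partial>M) = (\<integral>w. (\<integral>y. g (Z w, y) \<partial>meas (push (\<lambda>x. x + a w) (\<kappa> w))) \<partial>M)" .
qed

section \<open>Invariance of the value function along the flow\<close>

locale mckean_vlasov_pde = mckean_vlasov_solution M F T W W0 \<sigma> B t m X S \<mu> + smooth_function T K U Ut D1 D2
  for M :: "'w measure" and F T and W W0 :: "real \<Rightarrow> 'w \<Rightarrow> real^'d" and \<sigma> B t m X S \<mu> K U Ut and D1 :: "real \<Rightarrow> (real^'d) prob_measure \<Rightarrow> real^'d \<Rightarrow> real" and D2 +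
  assumes pde: "r \<in> {0..<T} \<Longrightarrow> Ut r n + generator B \<sigma> D1 D2 r n = 0"
begin

text \<open>The standard basis as columns of the identity: the formulas for the columns of
  \<open>\<sigma>\<close> then apply to \<open>W\<close> with the matrix
  \<open>mat 1\<close>.\<close>

abbreviation unit_col :: "'d \<Rightarrow> real^'d" where "unit_col k \<equiv> column k (mat 1 :: real^'d^'d)"

section \<open>Splitting of the generator into drift, idiosyncratic and common part\<close>

definition drift :: "real \<Rightarrow> (real^'d) prob_measure \<Rightarrow> real" where
  "drift r n = (\<integral>x. grad (D1 r n) x \<bullet> B r x n \<partial>meas n)"

definition idio_part :: "real \<Rightarrow> (real^'d) prob_measure \<Rightarrow> real" where
  "idio_part r n = (\<Sum>k\<in>UNIV. hess_form r n (unit_col k) (unit_col k)) / 2"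

text \<open>The common noise contributes its share of the Hessian term and the whole mixed term,
  because it moves all particles together.\<close>

definition common_part :: "real \<Rightarrow> (real^'d) prob_measure \<Rightarrow> real" where
  "common_part r n = (\<Sum>k\<in>UNIV. hess_form r n (column k \<sigma>) (column k \<sigma>) + mixed_form r n (column k \<sigma>) (column k \<sigma>)) / 2"

lemma mixed_integral:
  assumes r: "r \<in> {0..T}"
  shows "(\<integral>(x, y). a \<bullet> (mixed_grad (D2 r n) x y *v b) \<partial>(meas n \<Otimes>\<^sub>M meas n)) = mixed_form r n a b"
    "integrable (meas n \<Otimes>\<^sub>M meas n) (\<lambda>(x, y). a \<bullet> (mixed_grad (D2 r n) x y *v b))"
proof -
  interpret N: prob_space "meas n" by simp
  interpret P: pair_prob_space "meas n" "meas n" ..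
  have "(\<lambda>p. a \<bullet> (mixed_grad (D2 r n) (fst p) (snd p) *v b)) \<in> borel_measurable (borel \<Otimes>\<^sub>M borel)"
    by (intro measurable_forms(3)[OF r] measurable_fst measurable_snd measurable_const) simp
  moreover have "sets (meas n \<Otimes>\<^sub>M meas n) = sets (borel \<Otimes>\<^sub>M borel)" by (intro sets_pair_measure_cong) simp_all
  ultimately have m: "(\<lambda>(x, y). a \<bullet> (mixed_grad (D2 r n) x y *v b)) \<in> borel_measurable (meas n \<Otimes>\<^sub>M meas n)"
    unfolding case_prod_unfold by (simp cong: measurable_cong_sets)
  show i: "integrable (meas n \<Otimes>\<^sub>M meas n) (\<lambda>(x, y). a \<bullet> (mixed_grad (D2 r n) x y *v b))"
    by (rule P.P.integrable_const_bound[where B="K * (norm a * norm b)", OF _ m]) (use mixed_form_le[OF r] in auto)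
  show "(\<integral>(x, y). a \<bullet> (mixed_grad (D2 r n) x y *v b) \<partial>(meas n \<Otimes>\<^sub>M meas n)) = mixed_form r n a b"
    unfolding mixed_form_def P.integral_fst[OF i] ..
qed

lemma hess_integrable:
  assumes r: "r \<in> {0..T}"
  shows "integrable (meas n) (\<lambda>x. a \<bullet> (jac (grad (D1 r n)) x *v b))"
  by (rule integrable_meas_bounded[where C="K * (norm a * norm b)", OF measurable_form_pair(2)[OF r]])
    (use hess_form_le[OF r] in simp)

lemma generator_eq:
  assumes r: "r \<in> {0..T}"
  shows "generator B \<sigma> D1 D2 r n = drift r n + idio_part r n + common_part r n"
proof -
  have tr: "trace (A ** (mat 1 + \<sigma> ** transpose \<sigma>)) =
      (\<Sum>k\<in>UNIV. unit_col k \<bullet> (A *v unit_col k)) + (\<Sum>k\<in>UNIV. column k \<sigma> \<bullet> (A *v column k \<sigma>))" for A :: "real^'d^'d"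
    using trace_mult_transpose[of A "mat 1"] trace_mult_transpose[of A \<sigma>] by (simp add: matrix_add_ldistrib trace_add)
  have s: "integrable (meas n) (\<lambda>x. \<Sum>k\<in>UNIV. v k \<bullet> (jac (grad (D1 r n)) x *v v k))" for v :: "'d \<Rightarrow> real^'d"
    by (intro Bochner_Integration.integrable_sum hess_integrable[OF r])
  have e: "(\<integral>x. (\<Sum>k\<in>UNIV. v k \<bullet> (jac (grad (D1 r n)) x *v v k)) \<partial>meas n) = (\<Sum>k\<in>UNIV. hess_form r n (v k) (v k))" for v :: "'d \<Rightarrow> real^'d"
    unfolding hess_form_def by (rule Bochner_Integration.integral_sum) (rule hess_integrable[OF r])
  have 1: "(\<integral>x. trace (jac (grad (D1 r n)) x ** (mat 1 + \<sigma> ** transpose \<sigma>)) \<partial>meas n)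
      = (\<Sum>k\<in>UNIV. hess_form r n (unit_col k) (unit_col k)) + (\<Sum>k\<in>UNIV. hess_form r n (column k \<sigma>) (column k \<sigma>))"
    unfolding tr by (subst Bochner_Integration.integral_add[OF s s]) (simp only: e)
  have "(\<integral>(x, y). trace (mixed_grad (D2 r n) x y ** (\<sigma> ** transpose \<sigma>)) \<partial>(meas n \<Otimes>\<^sub>M meas n))
      = (\<integral>p. (\<Sum>k\<in>UNIV. case p of (x, y) \<Rightarrow> column k \<sigma> \<bullet> (mixed_grad (D2 r n) x y *v column k \<sigma>)) \<partial>(meas n \<Otimes>\<^sub>M meas n))"
    unfolding trace_mult_transpose by (simp add: case_prod_unfold)
  also have "\<dots> = (\<Sum>k\<in>UNIV. mixed_form r n (column k \<sigma>) (column k \<sigma>))"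
    by (subst Bochner_Integration.integral_sum, rule mixed_integral(2)[OF r]) (simp only: mixed_integral(1)[OF r])
  finally show ?thesis
    unfolding generator_def 1 drift_def[symmetric] idio_part_def common_part_def by (simp add: sum.distrib field_simps)
qed

lemma parts_tendsto:
  assumes "r \<longlonglongrightarrow> s" "\<And>n. r n \<in> {0..T}" "s \<in> {0..T}" "\<nu> \<longlonglongrightarrow> \<nu>0"
  shows "(\<lambda>n. idio_part (r n) (\<nu> n)) \<longlonglongrightarrow> idio_part s \<nu>0" "(\<lambda>n. common_part (r n) (\<nu> n)) \<longlonglongrightarrow> common_part s \<nu>0"
  unfolding idio_part_def common_part_def
  by (intro tendsto_divide tendsto_const tendsto_sum tendsto_add hess_form_tendsto[OF assms] mixed_form_tendsto[OF assms]; simp)+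

text \<open>Continuity in time cannot be taken from \<open>B\<close>. The equation writes the drift
  term through the time derivative and the two noise parts, which are continuous, but only for times
  before \<open>T\<close>.\<close>

lemma drift_tendsto:
  assumes "r \<longlonglongrightarrow> s" "\<And>n. r n \<in> {0..<T}" "s \<in> {0..<T}" "\<nu> \<longlonglongrightarrow> \<nu>0"
  shows "(\<lambda>n. drift (r n) (\<nu> n)) \<longlonglongrightarrow> drift s \<nu>0"
proof -
  have e: "drift r n = - Ut r n - idio_part r n - common_part r n" if "r \<in> {0..<T}" for r n
    using pde[OF that, of n] generator_eq[of r n] that by auto
  have r: "r n \<in> {0..T}" "s \<in> {0..T}" for n using assms(2)[of n] assms(3) by auto
  show ?thesis unfolding e[OF assms(2)] e[OF assms(3)]
    by (intro tendsto_intros Ut_tendsto[OF assms(1) r assms(4)] parts_tendsto[OF assms(1) r assms(4)])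
qed

lemma continuous_parts:
  assumes "r \<in> {0..T}"
  shows "continuous_on UNIV (Ut r)" "continuous_on UNIV (idio_part r)" "continuous_on UNIV (common_part r)" "continuous_on UNIV (U r)"
    "r < T \<Longrightarrow> continuous_on UNIV (drift r)"
  by (intro continuous_on_UNIV_sequentiallyI Ut_tendsto parts_tendsto U_tendsto drift_tendsto tendsto_const; use assms in simp)+

definition CB :: real where "CB = (SOME C. 0 \<le> C \<and> (\<forall>s\<in>{0..T}. \<forall>x n. norm (B s x n) \<le> C))"

lemma CB: "0 \<le> CB" "s \<in> {0..T} \<Longrightarrow> norm (B s x n) \<le> CB"
proof -
  obtain C L where C: "\<And>s x n. s \<in> {0..T} \<Longrightarrow> norm (B s x n) \<le> C" and L: "0 < L"
    and "\<And>s x y n. s \<in> {0..T} \<Longrightarrow> norm (B s x n - B s y n) \<le> L * norm (x - y)"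
    by (rule B_bounds) (rule that)
  have "0 \<le> C" using C[of 0 0 m] T0 order_trans[OF norm_ge_zero] by auto
  then have "\<exists>C. 0 \<le> C \<and> (\<forall>s\<in>{0..T}. \<forall>x n. norm (B s x n) \<le> C)" using C by blast
  from someI_ex[OF this, folded CB_def] show "0 \<le> CB" "s \<in> {0..T} \<Longrightarrow> norm (B s x n) \<le> CB" by blast+
qed

lemma parts_bounds:
  assumes "r \<in> {0..T}"
  shows "\<bar>drift r n\<bar> \<le> K * CB" "\<bar>idio_part r n\<bar> \<le> (\<Sum>k\<in>UNIV. K * (norm (unit_col k) * norm (unit_col k)))"
    "\<bar>common_part r n\<bar> \<le> (\<Sum>k\<in>UNIV. K * (norm (column k \<sigma>) * norm (column k \<sigma>)))"
proof -
  have "\<bar>grad (D1 r n) x \<bullet> B r x n\<bar> \<le> K * CB" for x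
    by (rule order_trans[OF Cauchy_Schwarz_ineq2 mult_mono]) (use grad_le[OF assms] CB(2)[OF assms] K_nonneg in auto)
  moreover have "(\<lambda>x. grad (D1 r n) x \<bullet> B r x n) \<in> borel_measurable borel"
    by (intro borel_measurable_inner measurable_derivatives(4)[OF assms, where h="\<lambda>_. 0"] B_measurable) (use assms in auto)
  ultimately show "\<bar>drift r n\<bar> \<le> K * CB"
    unfolding drift_def real_norm_def[symmetric] by (intro integral_meas_bounded)
  have "\<bar>\<Sum>k\<in>UNIV. hess_form r n (unit_col k) (unit_col k)\<bar> \<le> (\<Sum>k\<in>UNIV. K * (norm (unit_col k) * norm (unit_col k)))"
    by (rule order_trans[OF sum_abs sum_mono]) (rule hess_form_bound[OF assms])
  then show "\<bar>idio_part r n\<bar> \<le> (\<Sum>k\<in>UNIV. K * (norm (unit_col k) * norm (unit_col k)))"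
    unfolding idio_part_def by linarith
  have "\<bar>\<Sum>k\<in>UNIV. hess_form r n (column k \<sigma>) (column k \<sigma>) + mixed_form r n (column k \<sigma>) (column k \<sigma>)\<bar>
      \<le> (\<Sum>k\<in>UNIV. K * (norm (column k \<sigma>) * norm (column k \<sigma>)) + K * (norm (column k \<sigma>) * norm (column k \<sigma>)))"
    by (rule order_trans[OF sum_abs sum_mono], rule order_trans[OF abs_triangle_ineq add_mono])
      (rule hess_form_bound[OF assms] mixed_form_bound[OF assms])+
  then show "\<bar>common_part r n\<bar> \<le> (\<Sum>k\<in>UNIV. K * (norm (column k \<sigma>) * norm (column k \<sigma>)))"
    unfolding common_part_def by (simp add: sum.distrib flip: sum_distrib_left)
qed

lemma U_meas: "r \<in> {0..T} \<Longrightarrow> f \<in> borel_measurable N \<Longrightarrow> (\<lambda>w. U r (f w)) \<in> borel_measurable N"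
  using measurable_forms(5)[of r f N "\<lambda>_. 0"] by simp

lemma U_integrable: assumes "r \<in> {0..T}" "f \<in> borel_measurable M" shows "integrable M (\<lambda>w. U r (f w))"
proof -
  obtain C where "\<forall>t\<in>{0..T}. \<forall>m. \<bar>U t m\<bar> \<le> C" using U_bounded by blast
  then show ?thesis by (intro integrable_const_bound[where B=C] U_meas assms AE_I2) (use assms in auto)
qed

section \<open>Translation of the law by the common noise\<close>

definition noise :: "real \<Rightarrow> real \<Rightarrow> 'w \<Rightarrow> real^'d" where "noise u v w = \<sigma> *v (W0 v w - W0 u w)"

text \<open>The conditional law, given the common noise, of \<open>S u\<close> shifted by the noise
  increment: the intermediate law at which the increment of the value is split.\<close>

definition moved :: "real \<Rightarrow> real \<Rightarrow> 'w \<Rightarrow> (real^'d) prob_measure" where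
  "moved u v w = push (\<lambda>x. x + noise u v w) (\<mu> u w)"

lemma noise_path: "u \<in> {0..T} \<Longrightarrow> v \<in> {0..T} \<Longrightarrow> noise u v \<in> borel_measurable (path W0)"
  unfolding noise_def by (intro common_noise_measurable borel_measurable_diff path_component)

lemma noise_meas: "u \<in> {0..T} \<Longrightarrow> v \<in> {0..T} \<Longrightarrow> noise u v \<in> borel_measurable M"
  by (rule measurable_from_subalg[OF path_sub(2) noise_path])

lemma moved_path: "u \<in> {0..T} \<Longrightarrow> v \<in> {0..T} \<Longrightarrow> moved u v \<in> borel_measurable (path W0)"
proof -
  assume u: "u \<in> {0..T}" "v \<in> {0..T}"
  have [measurable]: "noise u v \<in> borel_measurable (path W0)" by (rule noise_path[OF u])
  show ?thesis unfolding moved_def by (rule measurable_push[OF \<mu>_path[OF u(1)]]) measurable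
qed

lemma moved_meas: "u \<in> {0..T} \<Longrightarrow> v \<in> {0..T} \<Longrightarrow> moved u v \<in> borel_measurable M"
  by (rule measurable_from_subalg[OF path_sub(2) moved_path])

lemma noise_moment:
  assumes "0 \<le> u" "u < v" "v \<le> T"
  shows "integrable M (\<lambda>w. norm (noise u v w) ^ 4)"
    "(\<integral>w. norm (noise u v w) ^ 4 \<partial>M) \<le> norm \<sigma> ^ 4 * (3 * real CARD('d) ^ 2) * (v - u)\<^sup>2"
proof -
  have uv: "u \<in> {0..T}" "v \<in> {0..T}" using assms by auto
  have h: "0 < v - u" using assms by simp
  have D: "(\<lambda>w. W0 v w - W0 u w) \<in> borel_measurable M" by (intro borel_measurable_diff W_meas uv)
  note mom = gaussian_low_moments(5,6)[OF h W_law(2)[OF assms] D]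
  have le: "norm (noise u v w) ^ 4 \<le> norm \<sigma> ^ 4 * norm (W0 v w - W0 u w) ^ 4" for w
    unfolding noise_def power_mult_distrib[symmetric] by (rule power_mono[OF matrix_vector_norm_le]) simp
  have [measurable]: "noise u v \<in> borel_measurable M" by (rule noise_meas[OF uv])
  show i: "integrable M (\<lambda>w. norm (noise u v w) ^ 4)"
    by (rule Bochner_Integration.integrable_bound[OF integrable_mult_right[OF mom(1), of "norm \<sigma> ^ 4"]])
      (use le in \<open>auto simp: abs_mult\<close>)
  have "(\<integral>w. norm (noise u v w) ^ 4 \<partial>M) \<le> (\<integral>w. norm \<sigma> ^ 4 * norm (W0 v w - W0 u w) ^ 4 \<partial>M)"
    by (rule integral_mono[OF i integrable_mult_right[OF mom(1)] le])
  also have "\<dots> = norm \<sigma> ^ 4 * (\<integral>w. norm (W0 v w - W0 u w) ^ 4 \<partial>M)" by simp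
  also have "\<dots> \<le> norm \<sigma> ^ 4 * (3 * real CARD('d) ^ 2 * (v - u)\<^sup>2)" by (rule mult_left_mono[OF mom(2)]) simp
  finally show "(\<integral>w. norm (noise u v w) ^ 4 \<partial>M) \<le> norm \<sigma> ^ 4 * (3 * real CARD('d) ^ 2) * (v - u)\<^sup>2" by (simp add: mult.assoc)
qed

lemma form_expansion:
  assumes r: "r \<in> {0..T}"
  shows "(\<integral>x. grad (D1 r n) x \<bullet> (\<sigma> *v z) \<partial>meas n) = (\<Sum>i\<in>UNIV. (\<integral>x. grad (D1 r n) x \<bullet> column i \<sigma> \<partial>meas n) * z $ i)"
    "hess_form r n (\<sigma> *v z) (\<sigma> *v z) = (\<Sum>i\<in>UNIV. \<Sum>j\<in>UNIV. hess_form r n (column i \<sigma>) (column j \<sigma>) * (z $ i * z $ j))"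
    "mixed_form r n (\<sigma> *v z) (\<sigma> *v z) = (\<Sum>i\<in>UNIV. \<Sum>j\<in>UNIV. mixed_form r n (column i \<sigma>) (column j \<sigma>) * (z $ i * z $ j))"
proof -
  have g: "integrable (meas n) (\<lambda>x. grad (D1 r n) x \<bullet> a)" for a
    by (rule integrable_meas_bounded[where C="K * norm a", OF measurable_form_pair(1)[OF r]], unfold real_norm_def,
        rule order_trans[OF Cauchy_Schwarz_ineq2 mult_right_mono[OF grad_le[OF r]]]) simp
  show "(\<integral>x. grad (D1 r n) x \<bullet> (\<sigma> *v z) \<partial>meas n) = (\<Sum>i\<in>UNIV. (\<integral>x. grad (D1 r n) x \<bullet> column i \<sigma> \<partial>meas n) * z $ i)"
    unfolding inner_column_sum by (subst Bochner_Integration.integral_sum) (simp_all add: g)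
  show "hess_form r n (\<sigma> *v z) (\<sigma> *v z) = (\<Sum>i\<in>UNIV. \<Sum>j\<in>UNIV. hess_form r n (column i \<sigma>) (column j \<sigma>) * (z $ i * z $ j))"
    unfolding hess_form_def inner_matrix_column_sum
    by (subst Bochner_Integration.integral_sum, (intro Bochner_Integration.integrable_sum integrable_mult_left hess_integrable[OF r]),
      subst Bochner_Integration.integral_sum, (intro integrable_mult_left hess_integrable[OF r])) simp
  have m: "integrable (meas n \<Otimes>\<^sub>M meas n) (\<lambda>p. a \<bullet> (mixed_grad (D2 r n) (fst p) (snd p) *v b))" for a b
    using mixed_integral(2)[OF r, of n a b] by (simp add: case_prod_unfold)
  show "mixed_form r n (\<sigma> *v z) (\<sigma> *v z) = (\<Sum>i\<in>UNIV. \<Sum>j\<in>UNIV. mixed_form r n (column i \<sigma>) (column j \<sigma>) * (z $ i * z $ j))"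
    unfolding mixed_integral(1)[OF r, symmetric] inner_matrix_column_sum case_prod_unfold
    by (subst Bochner_Integration.integral_sum, (intro Bochner_Integration.integrable_sum integrable_mult_left m),
      subst Bochner_Integration.integral_sum, (intro integrable_mult_left m)) simp
qed

text \<open>An exact identity, since \<open>remainder\<close> collects all that lies beyond the
  quadratic expansion. The increment of \<open>W0\<close> has to be independent of the coefficients,
  so these are measured by \<open>F u\<close>, which contains the information in
  \<open>\<mu> u\<close>, and not by \<open>past u\<close>, which contains all of
  \<open>W0\<close>.\<close>

lemma common_step:
  assumes uv: "0 \<le> u" "u < v" "v \<le> T"
  shows "(\<integral>w. U u (moved u v w) \<partial>M) - (\<integral>w. U u (\<mu> u w) \<partial>M)
     = (v - u) * (\<integral>w. common_part u (\<mu> u w) \<partial>M) + (\<integral>w. remainder u (\<mu> u w) (noise u v w) \<partial>M)"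
    "(\<lambda>w. remainder u (\<mu> u w) (noise u v w)) \<in> borel_measurable M"
proof -
  have u: "u \<in> {0..T}" "v \<in> {0..T}" and h: "0 < v - u" using uv by auto
  define \<Delta> where "\<Delta> w = W0 v w - W0 u w" for w
  have D: "\<Delta> \<in> borel_measurable M" unfolding \<Delta>_def by (intro borel_measurable_diff W_meas u)
  have \<mu>F: "\<mu> u \<in> borel_measurable (F u)" by (rule measurable_from_subalg[OF G_sub(3)[OF u(1)] \<mu>_G[OF u(1)]])
  have am: "almost_measurable M (F u) q \<and> q \<in> borel_measurable M" if "q \<in> borel_measurable (F u)" for q :: "'w \<Rightarrow> real"
    using that measurable_from_subalg[OF F_sub[OF u(1)] that] almost_measurableI by blast
  define l where "l i w = (\<integral>x. grad (D1 u (\<mu> u w)) x \<bullet> column i \<sigma> \<partial>meas (\<mu> u w))" for i w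
  define Q where "Q i j w = (hess_form u (\<mu> u w) (column i \<sigma>) (column j \<sigma>) + mixed_form u (\<mu> u w) (column i \<sigma>) (column j \<sigma>)) / 2" for i j w
  have lF: "l i \<in> borel_measurable (F u)" for i
    unfolding l_def
    by (rule borel_measurable_integral_meas[OF _ \<mu>F], unfold case_prod_unfold)
      (intro measurable_forms(1)[OF u(1)] measurable_compose[OF measurable_fst \<mu>F] measurable_snd)
  have form_cont: "continuous_on UNIV (\<lambda>n. (hess_form u n a b + mixed_form u n a b) / 2)" for a b
    by (intro continuous_on_UNIV_sequentiallyI tendsto_divide tendsto_add hess_form_tendsto mixed_form_tendsto tendsto_const)
      (use u in simp_all)
  have QF: "Q i j \<in> borel_measurable (F u)" for i j
    unfolding Q_def by (rule measurable_compose[OF \<mu>F borel_measurable_continuous_onI[OF form_cont]])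
  have l_le: "\<bar>l i w\<bar> \<le> K * (\<Sum>i\<in>UNIV. norm (column i \<sigma>))" for i w
  proof -
    have "\<bar>grad (D1 u n) x \<bullet> column i \<sigma>\<bar> \<le> K * (\<Sum>i\<in>UNIV. norm (column i \<sigma>))" for n x
      by (rule order_trans[OF Cauchy_Schwarz_ineq2 mult_mono[OF grad_le[OF u(1)]]])
        (use K_nonneg member_le_sum[of i UNIV "\<lambda>i. norm (column i \<sigma>)"] in auto)
    then show ?thesis unfolding l_def real_norm_def[symmetric]
      by (intro integral_meas_bounded measurable_form_pair(1)[OF u(1)])
  qed
  define c where "c = (\<Sum>i\<in>UNIV. norm (column i \<sigma>))"
  have c: "norm (column i \<sigma>) \<le> c" "0 \<le> c" for i
    unfolding c_def using member_le_sum[of i UNIV "\<lambda>i. norm (column i \<sigma>)"] by (auto intro: sum_nonneg)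
  have Q_le: "\<bar>Q i j w\<bar> \<le> K * (c * c)" for i j w
  proof -
    have k: "K * (norm (column i \<sigma>) * norm (column j \<sigma>)) \<le> K * (c * c)"
      by (intro mult_left_mono mult_mono c K_nonneg norm_ge_zero)
    have half: "\<bar>(x + y) / 2\<bar> \<le> b" if "\<bar>x\<bar> \<le> a" "\<bar>y\<bar> \<le> a" "a \<le> b" for x y a b :: real
      using that by (auto simp: abs_le_iff)
    show ?thesis unfolding Q_def by (rule half[OF hess_form_bound[OF u(1)] mixed_form_bound[OF u(1)] k])
  qed
  note ind = W_indep(2)[OF uv, folded \<Delta>_def] and law = W_law(2)[OF uv, folded \<Delta>_def]
  note lin = indep_gaussian_linear[OF prob_M F_sub[OF u(1)] h D ind law conjunct1[OF am[OF lF]] conjunct2[OF am[OF lF]] l_le]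
  note qua = indep_gaussian_quadratic[OF prob_M F_sub[OF u(1)] h D ind law conjunct1[OF am[OF QF]] conjunct2[OF am[OF QF]] Q_le]
  let ?L = "\<lambda>w. \<Sum>i\<in>UNIV. l i w * \<Delta> w $ i" and ?Q = "\<lambda>w. \<Sum>i\<in>UNIV. \<Sum>j\<in>UNIV. Q i j w * (\<Delta> w $ i * \<Delta> w $ j)"
  have "remainder u (\<mu> u w) (noise u v w) = U u (moved u v w) - U u (\<mu> u w) - ?L w - ?Q w" for w
  proof -
    have "?Q w = (hess_form u (\<mu> u w) (\<sigma> *v \<Delta> w) (\<sigma> *v \<Delta> w) + mixed_form u (\<mu> u w) (\<sigma> *v \<Delta> w) (\<sigma> *v \<Delta> w)) / 2"
      unfolding form_expansion(2,3)[OF u(1)] Q_def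
      by (simp add: sum.distrib[symmetric] sum_divide_distrib algebra_simps add_divide_distrib)
    then show ?thesis
      unfolding remainder_def moved_def l_def form_expansion(1)[OF u(1), symmetric]
      by (simp add: noise_def \<Delta>_def hess_form_def mixed_form_def)
  qed
  then have rem: "(\<lambda>w. remainder u (\<mu> u w) (noise u v w)) = (\<lambda>w. U u (moved u v w) - U u (\<mu> u w) - ?L w - ?Q w)" by auto
  note i = U_integrable[OF u(1) moved_meas[OF u]] U_integrable[OF u(1) \<mu>_meas[OF u(1)]] lin(1) qua(1)
  show "(\<lambda>w. remainder u (\<mu> u w) (noise u v w)) \<in> borel_measurable M"
    unfolding rem by (intro borel_measurable_diff borel_measurable_integrable i)
  \<comment> \<open>Off-diagonal second moments of the increment vanish, so exactly the diagonal of
    \<open>Q\<close> enters, and its sum is \<open>common_part\<close>.\<close>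
  have "(\<integral>w. common_part u (\<mu> u w) \<partial>M) = (\<Sum>i\<in>UNIV. \<integral>w. Q i i w \<partial>M)"
  proof -
    have "integrable M (Q k k)" for k
      by (rule integrable_const_bound[OF _ conjunct2[OF am[OF QF]], where B="K * (c * c)"]) (use Q_le in auto)
    then show ?thesis
      by (subst Bochner_Integration.integral_sum[symmetric]) (simp_all add: common_part_def Q_def sum_divide_distrib)
  qed
  then show "(\<integral>w. U u (moved u v w) \<partial>M) - (\<integral>w. U u (\<mu> u w) \<partial>M)
     = (v - u) * (\<integral>w. common_part u (\<mu> u w) \<partial>M) + (\<integral>w. remainder u (\<mu> u w) (noise u v w) \<partial>M)"
    unfolding rem using i lin(2) qua(2) by simp
qed

end

section \<open>The drift and the idiosyncratic increment\<close>

context mckean_vlasov_pde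
begin

definition rate :: "real \<Rightarrow> 'w \<Rightarrow> real^'d" where
  "rate \<tau> w = B (clip \<tau>) (S (clip \<tau>) w) (\<mu> (clip \<tau>) w)"

text \<open>The time integral is taken over a finite measure space, ready for Fubini with
  \<open>M\<close>.\<close>

definition drift_step :: "real \<Rightarrow> real \<Rightarrow> 'w \<Rightarrow> real^'d" where
  "drift_step u v w = (\<integral>\<tau>. rate \<tau> w \<partial>restrict_space lborel {u..v})"

lemma rate_joint: "(\<lambda>(\<tau>, w). rate \<tau> w) \<in> borel_measurable (borel \<Otimes>\<^sub>M M)"
proof -
  have "clip \<in> borel_measurable borel" by (intro borel_measurable_continuous_onI clip_cont)
  from measurable_compose[OF measurable_fst this]
  show ?thesis
    unfolding rate_def case_prod_unfold using S_clip \<mu>_clip unfolding case_prod_unfold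
    by (intro B_measurable) auto
qed

lemma rate_le: "norm (rate \<tau> w) \<le> CB"
  unfolding rate_def by (rule CB(2)) simp

lemma rate_meas: "rate \<tau> \<in> borel_measurable M"
  using measurable_compose[OF measurable_Pair1'[of \<tau> borel M] rate_joint] by simp

lemma rate_time: "w \<in> space M \<Longrightarrow> (\<lambda>\<tau>. rate \<tau> w) \<in> borel_measurable borel"
  using measurable_compose[OF measurable_Pair2'[of w M borel] rate_joint] by simp

lemma time_measure:
  fixes u v :: real
  assumes "u \<le> v"
  shows "finite_measure (restrict_space lborel {u..v})" "measure (restrict_space lborel {u..v}) {u..v} = v - u"
    "space (restrict_space lborel {u..v}) = {u..v}"
proof -
  show s: "space (restrict_space lborel {u..v}) = {u..v}" by (simp add: space_restrict_space)
  have e: "emeasure (restrict_space lborel {u..v}) {u..v} = ennreal (v - u)"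
    using assms by (simp add: emeasure_restrict_space)
  then show "measure (restrict_space lborel {u..v}) {u..v} = v - u"
    unfolding measure_def using assms by simp
  show "finite_measure (restrict_space lborel {u..v})" by (rule finite_measureI) (simp add: s e)
qed

lemma rate_joint_restrict: "(\<lambda>(\<tau>, w). rate \<tau> w) \<in> borel_measurable (restrict_space lborel {u..v} \<Otimes>\<^sub>M M)"
proof -
  have "(\<lambda>\<tau>. \<tau>) \<in> restrict_space lborel {u..v} \<rightarrow>\<^sub>M borel" by (rule measurable_restrict_space1) simp
  then have "(\<lambda>p. (fst p, snd p)) \<in> restrict_space lborel {u..v} \<Otimes>\<^sub>M M \<rightarrow>\<^sub>M borel \<Otimes>\<^sub>M M"
    by (intro measurable_Pair measurable_snd measurable_compose[OF measurable_fst])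
  from measurable_compose[OF this rate_joint] show ?thesis by simp
qed

lemma drift_step_meas:
  assumes "u \<le> v" shows "drift_step u v \<in> borel_measurable M"
proof -
  interpret N: finite_measure "restrict_space lborel {u..v}" by (rule time_measure[OF assms])
  have "(\<lambda>(w, \<tau>). rate \<tau> w) \<in> borel_measurable (M \<Otimes>\<^sub>M restrict_space lborel {u..v})"
    using measurable_compose[OF measurable_pair_swap' rate_joint_restrict] by (simp add: case_prod_unfold)
  then show ?thesis unfolding drift_step_def[abs_def] by (rule N.borel_measurable_lebesgue_integral)
qed

lemma rate_integrable:
  assumes "u \<le> v" "w \<in> space M"
  shows "integrable (restrict_space lborel {u..v}) (\<lambda>\<tau>. rate \<tau> w)"
proof -
  interpret N: finite_measure "restrict_space lborel {u..v}" by (rule time_measure[OF assms(1)])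
  show ?thesis
    by (rule N.integrable_const_bound[where B=CB]) (use rate_le measurable_restrict_space1[OF rate_time[OF assms(2)], of "{u..v}"] in
      \<open>auto simp: measurable_lborel1 cong: measurable_cong_sets\<close>)
qed

lemma drift_step_le:
  assumes "u \<le> v" "w \<in> space M"
  shows "norm (drift_step u v w) \<le> CB * (v - u)"
proof -
  interpret N: finite_measure "restrict_space lborel {u..v}" by (rule time_measure[OF assms(1)])
  have "norm (drift_step u v w) \<le> (\<integral>\<tau>. CB \<partial>restrict_space lborel {u..v})"
    unfolding drift_step_def by (rule norm_integral_le_integral[OF rate_integrable[OF assms]]) (use rate_le in auto)
  then show ?thesis using time_measure[OF assms(1)] by (simp add: mult.commute)
qed

lemma drift_step_fubini:
  assumes uv: "u \<le> v" and g: "g \<in> borel_measurable M" "\<And>w. norm (g w) \<le> C"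
  shows "(\<integral>w. g w \<bullet> drift_step u v w \<partial>M) = (\<integral>\<tau>. (\<integral>w. g w \<bullet> rate \<tau> w \<partial>M) \<partial>restrict_space lborel {u..v})"
    "integrable (restrict_space lborel {u..v}) (\<lambda>\<tau>. \<integral>w. g w \<bullet> rate \<tau> w \<partial>M)"
proof -
  let ?N = "restrict_space lborel {u..v}"
  interpret N: finite_measure ?N by (rule time_measure[OF uv])
  interpret P: pair_sigma_finite ?N M by standard
  have C: "0 \<le> C" using order_trans[OF norm_ge_zero g(2)] .
  have "(\<lambda>p. g (snd p)) \<in> borel_measurable (?N \<Otimes>\<^sub>M M)" by (rule measurable_compose[OF measurable_snd g(1)])
  from borel_measurable_inner[OF this rate_joint_restrict[unfolded case_prod_unfold]]
  have m: "(\<lambda>(\<tau>, w). g w \<bullet> rate \<tau> w) \<in> borel_measurable (?N \<Otimes>\<^sub>M M)" by (simp add: case_prod_unfold)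
  interpret PP: finite_measure "?N \<Otimes>\<^sub>M M" by (rule finite_measure_pair_measure) unfold_locales
  have "\<bar>g w \<bullet> rate \<tau> w\<bar> \<le> C * CB" for w \<tau>
    by (rule order_trans[OF Cauchy_Schwarz_ineq2 mult_mono]) (use g rate_le C in auto)
  then have i: "integrable (?N \<Otimes>\<^sub>M M) (\<lambda>(\<tau>, w). g w \<bullet> rate \<tau> w)"
    by (intro PP.integrable_const_bound[OF _ m, where B="C * CB"]) auto
  show "integrable ?N (\<lambda>\<tau>. \<integral>w. g w \<bullet> rate \<tau> w \<partial>M)" by (rule P.integrable_fst[OF i])
  have "(\<integral>w. g w \<bullet> drift_step u v w \<partial>M) = (\<integral>w. (\<integral>\<tau>. g w \<bullet> rate \<tau> w \<partial>?N) \<partial>M)"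
    unfolding drift_step_def by (rule Bochner_Integration.integral_cong[OF refl])
      (simp add: integral_inner_right[OF rate_integrable[OF uv]])
  also have "\<dots> = (\<integral>\<tau>. (\<integral>w. g w \<bullet> rate \<tau> w \<partial>M) \<partial>?N)"
    unfolding P.integral_snd[OF i] P.integral_fst[OF i] ..
  finally show "(\<integral>w. g w \<bullet> drift_step u v w \<partial>M) = (\<integral>\<tau>. (\<integral>w. g w \<bullet> rate \<tau> w \<partial>M) \<partial>?N)" .
qed

text \<open>The particle after the common noise up to \<open>v\<close> has acted, but before drift
  and \<open>W\<close> have; its law given the common noise is \<open>moved u v\<close>. What is
  missing to \<open>S v\<close> is \<open>increment\<close>.\<close>

definition start :: "real \<Rightarrow> real \<Rightarrow> 'w \<Rightarrow> real^'d" where "start u v w = S u w + noise u v w"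

definition increment :: "real \<Rightarrow> real \<Rightarrow> 'w \<Rightarrow> real^'d" where "increment u v w = S v w - start u v w"

lemma increment_eq:
  assumes uv: "t \<le> u" "u < v" "v \<le> T"
  shows "AE w in M. increment u v w = drift_step u v w + (W v w - W u w)"
  using S_eq AE_space
proof eventually_elim
  case (elim w)
  have tT: "0 \<le> t" using t by simp
  have r: "(LBINT s:{t..r}. B s (S s w) (\<mu> s w)) = (LBINT s:{t..r}. rate s w)" if "r \<le> T" for r
    by (rule set_lebesgue_integral_cong) (use that tT in \<open>auto simp: rate_def\<close>)
  have si: "set_integrable lborel A (\<lambda>s. rate s w)" if "A = {a..b}" for A and a b :: real
    unfolding that by (rule set_integrable_bounded_Icc[OF rate_time[OF elim(2)] rate_le])
  have "{t..u} \<union> {u..v} = {t..v}" using uv by auto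
  then have "(LBINT s:{t..v}. rate s w) = (LBINT s:{t..u} \<union> {u..v}. rate s w)" by simp
  also have "\<dots> = (LBINT s:{t..u}. rate s w) + (LBINT s:{u..v}. rate s w)"
  proof (rule set_integral_Un_AE[OF _ _ _ si si])
    show "AE x in lborel. \<not> (x \<in> {t..u} \<and> x \<in> {u..v})" using AE_lborel_singleton[of u] by eventually_elim auto
  qed auto
  also have "(LBINT s:{u..v}. rate s w) = drift_step u v w"
    unfolding drift_step_def set_lebesgue_integral_def by (subst integral_restrict_space) auto
  finally have "(LBINT s:{t..v}. rate s w) = (LBINT s:{t..u}. rate s w) + drift_step u v w" .
  moreover have "S v w = X w + (LBINT s:{t..v}. rate s w) + (W v w - W t w) + \<sigma> *v (W0 v w - W0 t w)"
    "S u w = X w + (LBINT s:{t..u}. rate s w) + (W u w - W t w) + \<sigma> *v (W0 u w - W0 t w)"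
    using elim(1) uv r by auto
  ultimately show ?case
    by (simp add: increment_def start_def noise_def matrix_vector_mult_diff_distrib)
qed

lemma increment_meas: "u \<in> {0..T} \<Longrightarrow> v \<in> {0..T} \<Longrightarrow> start u v \<in> borel_measurable M"
  "u \<in> {0..T} \<Longrightarrow> v \<in> {0..T} \<Longrightarrow> increment u v \<in> borel_measurable M"
  unfolding increment_def[abs_def] start_def[abs_def] by (intro borel_measurable_diff borel_measurable_add S_meas noise_meas; assumption)+

text \<open>The first moment is obtained from the fourth through
  \<open>x \<le> r + x ^ 4 / r ^ 3\<close>, where \<open>r = sqrt (v - u)\<close> is the scale at
  which the two terms balance.\<close>

lemma W_moment:
  assumes "0 \<le> u" "u < v" "v \<le> T"
  shows "integrable M (\<lambda>w. norm (W v w - W u w) ^ 4)"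
    "(\<integral>w. norm (W v w - W u w) ^ 4 \<partial>M) \<le> 3 * real CARD('d) ^ 2 * (v - u)\<^sup>2"
    "integrable M (\<lambda>w. norm (W v w - W u w))"
    "(\<integral>w. norm (W v w - W u w) \<partial>M) \<le> sqrt (v - u) * (1 + 3 * real CARD('d) ^ 2)"
proof -
  have h: "0 < v - u" using assms by simp
  have D: "(\<lambda>w. W v w - W u w) \<in> borel_measurable M" using assms by (intro borel_measurable_diff W_meas) auto
  show m: "integrable M (\<lambda>w. norm (W v w - W u w) ^ 4)"
    "(\<integral>w. norm (W v w - W u w) ^ 4 \<partial>M) \<le> 3 * real CARD('d) ^ 2 * (v - u)\<^sup>2"
    using gaussian_low_moments(5,6)[OF h W_law(1)[OF assms] D] by auto
  define r where "r = sqrt (v - u)"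
  have r: "0 < r" "r ^ 4 = (v - u)\<^sup>2"
    using h by (auto simp: r_def power4_eq_xxxx power2_eq_square)
  have le: "x \<le> r + x ^ 4 / r ^ 3" if x: "0 \<le> x" for x
  proof (cases "x \<le> r")
    case True then show ?thesis using r x by (simp add: add_increasing2)
  next
    case False
    then have "r ^ 3 \<le> x ^ 3" using r by (intro power_mono) auto
    then have "x * r ^ 3 \<le> x * x ^ 3" using x by (intro mult_left_mono)
    then have "x \<le> x ^ 4 / r ^ 3" using r by (simp add: pos_le_divide_eq power4_eq_xxxx power3_eq_cube mult_ac)
    then show ?thesis using r by linarith
  qed
  have i: "integrable M (\<lambda>w. r + norm (W v w - W u w) ^ 4 / r ^ 3)" using m by simp
  show n: "integrable M (\<lambda>w. norm (W v w - W u w))"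
    by (rule Bochner_Integration.integrable_bound[OF i]) (use D le r in \<open>auto intro: order_trans[OF _ abs_ge_self]\<close>)
  have "(\<integral>w. norm (W v w - W u w) \<partial>M) \<le> (\<integral>w. r + norm (W v w - W u w) ^ 4 / r ^ 3 \<partial>M)"
    by (rule integral_mono[OF n i]) (use le in simp)
  also have "\<dots> = r + (\<integral>w. norm (W v w - W u w) ^ 4 \<partial>M) / r ^ 3" using m by (simp add: prob_space)
  also have "\<dots> \<le> r + 3 * real CARD('d) ^ 2 * r ^ 4 / r ^ 3"
    using m(2) r by (intro add_left_mono divide_right_mono) auto
  also have "\<dots> = r * (1 + 3 * real CARD('d) ^ 2)"
    using r by (simp add: field_simps power4_eq_xxxx power3_eq_cube)
  finally show "(\<integral>w. norm (W v w - W u w) \<partial>M) \<le> sqrt (v - u) * (1 + 3 * real CARD('d) ^ 2)" by (simp add: r_def)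
qed

text \<open>The bounded drift contributes \<open>CB ^ 4 * (v - u) ^ 4\<close>, reduced to order two
  by \<open>v - u \<le> T\<close>. The factor \<open>8\<close> is the convexity constant of the
  fourth power of a sum.\<close>

lemma increment_moment:
  assumes uv: "t \<le> u" "u < v" "v \<le> T"
  shows "integrable M (\<lambda>w. norm (increment u v w) ^ 4)"
    "(\<integral>w. norm (increment u v w) ^ 4 \<partial>M) \<le> 8 * (CB ^ 4 * T\<^sup>2 + 3 * real CARD('d) ^ 2) * (v - u)\<^sup>2"
    "integrable M (\<lambda>w. (norm (increment u v w))\<^sup>2)" "integrable M (\<lambda>w. norm (increment u v w))"
proof -
  have u: "0 \<le> u" "u \<in> {0..T}" "v \<in> {0..T}" using uv t by auto
  note Wm = W_moment[OF u(1) uv(2,3)]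
  note [measurable] = increment_meas(2)[OF u(2,3)]
  have four: "(a + b) ^ 4 \<le> 8 * (a ^ 4 + b ^ 4)" for a b :: real
  proof -
    have "(a + b)\<^sup>2 \<le> 2 * (a\<^sup>2 + b\<^sup>2)" using sum_squares_bound[of a b] by (simp add: power2_eq_square algebra_simps)
    then have "((a + b)\<^sup>2)\<^sup>2 \<le> (2 * (a\<^sup>2 + b\<^sup>2))\<^sup>2" by (intro power_mono) auto
    also have "\<dots> \<le> 4 * (2 * ((a\<^sup>2)\<^sup>2 + (b\<^sup>2)\<^sup>2))"
      using sum_squares_bound[of "a\<^sup>2" "b\<^sup>2"] by (simp add: power2_eq_square algebra_simps)
    finally show ?thesis by simp
  qed
  have b: "CB ^ 4 * (v - u) ^ 4 \<le> CB ^ 4 * T\<^sup>2 * (v - u)\<^sup>2"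
  proof -
    have "(v - u)\<^sup>2 \<le> T\<^sup>2" using uv u by (intro power_mono) auto
    then have "CB ^ 4 * ((v - u)\<^sup>2 * (v - u)\<^sup>2) \<le> CB ^ 4 * (T\<^sup>2 * (v - u)\<^sup>2)" by (intro mult_left_mono mult_right_mono) auto
    then show ?thesis by (simp add: mult.assoc flip: power_add)
  qed
  have le: "AE w in M. norm (increment u v w) ^ 4 \<le> 8 * (CB ^ 4 * T\<^sup>2 * (v - u)\<^sup>2 + norm (W v w - W u w) ^ 4)"
    using increment_eq[OF uv] AE_space
  proof eventually_elim
    case (elim w)
    have "norm (drift_step u v w) ^ 4 \<le> (CB * (v - u)) ^ 4"
      using drift_step_le[OF _ elim(2), of u v] uv by (intro power_mono) auto
    then have d: "norm (drift_step u v w) ^ 4 \<le> CB ^ 4 * T\<^sup>2 * (v - u)\<^sup>2" using b by (simp add: power_mult_distrib)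
    have "norm (increment u v w) ^ 4 \<le> (norm (drift_step u v w) + norm (W v w - W u w)) ^ 4"
      unfolding elim(1) by (rule power_mono[OF norm_triangle_ineq]) simp
    also have "\<dots> \<le> 8 * (norm (drift_step u v w) ^ 4 + norm (W v w - W u w) ^ 4)" by (rule four)
    also have "\<dots> \<le> 8 * (CB ^ 4 * T\<^sup>2 * (v - u)\<^sup>2 + norm (W v w - W u w) ^ 4)"
      by (rule mult_left_mono[OF add_right_mono[OF d]]) simp
    finally show ?case .
  qed
  have i: "integrable M (\<lambda>w. 8 * (CB ^ 4 * T\<^sup>2 * (v - u)\<^sup>2 + norm (W v w - W u w) ^ 4))" using Wm(1) by simp
  show i4: "integrable M (\<lambda>w. norm (increment u v w) ^ 4)"
  proof (rule Bochner_Integration.integrable_bound[OF i])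
    show "AE w in M. norm (norm (increment u v w) ^ 4) \<le> norm (8 * (CB ^ 4 * T\<^sup>2 * (v - u)\<^sup>2 + norm (W v w - W u w) ^ 4))"
      using le by eventually_elim (simp add: abs_of_nonneg)
  qed measurable
  have "(\<integral>w. norm (increment u v w) ^ 4 \<partial>M) \<le> (\<integral>w. 8 * (CB ^ 4 * T\<^sup>2 * (v - u)\<^sup>2 + norm (W v w - W u w) ^ 4) \<partial>M)"
    by (rule integral_mono_AE[OF i4 i le])
  also have "\<dots> = 8 * (CB ^ 4 * T\<^sup>2 * (v - u)\<^sup>2 + (\<integral>w. norm (W v w - W u w) ^ 4 \<partial>M))" using Wm(1) by (simp add: prob_space)
  also have "\<dots> \<le> 8 * (CB ^ 4 * T\<^sup>2 * (v - u)\<^sup>2 + 3 * real CARD('d) ^ 2 * (v - u)\<^sup>2)"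
    by (rule mult_left_mono[OF add_left_mono[OF Wm(2)]]) simp
  finally show "(\<integral>w. norm (increment u v w) ^ 4 \<partial>M) \<le> 8 * (CB ^ 4 * T\<^sup>2 + 3 * real CARD('d) ^ 2) * (v - u)\<^sup>2" by (simp add: algebra_simps)
  have i5: "integrable M (\<lambda>w. 1 + norm (increment u v w) ^ 4)" using i4 by simp
  have "x \<le> 1 + x ^ 4 \<and> x\<^sup>2 \<le> 1 + x ^ 4" if "0 \<le> x" for x :: real
  proof -
    have "2 * x\<^sup>2 \<le> x ^ 4 + 1" using sum_squares_bound[of "x\<^sup>2" 1] by simp
    then have "x\<^sup>2 \<le> 1 + x ^ 4" using zero_le_power2[of x] by linarith
    moreover have "x \<le> 1 + x\<^sup>2" using sum_squares_bound[of x 1] that by simp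
    moreover have "x \<le> 1 \<or> x \<le> x ^ 4" using self_le_power[of x 4] by linarith
    moreover have "0 \<le> x ^ 4" using that by simp
    ultimately show ?thesis by linarith
  qed
  then have *: "norm (increment u v w) \<le> 1 + norm (increment u v w) ^ 4 \<and> (norm (increment u v w))\<^sup>2 \<le> 1 + norm (increment u v w) ^ 4" for w by simp
  show "integrable M (\<lambda>w. (norm (increment u v w))\<^sup>2)" "integrable M (\<lambda>w. norm (increment u v w))"
    by (rule Bochner_Integration.integrable_bound[OF i5]; use * in \<open>auto intro!: AE_I2 intro: order_trans[OF _ abs_ge_self]\<close>)+
qed

text \<open>A point of the segment between the two laws. It is a function of the common noise alone,
  which makes both disintegrations and the independence from \<open>W\<close> usable.\<close>

definition mid :: "real \<Rightarrow> real \<Rightarrow> real \<Rightarrow> 'w \<Rightarrow> (real^'d) prob_measure" where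
  "mid u v \<theta> w = mix \<theta> (moved u v w) (\<mu> v w)"

definition slope :: "real \<Rightarrow> real \<Rightarrow> real \<Rightarrow> 'w \<Rightarrow> real^'d" where
  "slope u v \<theta> w = grad (D1 u (mid u v \<theta> w)) (start u v w)"

definition curv :: "real \<Rightarrow> real \<Rightarrow> real \<Rightarrow> 'w \<Rightarrow> real^'d^'d" where
  "curv u v \<theta> w = jac (grad (D1 u (mid u v \<theta> w))) (start u v w)"

text \<open>\<open>start u v\<close> and \<open>S v\<close> are disintegrated by their respective
  laws over the same variable, the pair of laws, which is measurable for the common noise. For
  \<open>start\<close> this comes from \<open>\<mu> u\<close> by translation. Their difference is
  integrable, as \<open>expectation_coupling_mvt\<close> demands.\<close>

lemma coupling_step:
  assumes uv: "t \<le> u" "u < v" "v \<le> T"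
  shows "\<exists>\<theta>\<in>{0..1}. (\<integral>w. U u (\<mu> v w) \<partial>M) - (\<integral>w. U u (moved u v w) \<partial>M) =
    (\<integral>w. D1 u (mid u v \<theta> w) (S v w) - D1 u (mid u v \<theta> w) (start u v w) \<partial>M)"
  unfolding mid_def
proof (rule expectation_coupling_mvt)
  have u: "u \<in> {0..T}" "v \<in> {0..T}" using uv t by auto
  show "regular_linear_derivative (U u) (D1 u) K" by (rule regular_U[OF u(1)])
  show "prob_space M" by (rule prob_M)
  show "moved u v \<in> borel_measurable M" "\<mu> v \<in> borel_measurable M" "start u v \<in> borel_measurable M" "S v \<in> borel_measurable M"
    by (intro moved_meas \<mu>_meas increment_meas S_meas u)+
  have Z: "(\<lambda>w. (moved u v w, \<mu> v w)) \<in> borel_measurable (path W0)"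
    by (intro borel_measurable_Pair moved_path \<mu>_path u)
  show "disintegrates M (\<lambda>w. (moved u v w, \<mu> v w)) (\<mu> v) (S v)" by (rule \<mu>_disintegrates[OF u(2) Z])
  show "disintegrates M (\<lambda>w. (moved u v w, \<mu> v w)) (moved u v) (start u v)"
    unfolding start_def[abs_def] unfolding moved_def
    by (rule disintegrates_translate[OF \<mu>_disintegrates[OF u(1) borel_measurable_Pair[OF Z[unfolded moved_def] noise_path[OF u]]]])
  show "integrable M (\<lambda>w. norm (S v w - start u v w))"
    using increment_moment(4)[OF uv] by (simp add: increment_def)
qed

end

context mckean_vlasov_pde
begin

lemma unit_col: "unit_col k = axis k 1"
  by (simp add: column_def mat_def axis_def vec_eq_iff)

lemma norm_unit_col: "norm (unit_col k) = 1"
  by (simp add: unit_col)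

context
  fixes u v \<theta> :: real
  assumes uv: "t \<le> u" "u < v" "v \<le> T" and \<theta>: "\<theta> \<in> {0..1}"
begin

lemma uv_range: "0 \<le> u" "u \<in> {0..T}" "v \<in> {0..T}" "0 < v - u"
  using uv t by auto

lemma mid_path: "mid u v \<theta> \<in> borel_measurable (path W0)"
  unfolding mid_def[abs_def] by (intro measurable_mix moved_path \<mu>_path uv_range measurable_const) (use \<theta> in auto)

lemma mid_meas: "mid u v \<theta> \<in> borel_measurable M"
  by (rule measurable_from_subalg[OF path_sub(2) mid_path])

text \<open>\<open>mid\<close> involves the law at the later time \<open>v\<close>, hence the common
  noise after \<open>u\<close>. It still belongs to \<open>past u\<close>, which contains the whole
  path of \<open>W0\<close>, and so remains independent of the increment of
  \<open>W\<close>.\<close>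

lemma mid_start_past:
  assumes f: "(\<lambda>(n, x). f n x) \<in> borel_measurable borel"
  shows "almost_measurable M (past u) (\<lambda>w. f (mid u v \<theta> w) (start u v w))"
proof -
  have p: "Y \<in> borel_measurable (past u)" if "Y \<in> borel_measurable (path W0)" for Y :: "'w \<Rightarrow> 'b::topological_space"
    by (rule measurable_sets_mono[OF that past_sub(2)[OF uv_range(2)]])
      (use past_sub(1)[OF uv_range(2)] in \<open>simp add: subalgebra_def\<close>)
  have "almost_measurable M (past u) (start u v)"
    unfolding start_def[abs_def]
    by (rule almost_measurable_add[OF solution_past[OF uv_range(2)] almost_measurableI[OF p[OF noise_path[OF uv_range(2,3)]]]])
  from almost_measurable_compose[OF almost_measurable_Pair[OF almost_measurableI[OF p[OF mid_path]] this] f]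
  show ?thesis by simp
qed

lemma slope_meas: "slope u v \<theta> \<in> borel_measurable M" "norm (slope u v \<theta> w) \<le> K"
  unfolding slope_def[abs_def]
  by (intro measurable_derivatives(4)[OF uv_range(2), where h="\<lambda>_. 0"] mid_meas increment_meas uv_range, simp)
    (rule grad_le[OF uv_range(2)])

lemma curv_meas: "curv u v \<theta> \<in> borel_measurable M" "\<bar>a \<bullet> (curv u v \<theta> w *v b)\<bar> \<le> K * (norm a * norm b)"
  unfolding curv_def[abs_def]
  by (intro measurable_derivatives(5)[OF uv_range(2), where h="\<lambda>_. 0"] mid_meas increment_meas uv_range, simp)
    (rule hess_form_le[OF uv_range(2)])

lemma curv_quadratic_meas:
  assumes [measurable]: "y \<in> borel_measurable M"
  shows "(\<lambda>w. y w \<bullet> (curv u v \<theta> w *v y w)) \<in> borel_measurable M"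
proof -
  note [measurable] = curv_meas(1)
  have eq: "y w \<bullet> (curv u v \<theta> w *v y w) = (\<Sum>i\<in>UNIV. \<Sum>j\<in>UNIV. (unit_col i \<bullet> (curv u v \<theta> w *v unit_col j)) * (y w $ i * y w $ j))" for w
    using inner_matrix_column_sum[of "mat 1" "y w" "curv u v \<theta> w"] by simp
  have "(\<lambda>w. y w $ i) \<in> borel_measurable M" for i
    by (rule measurable_compose[OF assms borel_measurable_continuous_onI]) (intro continuous_intros)
  then show ?thesis unfolding eq
    by (intro borel_measurable_sum borel_measurable_times borel_measurable_inner_matrix curv_meas(1))
qed

lemma taylor_meas: "(\<lambda>w. taylor_rem u (mid u v \<theta> w) (increment u v w) (start u v w)) \<in> borel_measurable M"
proof -
  note [measurable] = slope_meas(1) increment_meas[OF uv_range(2,3)] curv_quadratic_meas[OF increment_meas(2)[OF uv_range(2,3)]]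
  have [measurable]: "(\<lambda>w. D1 u (mid u v \<theta> w) (y w)) \<in> borel_measurable M" if "y \<in> borel_measurable M" for y
    by (rule measurable_forms(4)[OF uv_range(2) mid_meas that])
  show ?thesis unfolding taylor_rem_def slope_def[symmetric] curv_def[symmetric] by measurable
qed

text \<open>The increment is drift plus Brownian part. The linear term in the Brownian part has mean
  zero, and its quadratic term has mean \<open>v - u\<close> times a trace. The quadratic terms that
  contain the drift remain; by \<open>CB * (v - u)\<close> and the first moment of the Brownian
  increment they are of order \<open>3 / 2\<close> in \<open>v - u\<close>.\<close>

lemma idio_step:
  "\<bar>(\<integral>w. D1 u (mid u v \<theta> w) (S v w) - D1 u (mid u v \<theta> w) (start u v w) \<partial>M)
     - (\<integral>w. slope u v \<theta> w \<bullet> drift_step u v w \<partial>M)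
     - (v - u) * ((\<Sum>k\<in>UNIV. \<integral>w. unit_col k \<bullet> (curv u v \<theta> w *v unit_col k) \<partial>M) / 2)
     - (\<integral>w. taylor_rem u (mid u v \<theta> w) (increment u v w) (start u v w) \<partial>M)\<bar>
   \<le> K * (CB\<^sup>2 * (v - u)\<^sup>2 + 2 * (CB * (v - u)) * (sqrt (v - u) * (1 + 3 * real CARD('d) ^ 2))) / 2"
proof -
  define \<Delta> where "\<Delta> w = W v w - W u w" for w
  define \<delta> where "\<delta> = increment u v"
  define b where "b = CB * (v - u)"
  let ?g = "slope u v \<theta>" and ?C = "curv u v \<theta>" and ?\<beta> = "drift_step u v"
  let ?tr = "\<lambda>w. taylor_rem u (mid u v \<theta> w) (\<delta> w) (start u v w)"
  have D [measurable]: "\<Delta> \<in> borel_measurable M" unfolding \<Delta>_def by (intro borel_measurable_diff W_meas uv_range)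
  have \<delta>m [measurable]: "\<delta> \<in> borel_measurable M" unfolding \<delta>_def by (rule increment_meas[OF uv_range(2,3)])
  note [measurable] = slope_meas(1) curv_meas(1) drift_step_meas[OF less_imp_le[OF uv(2)]] curv_quadratic_meas
  note Wm = W_moment[OF uv_range(1) uv(2,3), folded \<Delta>_def] and inc = increment_moment[OF uv, folded \<delta>_def]
  note ind = past_indep[OF uv_range(2) uv(2,3), folded \<Delta>_def] and law = W_law(1)[OF uv_range(1) uv(2,3), folded \<Delta>_def]
  have ps: "subalgebra M (past u)" by (rule past_sub(1)[OF uv_range(2)])
  have g_am: "almost_measurable M (past u) (\<lambda>w. ?g w \<bullet> unit_col i)" for i
    unfolding slope_def by (rule mid_start_past, unfold case_prod_unfold)
      (intro borel_measurable_inner measurable_derivatives(4)[OF uv_range(2), where h="\<lambda>_. 0"], simp_all add: borel_prod[symmetric])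
  have C_am: "almost_measurable M (past u) (\<lambda>w. unit_col i \<bullet> (?C w *v unit_col j))" for i j
    unfolding curv_def by (rule mid_start_past, unfold case_prod_unfold)
      (intro measurable_forms(2)[OF uv_range(2)], simp_all add: borel_prod[symmetric])
  have g_le: "\<bar>?g w \<bullet> unit_col i\<bar> \<le> K" for w i
    by (rule order_trans[OF Cauchy_Schwarz_ineq2]) (simp add: norm_unit_col slope_meas(2))
  have C_le: "\<bar>unit_col i \<bullet> (?C w *v unit_col j)\<bar> \<le> K" for w i j
    using curv_meas(2)[of "unit_col i" w "unit_col j"] by (simp add: norm_unit_col)
  note lin = indep_gaussian_linear[where q="\<lambda>i w. ?g w \<bullet> unit_col i", OF prob_M ps uv_range(4) D ind law g_am _ g_le]
  note qua = indep_gaussian_quadratic[where q="\<lambda>i j w. unit_col i \<bullet> (?C w *v unit_col j)", OF prob_M ps uv_range(4) D ind law C_am _ C_le]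
  have lin_eq: "(\<Sum>i\<in>UNIV. (?g w \<bullet> unit_col i) * \<Delta> w $ i) = ?g w \<bullet> \<Delta> w" for w
    using inner_column_sum[of "?g w" "mat 1" "\<Delta> w"] by simp
  have qua_eq: "(\<Sum>i\<in>UNIV. \<Sum>j\<in>UNIV. (unit_col i \<bullet> (?C w *v unit_col j)) * (\<Delta> w $ i * \<Delta> w $ j)) = \<Delta> w \<bullet> (?C w *v \<Delta> w)" for w
    using inner_matrix_column_sum[of "mat 1" "\<Delta> w" "?C w"] by simp
  have l: "integrable M (\<lambda>w. ?g w \<bullet> \<Delta> w)" "(\<integral>w. ?g w \<bullet> \<Delta> w \<partial>M) = 0"
    using lin unfolding lin_eq by simp_all
  have q: "integrable M (\<lambda>w. \<Delta> w \<bullet> (?C w *v \<Delta> w))"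
      "(\<integral>w. \<Delta> w \<bullet> (?C w *v \<Delta> w) \<partial>M) = (v - u) * (\<Sum>k\<in>UNIV. \<integral>w. unit_col k \<bullet> (?C w *v unit_col k) \<partial>M)"
    using qua unfolding qua_eq by simp_all
  have K2: "integrable M (\<lambda>w. K * (norm (\<delta> w))\<^sup>2)" using inc(3) by simp
  have Q\<delta>: "integrable M (\<lambda>w. \<delta> w \<bullet> (?C w *v \<delta> w))"
  proof (rule Bochner_Integration.integrable_bound[OF K2])
    show "AE w in M. norm (\<delta> w \<bullet> (?C w *v \<delta> w)) \<le> norm (K * (norm (\<delta> w))\<^sup>2)"
      using curv_meas(2) K_nonneg by (intro AE_I2) (simp add: power2_eq_square abs_mult)
  qed measurable
  have tri: "integrable M ?tr"
  proof (rule Bochner_Integration.integrable_bound[OF K2])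
    show "AE w in M. norm (?tr w) \<le> norm (K * (norm (\<delta> w))\<^sup>2)"
      using taylor_rem_le[OF uv_range(2)] K_nonneg by (intro AE_I2) (simp add: abs_mult)
  qed (use taylor_meas in \<open>simp add: \<delta>_def\<close>)
  have \<beta>_le: "AE w in M. norm (?\<beta> w) \<le> b" unfolding b_def using drift_step_le[of u v] uv(2) by (intro AE_I2) auto
  have g\<beta>: "integrable M (\<lambda>w. ?g w \<bullet> ?\<beta> w)"
  proof (rule integrable_const_bound[where B="K * b"])
    show "AE w in M. norm (?g w \<bullet> ?\<beta> w) \<le> K * b"
      using \<beta>_le by eventually_elim
        (unfold real_norm_def, rule order_trans[OF Cauchy_Schwarz_ineq2 mult_mono], use slope_meas(2) K_nonneg in auto)
  qed measurable
  have inc_eq: "AE w in M. \<delta> w = ?\<beta> w + \<Delta> w" unfolding \<delta>_def \<Delta>_def by (rule increment_eq[OF uv])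
  \<comment> \<open>This is the definition of \<open>taylor_rem\<close>, because
    \<open>start\<close> plus \<open>increment\<close> is \<open>S v\<close>.\<close>
  have pw: "D1 u (mid u v \<theta> w) (S v w) - D1 u (mid u v \<theta> w) (start u v w) = ?tr w + ?g w \<bullet> \<delta> w + \<delta> w \<bullet> (?C w *v \<delta> w) / 2" for w
  proof -
    have "start u v w + \<delta> w = S v w" by (simp add: \<delta>_def increment_def)
    then show ?thesis by (simp add: taylor_rem_def slope_def curv_def)
  qed
  have "(\<integral>w. D1 u (mid u v \<theta> w) (S v w) - D1 u (mid u v \<theta> w) (start u v w) \<partial>M)
    = (\<integral>w. ?tr w + (?g w \<bullet> ?\<beta> w + ?g w \<bullet> \<Delta> w) + \<delta> w \<bullet> (?C w *v \<delta> w) / 2 \<partial>M)"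
    unfolding pw
  proof (rule integral_cong_AE)
    show "AE w in M. ?tr w + ?g w \<bullet> \<delta> w + \<delta> w \<bullet> (?C w *v \<delta> w) / 2
       = ?tr w + (?g w \<bullet> ?\<beta> w + ?g w \<bullet> \<Delta> w) + \<delta> w \<bullet> (?C w *v \<delta> w) / 2"
      using inc_eq by eventually_elim (simp add: inner_add_right)
  qed (use borel_measurable_integrable[OF tri] in measurable)
  also have "\<dots> = (\<integral>w. ?tr w \<partial>M) + (\<integral>w. ?g w \<bullet> ?\<beta> w \<partial>M) + (\<integral>w. \<delta> w \<bullet> (?C w *v \<delta> w) \<partial>M) / 2"
    using tri g\<beta> l Q\<delta> by simp
  finally have 1: "(\<integral>w. D1 u (mid u v \<theta> w) (S v w) - D1 u (mid u v \<theta> w) (start u v w) \<partial>M)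
     - (\<integral>w. ?g w \<bullet> ?\<beta> w \<partial>M) - (v - u) * ((\<Sum>k\<in>UNIV. \<integral>w. unit_col k \<bullet> (?C w *v unit_col k) \<partial>M) / 2) - (\<integral>w. ?tr w \<partial>M)
     = (\<integral>w. \<delta> w \<bullet> (?C w *v \<delta> w) - \<Delta> w \<bullet> (?C w *v \<Delta> w) \<partial>M) / 2"
    using Q\<delta> q by (simp add: diff_divide_distrib)
  have "AE w in M. norm (\<delta> w \<bullet> (?C w *v \<delta> w) - \<Delta> w \<bullet> (?C w *v \<Delta> w)) \<le> K * (b\<^sup>2 + 2 * b * norm (\<Delta> w))"
    using inc_eq \<beta>_le
  proof eventually_elim
    case (elim w)
    let ?n = "norm (?\<beta> w)" and ?w = "norm (\<Delta> w)"
    have b0: "0 \<le> b" using elim(2) norm_ge_zero order_trans by blast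
    \<comment> \<open>The purely Brownian term cancels, and each of the three remaining products
      contains the drift.\<close>
    have "\<delta> w \<bullet> (?C w *v \<delta> w) - \<Delta> w \<bullet> (?C w *v \<Delta> w)
        = ?\<beta> w \<bullet> (?C w *v ?\<beta> w) + ?\<beta> w \<bullet> (?C w *v \<Delta> w) + \<Delta> w \<bullet> (?C w *v ?\<beta> w)"
      unfolding elim(1) by (simp add: matrix_vector_right_distrib inner_add_left inner_add_right)
    then have "norm (\<delta> w \<bullet> (?C w *v \<delta> w) - \<Delta> w \<bullet> (?C w *v \<Delta> w))
        \<le> K * (?n * ?n) + K * (?n * ?w) + K * (?w * ?n)"
      unfolding real_norm_def
      by (simp only:) (rule order_trans[OF abs_triangle_ineq add_mono[OF order_trans[OF abs_triangle_ineq
        add_mono[OF curv_meas(2) curv_meas(2)]] curv_meas(2)]])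
    also have "\<dots> = K * (?n * ?n + 2 * (?n * ?w))" by (simp add: algebra_simps)
    also have "\<dots> \<le> K * (b * b + 2 * (b * ?w))"
      by (intro mult_left_mono add_mono mult_mono elim(2) K_nonneg order_refl b0) auto
    finally show ?case by (simp add: power2_eq_square mult.assoc)
  qed
  from norm_integral_le_integral[OF Bochner_Integration.integrable_diff[OF Q\<delta> q(1)] _ this]
  have "norm (\<integral>w. \<delta> w \<bullet> (?C w *v \<delta> w) - \<Delta> w \<bullet> (?C w *v \<Delta> w) \<partial>M) \<le> (\<integral>w. K * (b\<^sup>2 + 2 * b * norm (\<Delta> w)) \<partial>M)"
    using Wm(3) by simp
  also have "\<dots> = K * (b\<^sup>2 + 2 * b * (\<integral>w. norm (\<Delta> w) \<partial>M))" using Wm(3) by (simp add: prob_space)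
  also have "\<dots> \<le> K * (b\<^sup>2 + 2 * b * (sqrt (v - u) * (1 + 3 * real CARD('d) ^ 2)))"
    by (intro mult_left_mono add_left_mono Wm(4) K_nonneg) (use CB(1) uv(2) in \<open>simp add: b_def\<close>)
  finally show ?thesis
    unfolding \<delta>_def[symmetric] 1 by (simp add: b_def power_mult_distrib)
qed

end

end

section \<open>Limits of the difference quotients\<close>

context mckean_vlasov_pde
begin

text \<open>The inequalities around \<open>s\<close> are weak, so that at each index one of the two
  points may be \<open>s\<close> itself. Staying below \<open>T\<close> keeps every intermediate
  time in the range of the equation.\<close>

context
  fixes u v :: "nat \<Rightarrow> real" and s :: real
  assumes uv: "\<And>n. t \<le> u n" "\<And>n. u n < v n" "\<And>n. v n < T" "\<And>n. u n \<le> s" "\<And>n. s \<le> v n"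
    and u_lim: "u \<longlonglongrightarrow> s" and v_lim: "v \<longlonglongrightarrow> s"
begin

lemma seq_range: "0 \<le> u n" "v n \<le> T" "u n \<in> {0..T}" "v n \<in> {0..T}" "s \<in> {0..T}" "s \<in> {0..<T}" "0 < v n - u n"
  using uv(1,2,3,4,5)[of n] t by auto

lemma width_tendsto: "(\<lambda>n. v n - u n) \<longlonglongrightarrow> 0"
  using tendsto_diff[OF v_lim u_lim] by simp

lemma time_between_tendsto:
  assumes "\<And>n. \<tau> n \<in> {u n..v n}" shows "\<tau> \<longlonglongrightarrow> s" "\<tau> n \<in> {0..<T}"
proof -
  show "\<tau> \<longlonglongrightarrow> s" by (rule tendsto_sandwich[OF always_eventually always_eventually u_lim v_lim]) (use assms in auto)
  show "\<tau> n \<in> {0..<T}" using assms[of n] seq_range(1)[of n] uv(3)[of n] by auto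
qed

lemma \<mu>_seq: "AE w in M. (\<lambda>n. \<mu> (u n) w) \<longlonglongrightarrow> \<mu> s w" "AE w in M. (\<lambda>n. \<mu> (v n) w) \<longlonglongrightarrow> \<mu> s w"
  by (rule \<mu>_tendsto[OF u_lim seq_range(3,5)] \<mu>_tendsto[OF v_lim seq_range(4,5)])+

lemma process_seq:
  assumes "\<tau> \<longlonglongrightarrow> s" "\<And>n. \<tau> n \<in> {0..T}" "continuous_on {0..T} f"
  shows "(\<lambda>n. f (\<tau> n)) \<longlonglongrightarrow> f s"
  by (rule continuous_on_tendsto_compose[OF assms(3,1) seq_range(5)]) (use assms(2) in simp)

lemma noise_seq: "w \<in> space M \<Longrightarrow> (\<lambda>n. noise (u n) (v n) w) \<longlonglongrightarrow> 0"
proof -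
  assume "w \<in> space M"
  note c = W_cont(2)[OF this]
  have "(\<lambda>n. W0 (v n) w - W0 (u n) w) \<longlonglongrightarrow> 0"
    using tendsto_diff[OF process_seq[OF v_lim seq_range(4) c] process_seq[OF u_lim seq_range(3) c]] by simp
  from continuous_on_tendsto_compose[OF matrix_vector_mult_linear_continuous_on[of UNIV \<sigma>] this]
  show ?thesis by (simp add: noise_def)
qed

lemma start_seq: "w \<in> space M \<Longrightarrow> (\<lambda>n. start (u n) (v n) w) \<longlonglongrightarrow> S s w"
  unfolding start_def using tendsto_add[OF process_seq[OF u_lim seq_range(3) S_cont[of w]] noise_seq[of w]] by simp

lemma increment_seq: "w \<in> space M \<Longrightarrow> (\<lambda>n. increment (u n) (v n) w) \<longlonglongrightarrow> 0"
  unfolding increment_def using tendsto_diff[OF process_seq[OF v_lim seq_range(4) S_cont[of w]] start_seq[of w]] by simp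

text \<open>The mean value theorem in time yields an intermediate time that depends on the sample
  point. Its measurability does not matter: it serves only to bound the quotient and to find its
  pointwise limit.\<close>

lemma time_part:
  "(\<lambda>n. ((\<integral>w. U (v n) (\<mu> (v n) w) \<partial>M) - (\<integral>w. U (u n) (\<mu> (v n) w) \<partial>M)) / (v n - u n)) \<longlonglongrightarrow> (\<integral>w. Ut s (\<mu> s w) \<partial>M)"
proof -
  define q where "q n w = (U (v n) (\<mu> (v n) w) - U (u n) (\<mu> (v n) w)) / (v n - u n)" for n w
  have qm: "q n \<in> borel_measurable M" for n unfolding q_def
    by (intro borel_measurable_divide borel_measurable_diff borel_measurable_const U_meas \<mu>_meas seq_range)
  have ex: "\<exists>\<tau>. \<tau> \<in> {u n..v n} \<and> q n w = Ut \<tau> (\<mu> (v n) w)" for n w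
    using U_time_mvt[OF seq_range(3,4) uv(2), of n "\<mu> (v n) w"] seq_range(7)[of n] by (auto simp: q_def)
  have "(\<lambda>n. \<integral>w. q n w \<partial>M) \<longlonglongrightarrow> (\<integral>w. Ut s (\<mu> s w) \<partial>M)"
  proof (rule bounded_expectation_tendsto[OF qm])
    show "(\<lambda>w. Ut s (\<mu> s w)) \<in> borel_measurable M"
      by (rule measurable_compose[OF \<mu>_meas[OF seq_range(5)] borel_measurable_continuous_onI[OF continuous_parts(1)[OF seq_range(5)]]])
    show "AE w in M. \<bar>q n w\<bar> \<le> K" for n
    proof (rule AE_I2)
      fix w
      obtain \<tau> where "\<tau> \<in> {u n..v n}" "q n w = Ut \<tau> (\<mu> (v n) w)" using ex by blast
      then show "\<bar>q n w\<bar> \<le> K" using Ut_le seq_range(1,2)[of n] by auto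
    qed
    show "AE w in M. (\<lambda>n. q n w) \<longlonglongrightarrow> Ut s (\<mu> s w)"
      using \<mu>_seq(2)
    proof eventually_elim
      case (elim w)
      have "\<forall>n. \<exists>\<tau>. \<tau> \<in> {u n..v n} \<and> q n w = Ut \<tau> (\<mu> (v n) w)" using ex by blast
      from choice[OF this] obtain \<tau> where \<tau>: "\<And>n. \<tau> n \<in> {u n..v n}" "\<And>n. q n w = Ut (\<tau> n) (\<mu> (v n) w)" by blast
      have "\<tau> n \<in> {0..T}" for n using time_between_tendsto(2)[OF \<tau>(1), of n] by auto
      from Ut_tendsto[OF time_between_tendsto(1)[OF \<tau>(1)] this seq_range(5) elim] show ?case by (simp add: \<tau>(2))
    qed
  qed
  moreover have "(\<integral>w. q n w \<partial>M) = ((\<integral>w. U (v n) (\<mu> (v n) w) \<partial>M) - (\<integral>w. U (u n) (\<mu> (v n) w) \<partial>M)) / (v n - u n)" for n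
    unfolding q_def using U_integrable[OF seq_range(4) \<mu>_meas[OF seq_range(4)]] U_integrable[OF seq_range(3) \<mu>_meas[OF seq_range(4)]] by simp
  ultimately show ?thesis by simp
qed

text \<open>Pointwise the remainder is of smaller order than the squared noise increment;
  \<open>quad_error_tendsto\<close> turns this into smaller order than \<open>v n - u n\<close> in
  mean.\<close>

lemma common_noise_part:
  "(\<lambda>n. ((\<integral>w. U (u n) (moved (u n) (v n) w) \<partial>M) - (\<integral>w. U (u n) (\<mu> (u n) w) \<partial>M)) / (v n - u n)) \<longlonglongrightarrow> (\<integral>w. common_part s (\<mu> s w) \<partial>M)"
proof -
  have "(\<lambda>n. \<integral>w. common_part (u n) (\<mu> (u n) w) \<partial>M) \<longlonglongrightarrow> (\<integral>w. common_part s (\<mu> s w) \<partial>M)"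
  proof (rule bounded_expectation_tendsto)
    show "(\<lambda>w. common_part (u n) (\<mu> (u n) w)) \<in> borel_measurable M" for n
      by (rule measurable_compose[OF \<mu>_meas[OF seq_range(3)] borel_measurable_continuous_onI[OF continuous_parts(3)[OF seq_range(3)]]])
    show "(\<lambda>w. common_part s (\<mu> s w)) \<in> borel_measurable M"
      by (rule measurable_compose[OF \<mu>_meas[OF seq_range(5)] borel_measurable_continuous_onI[OF continuous_parts(3)[OF seq_range(5)]]])
    show "AE w in M. \<bar>common_part (u n) (\<mu> (u n) w)\<bar> \<le> (\<Sum>k\<in>UNIV. K * (norm (column k \<sigma>) * norm (column k \<sigma>)))" for n
      by (intro AE_I2 parts_bounds seq_range)
    show "AE w in M. (\<lambda>n. common_part (u n) (\<mu> (u n) w)) \<longlonglongrightarrow> common_part s (\<mu> s w)"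
      using \<mu>_seq(1) by eventually_elim (rule parts_tendsto(2)[OF u_lim seq_range(3,5)])
  qed
  moreover have "(\<lambda>n. (\<integral>w. remainder (u n) (\<mu> (u n) w) (noise (u n) (v n) w) \<partial>M) / (v n - u n)) \<longlonglongrightarrow> 0"
  proof (rule quad_error_tendsto[where \<Delta>="\<lambda>n. noise (u n) (v n)" and K="2 * K", OF prob_M])
    show "(\<lambda>w. remainder (u n) (\<mu> (u n) w) (noise (u n) (v n) w)) \<in> borel_measurable M" for n
      by (rule common_step(2)[OF seq_range(1) uv(2) seq_range(2)])
    show "noise (u n) (v n) \<in> borel_measurable M" for n by (rule noise_meas[OF seq_range(3,4)])
    show "\<bar>remainder (u n) (\<mu> (u n) w) (noise (u n) (v n) w)\<bar> \<le> 2 * K * (norm (noise (u n) (v n) w))\<^sup>2" for n w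
      by (rule remainder_le[OF seq_range(3)])
    show "AE w in M. (\<lambda>n. remainder (u n) (\<mu> (u n) w) (noise (u n) (v n) w) / (norm (noise (u n) (v n) w))\<^sup>2) \<longlonglongrightarrow> 0"
      using \<mu>_seq(1) AE_space by eventually_elim (rule remainder_tendsto[OF u_lim seq_range(3,5) _ noise_seq])
    show "integrable M (\<lambda>w. norm (noise (u n) (v n) w) ^ 4)"
      "(\<integral>w. norm (noise (u n) (v n) w) ^ 4 \<partial>M) \<le> norm \<sigma> ^ 4 * (3 * real CARD('d) ^ 2) * (v n - u n)\<^sup>2" for n
      by (rule noise_moment[OF seq_range(1) uv(2) seq_range(2)])+
  qed (rule seq_range(7))
  ultimately have "(\<lambda>n. (\<integral>w. common_part (u n) (\<mu> (u n) w) \<partial>M) + (\<integral>w. remainder (u n) (\<mu> (u n) w) (noise (u n) (v n) w) \<partial>M) / (v n - u n))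
      \<longlonglongrightarrow> (\<integral>w. common_part s (\<mu> s w) \<partial>M) + 0" by (rule tendsto_add)
  moreover have "((\<integral>w. U (u n) (moved (u n) (v n) w) \<partial>M) - (\<integral>w. U (u n) (\<mu> (u n) w) \<partial>M)) / (v n - u n)
      = (\<integral>w. common_part (u n) (\<mu> (u n) w) \<partial>M) + (\<integral>w. remainder (u n) (\<mu> (u n) w) (noise (u n) (v n) w) \<partial>M) / (v n - u n)" for n
    unfolding common_step(1)[OF seq_range(1) uv(2) seq_range(2)] using seq_range(7)[of n] by (simp add: add_divide_distrib)
  ultimately show ?thesis by simp
qed

lemma mid_seq:
  assumes "\<And>n. \<theta> n \<in> {0..1}"
  shows "AE w in M. (\<lambda>n. mid (u n) (v n) (\<theta> n) w) \<longlonglongrightarrow> \<mu> s w"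
  using \<mu>_seq AE_space
  by eventually_elim (unfold mid_def moved_def, rule tendsto_mix_same[OF push_translate_tendsto[OF _ noise_seq] _ assms])

text \<open>\<open>B\<close> is only measurable in time, but the equation expresses \<open>drift\<close> by continuous terms.\<close>

lemma rate_expectation:
  assumes g: "\<And>n. g n \<in> borel_measurable M" "\<And>n w. norm (g n w) \<le> K"
    and lim: "AE w in M. (\<lambda>n. g n w) \<longlonglongrightarrow> grad (D1 s (\<mu> s w)) (S s w)"
    and \<tau>: "\<And>n. \<tau> n \<in> {u n..v n}"
  shows "(\<lambda>n. \<integral>w. g n w \<bullet> rate (\<tau> n) w \<partial>M) \<longlonglongrightarrow> (\<integral>w. drift s (\<mu> s w) \<partial>M)"
proof -
  note \<tau>_lim = time_between_tendsto(1)[OF \<tau>]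
  have r: "\<tau> n \<in> {0..<T}" "\<tau> n \<in> {0..T}" for n using time_between_tendsto(2)[OF \<tau>, of n] by auto
  \<comment> \<open>\<open>g'\<close> is taken at the time of the rate, so that disintegration by
    the law at that time turns the pairing into \<open>drift\<close>. The rate itself need not
    converge, but it is bounded and \<open>g\<close> and \<open>g'\<close> share their limit, so one
    may replace the other.\<close>
  define g' where "g' n w = grad (D1 (\<tau> n) (\<mu> (\<tau> n) w)) (S (\<tau> n) w)" for n w
  have g'm: "g' n \<in> borel_measurable M" for n unfolding g'_def
    by (rule measurable_derivatives(4)[OF r(2) \<mu>_meas[OF r(2)] S_meas[OF r(2)], where h="\<lambda>_. 0"]) simp
  have g'K: "norm (g' n w) \<le> K" for n w unfolding g'_def by (rule grad_le[OF r(2)])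
  have int: "integrable M (\<lambda>w. f w \<bullet> rate (\<tau> n) w)" if "f \<in> borel_measurable M" "\<And>w. norm (f w) \<le> K" for f n
    by (rule integrable_const_bound[OF AE_I2 borel_measurable_inner[OF that(1) rate_meas], where B="K * CB"],
      unfold real_norm_def, rule order_trans[OF Cauchy_Schwarz_ineq2 mult_mono[OF that(2) rate_le K_nonneg norm_ge_zero]])
  have dr: "(\<integral>w. g' n w \<bullet> rate (\<tau> n) w \<partial>M) = (\<integral>w. drift (\<tau> n) (\<mu> (\<tau> n) w) \<partial>M)" for n
  proof -
    have "(\<lambda>(z, y). grad (D1 (\<tau> n) z) y \<bullet> B (\<tau> n) y z) \<in> borel_measurable (borel \<Otimes>\<^sub>M borel)"
      unfolding case_prod_unfold
      by (intro borel_measurable_inner measurable_derivatives(4)[OF r(2), where h="\<lambda>_. 0"] B_measurable) (use r(2) in auto)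
    then have m: "(\<lambda>(z, y). grad (D1 (\<tau> n) z) y \<bullet> B (\<tau> n) y z) \<in> borel_measurable borel" by (simp add: borel_prod)
    have "\<bar>grad (D1 (\<tau> n) z) y \<bullet> B (\<tau> n) y z\<bar> \<le> K * CB" for z y
      by (rule order_trans[OF Cauchy_Schwarz_ineq2 mult_mono[OF grad_le[OF r(2)] CB(2)[OF r(2)] K_nonneg norm_ge_zero]])
    from disintegrates_integral[OF \<mu>_disintegrates[OF r(2) \<mu>_path[OF r(2)]] m this]
    show ?thesis using r(2)[of n] unfolding drift_def g'_def rate_def by simp
  qed
  have "(\<lambda>n. \<integral>w. (g n w - g' n w) \<bullet> rate (\<tau> n) w \<partial>M) \<longlonglongrightarrow> (\<integral>w. 0 \<partial>M)"
  proof (rule bounded_expectation_tendsto)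
    show "(\<lambda>w. (g n w - g' n w) \<bullet> rate (\<tau> n) w) \<in> borel_measurable M" for n
      by (intro borel_measurable_inner borel_measurable_diff g(1) g'm rate_meas)
    show "AE w in M. \<bar>(g n w - g' n w) \<bullet> rate (\<tau> n) w\<bar> \<le> (K + K) * CB" for n
      by (intro AE_I2 order_trans[OF Cauchy_Schwarz_ineq2 mult_mono[OF order_trans[OF norm_triangle_ineq4 add_mono[OF g(2) g'K]] rate_le]])
        (simp_all add: K_nonneg)
    show "AE w in M. (\<lambda>n. (g n w - g' n w) \<bullet> rate (\<tau> n) w) \<longlonglongrightarrow> 0"
      using lim \<mu>_tendsto[OF \<tau>_lim r(2) seq_range(5)] AE_space
    proof eventually_elim
      case (elim w)
      have "(\<lambda>n. g' n w) \<longlonglongrightarrow> grad (D1 s (\<mu> s w)) (S s w)"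
        unfolding g'_def by (rule grad_tendsto[OF \<tau>_lim r(2) seq_range(5) elim(2) process_seq[OF \<tau>_lim r(2) S_cont[OF elim(3)]]])
      from tendsto_norm_zero[OF LIM_zero[OF tendsto_diff[OF elim(1) this]]]
      have "(\<lambda>n. norm (g n w - g' n w) * CB) \<longlonglongrightarrow> 0" by (intro tendsto_mult_left_zero) simp
      then show ?case
      proof (rule Lim_null_comparison[rotated])
        show "\<forall>\<^sub>F n in sequentially. norm ((g n w - g' n w) \<bullet> rate (\<tau> n) w) \<le> norm (g n w - g' n w) * CB"
          unfolding real_norm_def
          by (intro always_eventually allI order_trans[OF Cauchy_Schwarz_ineq2 mult_left_mono[OF rate_le norm_ge_zero]])
      qed
    qed
  qed simp
  moreover have "(\<integral>w. (g n w - g' n w) \<bullet> rate (\<tau> n) w \<partial>M)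
      = (\<integral>w. g n w \<bullet> rate (\<tau> n) w \<partial>M) - (\<integral>w. drift (\<tau> n) (\<mu> (\<tau> n) w) \<partial>M)" for n
    unfolding dr[symmetric] using int[OF g(1,2)] int[OF g'm g'K] by (simp add: inner_diff_left)
  moreover have "(\<lambda>n. \<integral>w. drift (\<tau> n) (\<mu> (\<tau> n) w) \<partial>M) \<longlonglongrightarrow> (\<integral>w. drift s (\<mu> s w) \<partial>M)"
  proof (rule bounded_expectation_tendsto)
    have dm: "(\<lambda>w. drift x (\<mu> x w)) \<in> borel_measurable M" if "x \<in> {0..<T}" for x
      by (rule measurable_compose[OF \<mu>_meas borel_measurable_continuous_onI[OF continuous_parts(5)]]) (use that in auto)
    show "(\<lambda>w. drift (\<tau> n) (\<mu> (\<tau> n) w)) \<in> borel_measurable M" "(\<lambda>w. drift s (\<mu> s w)) \<in> borel_measurable M" for n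
      by (rule dm[OF r(1)] dm[OF seq_range(6)])+
    show "AE w in M. \<bar>drift (\<tau> n) (\<mu> (\<tau> n) w)\<bar> \<le> K * CB" for n by (intro AE_I2 parts_bounds r)
    show "AE w in M. (\<lambda>n. drift (\<tau> n) (\<mu> (\<tau> n) w)) \<longlonglongrightarrow> drift s (\<mu> s w)"
      using \<mu>_tendsto[OF \<tau>_lim r(2) seq_range(5)] by eventually_elim (rule drift_tendsto[OF \<tau>_lim r(1) seq_range(6)])
  qed
  ultimately show ?thesis using tendsto_add by fastforce
qed

text \<open>The time average is compared with a nearly worst instant: some \<open>\<tau> n\<close>
  deviates from the limit almost as much as the average does. This takes the place of a mean value
  theorem, since \<open>\<phi> n\<close> is not known to be continuous in time.\<close>

lemma drift_part:
  assumes g: "\<And>n. g n \<in> borel_measurable M" "\<And>n w. norm (g n w) \<le> K"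
    and lim: "AE w in M. (\<lambda>n. g n w) \<longlonglongrightarrow> grad (D1 s (\<mu> s w)) (S s w)"
  shows "(\<lambda>n. (\<integral>w. g n w \<bullet> drift_step (u n) (v n) w \<partial>M) / (v n - u n)) \<longlonglongrightarrow> (\<integral>w. drift s (\<mu> s w) \<partial>M)"
proof -
  define c where "c = (\<integral>w. drift s (\<mu> s w) \<partial>M)"
  define \<phi> where "\<phi> n \<tau> = (\<integral>w. g n w \<bullet> rate \<tau> w \<partial>M)" for n \<tau>
  define A where "A n = \<bar>(\<integral>w. g n w \<bullet> drift_step (u n) (v n) w \<partial>M) / (v n - u n) - c\<bar>" for n
  \<comment> \<open>If every instant deviated by at most \<open>q\<close>, so would the average,
    whose deviation is \<open>A n > q\<close>. The margin \<open>1 / Suc n\<close> supplies the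
    strict inequality and vanishes in the limit.\<close>
  have "\<exists>\<tau>. \<tau> \<in> {u n..v n} \<and> A n - 1 / real (Suc n) < \<bar>\<phi> n \<tau> - c\<bar>" for n
  proof (rule ccontr)
    assume no: "\<not> ?thesis"
    define q where "q = A n - 1 / real (Suc n)"
    have le: "u n \<le> v n" using uv(2)[of n] by simp
    let ?N = "restrict_space lborel {u n..v n}"
    interpret N: finite_measure ?N by (rule time_measure[OF le])
    have m: "measure ?N (space ?N) = v n - u n" using time_measure[OF le] by simp
    note f = drift_step_fubini[OF le g(1,2), folded \<phi>_def]
    have "\<bar>\<phi> n \<tau> - c\<bar> \<le> q" if "\<tau> \<in> {u n..v n}" for \<tau> using no that by (auto simp: q_def not_less)
    then have "norm (\<integral>\<tau>. \<phi> n \<tau> - c \<partial>?N) \<le> (\<integral>\<tau>. q \<partial>?N)"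
      using f(2) by (intro norm_integral_le_integral AE_I2) (auto simp: time_measure(3)[OF le])
    moreover have "(\<integral>\<tau>. \<phi> n \<tau> - c \<partial>?N) = (\<integral>w. g n w \<bullet> drift_step (u n) (v n) w \<partial>M) - (v n - u n) * c"
      unfolding f(1) using f(2) m by simp
    ultimately have "\<bar>(\<integral>w. g n w \<bullet> drift_step (u n) (v n) w \<partial>M) - (v n - u n) * c\<bar> \<le> (v n - u n) * q"
      using m by simp
    then have "\<bar>(\<integral>w. g n w \<bullet> drift_step (u n) (v n) w \<partial>M) - (v n - u n) * c\<bar> / (v n - u n) \<le> q"
      using seq_range(7)[of n] by (simp add: pos_divide_le_eq mult.commute)
    moreover have "\<bar>(\<integral>w. g n w \<bullet> drift_step (u n) (v n) w \<partial>M) - (v n - u n) * c\<bar> / (v n - u n) = A n"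
    proof -
      have "((\<integral>w. g n w \<bullet> drift_step (u n) (v n) w \<partial>M) - (v n - u n) * c) / (v n - u n)
          = (\<integral>w. g n w \<bullet> drift_step (u n) (v n) w \<partial>M) / (v n - u n) - c"
        using seq_range(7)[of n] by (simp add: diff_divide_distrib)
      then show ?thesis unfolding A_def using seq_range(7)[of n] abs_divide[of _ "v n - u n"] abs_of_pos by metis
    qed
    ultimately show False by (simp add: q_def)
  qed
  then have "\<forall>n. \<exists>\<tau>. \<tau> \<in> {u n..v n} \<and> A n - 1 / real (Suc n) < \<bar>\<phi> n \<tau> - c\<bar>" by blast
  from choice[OF this] obtain \<tau> where \<tau>: "\<And>n. \<tau> n \<in> {u n..v n}" "\<And>n. A n - 1 / real (Suc n) < \<bar>\<phi> n (\<tau> n) - c\<bar>" by blast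
  have "(\<lambda>n. \<phi> n (\<tau> n)) \<longlonglongrightarrow> c" unfolding \<phi>_def c_def by (rule rate_expectation[OF g lim \<tau>(1)])
  then have "(\<lambda>n. \<bar>\<phi> n (\<tau> n) - c\<bar>) \<longlonglongrightarrow> 0" by (rule tendsto_rabs_zero[OF LIM_zero])
  from tendsto_add[OF this LIMSEQ_inverse_real_of_nat]
  have lim0: "(\<lambda>n. \<bar>\<phi> n (\<tau> n) - c\<bar> + inverse (real (Suc n))) \<longlonglongrightarrow> 0" by simp
  have A_le: "A n \<le> \<bar>\<phi> n (\<tau> n) - c\<bar> + inverse (real (Suc n))" "0 \<le> A n" for n
    using \<tau>(2)[of n] by (simp_all add: A_def inverse_eq_divide)
  have "A \<longlonglongrightarrow> 0"
    by (rule tendsto_sandwich[OF always_eventually always_eventually tendsto_const lim0]) (intro allI A_le)+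
  then show ?thesis unfolding A_def c_def by (rule LIM_zero_cancel[OF tendsto_rabs_zero_cancel])
qed

text \<open>The quotient splits into drift, curvature and Taylor error. The mean value parameters
  \<open>\<theta> n\<close> are arbitrary, yet all intermediate laws converge to
  \<open>\<mu> s\<close> by \<open>mid_seq\<close>, so the limit does not depend on them.\<close>

lemma idiosyncratic_part:
  "(\<lambda>n. ((\<integral>w. U (u n) (\<mu> (v n) w) \<partial>M) - (\<integral>w. U (u n) (moved (u n) (v n) w) \<partial>M)) / (v n - u n))
     \<longlonglongrightarrow> (\<integral>w. drift s (\<mu> s w) \<partial>M) + (\<integral>w. idio_part s (\<mu> s w) \<partial>M)"
proof -
  have "\<forall>n. \<exists>\<theta>. \<theta> \<in> {0..1} \<and> (\<integral>w. U (u n) (\<mu> (v n) w) \<partial>M) - (\<integral>w. U (u n) (moved (u n) (v n) w) \<partial>M) =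
    (\<integral>w. D1 (u n) (mid (u n) (v n) \<theta> w) (S (v n) w) - D1 (u n) (mid (u n) (v n) \<theta> w) (start (u n) (v n) w) \<partial>M)"
    using coupling_step[OF uv(1,2) seq_range(2)] by blast
  from choice[OF this] obtain \<theta> where \<theta>: "\<And>n. \<theta> n \<in> {0..1}"
    and eq: "\<And>n. (\<integral>w. U (u n) (\<mu> (v n) w) \<partial>M) - (\<integral>w. U (u n) (moved (u n) (v n) w) \<partial>M) =
    (\<integral>w. D1 (u n) (mid (u n) (v n) (\<theta> n) w) (S (v n) w) - D1 (u n) (mid (u n) (v n) (\<theta> n) w) (start (u n) (v n) w) \<partial>M)"
    by blast
  define h where "h n = v n - u n" for n
  have h: "0 < h n" for n unfolding h_def by (rule seq_range(7))
  define a where "a n = (\<integral>w. slope (u n) (v n) (\<theta> n) w \<bullet> drift_step (u n) (v n) w \<partial>M)" for n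
  define b where "b n = (\<Sum>k\<in>UNIV. \<integral>w. unit_col k \<bullet> (curv (u n) (v n) (\<theta> n) w *v unit_col k) \<partial>M) / 2" for n
  define e where "e n = (\<integral>w. taylor_rem (u n) (mid (u n) (v n) (\<theta> n) w) (increment (u n) (v n) w) (start (u n) (v n) w) \<partial>M)" for n
  define d where "d n = (\<integral>w. U (u n) (\<mu> (v n) w) \<partial>M) - (\<integral>w. U (u n) (moved (u n) (v n) w) \<partial>M)" for n
  define k where "k = 1 + 3 * real CARD('d) ^ 2"
  have main: "\<bar>d n - a n - h n * b n - e n\<bar> \<le> K * (CB\<^sup>2 * (h n)\<^sup>2 + 2 * (CB * h n) * (sqrt (h n) * k)) / 2" for n
    unfolding d_def eq a_def b_def e_def h_def k_def by (rule idio_step[OF uv(1,2) seq_range(2) \<theta>])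
  have h0: "h \<longlonglongrightarrow> 0" unfolding h_def by (rule width_tendsto)
  \<comment> \<open>The bound of \<open>idio_step\<close> divided by \<open>h n\<close>; it vanishes
    like \<open>sqrt (h n)\<close>.\<close>
  have "(\<lambda>n. K * (CB\<^sup>2 * h n + 2 * CB * (sqrt (h n) * k)) / 2) \<longlonglongrightarrow> K * (CB\<^sup>2 * 0 + 2 * CB * (sqrt 0 * k)) / 2"
    by (intro tendsto_intros h0) simp
  then have "(\<lambda>n. K * (CB\<^sup>2 * h n + 2 * CB * (sqrt (h n) * k)) / 2) \<longlonglongrightarrow> 0" by simp
  then have r: "(\<lambda>n. (d n - a n - h n * b n - e n) / h n) \<longlonglongrightarrow> 0"
  proof (rule Lim_null_comparison[rotated], intro always_eventually allI)
    fix n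
    have "norm ((d n - a n - h n * b n - e n) / h n) = \<bar>d n - a n - h n * b n - e n\<bar> / h n" using h[of n] by simp
    also have "\<dots> \<le> K * (CB\<^sup>2 * (h n)\<^sup>2 + 2 * (CB * h n) * (sqrt (h n) * k)) / 2 / h n"
      using main[of n] h[of n] by (intro divide_right_mono) auto
    also have "\<dots> = K * (CB\<^sup>2 * h n + 2 * CB * (sqrt (h n) * k)) / 2"
      using h[of n] by (simp add: field_simps power2_eq_square)
    finally show "norm ((d n - a n - h n * b n - e n) / h n) \<le> K * (CB\<^sup>2 * h n + 2 * CB * (sqrt (h n) * k)) / 2" .
  qed
  note ms = slope_meas[OF uv(1,2) seq_range(2) \<theta>] curv_meas[OF uv(1,2) seq_range(2) \<theta>]
  have A: "(\<lambda>n. a n / h n) \<longlonglongrightarrow> (\<integral>w. drift s (\<mu> s w) \<partial>M)"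
    unfolding a_def h_def
  proof (rule drift_part[OF ms(1,2)])
    show "AE w in M. (\<lambda>n. slope (u n) (v n) (\<theta> n) w) \<longlonglongrightarrow> grad (D1 s (\<mu> s w)) (S s w)"
      using mid_seq[of \<theta>, OF \<theta>] AE_space
      by eventually_elim (unfold slope_def, rule grad_tendsto[OF u_lim seq_range(3,5) _ start_seq])
  qed
  have E: "(\<lambda>n. e n / h n) \<longlonglongrightarrow> 0"
    unfolding e_def
  proof (rule quad_error_tendsto[where \<Delta>="\<lambda>n. increment (u n) (v n)" and K=K, OF prob_M])
    show "(\<lambda>w. taylor_rem (u n) (mid (u n) (v n) (\<theta> n) w) (increment (u n) (v n) w) (start (u n) (v n) w)) \<in> borel_measurable M" for n
      by (rule taylor_meas[OF uv(1,2) seq_range(2) \<theta>])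
    show "increment (u n) (v n) \<in> borel_measurable M" for n by (rule increment_meas[OF seq_range(3,4)])
    show "\<bar>taylor_rem (u n) (mid (u n) (v n) (\<theta> n) w) (increment (u n) (v n) w) (start (u n) (v n) w)\<bar> \<le> K * (norm (increment (u n) (v n) w))\<^sup>2" for n w
      by (rule taylor_rem_le[OF seq_range(3)])
    show "AE w in M. (\<lambda>n. taylor_rem (u n) (mid (u n) (v n) (\<theta> n) w) (increment (u n) (v n) w) (start (u n) (v n) w) / (norm (increment (u n) (v n) w))\<^sup>2) \<longlonglongrightarrow> 0"
      using mid_seq[of \<theta>, OF \<theta>] AE_space
      by eventually_elim (rule taylor_rem_tendsto[OF u_lim seq_range(3,5) _ increment_seq start_seq])
    show "integrable M (\<lambda>w. norm (increment (u n) (v n) w) ^ 4)"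
      "(\<integral>w. norm (increment (u n) (v n) w) ^ 4 \<partial>M) \<le> 8 * (CB ^ 4 * T\<^sup>2 + 3 * real CARD('d) ^ 2) * (h n)\<^sup>2" for n
      unfolding h_def by (rule increment_moment[OF uv(1,2) seq_range(2)])+
  qed (rule h)
  have "(\<lambda>n. b n) \<longlonglongrightarrow> (\<Sum>k\<in>UNIV. \<integral>w. hess_form s (\<mu> s w) (unit_col k) (unit_col k) \<partial>M) / 2"
    unfolding b_def
  proof (intro tendsto_divide tendsto_sum tendsto_const)
    fix k
    let ?f = "\<lambda>z y. unit_col k \<bullet> (jac (grad (D1 s z)) y *v unit_col k)"
    have "(\<lambda>(z, y). ?f z y) \<in> borel_measurable (borel \<Otimes>\<^sub>M borel)"
      unfolding case_prod_unfold by (intro measurable_forms(2)[OF seq_range(5)] measurable_fst measurable_snd)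
    then have m: "(\<lambda>(z, y). ?f z y) \<in> borel_measurable borel" by (simp add: borel_prod)
    have "(\<lambda>n. \<integral>w. unit_col k \<bullet> (curv (u n) (v n) (\<theta> n) w *v unit_col k) \<partial>M) \<longlonglongrightarrow> (\<integral>w. ?f (\<mu> s w) (S s w) \<partial>M)"
    proof (rule bounded_expectation_tendsto)
      show "(\<lambda>w. unit_col k \<bullet> (curv (u n) (v n) (\<theta> n) w *v unit_col k)) \<in> borel_measurable M" for n
        by (rule borel_measurable_inner_matrix[OF ms(3)])
      show "(\<lambda>w. ?f (\<mu> s w) (S s w)) \<in> borel_measurable M"
        by (rule measurable_forms(2)[OF seq_range(5) \<mu>_meas[OF seq_range(5)] S_meas[OF seq_range(5)]])
      show "AE w in M. \<bar>unit_col k \<bullet> (curv (u n) (v n) (\<theta> n) w *v unit_col k)\<bar> \<le> K * (norm (unit_col k) * norm (unit_col k))" for n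
        by (intro AE_I2 ms(4))
      show "AE w in M. (\<lambda>n. unit_col k \<bullet> (curv (u n) (v n) (\<theta> n) w *v unit_col k)) \<longlonglongrightarrow> ?f (\<mu> s w) (S s w)"
        using mid_seq[of \<theta>, OF \<theta>] AE_space
        by eventually_elim (unfold curv_def, rule inner_matrix_tendsto[OF hess_tendsto[OF u_lim seq_range(3,5) _ start_seq]])
    qed
    \<comment> \<open>The limit just found is an expectation at the random point \<open>S s\<close>;
      disintegration averages it over \<open>\<mu> s\<close>, which is
      \<open>hess_form\<close>.\<close>
    then show "(\<lambda>n. \<integral>w. unit_col k \<bullet> (curv (u n) (v n) (\<theta> n) w *v unit_col k) \<partial>M) \<longlonglongrightarrow> (\<integral>w. hess_form s (\<mu> s w) (unit_col k) (unit_col k) \<partial>M)"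
      unfolding hess_form_def
      using disintegrates_integral[OF \<mu>_disintegrates[OF seq_range(5) \<mu>_path[OF seq_range(5)]] m hess_form_le[OF seq_range(5)]] by simp
  qed simp
  moreover have "(\<Sum>k\<in>UNIV. \<integral>w. hess_form s (\<mu> s w) (unit_col k) (unit_col k) \<partial>M) / 2 = (\<integral>w. idio_part s (\<mu> s w) \<partial>M)"
  proof -
    have "continuous_on UNIV (\<lambda>n. hess_form s n a a)" for a
      by (intro continuous_on_UNIV_sequentiallyI hess_form_tendsto[OF tendsto_const]) (use seq_range(5) in simp_all)
    from measurable_compose[OF \<mu>_meas[OF seq_range(5)] borel_measurable_continuous_onI[OF this]]
    have "integrable M (\<lambda>w. hess_form s (\<mu> s w) a a)" for a
      by (intro integrable_const_bound[where B="K * (norm a * norm a)"] AE_I2) (use hess_form_bound[OF seq_range(5)] in auto)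
    then show ?thesis unfolding idio_part_def by (simp add: Bochner_Integration.integral_sum)
  qed
  ultimately have Bn: "b \<longlonglongrightarrow> (\<integral>w. idio_part s (\<mu> s w) \<partial>M)" by simp
  have "d n / h n = (d n - a n - h n * b n - e n) / h n + (a n / h n + b n + e n / h n)" for n
    using h[of n] by (simp add: field_simps)
  then have "(\<lambda>n. d n / h n) \<longlonglongrightarrow> 0 + ((\<integral>w. drift s (\<mu> s w) \<partial>M) + (\<integral>w. idio_part s (\<mu> s w) \<partial>M) + 0)"
    using tendsto_add[OF r tendsto_add[OF tendsto_add[OF A Bn] E]] by simp
  then show ?thesis unfolding d_def h_def by simp
qed

lemma value_quotient_tendsto:
  "(\<lambda>n. ((\<integral>w. U (v n) (\<mu> (v n) w) \<partial>M) - (\<integral>w. U (u n) (\<mu> (u n) w) \<partial>M)) / (v n - u n)) \<longlonglongrightarrow> 0"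
proof -
  have i: "integrable M (\<lambda>w. f (\<mu> s w))" if "continuous_on UNIV f" "\<And>n. \<bar>f n\<bar> \<le> C" for f :: "(real^'d) prob_measure \<Rightarrow> real" and C
    by (intro integrable_const_bound[where B=C] AE_I2 measurable_compose[OF \<mu>_meas[OF seq_range(5)] borel_measurable_continuous_onI[OF that(1)]])
      (use that(2) in auto)
  have sT: "s < T" using seq_range(6) by simp
  note c = continuous_parts[OF seq_range(5)]
  note ii = i[OF c(1) Ut_le[OF seq_range(5)]] i[OF c(5)[OF sT] parts_bounds(1)[OF seq_range(5)]]
    i[OF c(2) parts_bounds(2)[OF seq_range(5)]] i[OF c(3) parts_bounds(3)[OF seq_range(5)]]
  have "(\<integral>w. Ut s (\<mu> s w) \<partial>M) + ((\<integral>w. drift s (\<mu> s w) \<partial>M) + (\<integral>w. idio_part s (\<mu> s w) \<partial>M)) + (\<integral>w. common_part s (\<mu> s w) \<partial>M)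
    = (\<integral>w. Ut s (\<mu> s w) + (drift s (\<mu> s w) + idio_part s (\<mu> s w)) + common_part s (\<mu> s w) \<partial>M)"
    using ii by simp
  also have "\<dots> = 0"
  proof -
    have "Ut s n + (drift s n + idio_part s n) + common_part s n = 0" for n
      using pde[OF seq_range(6), of n] generator_eq[OF seq_range(5), of n] by simp
    then show ?thesis by simp
  qed
  finally have z: "(\<integral>w. Ut s (\<mu> s w) \<partial>M) + ((\<integral>w. drift s (\<mu> s w) \<partial>M) + (\<integral>w. idio_part s (\<mu> s w) \<partial>M)) + (\<integral>w. common_part s (\<mu> s w) \<partial>M) = 0" .
  show ?thesis
    using tendsto_add[OF tendsto_add[OF time_part idiosyncratic_part] common_noise_part]
    unfolding z by (simp add: add_divide_distrib[symmetric])
qed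

end

text \<open>The vanishing quotient limit is available at times strictly between \<open>t\<close> and
  \<open>T\<close>; continuity of the expected value up to both ends extends constancy to the closed
  interval. At \<open>t\<close> the law is \<open>m\<close> by \<open>\<mu>_initial\<close>.\<close>

lemma value_constant: "(\<integral>w. U T (\<mu> T w) \<partial>M) = U t m"
proof -
  define f where "f r = (\<integral>w. U r (\<mu> r w) \<partial>M)" for r
  have start_value: "f t = U t m"
  proof -
    have "f t = (\<integral>w. U t m \<partial>M)"
      unfolding f_def using \<mu>_initial[OF continuous_parts(4)[OF t]] U_meas[OF t \<mu>_meas[OF t]] by (intro integral_cong_AE) auto
    then show ?thesis by (simp add: prob_space)
  qed
  have "f T = f t"
  proof (cases "t = T")
    case False
    then have tT: "t < T" using t by simp
    show ?thesis
    proof (rule DERIV_isconst_end[OF tT])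
      obtain C where C: "\<And>r n. r \<in> {0..T} \<Longrightarrow> \<bar>U r n\<bar> \<le> C" using U_bounded by blast
      show "continuous_on {t..T} f"
        unfolding continuous_on_sequentially comp_def
      proof (intro ballI allI impI, elim conjE)
        fix x a assume a: "a \<in> {t..T}" and x: "\<forall>n. x n \<in> {t..T}" and xa: "x \<longlonglongrightarrow> a"
        have r: "x n \<in> {0..T}" "a \<in> {0..T}" for n using x[rule_format, of n] a t by auto
        show "(\<lambda>n. f (x n)) \<longlonglongrightarrow> f a"
          unfolding f_def
        proof (rule bounded_expectation_tendsto[OF U_meas[OF r(1) \<mu>_meas[OF r(1)]] U_meas[OF r(2) \<mu>_meas[OF r(2)]] AE_I2[OF C[OF r(1)]]])
          show "AE w in M. (\<lambda>n. U (x n) (\<mu> (x n) w)) \<longlonglongrightarrow> U a (\<mu> a w)"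
            using \<mu>_tendsto[OF xa r] by eventually_elim (rule U_tendsto[OF xa r])
        qed
      qed
      fix x assume x: "t < x" "x < T"
      have "((\<lambda>y. (f y - f x) / (y - x)) \<longlongrightarrow> 0) (at x within {t<..<T})"
        unfolding tendsto_at_iff_sequentially comp_def
      proof (intro allI impI)
        fix y assume y: "\<forall>i. y i \<in> {t<..<T} - {x}" and yx: "y \<longlonglongrightarrow> x"
        \<comment> \<open>Ordering \<open>y n\<close> and \<open>x\<close> lets one lemma treat
          quotients from both sides; exchanging the points changes the sign of numerator and
          denominator alike.\<close>
        define u v where "u n = min (y n) x" and "v n = max (y n) x" for n
        have yn: "t < y n" "y n < T" "y n \<noteq> x" for n using y by auto
        have lim: "u \<longlonglongrightarrow> x" "v \<longlonglongrightarrow> x"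
          unfolding u_def v_def using tendsto_min[OF yx tendsto_const[of x]] tendsto_max[OF yx tendsto_const[of x]] by simp_all
        have "(\<lambda>n. (f (v n) - f (u n)) / (v n - u n)) \<longlonglongrightarrow> 0"
          unfolding f_def
        proof (rule value_quotient_tendsto[OF _ _ _ _ _ lim])
          show "t \<le> u n" "u n < v n" "v n < T" "u n \<le> x" "x \<le> v n" for n
            using yn[of n] x by (auto simp: u_def v_def)
        qed
        moreover have "(f (v n) - f (u n)) / (v n - u n) = (f (y n) - f x) / (y n - x)" for n
        proof (cases "y n < x")
          case True
          then have "(f (v n) - f (u n)) / (v n - u n) = (- (f (y n) - f x)) / (- (y n - x))" by (simp add: u_def v_def)
          then show ?thesis unfolding minus_divide_divide .
        qed (simp add: u_def v_def)
        ultimately show "(\<lambda>n. (f (y n) - f x) / (y n - x)) \<longlonglongrightarrow> 0" by simp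
      qed
      then show "DERIV f x :> 0"
        unfolding has_field_derivative_iff using at_within_open[of x "{t<..<T}"] x by simp
    qed
  qed simp
  then show ?thesis using start_value by (simp add: f_def)
qed

end

theorem mainTheorem5:
  fixes M :: "'w measure" and F :: "real \<Rightarrow> 'w measure" and T :: real
    and W W0 :: "real \<Rightarrow> 'w \<Rightarrow> real^'d" and \<sigma> :: "real^'d^'d"
    and B :: "real \<Rightarrow> real^'d \<Rightarrow> (real^'d) prob_measure \<Rightarrow> real^'d"
    and G :: "(real^'d) prob_measure \<Rightarrow> real"
    and U Ut :: "real \<Rightarrow> (real^'d) prob_measure \<Rightarrow> real"
    and D1 :: "real \<Rightarrow> (real^'d) prob_measure \<Rightarrow> real^'d \<Rightarrow> real"
    and D2 :: "real \<Rightarrow> (real^'d) prob_measure \<Rightarrow> real^'d \<Rightarrow> real^'d \<Rightarrow> real"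
  assumes "T > 0"
    and "filtered_prob_space M F T"
    and "brownian_motion M F T W"
    and "brownian_motion M F T W0"
    and "independent_processes M T W W0"
    and "assumption_B T B"
    and "assumption_G G"
    and "smooth_with T U Ut D1 D2"
    and "\<forall>t\<in>{0..<T}. \<forall>m. Ut t m + generator B \<sigma> D1 D2 t m = 0"
    and "\<forall>m. U T m = G m"
  shows "\<forall>t\<in>{0..T}. \<forall>m X S \<mu>. mckean_vlasov_flow M T B \<sigma> W W0 t m X S \<mu> \<longrightarrow>
    U t m = mckean_vlasov_semigroup M T B \<sigma> W W0 G t m \<and>
    mckean_vlasov_semigroup M T B \<sigma> W W0 G t m = (\<integral>\<omega>. G (\<mu> T \<omega>) \<partial>M)"
proof (intro ballI allI impI)
  fix t m X S \<mu>
  assume t: "t \<in> {0..T}" and flow: "mckean_vlasov_flow M T B \<sigma> W W0 t m X S \<mu>"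
  have "bounded ((\<lambda>(t, m). Ut t m) ` ({0..T} \<times> UNIV))"
    "bounded ((\<lambda>(t, m, x). grad (D1 t m) x) ` ({0..T} \<times> UNIV \<times> UNIV))"
    "bounded ((\<lambda>(t, m, x). jac (grad (D1 t m)) x) ` ({0..T} \<times> UNIV \<times> UNIV))"
    "bounded ((\<lambda>(t, m, x, y). mixed_grad (D2 t m) x y) ` ({0..T} \<times> UNIV \<times> UNIV \<times> UNIV))"
    using assms(8) unfolding smooth_with_def bounded_continuous_on_def by blast+
  then obtain K1 K2 K3 K4 where K:
    "\<And>t m. t \<in> {0..T} \<Longrightarrow> \<bar>Ut t m\<bar> \<le> K1" "\<And>t m x. t \<in> {0..T} \<Longrightarrow> norm (grad (D1 t m) x) \<le> K2"
    "\<And>t m x. t \<in> {0..T} \<Longrightarrow> norm (jac (grad (D1 t m)) x) \<le> K3"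
    "\<And>t m x y. t \<in> {0..T} \<Longrightarrow> norm (mixed_grad (D2 t m) x y) \<le> K4"
    unfolding bounded_iff by fastforce
  define K where "K = max (max K1 K2) (max K3 K4)"
  have KK: "K1 \<le> K" "K2 \<le> K" "K3 \<le> K" "K4 \<le> K" by (simp_all add: K_def)
  have UG: "U T = G" using assms(10) by auto
  have "bounded_continuous_on UNIV (U T)" using assms(7) by (simp add: assumption_G_def UG)
  then have sm: "smooth_function T K U Ut D1 D2"
    using assms(1,8) by unfold_locales (assumption | rule order_trans[OF K(1) KK(1)] order_trans[OF K(2) KK(2)]
      order_trans[OF K(3) KK(3)] order_trans[OF K(4) KK(4)])+
  \<comment> \<open>Proved for every solution from \<open>m\<close> at time \<open>t\<close>, not
    only for the given one: all of them yield \<open>U t m\<close>, which is what makes the definite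
    description in \<open>mckean_vlasov_semigroup\<close> denote this value.\<close>
  have val: "(\<integral>\<omega>. G (\<mu>' T \<omega>) \<partial>M) = U t m" if fl: "mckean_vlasov_flow M T B \<sigma> W W0 t m X' S' \<mu>'" for X' S' \<mu>'
  proof -
    have "mckean_vlasov_solution M F T W W0 \<sigma> B t m X' S' \<mu>'"
      using assms(1-6) t fl by (intro mckean_vlasov_solution.intro)
    moreover have "mckean_vlasov_pde_axioms T \<sigma> B Ut D1 D2"
      using assms(9) by (intro mckean_vlasov_pde_axioms.intro) blast
    ultimately have "mckean_vlasov_pde M F T W W0 \<sigma> B t m X' S' \<mu>' K U Ut D1 D2"
      using sm by (intro mckean_vlasov_pde.intro)
    from mckean_vlasov_pde.value_constant[OF this] show ?thesis by (simp add: UG)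
  qed
  have "mckean_vlasov_semigroup M T B \<sigma> W W0 G t m = U t m"
    unfolding mckean_vlasov_semigroup_def
  proof (rule the_equality)
    show "\<exists>X S \<mu>. mckean_vlasov_flow M T B \<sigma> W W0 t m X S \<mu> \<and> U t m = (\<integral>\<omega>. G (\<mu> T \<omega>) \<partial>M)"
      using flow val[OF flow, symmetric] by blast
    show "v = U t m" if "\<exists>X S \<mu>. mckean_vlasov_flow M T B \<sigma> W W0 t m X S \<mu> \<and> v = (\<integral>\<omega>. G (\<mu> T \<omega>) \<partial>M)" for v
      using that val by blast
  qed
  with val[OF flow] show "U t m = mckean_vlasov_semigroup M T B \<sigma> W W0 G t m \<and>
    mckean_vlasov_semigroup M T B \<sigma> W W0 G t m = (\<integral>\<omega>. G (\<mu> T \<omega>) \<partial>M)" by simp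
qed

end
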